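(* Suppose that each $X^{(i)}$, $i=1,\dots,p$, satisfies $$\sup_{x\in E}\int_E R_1^{(i)}(x,y)^p\,m(dy)<\infty,\qquad R_1^{(i)}(x,y)=\int_0^\infty e^{-s}p_s^{(i)}(x,y)\,ds,$$ and let $t>0$. Then there exists a random measure $\ell_t^{\mathrm{IS}}\in\mathcal{M}_f(E)$ such that, in the vague topology of $\mathcal{M}_f(E)$, $$\ell_{\varepsilon,t}^{\mathrm{IS}}\to\ell_t^{\mathrm{IS}}\quad\text{in distribution, as }\varepsilon\to0,$$ with respect to the probability measure $\widetilde{\mathbb{P}}_t$. Furthermore, for all nonnegative continuous compactly supported functions $f$ on $E$ and all integers $k\ge1$, $$\langle f,\ell_{\varepsilon,t}^{\mathrm{IS}}\rangle\to\langle f,\ell_t^{\mathrm{IS}}\rangle\quad\text{in }L^k(\widetilde{\mathbb{P}}_t),\text{ as }\varepsilon\to0.$$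
   Context: Setting. $p\ge 2$ is an integer, $E$ is a locally compact separable metric space, $m$ is a Radon measure on $E$ with $\mathrm{supp}[m]=E$. $X^{(1)},\dots,X^{(p)}$ are independent irreducible $m$-symmetric Hunt processes on $E$ (not necessarily with the same law), started at fixed points $x_0^{(1)},\dots,x_0^{(p)}\in E$, with life times $\zeta^{(1)},\dots,\zeta^{(p)}$ and transition densities $p^{(i)}_t(x,y)$ with respect to $m$. $\mathcal{M}_f(E)$ is the set of finite measures on $E$ with the vague topology. $\widetilde{\mathbb{P}}_t(F)=\mathbb{P}(F\cap\{t<\zeta^{(1)}\wedge\dots\wedge\zeta^{(p)}\})/\mathbb{P}(t<\zeta^{(1)}\wedge\dots\wedge\zeta^{(p)})$. For $\varepsilon>0$, on the event $\{t<\zeta^{(1)}\wedge\dots\wedge\zeta^{(p)}\}$, the approximated intersection measure is $$\ell_{\varepsilon,t}^{\mathrm{IS}}(A)=\int_A\Big[\int_{[0,t]^p}\prod_{i=1}^p p_\varepsilon^{(i)}(X^{(i)}(s_i),x)\,ds_1\cdots ds_p\Big]m(dx),\quad A\subset E\text{ Borel}.$$ $\langle f,\ell\rangle=\int f\,d\ell$. *)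

theory Defs
  imports "HOL-Probability.Probability"
begin

section \<open>Measures on a topological space\<close>

definition radon_measure :: "'a::topological_space measure \<Rightarrow> bool" where
  "radon_measure m \<longleftrightarrow>
     sets m = sets borel \<and>
     (\<forall>K. compact K \<longrightarrow> emeasure m K < \<infinity>) \<and>
     (\<forall>A\<in>sets borel. emeasure m A = (SUP K\<in>{K. compact K \<and> K \<subseteq> A}. emeasure m K))"

definition measure_supp :: "'a::topological_space measure \<Rightarrow> 'a set" where
  "measure_supp m = {x. \<forall>U. open U \<and> x \<in> U \<longrightarrow> emeasure m U > 0}"

definition borel_of :: "'a topology \<Rightarrow> 'a measure" where
  "borel_of T = sigma (topspace T) {U. openin T U}"

definition Cc :: "('a::topological_space \<Rightarrow> real) set" where
  "Cc = {f. continuous_on UNIV f \<and> compact (closure {x. f x \<noteq> 0})}"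

definition finite_measures :: "'a::topological_space measure set" where
  "finite_measures = {\<mu>. sets \<mu> = sets borel \<and> finite_measure \<mu>}"

text \<open>The coarsest topology on the finite Borel measures that makes all evaluations
  \<open>\<mu> \<mapsto> \<integral> f d\<mu>\<close> with \<open>f \<in> Cc\<close> continuous.\<close>

definition vague_topology :: "'a::topological_space measure topology" where
  "vague_topology =
     pullback_topology finite_measures (\<lambda>\<mu>. \<lambda>f\<in>Cc. \<integral>x. f x \<partial>\<mu>) (product_topology (\<lambda>_. euclideanreal) Cc)"


section \<open>Modes of convergence\<close>

text \<open>The random elements \<open>Y \<epsilon>\<close> only have to be almost surely well defined: \<open>Y \<epsilon>\<close> has to agree
  almost surely with a genuine \<open>T\<close>-valued random element \<open>Y' \<epsilon>\<close>. The value of the limit relation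
  does not depend on the choice of the versions \<open>Y'\<close>.\<close>

definition converges_in_distribution ::
    "'w measure \<Rightarrow> 'b topology \<Rightarrow> ('e \<Rightarrow> 'w \<Rightarrow> 'b) \<Rightarrow> ('w \<Rightarrow> 'b) \<Rightarrow> 'e filter \<Rightarrow> bool" where
  "converges_in_distribution N T Y Y0 G \<longleftrightarrow>
     Y0 \<in> N \<rightarrow>\<^sub>M borel_of T \<and>
     (\<exists>Y'. (\<forall>\<^sub>F \<epsilon> in G. Y' \<epsilon> \<in> N \<rightarrow>\<^sub>M borel_of T \<and> (AE \<omega> in N. Y \<epsilon> \<omega> = Y' \<epsilon> \<omega>)) \<and>
        (\<forall>\<Phi>. continuous_map T euclideanreal \<Phi> \<and> bounded (\<Phi> ` topspace T) \<longrightarrow>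
           ((\<lambda>\<epsilon>. \<integral>\<omega>. \<Phi> (Y' \<epsilon> \<omega>) \<partial>N) \<longlongrightarrow> (\<integral>\<omega>. \<Phi> (Y0 \<omega>) \<partial>N)) G))"

definition in_Lk :: "'w measure \<Rightarrow> nat \<Rightarrow> ('w \<Rightarrow> real) \<Rightarrow> bool" where
  "in_Lk N k Z \<longleftrightarrow> Z \<in> borel_measurable N \<and> integrable N (\<lambda>\<omega>. \<bar>Z \<omega>\<bar> ^ k)"

definition converges_in_Lk ::
    "'w measure \<Rightarrow> nat \<Rightarrow> ('e \<Rightarrow> 'w \<Rightarrow> real) \<Rightarrow> ('w \<Rightarrow> real) \<Rightarrow> 'e filter \<Rightarrow> bool" where
  "converges_in_Lk N k Z Z0 G \<longleftrightarrow>
     in_Lk N k Z0 \<and> (\<forall>\<^sub>F \<epsilon> in G. in_Lk N k (Z \<epsilon>)) \<and>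
     ((\<lambda>\<epsilon>. \<integral>\<omega>. \<bar>Z \<epsilon> \<omega> - Z0 \<omega>\<bar> ^ k \<partial>N) \<longlongrightarrow> 0) G"


section \<open>Hunt processes\<close>

text \<open>The state space \<open>E\<close> is the type \<open>'a\<close>; the cemetery \<open>\<Delta>\<close> is \<open>None :: 'a option\<close>, adjoined as the
  point at infinity of the one-point compactification (an isolated point if \<open>E\<close> is compact).
  Processes are indexed by \<open>[0, \<infinity>]\<close>, i.e. by \<^typ>\<open>ennreal\<close>.\<close>

definition E_Delta :: "'a::topological_space option topology" where
  "E_Delta = Alexandroff_compactification euclidean"

abbreviation borel_Delta :: "'a::topological_space option measure" where
  "borel_Delta \<equiv> borel_of E_Delta"

definition lifetime :: "(ennreal \<Rightarrow> 'w \<Rightarrow> 'a option) \<Rightarrow> 'w \<Rightarrow> ennreal" where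
  "lifetime X \<omega> = Inf {t. X t \<omega> = None}"

definition admissible_filtration ::
    "'w measure \<Rightarrow> (ennreal \<Rightarrow> 'w \<Rightarrow> 'a::topological_space option) \<Rightarrow> (ennreal \<Rightarrow> 'w measure) \<Rightarrow> bool" where
  "admissible_filtration \<Omega> X F \<longleftrightarrow>
     filtration (space \<Omega>) F \<and> (\<forall>t. sets (F t) \<subseteq> sets \<Omega>) \<and> (\<forall>t. X t \<in> F t \<rightarrow>\<^sub>M borel_Delta)"

definition right_continuous_filtration :: "(ennreal \<Rightarrow> 'w measure) \<Rightarrow> bool" where
  "right_continuous_filtration F \<longleftrightarrow> (\<forall>t<\<infinity>. sets (F t) = (\<Inter>u\<in>{t<..}. sets (F u)))"

locale markov_process =
  fixes \<Omega> :: "'w measure"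
    and P :: "'a::{metric_space, second_countable_topology} option \<Rightarrow> 'w measure"
    and X :: "ennreal \<Rightarrow> 'w \<Rightarrow> 'a option"
  assumes prob_P: "\<And>x. P x \<in> space (prob_algebra \<Omega>)"
    and measurable_X: "\<And>t. X t \<in> \<Omega> \<rightarrow>\<^sub>M borel_Delta"
    and borel_transition: "\<And>t B. B \<in> sets borel_Delta \<Longrightarrow>
          (\<lambda>x. emeasure (P x) {\<omega>\<in>space \<Omega>. X t \<omega> \<in> B}) \<in> borel_measurable borel_Delta"
    and markov_property: "\<exists>F. admissible_filtration \<Omega> X F \<and>
          (\<forall>x t s. \<forall>B\<in>sets borel_Delta. t < \<infinity> \<and> s < \<infinity> \<longrightarrow>
             (AE \<omega> in P (Some x).
                real_cond_exp (P (Some x)) (F t) (\<lambda>\<omega>. indicator B (X (t + s) \<omega>)) \<omega> =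
                measure (P (X t \<omega>)) {\<omega>'\<in>space \<Omega>. X s \<omega>' \<in> B}))"
    and cemetery: "\<And>t. AE \<omega> in P None. X t \<omega> = None"
    and normal: "\<And>x. AE \<omega> in P (Some x). X 0 \<omega> = Some x"

text \<open>The law with initial distribution \<open>\<mu>\<close>, i.e. \<open>\<Lambda> \<mapsto> \<integral> P x \<Lambda> \<mu>(dx)\<close>. The completion of \<open>\<mu>\<close> is taken
  because \<open>x \<mapsto> P x \<Lambda>\<close> is in general only universally measurable for \<open>\<Lambda>\<close> in \<open>\<Omega>\<close>.\<close>

definition initial_law :: "('b \<Rightarrow> 'w measure) \<Rightarrow> 'b measure \<Rightarrow> 'w measure" where
  "initial_law P \<mu> = bind (completion \<mu>) P"

definition strong_markov ::
    "'w measure \<Rightarrow> ('a::topological_space option \<Rightarrow> 'w measure) \<Rightarrow> (ennreal \<Rightarrow> 'w \<Rightarrow> 'a option) \<Rightarrow>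
     (ennreal \<Rightarrow> 'w measure) \<Rightarrow> bool" where
  "strong_markov \<Omega> P X F \<longleftrightarrow>
     (\<forall>\<mu>\<in>space (prob_algebra borel_Delta). \<forall>\<sigma> s. \<forall>B\<in>sets borel_Delta.
        stopping_time F \<sigma> \<and> s < \<infinity> \<longrightarrow>
        (AE \<omega> in initial_law P \<mu>.
           real_cond_exp (initial_law P \<mu>) (filtration.pre_sigma (space \<Omega>) F \<sigma>)
             (\<lambda>\<omega>. indicator B (X (\<sigma> \<omega> + s) \<omega>)) \<omega> =
           measure (P (X (\<sigma> \<omega>) \<omega>)) {\<omega>'\<in>space \<Omega>. X s \<omega>' \<in> B}))"

definition quasi_left_continuous ::
    "('a::topological_space option \<Rightarrow> 'w measure) \<Rightarrow> (ennreal \<Rightarrow> 'w \<Rightarrow> 'a option) \<Rightarrow>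
     (ennreal \<Rightarrow> 'w measure) \<Rightarrow> bool" where
  "quasi_left_continuous P X F \<longleftrightarrow>
     (\<forall>\<mu>\<in>space (prob_algebra borel_Delta). \<forall>S \<sigma>.
        (\<forall>n. stopping_time F (S n)) \<and> (\<forall>\<omega>. incseq (\<lambda>n. S n \<omega>) \<and> (\<lambda>n. S n \<omega>) \<longlonglongrightarrow> \<sigma> \<omega>) \<longrightarrow>
        (AE \<omega> in initial_law P \<mu>. \<sigma> \<omega> < \<infinity> \<longrightarrow>
           limitin E_Delta (\<lambda>n. X (S n \<omega>) \<omega>) (X (\<sigma> \<omega>) \<omega>) sequentially))"

locale hunt_process = markov_process +
  assumes universally_measurable: "\<And>\<mu>. \<mu> \<in> space (prob_algebra borel_Delta) \<Longrightarrow>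
          P \<in> completion \<mu> \<rightarrow>\<^sub>M prob_algebra \<Omega>"
    and X_infinity: "\<And>\<omega>. \<omega> \<in> space \<Omega> \<Longrightarrow> X \<infinity> \<omega> = None"
    and dead: "\<And>\<omega> t. \<omega> \<in> space \<Omega> \<Longrightarrow> lifetime X \<omega> \<le> t \<Longrightarrow> X t \<omega> = None"
    and shift: "\<exists>\<theta>. \<forall>t. \<forall>\<omega>\<in>space \<Omega>. \<theta> t \<omega> \<in> space \<Omega> \<and> (\<forall>s. X s (\<theta> t \<omega>) = X (s + t) \<omega>)"
    and right_continuous: "\<And>\<omega> t. \<omega> \<in> space \<Omega> \<Longrightarrow> t < \<infinity> \<Longrightarrow>
          limitin E_Delta (\<lambda>s. X s \<omega>) (X t \<omega>) (at_right t)"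
    and left_limits: "\<And>\<omega> t. \<omega> \<in> space \<Omega> \<Longrightarrow> 0 < t \<Longrightarrow> t < \<infinity> \<Longrightarrow>
          \<exists>l. limitin E_Delta (\<lambda>s. X s \<omega>) l (at_left t)"
    and hunt: "\<exists>F. admissible_filtration \<Omega> X F \<and> right_continuous_filtration F \<and>
          strong_markov \<Omega> P X F \<and> quasi_left_continuous P X F"


section \<open>Symmetry, irreducibility, transition densities\<close>

text \<open>Functions on \<open>E\<close> are extended by \<open>0\<close> to the cemetery.\<close>

definition semigroup_nn ::
    "('a option \<Rightarrow> 'w measure) \<Rightarrow> (ennreal \<Rightarrow> 'w \<Rightarrow> 'a option) \<Rightarrow> real \<Rightarrow> ('a \<Rightarrow> ennreal) \<Rightarrow> 'a \<Rightarrow> ennreal" where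
  "semigroup_nn P X t f x =
     (\<integral>\<^sup>+\<omega>. (case X (ennreal t) \<omega> of None \<Rightarrow> 0 | Some y \<Rightarrow> f y) \<partial>P (Some x))"

definition semigroup_real ::
    "('a option \<Rightarrow> 'w measure) \<Rightarrow> (ennreal \<Rightarrow> 'w \<Rightarrow> 'a option) \<Rightarrow> real \<Rightarrow> ('a \<Rightarrow> real) \<Rightarrow> 'a \<Rightarrow> real" where
  "semigroup_real P X t f x =
     (\<integral>\<omega>. (case X (ennreal t) \<omega> of None \<Rightarrow> 0 | Some y \<Rightarrow> f y) \<partial>P (Some x))"

definition m_symmetric ::
    "'a::topological_space measure \<Rightarrow> ('a option \<Rightarrow> 'w measure) \<Rightarrow> (ennreal \<Rightarrow> 'w \<Rightarrow> 'a option) \<Rightarrow> bool" where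
  "m_symmetric m P X \<longleftrightarrow>
     (\<forall>t>0. \<forall>u\<in>borel_measurable borel. \<forall>v\<in>borel_measurable borel.
        (\<integral>\<^sup>+x. u x * semigroup_nn P X t v x \<partial>m) = (\<integral>\<^sup>+x. semigroup_nn P X t u x * v x \<partial>m))"

definition invariant_set ::
    "'a::topological_space measure \<Rightarrow> ('a option \<Rightarrow> 'w measure) \<Rightarrow> (ennreal \<Rightarrow> 'w \<Rightarrow> 'a option) \<Rightarrow>
     'a set \<Rightarrow> bool" where
  "invariant_set m P X A \<longleftrightarrow>
     A \<in> sets borel \<and>
     (\<forall>t>0. \<forall>f\<in>borel_measurable borel. integrable m (\<lambda>x. (f x)\<^sup>2) \<longrightarrow>
        (AE x in m. semigroup_real P X t (\<lambda>y. indicator A y * f y) x =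
                    indicator A x * semigroup_real P X t f x))"

definition irreducible_process ::
    "'a::topological_space measure \<Rightarrow> ('a option \<Rightarrow> 'w measure) \<Rightarrow> (ennreal \<Rightarrow> 'w \<Rightarrow> 'a option) \<Rightarrow> bool" where
  "irreducible_process m P X \<longleftrightarrow>
     (\<forall>A. invariant_set m P X A \<longrightarrow> emeasure m A = 0 \<or> emeasure m (UNIV - A) = 0)"

text \<open>Only times \<open>t > 0\<close> matter. No regularity beyond joint measurability is required of \<open>q\<close>.\<close>

definition transition_density ::
    "'a::topological_space measure \<Rightarrow> ('a option \<Rightarrow> 'w measure) \<Rightarrow> (ennreal \<Rightarrow> 'w \<Rightarrow> 'a option) \<Rightarrow>
     (real \<Rightarrow> 'a \<Rightarrow> 'a \<Rightarrow> ennreal) \<Rightarrow> bool" where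
  "transition_density m P X q \<longleftrightarrow>
     (\<lambda>(t, x, y). q t x y)
        \<in> borel_measurable (restrict_space borel {0<..} \<Otimes>\<^sub>M borel \<Otimes>\<^sub>M borel) \<and>
     (\<forall>t>0. \<forall>x. \<forall>A\<in>sets borel.
        emeasure (P (Some x)) {\<omega>\<in>space (P (Some x)). X (ennreal t) \<omega> \<in> Some ` A} =
        (\<integral>\<^sup>+y\<in>A. q t x y \<partial>m))"

definition resolvent_density :: "real \<Rightarrow> (real \<Rightarrow> 'a \<Rightarrow> 'a \<Rightarrow> ennreal) \<Rightarrow> 'a \<Rightarrow> 'a \<Rightarrow> ennreal" where
  "resolvent_density \<alpha> q x y = (\<integral>\<^sup>+s\<in>{0<..}. ennreal (exp (- \<alpha> * s)) * q s x y \<partial>lborel)"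


text \<open>Several Hunt processes may share the measurable space \<open>\<Omega>\<close>: on a product space, process \<open>i\<close> has
  the laws \<open>P i x\<close> obtained by replacing the \<open>i\<close>-th factor of the product measure. A measure \<open>\<P>\<close> with
  \<open>P i (Some (x0 i)) = \<P>\<close> for all \<open>i\<close> is then a single law under which process \<open>i\<close> starts at \<open>x0 i\<close>.\<close>

section \<open>Independent processes and their approximated intersection measure\<close>

definition independent_processes ::
    "'w measure \<Rightarrow> nat \<Rightarrow> (nat \<Rightarrow> ennreal \<Rightarrow> 'w \<Rightarrow> 'a::topological_space option) \<Rightarrow> bool" where
  "independent_processes \<P> p X \<longleftrightarrow>
     prob_space.indep_vars \<P> (\<lambda>_. \<Pi>\<^sub>M t\<in>(UNIV::ennreal set). borel_Delta) (\<lambda>i \<omega> t. X i t \<omega>) {1..p}"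

definition alive_event :: "'w measure \<Rightarrow> nat \<Rightarrow> (nat \<Rightarrow> ennreal \<Rightarrow> 'w \<Rightarrow> 'a option) \<Rightarrow> real \<Rightarrow> 'w set" where
  "alive_event \<P> p X t = {\<omega>\<in>space \<P>. ennreal t < (MIN i\<in>{1..p}. lifetime (X i) \<omega>)}"

definition alive_measure ::
    "'w measure \<Rightarrow> nat \<Rightarrow> (nat \<Rightarrow> ennreal \<Rightarrow> 'w \<Rightarrow> 'a option) \<Rightarrow> real \<Rightarrow> 'w measure" where
  "alive_measure \<P> p X t = uniform_measure \<P> (alive_event \<P> p X t)"

text \<open>The value \<open>0\<close> at the cemetery is never used on \<^const>\<open>alive_event\<close>, which carries all the mass
  of \<^const>\<open>alive_measure\<close>.\<close>

definition approx_intersection_measure ::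
    "'a::topological_space measure \<Rightarrow> nat \<Rightarrow> (nat \<Rightarrow> ennreal \<Rightarrow> 'w \<Rightarrow> 'a option) \<Rightarrow>
     (nat \<Rightarrow> real \<Rightarrow> 'a \<Rightarrow> 'a \<Rightarrow> ennreal) \<Rightarrow> real \<Rightarrow> real \<Rightarrow> 'w \<Rightarrow> 'a measure" where
  "approx_intersection_measure m p X q t \<epsilon> \<omega> =
     density m (\<lambda>x. \<integral>\<^sup>+s. (\<Prod>i=1..p. case X i (ennreal (s i)) \<omega> of None \<Rightarrow> 0 | Some y \<Rightarrow> q i \<epsilon> y x)
                    \<partial>(\<Pi>\<^sub>M i\<in>{1..p}. restrict_space lborel {0..t}))"

end

theory Submission
  imports Defs
begin

text \<open>
  Fix \<open>t\<close> and write \<open>W \<epsilon> f\<close> for the integral of \<open>f\<close> against the approximated intersection measure. By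
  independence, the second moments \<open>E (W a f * W b f)\<close> are integrals over \<open>m \<otimes> m\<close> of a product over \<open>i\<close>
  of the functions \<open>(T a \<otimes> T b) h\<close>, where \<open>T\<close> is the transition semigroup of the \<open>i\<close>-th process and
  \<open>h\<close> is the density of its occupation measures at pairs of times, which is dominated by products of
  resolvent densities and hence lies in \<open>L\<^sup>p\<close>. Symmetric semigroups are strongly continuous on
  \<open>L\<^sup>2\<close>, hence on \<open>L\<^sup>p\<close> by truncation, so \<open>W \<epsilon> f\<close> is Cauchy in \<open>L\<^sup>2\<close> as \<open>\<epsilon> \<rightarrow> 0\<close> for every bounded
  Borel function \<open>f\<close>. The same domination bounds all moments uniformly in \<open>\<epsilon>\<close>.

  The setwise limits, dominated in mean by one finite measure, are regularised to a random measure by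
  embedding \<open>E\<close> into the real line as a Borel set and passing to distribution functions. The vague
  topology is determined by the integrals of countably many Urysohn functions, and along suitable
  sequences \<open>\<epsilon> \<rightarrow> 0\<close> all of these converge almost surely. This gives convergence in distribution, and
  convergence in \<open>L\<^sup>k\<close> follows from convergence in \<open>L\<^sup>1\<close> and the bounded moments of order \<open>k + 1\<close>.
\<close>

text \<open>All integrals are taken in \<open>ennreal\<close>, so that Tonelli applies at every
  exchange before anything is known to be finite; differences are measured by \<open>ed\<close>, and
  a term is cancelled only once it is known to be finite. The obstacle is that the densities are
  merely jointly measurable: symmetry and the Chapman-Kolmogorov equation are available for the
  operators, not for the densities at given points. Identities between kernels are therefore
  obtained by testing against functions and hold almost everywhere, while the semigroup law is taken
  from the process and holds everywhere. No candidate for the limit is written down; the Cauchy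
  property of the whole family replaces it. Convergence is proved for bounded Borel functions, not
  just continuous ones, because the limit is to be built from its values on sets: these limits,
  together with a dominating finite measure, yield countable additivity. All estimates are made
  under the unconditioned law; conditioning on survival up to \<open>t\<close> costs a constant
  factor.\<close>

section \<open>Extended nonnegative reals\<close>

text \<open>The distance has value \<open>0\<close> at \<open>(\<infinity>, \<infinity>)\<close>, so that \<open>ed_le_iff\<close> holds without exception.\<close>

definition ed :: "ennreal \<Rightarrow> ennreal \<Rightarrow> ennreal" where
  "ed a b = (if a = b then 0 else (a - b) + (b - a))"

text \<open>The metric properties below are read off from these two one-sided inequalities, so that
  they involve no truncated subtraction.\<close>

lemma ed_le_iff: "ed a b \<le> c \<longleftrightarrow> a \<le> b + c \<and> b \<le> a + c"
proof (cases "a = \<top> \<or> b = \<top>")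
  case True
  then show ?thesis
    by (auto simp: ed_def top_unique)
next
  case False
  then obtain x y where xy: "a = ennreal x" "b = ennreal y" "x \<ge> 0" "y \<ge> 0"
    by (metis ennreal_cases)
  show ?thesis
  proof (cases c)
    case (real z)
    show ?thesis
      using xy real by (cases "x \<le> y") (auto simp: ed_def ennreal_minus ennreal_neg simp flip: ennreal_plus)
  qed (use xy in auto)
qed

lemma ed_self [simp]: "ed a a = 0"
  by (simp add: ed_def)

lemma ed_upper: "a \<le> b + ed a b"
  using ed_le_iff[of a b "ed a b"] by simp

lemma ed_upper': "b \<le> a + ed a b"
  using ed_le_iff[of a b "ed a b"] by simp

lemma ed_triangle: "ed a c \<le> ed a b + ed b c"
  unfolding ed_le_iff
proof
  have "a \<le> b + ed a b" by (rule ed_upper)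
  also have "\<dots> \<le> (c + ed b c) + ed a b" by (intro add_right_mono ed_upper)
  finally show "a \<le> c + (ed a b + ed b c)" by (simp add: ac_simps)
  have "c \<le> b + ed b c" by (rule ed_upper')
  also have "\<dots> \<le> (a + ed a b) + ed b c" by (intro add_right_mono ed_upper')
  finally show "c \<le> a + (ed a b + ed b c)" by (simp add: ac_simps)
qed

lemma ed_le_max: "ed a b \<le> max a b"
  by (auto simp: ed_le_iff intro: add_increasing add_increasing2)

lemma ed_add_le: "ed (a + c) (b + d) \<le> ed a b + ed c d"
  unfolding ed_le_iff
proof
  have "a + c \<le> (b + ed a b) + (d + ed c d)"
    by (intro add_mono ed_upper)
  then show "a + c \<le> b + d + (ed a b + ed c d)"
    by (simp add: ac_simps)
  have "b + d \<le> (a + ed a b) + (c + ed c d)"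
    by (intro add_mono ed_upper')
  then show "b + d \<le> a + c + (ed a b + ed c d)"
    by (simp add: ac_simps)
qed

lemma ed_ennreal: "a \<ge> 0 \<Longrightarrow> b \<ge> 0 \<Longrightarrow> ed (ennreal a) (ennreal b) = ennreal \<bar>a - b\<bar>"
  by (cases "a \<le> b") (auto simp: ed_def ennreal_minus ennreal_neg)

lemma ed_eq_0_iff: "ed a b = 0 \<longleftrightarrow> a = b"
  using ed_le_iff[of a b 0] by auto

lemma measurable_ed [measurable]:
  assumes [measurable]: "f \<in> borel_measurable M" "g \<in> borel_measurable M"
  shows "(\<lambda>x. ed (f x) (g x)) \<in> borel_measurable M"
  unfolding ed_def by measurable

text \<open>The binomial formula with the mixed term kept on the left: it stays true at infinity and
  can be integrated termwise. Finiteness of the mixed integral matters only when it is cancelled at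
  the very end.\<close>

lemma ed_square: "(ed a b)\<^sup>2 + 2 * (a * b) = a\<^sup>2 + b\<^sup>2"
proof (cases "a = \<top> \<or> b = \<top>")
  case True
  then show ?thesis
    by (auto simp: ed_def power2_eq_square ennreal_top_mult ennreal_mult_top)
next
  case False
  then obtain x y where xy: "a = ennreal x" "b = ennreal y" "x \<ge> 0" "y \<ge> 0"
    by (metis ennreal_cases)
  have *: "(2::ennreal) = ennreal 2" by simp
  have "(x - y)\<^sup>2 + 2 * (x * y) = x\<^sup>2 + y\<^sup>2"
    by (simp add: power2_eq_square algebra_simps)
  then show ?thesis
    using xy unfolding * by (simp add: ed_ennreal ennreal_power del: ennreal_numeral
        flip: ennreal_mult ennreal_plus)
qed

text \<open>The largest factor, raised to the number of factors, bounds the product. This crude form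
  of the inequality of arithmetic and geometric means stands in for the generalised Hoelder
  inequality wherever only finiteness matters.\<close>

lemma prod_le_sum_power:
  fixes h :: "'i \<Rightarrow> ennreal"
  assumes "finite I" "I \<noteq> {}"
  shows "(\<Prod>i\<in>I. h i) \<le> (\<Sum>i\<in>I. h i ^ card I)"
proof -
  have "Max (h ` I) \<in> h ` I"
    using assms by (intro Max_in) auto
  then obtain i0 where i0: "i0 \<in> I" "Max (h ` I) = h i0"
    by auto
  have "(\<Prod>i\<in>I. h i) \<le> (\<Prod>i\<in>I. h i0)"
    using assms by (intro prod_mono_ennreal) (simp_all add: i0(2)[symmetric])
  also have "\<dots> = h i0 ^ card I" by simp
  also have "\<dots> \<le> (\<Sum>i\<in>I. h i ^ card I)"
    using i0 assms by (intro member_le_sum) auto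
  finally show ?thesis .
qed

text \<open>Each summand is at most the largest one. The resulting constant is larger than the one
  from convexity, which is harmless here.\<close>

lemma power_sum_le:
  fixes h :: "'i \<Rightarrow> ennreal"
  assumes "finite I" "I \<noteq> {}"
  shows "(\<Sum>i\<in>I. h i) ^ n \<le> of_nat (card I) ^ n * (\<Sum>i\<in>I. h i ^ n)"
proof -
  have "Max (h ` I) \<in> h ` I"
    using assms by (intro Max_in) auto
  then obtain i0 where i0: "i0 \<in> I" "Max (h ` I) = h i0"
    by auto
  have "(\<Sum>i\<in>I. h i) \<le> of_nat (card I) * h i0"
    using assms by (intro sum_bounded_above) (simp_all add: i0(2)[symmetric])
  then have "(\<Sum>i\<in>I. h i) ^ n \<le> (of_nat (card I) * h i0) ^ n"
    by (intro power_mono_ennreal)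
  also have "\<dots> = of_nat (card I) ^ n * h i0 ^ n" by (simp add: power_mult_distrib)
  also have "\<dots> \<le> of_nat (card I) ^ n * (\<Sum>i\<in>I. h i ^ n)"
    using i0 assms by (intro mult_left_mono member_le_sum) auto
  finally show ?thesis .
qed

lemma power_add_le: "(a + b) ^ n \<le> 2 ^ n * (a ^ n + b ^ n)" for a b :: ennreal
  using power_sum_le[of "UNIV::bool set" "\<lambda>i. if i then a else b" n]
  by (simp add: UNIV_bool add.commute)

text \<open>The weight \<open>c\<close> replaces Hoelder's inequality: the first summand is small for \<open>x\<close> small, the second
  for \<open>c\<close> small.\<close>

lemma mult_prod_le_weighted:
  fixes h :: "'i \<Rightarrow> ennreal"
  assumes "finite I" "0 < c"
  shows "x * (\<Prod>i\<in>I. h i) \<le>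
     ennreal (1 / c) ^ (card I * Suc (card I)) * x ^ Suc (card I) + ennreal c ^ Suc (card I) * (\<Sum>i\<in>I. h i ^ Suc (card I))"
proof -
  \<comment> \<open>The weights \<open>(1 / c) ^ card I\<close> on \<open>x\<close> and
    \<open>c\<close> on each \<open>h i\<close> multiply to \<open>1\<close>, so the product is
    unchanged while the powers are rescaled.\<close>
  define g where "g j = (case j of None \<Rightarrow> ennreal (1 / c) ^ card I * x | Some i \<Rightarrow> ennreal c * h i)" for j
  define J where "J = insert None (Some ` I)"
  have J: "finite J" "J \<noteq> {}" "card J = Suc (card I)"
    using assms by (auto simp: J_def card_image)
  have c: "ennreal (1 / c) * ennreal c = 1"
    using assms by (simp flip: ennreal_mult)
  have "(\<Prod>j\<in>J. g j) = (ennreal (1/c) ^ card I * x) * (\<Prod>i\<in>I. ennreal c * h i)"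
    using assms by (simp add: J_def g_def prod.reindex)
  also have "\<dots> = (ennreal (1/c) ^ card I * ennreal c ^ card I) * (x * (\<Prod>i\<in>I. h i))"
    by (simp add: prod.distrib ac_simps)
  also have "\<dots> = x * (\<Prod>i\<in>I. h i)"
    by (simp add: c flip: power_mult_distrib)
  finally have "x * (\<Prod>i\<in>I. h i) \<le> (\<Sum>j\<in>J. g j ^ Suc (card I))"
    using prod_le_sum_power[of J g] J by simp
  also have "\<dots> = (ennreal (1/c) ^ card I * x) ^ Suc (card I) + (\<Sum>i\<in>I. (ennreal c * h i) ^ Suc (card I))"
    using assms by (simp add: J_def g_def sum.reindex)
  finally show ?thesis
    by (simp only: power_mult_distrib power_mult sum_distrib_left)
qed

text \<open>The factors are exchanged one at a time. Bounding the other factors by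
  \<open>a l + b l\<close> makes the error term independent of the order of exchange.\<close>

lemma prod_le_prod_add_ed:
  fixes a b :: "'i \<Rightarrow> ennreal"
  assumes "finite I"
  shows "(\<Prod>i\<in>I. a i) \<le> (\<Prod>i\<in>I. b i) + (\<Sum>i\<in>I. ed (a i) (b i) * (\<Prod>l\<in>I - {i}. a l + b l))"
  using assms
proof (induction I rule: finite_induct)
  case (insert j I)
  let ?E = "\<lambda>I. \<Sum>i\<in>I. ed (a i) (b i) * (\<Prod>l\<in>I - {i}. a l + b l)"
  have I: "(\<Prod>i\<in>insert j I. a i) = a j * (\<Prod>i\<in>I. a i)"
    using insert.hyps by simp
  have "a j * (\<Prod>i\<in>I. a i) \<le> a j * ((\<Prod>i\<in>I. b i) + ?E I)"
    using insert.IH by (rule mult_left_mono) simp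
  also have "\<dots> = a j * (\<Prod>i\<in>I. b i) + a j * ?E I"
    by (simp add: distrib_left)
  also have "\<dots> \<le> (b j + ed (a j) (b j)) * (\<Prod>i\<in>I. b i) + (a j + b j) * ?E I"
    by (intro add_mono mult_right_mono ed_upper) auto
  also have "\<dots> = b j * (\<Prod>i\<in>I. b i) + ed (a j) (b j) * (\<Prod>i\<in>I. b i) + (a j + b j) * ?E I"
    by (simp add: distrib_right)
  also have "\<dots> \<le> b j * (\<Prod>i\<in>I. b i) + ed (a j) (b j) * (\<Prod>i\<in>I. a i + b i) + (a j + b j) * ?E I"
    by (intro add_mono mult_left_mono prod_mono_ennreal order_refl) (auto simp: add_increasing)
  also have "(a j + b j) * ?E I = (\<Sum>i\<in>I. ed (a i) (b i) * (\<Prod>l\<in>insert j I - {i}. a l + b l))"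
    unfolding sum_distrib_left
  proof (intro sum.cong refl)
    fix i assume "i \<in> I"
    then have "insert j I - {i} = insert j (I - {i})" "j \<notin> I - {i}"
      using insert.hyps by auto
    then show "(a j + b j) * (ed (a i) (b i) * (\<Prod>l\<in>I - {i}. a l + b l)) =
        ed (a i) (b i) * (\<Prod>l\<in>insert j I - {i}. a l + b l)"
      using insert.hyps by (simp add: ac_simps)
  qed
  also have "ed (a j) (b j) * (\<Prod>i\<in>I. a i + b i) = ed (a j) (b j) * (\<Prod>l\<in>insert j I - {j}. a l + b l)"
    using insert.hyps by simp
  also have "b j * (\<Prod>i\<in>I. b i) + ed (a j) (b j) * (\<Prod>l\<in>insert j I - {j}. a l + b l) +
      (\<Sum>i\<in>I. ed (a i) (b i) * (\<Prod>l\<in>insert j I - {i}. a l + b l)) =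
      (\<Prod>i\<in>insert j I. b i) + ?E (insert j I)"
    using insert.hyps by (simp add: ac_simps)
  finally show ?case
    unfolding I .
qed simp

text \<open>The tangent of \<open>h ^ n\<close> at \<open>a\<close> lies below the graph; the
  inequality is rearranged so that no subtraction occurs.\<close>

lemma power_tangent_le:
  fixes h a :: ennreal
  assumes "n \<ge> 1"
  shows "of_nat n * (a ^ (n - 1) * h) \<le> h ^ n + of_nat (n - 1) * a ^ n"
proof (cases "h = \<top> \<or> a = \<top>")
  case True
  consider "h = \<top>" | "a = \<top>" "n = 1" | "a = \<top>" "n > 1" using True assms by linarith
  then show ?thesis
    using assms by cases (auto simp: ennreal_mult_top)
next
  case False
  then obtain x y where xy: "h = ennreal x" "a = ennreal y" "x \<ge> 0" "y \<ge> 0"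
    by (metis ennreal_cases)
  obtain k where k: "n = Suc k" using assms by (cases n) auto
  have "real (Suc k) * (y ^ k * x) \<le> x ^ Suc k + real k * y ^ Suc k"
  proof (induction k)
    case (Suc k)
    \<comment> \<open>This product of two differences of equal sign is exactly what the inductive
      step adds to \<open>y\<close> times the induction hypothesis.\<close>
    have "(x - y) * (x ^ Suc k - y ^ Suc k) \<ge> 0"
      using xy power_mono[of x y "Suc k"] power_mono[of y x "Suc k"]
      by (cases "x \<le> y") (auto intro: mult_nonneg_nonneg mult_nonpos_nonpos)
    moreover have "y * (real (Suc k) * (y ^ k * x)) \<le> y * (x ^ Suc k + real k * y ^ Suc k)"
      using Suc.IH xy by (intro mult_left_mono) auto
    ultimately show ?case
      by (simp add: algebra_simps)
  qed simp
  then show ?thesis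
    using xy k
    by (simp add: ennreal_power ennreal_of_nat_eq_real_of_nat flip: ennreal_mult ennreal_plus)
qed

text \<open>Jensen's inequality for a density of mass at most \<open>1\<close>: the tangent
  inequality at the mean \<open>a\<close> is integrated. Missing mass only helps, because the
  constant term of the tangent stands on the larger side.\<close>

lemma nn_integral_power_le:
  fixes k h :: "'s \<Rightarrow> ennreal"
  assumes [measurable]: "k \<in> borel_measurable M" "h \<in> borel_measurable M"
    and k: "(\<integral>\<^sup>+x. k x \<partial>M) \<le> 1" and n: "n \<ge> 1"
  shows "(\<integral>\<^sup>+x. k x * h x \<partial>M) ^ n \<le> (\<integral>\<^sup>+x. k x * h x ^ n \<partial>M)"
proof -
  define a where "a = (\<integral>\<^sup>+x. k x * h x \<partial>M)"
  define b where "b = (\<integral>\<^sup>+x. k x * h x ^ n \<partial>M)"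
  obtain l where l: "n = Suc l" using n by (cases n) auto
  have "a ^ n \<le> b"
  \<comment> \<open>An infinite mean admits no tangent; here \<open>h \<le> 1 + h ^ n\<close>
    already forces the right-hand side to be infinite.\<close>
  proof (cases "a = \<top>")
    case True
    have "h x \<le> 1 + h x ^ n" for x
    proof (cases "h x \<le> 1")
      case True then show ?thesis by (simp add: add_increasing2)
    next
      case False
      then have "1 \<le> h x ^ l"
        using power_mono_ennreal[of 1 "h x" l] by simp
      then have "h x * 1 \<le> h x * h x ^ l"
        by (rule mult_left_mono) simp
      then show ?thesis by (simp add: add_increasing l)
    qed
    then have "k x * h x \<le> k x * (1 + h x ^ n)" for x
      by (intro mult_left_mono) auto
    then have "a \<le> (\<integral>\<^sup>+x. k x + k x * h x ^ n \<partial>M)"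
      unfolding a_def distrib_left mult_1_right by (intro nn_integral_mono)
    also have "\<dots> = (\<integral>\<^sup>+x. k x \<partial>M) + b"
      unfolding b_def by (rule nn_integral_add) auto
    also have "\<dots> \<le> 1 + b"
      using k by (rule add_right_mono)
    finally show ?thesis
      using True by (simp add: top_unique)
  next
    case False
    have "of_nat n * (a ^ l * a) = (\<integral>\<^sup>+x. of_nat n * (a ^ l * (k x * h x)) \<partial>M)"
      unfolding a_def by (simp add: nn_integral_cmult)
    also have "\<dots> = (\<integral>\<^sup>+x. k x * (of_nat n * (a ^ (n - 1) * h x)) \<partial>M)"
      unfolding l by (intro nn_integral_cong) (simp add: mult.left_commute)
    also have "\<dots> \<le> (\<integral>\<^sup>+x. k x * (h x ^ n + of_nat (n - 1) * a ^ n) \<partial>M)"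
      by (intro nn_integral_mono mult_left_mono power_tangent_le n) auto
    also have "\<dots> = b + (\<integral>\<^sup>+x. k x \<partial>M) * (of_nat l * a ^ n)"
      unfolding b_def l distrib_left by (subst nn_integral_add) (auto simp: nn_integral_multc)
    also have "\<dots> \<le> b + 1 * (of_nat l * a ^ n)"
      by (intro add_left_mono mult_right_mono k) auto
    also have "of_nat n * (a ^ l * a) = of_nat l * a ^ n + a ^ n"
      unfolding l by (simp add: distrib_right power_Suc2 add.commute del: power_Suc)
    finally have *: "of_nat l * a ^ n + a ^ n \<le> of_nat l * a ^ n + b"
      by (simp only: add.commute mult_1)
    have "of_nat l * a ^ n \<noteq> \<top>"
      using False by (simp add: ennreal_mult_eq_top_iff power_eq_top_ennreal)
    then show ?thesis
      using * by (simp add: ennreal_add_left_cancel_le)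
  qed
  then show ?thesis unfolding a_def b_def .
qed

text \<open>\<open>max f g\<close> and \<open>g\<close> have the same integral over every set, so
  uniqueness of densities applies and differences of possibly infinite integrals never
  occur.\<close>

lemma (in sigma_finite_measure) AE_le_of_set_nn_integral_le:
  assumes [measurable]: "f \<in> borel_measurable M" "g \<in> borel_measurable M"
    and le: "\<And>A. A \<in> sets M \<Longrightarrow> (\<integral>\<^sup>+x\<in>A. f x \<partial>M) \<le> (\<integral>\<^sup>+x\<in>A. g x \<partial>M)"
  shows "AE x in M. f x \<le> g x"
proof -
  have "AE x in M. max (f x) (g x) = g x"
  proof (rule density_unique2)
    fix A assume [measurable]: "A \<in> sets M"
    define B where "B = {x\<in>space M. g x < f x}"
    have [measurable]: "B \<in> sets M" unfolding B_def by measurable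
    have "(\<integral>\<^sup>+x\<in>A. max (f x) (g x) \<partial>M) = (\<integral>\<^sup>+x. f x * indicator (A \<inter> B) x + g x * indicator (A - B) x \<partial>M)"
      by (intro nn_integral_cong) (auto simp: B_def max_def split: split_indicator)
    also have "\<dots> = (\<integral>\<^sup>+x\<in>A \<inter> B. f x \<partial>M) + (\<integral>\<^sup>+x\<in>A - B. g x \<partial>M)"
      by (intro nn_integral_add) auto
    also have "\<dots> \<le> (\<integral>\<^sup>+x\<in>A \<inter> B. g x \<partial>M) + (\<integral>\<^sup>+x\<in>A - B. g x \<partial>M)"
      by (intro add_right_mono le) auto
    also have "\<dots> = (\<integral>\<^sup>+x. g x * indicator (A \<inter> B) x + g x * indicator (A - B) x \<partial>M)"
      by (subst nn_integral_add) auto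
    also have "\<dots> = (\<integral>\<^sup>+x\<in>A. g x \<partial>M)"
      by (intro nn_integral_cong) (auto split: split_indicator)
    finally have "(\<integral>\<^sup>+x\<in>A. max (f x) (g x) \<partial>M) \<le> (\<integral>\<^sup>+x\<in>A. g x \<partial>M)" .
    moreover have "(\<integral>\<^sup>+x\<in>A. g x \<partial>M) \<le> (\<integral>\<^sup>+x\<in>A. max (f x) (g x) \<partial>M)"
      by (intro nn_integral_mono) (auto split: split_indicator)
    ultimately show "(\<integral>\<^sup>+x\<in>A. max (f x) (g x) \<partial>M) = (\<integral>\<^sup>+x\<in>A. g x \<partial>M)"
      by (rule antisym)
  qed auto
  then show ?thesis
    by eventually_elim (metis max.cobounded1)
qed

section \<open>Strong continuity of symmetric semigroups\<close>

text \<open>An abstract setting, because the argument is later applied not on \<open>E\<close> but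
  to one coordinate of \<open>E \<times> E\<close>. The operators act on functions, not on classes,
  and the semigroup law is required at every point. \<open>T_const\<close> and
  \<open>T_power\<close> express the sub-Markov property and Jensen's inequality.\<close>

locale symmetric_semigroup = sigma_finite_measure M for M :: "'s measure" +
  fixes T :: "real \<Rightarrow> ('s \<Rightarrow> ennreal) \<Rightarrow> 's \<Rightarrow> ennreal"
  assumes measurable_T [measurable]: "a > 0 \<Longrightarrow> u \<in> borel_measurable M \<Longrightarrow> T a u \<in> borel_measurable M"
    and T_mono: "a > 0 \<Longrightarrow> (\<And>x. u x \<le> v x) \<Longrightarrow> T a u x \<le> T a v x"
    and T_add: "a > 0 \<Longrightarrow> u \<in> borel_measurable M \<Longrightarrow> v \<in> borel_measurable M \<Longrightarrow> x \<in> space M \<Longrightarrow>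
          T a (\<lambda>x. u x + v x) x = T a u x + T a v x"
    and T_const: "a > 0 \<Longrightarrow> T a (\<lambda>_. c) x \<le> c"
    and T_T: "a > 0 \<Longrightarrow> b > 0 \<Longrightarrow> u \<in> borel_measurable M \<Longrightarrow> x \<in> space M \<Longrightarrow> T a (T b u) x = T (a + b) u x"
    and T_sym: "a > 0 \<Longrightarrow> u \<in> borel_measurable M \<Longrightarrow> v \<in> borel_measurable M \<Longrightarrow>
          (\<integral>\<^sup>+x. u x * T a v x \<partial>M) = (\<integral>\<^sup>+x. T a u x * v x \<partial>M)"
    and T_power: "a > 0 \<Longrightarrow> u \<in> borel_measurable M \<Longrightarrow> n \<ge> 1 \<Longrightarrow> x \<in> space M \<Longrightarrow>
          T a u x ^ n \<le> T a (\<lambda>x. u x ^ n) x"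
begin

text \<open>Symmetry against the constant \<open>1\<close> moves the operator onto that constant,
  where the sub-Markov property bounds it.\<close>

lemma nn_integral_T_le:
  assumes a: "a > 0" and [measurable]: "u \<in> borel_measurable M"
  shows "(\<integral>\<^sup>+x. T a u x \<partial>M) \<le> (\<integral>\<^sup>+x. u x \<partial>M)"
proof -
  have "(\<integral>\<^sup>+x. T a u x \<partial>M) = (\<integral>\<^sup>+x. 1 * T a u x \<partial>M)" by simp
  also have "\<dots> = (\<integral>\<^sup>+x. T a (\<lambda>_. 1) x * u x \<partial>M)"
    by (intro T_sym a) auto
  also have "\<dots> \<le> (\<integral>\<^sup>+x. 1 * u x \<partial>M)"
    by (intro nn_integral_mono mult_right_mono T_const a) auto
  finally show ?thesis by simp
qed

lemma nn_integral_T_power_le: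
  assumes a: "a > 0" and u [measurable]: "u \<in> borel_measurable M" and n: "n \<ge> 1"
  shows "(\<integral>\<^sup>+x. T a u x ^ n \<partial>M) \<le> (\<integral>\<^sup>+x. u x ^ n \<partial>M)"
proof -
  have "(\<integral>\<^sup>+x. T a u x ^ n \<partial>M) \<le> (\<integral>\<^sup>+x. T a (\<lambda>x. u x ^ n) x \<partial>M)"
    by (intro nn_integral_mono T_power a u n)
  also have "\<dots> \<le> (\<integral>\<^sup>+x. u x ^ n \<partial>M)"
    by (intro nn_integral_T_le a) auto
  finally show ?thesis .
qed

lemma ed_T_le:
  assumes a: "a > 0" and [measurable]: "u \<in> borel_measurable M" "v \<in> borel_measurable M"
    and x: "x \<in> space M"
  shows "ed (T a u x) (T a v x) \<le> T a (\<lambda>x. ed (u x) (v x)) x"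
  unfolding ed_le_iff
proof
  have "T a u x \<le> T a (\<lambda>x. v x + ed (u x) (v x)) x"
    by (intro T_mono a ed_upper)
  also have "\<dots> = T a v x + T a (\<lambda>x. ed (u x) (v x)) x"
    by (intro T_add a x) auto
  finally show "T a u x \<le> T a v x + T a (\<lambda>x. ed (u x) (v x)) x" .
  have "T a v x \<le> T a (\<lambda>x. u x + ed (u x) (v x)) x"
    by (intro T_mono a ed_upper')
  also have "\<dots> = T a u x + T a (\<lambda>x. ed (u x) (v x)) x"
    by (intro T_add a x) auto
  finally show "T a v x \<le> T a u x + T a (\<lambda>x. ed (u x) (v x)) x" .
qed

lemma nn_integral_T_mult_T:
  assumes a: "a > 0" and b: "b > 0" and [measurable]: "u \<in> borel_measurable M"
  shows "(\<integral>\<^sup>+x. T a u x * T b u x \<partial>M) = (\<integral>\<^sup>+x. u x * T (a + b) u x \<partial>M)"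
proof -
  have "(\<integral>\<^sup>+x. T a u x * T b u x \<partial>M) = (\<integral>\<^sup>+x. u x * T a (T b u) x \<partial>M)"
    by (intro T_sym[symmetric] a measurable_T b) auto
  also have "\<dots> = (\<integral>\<^sup>+x. u x * T (a + b) u x \<partial>M)"
    by (intro nn_integral_cong) (simp add: T_T a b)
  finally show ?thesis .
qed

text \<open>By symmetry \<open>c \<mapsto> \<langle>u, T c u\<rangle>\<close> is antitone and bounded, hence convergent as \<open>c \<rightarrow> 0\<close>, and
  \<open>\<parallel>T a u - T b u\<parallel>\<^sup>2\<close> is a combination of its values at \<open>2 a\<close>, \<open>a + b\<close> and \<open>2 b\<close>.\<close>

lemma T_Cauchy_L2:
  assumes [measurable]: "u \<in> borel_measurable M" and fin: "(\<integral>\<^sup>+x. u x ^ 2 \<partial>M) < \<infinity>" and \<eta>: "\<eta> > 0"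
  shows "\<exists>r>0. \<forall>a b. 0 < a \<and> a < r \<and> 0 < b \<and> b < r \<longrightarrow> (\<integral>\<^sup>+x. ed (T a u x) (T b u x) ^ 2 \<partial>M) \<le> ennreal \<eta>"
proof -
  define \<phi> where "\<phi> c = (\<integral>\<^sup>+x. u x * T c u x \<partial>M)" for c
  have \<phi>_sq: "\<phi> (a + a) = (\<integral>\<^sup>+x. T a u x ^ 2 \<partial>M)" if "a > 0" for a
    using nn_integral_T_mult_T[OF that that, of u] by (simp add: \<phi>_def power2_eq_square)
  have half: "\<phi> c = \<phi> (c / 2 + c / 2)" for c
    by simp
  have \<phi>_le: "\<phi> c \<le> (\<integral>\<^sup>+x. u x ^ 2 \<partial>M)" if "c > 0" for c
    using that by (subst half, subst \<phi>_sq) (auto intro!: nn_integral_T_power_le)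
  \<comment> \<open>With half of the time on each side the value becomes a squared norm, and the
    longer time factors through a contraction.\<close>
  have anti: "\<phi> d \<le> \<phi> c" if "0 < c" "c < d" for c d
  proof -
    have "\<phi> d = (\<integral>\<^sup>+x. T (d / 2) u x ^ 2 \<partial>M)"
      using that by (subst half, subst \<phi>_sq) auto
    also have "\<dots> = (\<integral>\<^sup>+x. T (d / 2 - c / 2) (T (c / 2) u) x ^ 2 \<partial>M)"
      using that by (intro nn_integral_cong) (simp add: T_T)
    also have "\<dots> \<le> (\<integral>\<^sup>+x. T (c / 2) u x ^ 2 \<partial>M)"
      using that by (intro nn_integral_T_power_le) auto
    also have "\<dots> = \<phi> c"
      using that \<phi>_sq[of "c / 2"] by simp
    finally show ?thesis .
  qed
  define S where "S = (SUP c\<in>{0<..}. \<phi> c)"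
  have S_fin: "S < \<infinity>"
    unfolding S_def by (rule le_less_trans[OF _ fin]) (auto intro!: SUP_least \<phi>_le)
  have \<phi>_S: "\<phi> c \<le> S" if "c > 0" for c
    unfolding S_def using that by (intro SUP_upper) auto
  \<comment> \<open>\<open>c0\<close> brings the value within half of the tolerance of the supremum.
    A vanishing supremum is separated off because nothing lies strictly below it.\<close>
  obtain c0 where c0: "c0 > 0" "S < \<phi> c0 + ennreal (\<eta> / 2)"
  proof (cases "S = 0")
    case True
    then show ?thesis using that[of 1] \<eta> by (simp add: add_nonneg_pos)
  next
    case False
    then have "S - ennreal (\<eta> / 2) < S"
      using S_fin \<eta> by (intro ennreal_between) (auto simp: zero_less_iff_neq_zero)
    then obtain c where c: "c > 0" "S - ennreal (\<eta> / 2) < \<phi> c"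
      unfolding S_def less_SUP_iff by auto
    have "S < \<phi> c + ennreal (\<eta> / 2)"
    proof (rule ccontr)
      assume "\<not> S < \<phi> c + ennreal (\<eta> / 2)"
      then have "(\<phi> c + ennreal (\<eta> / 2)) - ennreal (\<eta> / 2) \<le> S - ennreal (\<eta> / 2)"
        by (intro ennreal_minus_mono) (auto simp: not_less)
      then show False using c by (simp add: not_le)
    qed
    then show ?thesis
      using that[of c] c by simp
  qed
  \<comment> \<open>Bounding \<open>a\<close> and \<open>b\<close> by \<open>c0 / 2\<close> keeps
    \<open>a + b\<close> below \<open>c0\<close>, so that the mixed term is close to the supremum as
    well.\<close>
  have "(\<integral>\<^sup>+x. ed (T a u x) (T b u x) ^ 2 \<partial>M) \<le> ennreal \<eta>" if "0 < a" "a < c0 / 2" "0 < b" "b < c0 / 2" for a b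
  proof -
    let ?I = "\<integral>\<^sup>+x. ed (T a u x) (T b u x) ^ 2 \<partial>M"
    have [measurable]: "T a u \<in> borel_measurable M" "T b u \<in> borel_measurable M"
      using that by auto
    have "?I + 2 * \<phi> (a + b) = (\<integral>\<^sup>+x. ed (T a u x) (T b u x) ^ 2 + 2 * (T a u x * T b u x) \<partial>M)"
      using that by (simp add: \<phi>_def nn_integral_add nn_integral_cmult nn_integral_T_mult_T)
    also have "\<dots> = (\<integral>\<^sup>+x. T a u x ^ 2 + T b u x ^ 2 \<partial>M)"
      by (simp only: ed_square)
    also have "\<dots> = \<phi> (a + a) + \<phi> (b + b)"
      using that \<phi>_sq[of a] \<phi>_sq[of b] by (simp add: nn_integral_add)
    also have "\<dots> \<le> S + S"
      using that by (intro add_mono \<phi>_S) auto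
    also have "\<dots> \<le> (\<phi> c0 + ennreal (\<eta> / 2)) + (\<phi> c0 + ennreal (\<eta> / 2))"
      using c0 by (intro add_mono) auto
    also have "\<dots> \<le> (\<phi> (a + b) + ennreal (\<eta> / 2)) + (\<phi> (a + b) + ennreal (\<eta> / 2))"
      using that by (intro add_mono anti order_refl) auto
    also have "\<dots> = (ennreal (\<eta> / 2) + ennreal (\<eta> / 2)) + 2 * \<phi> (a + b)"
      by (simp only: mult_2 ac_simps)
    also have "ennreal (\<eta> / 2) + ennreal (\<eta> / 2) = ennreal \<eta>"
      using \<eta> by (simp flip: ennreal_plus)
    finally have "2 * \<phi> (a + b) + ?I \<le> 2 * \<phi> (a + b) + ennreal \<eta>"
      by (simp only: add.commute)
    moreover have "\<phi> (a + b) < \<infinity>"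
      using \<phi>_S[of "a + b"] S_fin that by auto
    ultimately show ?thesis
      by (auto simp: ennreal_add_left_cancel_le ennreal_mult_eq_top_iff)
  qed
  then show ?thesis
    using c0(1) by (intro exI[of _ "c0 / 2"]) auto
qed

text \<open>The truncation is \<open>u = v n + w n\<close>. The rest \<open>w n\<close> is small in
  \<open>L^p\<close> and remains so under the contractions \<open>T a\<close>; the bulk
  \<open>v n\<close> is square integrable and bounded by \<open>N\<close>, so the
  \<open>p\<close>-th power of a difference is at most \<open>N ^ (p - 2)\<close> times its
  square.\<close>

lemma T_Cauchy:
  assumes u [measurable]: "u \<in> borel_measurable M" and fin: "(\<integral>\<^sup>+x. u x ^ p \<partial>M) < \<infinity>" and p: "p \<ge> 2"
    and \<eta>: "\<eta> > 0"
  shows "\<exists>r>0. \<forall>a b. 0 < a \<and> a < r \<and> 0 < b \<and> b < r \<longrightarrow> (\<integral>\<^sup>+x. ed (T a u x) (T b u x) ^ p \<partial>M) \<le> ennreal \<eta>"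
proof -
  \<comment> \<open>The upper cut makes \<open>v n\<close> bounded. The lower cut makes it square
    integrable, since on \<open>u \<ge> 1 / N\<close> the square is dominated by
    \<open>N ^ (p - 2) * u ^ p\<close>.\<close>
  define v where "v n x = (if u x < ennreal (1 / real (Suc n)) then 0 else min (u x) (ennreal (real (Suc n))))" for n :: nat and x
  define w where "w n x = u x - v n x" for n :: nat and x
  have v_le: "v n x \<le> u x" for n x
    by (auto simp: v_def)
  have v_n: "v n x \<le> ennreal (real (Suc n))" for n x
    by (auto simp: v_def)
  have [measurable]: "v n \<in> borel_measurable M" "w n \<in> borel_measurable M" for n
    unfolding v_def w_def by measurable
  have u_eq: "u x = v n x + w n x" for n x
    using v_le[of n x] unfolding w_def by (metis diff_add_cancel_ennreal add.commute)
  have p_split: "z ^ (p - 2) * z ^ 2 = z ^ p" for z :: ennreal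
    using p by (metis le_add_diff_inverse2 power_add)
  have u_top: "AE x in M. u x \<noteq> \<top>"
  proof -
    have "AE x in M. u x ^ p \<noteq> \<top>"
      using fin nn_integral_PInf_AE[of "\<lambda>x. u x ^ p" M] by simp
    then show ?thesis
      by (rule AE_mp) (use p in \<open>auto simp: power_eq_top_ennreal\<close>)
  qed
  have lim: "(\<lambda>n. \<integral>\<^sup>+x. w n x ^ p \<partial>M) \<longlonglongrightarrow> (\<integral>\<^sup>+x. 0 \<partial>M)"
  proof (rule nn_integral_dominated_convergence[where w = "\<lambda>x. u x ^ p"])
    show "AE x in M. w n x ^ p \<le> u x ^ p" for n
      by (intro AE_I2 power_mono_ennreal) (auto simp: w_def)
    show "AE x in M. (\<lambda>n. w n x ^ p) \<longlonglongrightarrow> 0"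
      using u_top
    proof eventually_elim
      fix x assume "u x \<noteq> \<top>"
      then obtain y where y: "u x = ennreal y" "y \<ge> 0" by (cases "u x") auto
      have "\<forall>\<^sub>F n in sequentially. w n x ^ p = 0"
      proof (cases "y = 0")
        case True
        then show ?thesis using y p by (simp add: w_def v_def)
      next
        case False
        obtain N1 :: nat where N1: "1 / real (Suc N1) < y"
          using False y nat_approx_posE[of y] by auto
        obtain N2 :: nat where N2: "y < real N2" using reals_Archimedean2 by blast
        have "w n x ^ p = 0" if "n \<ge> N1" "n \<ge> N2" for n
        proof -
          have "1 / real (Suc n) \<le> 1 / real (Suc N1)" using that by (auto intro!: divide_left_mono)
          then have "\<not> y < 1 / real (Suc n)" "y \<le> real (Suc n)"
            using N1 N2 that by (auto simp del: of_nat_Suc)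
          then have "v n x = u x"
            using y by (auto simp: v_def min_def ennreal_less_iff simp del: of_nat_Suc)
          then show ?thesis
            using y p by (simp add: w_def)
        qed
        then show ?thesis
          by (intro eventually_sequentiallyI[of "max N1 N2"]) auto
      qed
      then show "(\<lambda>n. w n x ^ p) \<longlonglongrightarrow> 0"
        by (rule tendsto_eventually)
    qed
  qed (use fin in auto)
  \<comment> \<open>Three summands arise, the bulk and the two remainders; their shares of the
    tolerance are one half, one quarter and one quarter.\<close>
  define c where "c = (3::real) ^ p"
  have c: "c > 0" by (simp add: c_def)
  have "\<forall>\<^sub>F n in sequentially. (\<integral>\<^sup>+x. w n x ^ p \<partial>M) < ennreal (\<eta> / (4 * c))"
    using lim \<eta> c by (intro order_tendstoD(2)) auto
  then obtain n where n: "(\<integral>\<^sup>+x. w n x ^ p \<partial>M) < ennreal (\<eta> / (4 * c))"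
    by (meson eventually_sequentially order_refl)
  define N where "N = real (Suc n)"
  have N: "N > 0" "v n x \<le> ennreal N" for x
    using v_n[of n] by (auto simp: N_def)
  have "v n x ^ 2 \<le> ennreal (N ^ (p - 2)) * u x ^ p" for x
  proof (cases "v n x = 0")
    case False
    then have "ennreal (1 / N) \<le> u x"
      by (auto simp: v_def N_def not_less split: if_splits)
    then have "ennreal (1 / N) ^ (p - 2) * u x ^ 2 \<le> u x ^ (p - 2) * u x ^ 2"
      by (intro mult_right_mono power_mono_ennreal) auto
    also have "\<dots> = u x ^ p"
      by (rule p_split)
    finally have "ennreal (N ^ (p - 2)) * (ennreal (1 / N) ^ (p - 2) * u x ^ 2) \<le> ennreal (N ^ (p - 2)) * u x ^ p"
      by (intro mult_left_mono) auto
    also have "ennreal (N ^ (p - 2)) * (ennreal (1 / N) ^ (p - 2) * u x ^ 2) = u x ^ 2"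
      using N(1) by (simp add: ennreal_power power_one_over mult.assoc[symmetric] flip: ennreal_mult)
    finally show ?thesis
      using power_mono_ennreal[OF v_le, of n x 2] by (rule order_trans[rotated])
  qed simp
  then have "(\<integral>\<^sup>+x. v n x ^ 2 \<partial>M) \<le> (\<integral>\<^sup>+x. ennreal (N ^ (p - 2)) * u x ^ p \<partial>M)"
    by (rule nn_integral_mono)
  also have "\<dots> < \<infinity>"
    using fin by (simp add: nn_integral_cmult ennreal_mult_less_top)
  finally have v2: "(\<integral>\<^sup>+x. v n x ^ 2 \<partial>M) < \<infinity>" .
  define \<eta>' where "\<eta>' = \<eta> / (2 * c * N ^ (p - 2))"
  have "\<eta>' > 0" using N \<eta> c by (auto simp: \<eta>'_def)
  from T_Cauchy_L2[OF _ v2 this]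
  obtain r where r: "r > 0" "\<And>a b. 0 < a \<and> a < r \<and> 0 < b \<and> b < r \<Longrightarrow>
      (\<integral>\<^sup>+x. ed (T a (v n) x) (T b (v n) x) ^ 2 \<partial>M) \<le> ennreal \<eta>'"
    by auto
  have "(\<integral>\<^sup>+x. ed (T a u x) (T b u x) ^ p \<partial>M) \<le> ennreal \<eta>" if ab: "0 < a" "a < r" "0 < b" "b < r" for a b
  proof -
    have [measurable]: "T a (v n) \<in> borel_measurable M" "T b (v n) \<in> borel_measurable M"
      "T a (w n) \<in> borel_measurable M" "T b (w n) \<in> borel_measurable M"
      using ab by auto
    let ?e = "\<lambda>x. ed (T a (v n) x) (T b (v n) x)"
    have T_v: "T d (v n) x \<le> ennreal N" if "d > 0" for d x
      using T_mono[OF that, of "v n" "\<lambda>_. ennreal N"] T_const[OF that, of "ennreal N"] N order_trans by blast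
    have e_p: "?e x ^ p \<le> ennreal (N ^ (p - 2)) * ?e x ^ 2" for x
    proof -
      have "?e x \<le> ennreal N"
        using ed_le_max[of "T a (v n) x" "T b (v n) x"] T_v[of a x] T_v[of b x] ab by (simp add: max_def split: if_splits)
      then have "?e x ^ (p - 2) * ?e x ^ 2 \<le> ennreal N ^ (p - 2) * ?e x ^ 2"
        by (intro mult_right_mono power_mono_ennreal) auto
      then show ?thesis
        using N(1) by (simp only: p_split ennreal_power)
    qed
    have T_u: "T d u x = T d (v n) x + T d (w n) x" if "d > 0" "x \<in> space M" for d x
      using T_add[OF that(1), of "v n" "w n" x] that(2) by (simp flip: u_eq)
    have le: "ed (T a u x) (T b u x) ^ p \<le> ennreal c * (?e x ^ p + (T a (w n) x ^ p + T b (w n) x ^ p))"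
      if x: "x \<in> space M" for x
    proof -
      define h where "h i = (if i = 0 then ?e x else if i = 1 then T a (w n) x else T b (w n) x)" for i :: nat
      have "ed (T a u x) (T b u x) \<le> ?e x + ed (T a (w n) x) (T b (w n) x)"
        using ab x by (simp add: T_u ed_add_le)
      also have "ed (T a (w n) x) (T b (w n) x) \<le> T a (w n) x + T b (w n) x"
        by (rule order_trans[OF ed_le_max]) (auto simp: add_increasing add_increasing2)
      finally have "ed (T a u x) (T b u x) \<le> (\<Sum>i\<in>{0, 1, 2}. h i)"
        by (simp add: h_def add_left_mono)
      then have "ed (T a u x) (T b u x) ^ p \<le> (\<Sum>i\<in>{0, 1, 2}. h i) ^ p"
        by (rule power_mono_ennreal)
      also have "\<dots> \<le> of_nat (card {0, 1, 2 :: nat}) ^ p * (\<Sum>i\<in>{0, 1, 2}. h i ^ p)"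
        by (rule power_sum_le) auto
      also have "of_nat (card {0, 1, 2 :: nat}) ^ p = ennreal c"
        by (simp add: c_def flip: ennreal_power)
      finally show ?thesis by (simp add: h_def)
    qed
    have "(\<integral>\<^sup>+x. ed (T a u x) (T b u x) ^ p \<partial>M) \<le>
        (\<integral>\<^sup>+x. ennreal c * (?e x ^ p + (T a (w n) x ^ p + T b (w n) x ^ p)) \<partial>M)"
      by (intro nn_integral_mono le)
    also have "\<dots> = ennreal c * ((\<integral>\<^sup>+x. ?e x ^ p \<partial>M) + ((\<integral>\<^sup>+x. T a (w n) x ^ p \<partial>M) + (\<integral>\<^sup>+x. T b (w n) x ^ p \<partial>M)))"
      by (simp add: nn_integral_cmult nn_integral_add)
    also have "\<dots> \<le> ennreal c * (ennreal (N ^ (p - 2)) * ennreal \<eta>' + (ennreal (\<eta> / (4 * c)) + ennreal (\<eta> / (4 * c))))"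
    proof (intro mult_left_mono add_mono)
      have "(\<integral>\<^sup>+x. ?e x ^ p \<partial>M) \<le> (\<integral>\<^sup>+x. ennreal (N ^ (p - 2)) * ?e x ^ 2 \<partial>M)"
        by (intro nn_integral_mono e_p)
      also have "\<dots> \<le> ennreal (N ^ (p - 2)) * ennreal \<eta>'"
        using r(2)[of a b] ab by (simp add: nn_integral_cmult mult_left_mono)
      finally show "(\<integral>\<^sup>+x. ?e x ^ p \<partial>M) \<le> ennreal (N ^ (p - 2)) * ennreal \<eta>'" .
      show "(\<integral>\<^sup>+x. T a (w n) x ^ p \<partial>M) \<le> ennreal (\<eta> / (4 * c))"
        using nn_integral_T_power_le[OF ab(1), of "w n" p] n p by simp
      show "(\<integral>\<^sup>+x. T b (w n) x ^ p \<partial>M) \<le> ennreal (\<eta> / (4 * c))"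
        using nn_integral_T_power_le[OF ab(3), of "w n" p] n p by simp
    qed auto
    also have "\<dots> = ennreal \<eta>"
      using N \<eta> c by (simp add: \<eta>'_def field_simps flip: ennreal_mult ennreal_plus)
    finally show ?thesis .
  qed
  then show ?thesis
    using r(1) by blast
qed

end

section \<open>The state space\<close>

lemma compact_nbhd:
  fixes x :: "'a::metric_space"
  assumes "locally_compact_space (euclidean :: 'a topology)" "open U" "x \<in> U"
  obtains V C where "open V" "compact C" "x \<in> V" "V \<subseteq> C" "C \<subseteq> U"
proof -
  obtain W C where W: "open W" "compact C" "x \<in> W" "W \<subseteq> C"
    using assms(1)[unfolded locally_compact_space_def, rule_format, of x] by auto
  obtain e where e: "e > 0" "cball x e \<subseteq> U \<inter> W"
    using open_contains_cball[of "U \<inter> W"] assms W by (metis IntI open_Int)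
  show thesis
  proof (rule that[of "ball x e" "cball x e \<inter> C"])
    show "compact (cball x e \<inter> C)"
      using W by (simp add: compact_Int_closed inf.commute)
  qed (use e W in \<open>auto dest: ball_subset_cball[THEN subsetD]\<close>)
qed

text \<open>One countable family serves four purposes: sigma-finiteness of \<open>m\<close>, joint
  measurability of the paths, decoding in the Borel embedding, and the countable family of Urysohn
  functions.\<close>

lemma countable_precompact_basis:
  assumes "locally_compact_space (euclidean :: 'a::{metric_space, second_countable_topology} topology)"
  obtains \<B> :: "'a::{metric_space, second_countable_topology} set set" where "countable \<B>" "\<And>B. B \<in> \<B> \<Longrightarrow> open B" "\<And>B. B \<in> \<B> \<Longrightarrow> compact (closure B)"
    "\<And>U x. open U \<Longrightarrow> x \<in> U \<Longrightarrow> \<exists>B\<in>\<B>. x \<in> B \<and> closure B \<subseteq> U"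
proof -
  obtain \<C> :: "'a set set" where \<C>: "countable \<C>" "topological_basis \<C>"
    using ex_countable_basis by auto
  show thesis
  proof (rule that[of "{B\<in>\<C>. compact (closure B)}"])
    fix U and x :: 'a assume "open U" "x \<in> U"
    then obtain V C where V: "open V" "compact C" "x \<in> V" "V \<subseteq> C" "C \<subseteq> U"
      using compact_nbhd[OF assms] by metis
    obtain B where B: "B \<in> \<C>" "x \<in> B" "B \<subseteq> V"
      using topological_basisE[OF \<C>(2) V(1,3)] by auto
    have "closure B \<subseteq> C"
      using B V by (intro closure_minimal compact_imp_closed) auto
    moreover have "compact (closure B)"
      using \<open>closure B \<subseteq> C\<close> V(2) by (metis closed_closure compact_Int_closed inf.absorb_iff2)
    ultimately show "\<exists>B\<in>{B \<in> \<C>. compact (closure B)}. x \<in> B \<and> closure B \<subseteq> U"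
      using B V by (intro bexI[of _ B]) auto
  qed (use \<C> topological_basis_open in auto)
qed

lemma radon_measure_sigma_finite:
  fixes m :: "'a::{metric_space, second_countable_topology} measure"
  assumes lc: "locally_compact_space (euclidean :: 'a topology)" and m: "radon_measure m"
  shows "sigma_finite_measure m"
proof -
  obtain \<B> :: "'a set set" where \<B>: "countable \<B>" "\<And>B. B \<in> \<B> \<Longrightarrow> open B" "\<And>B. B \<in> \<B> \<Longrightarrow> compact (closure B)"
    "\<And>U x. open U \<Longrightarrow> x \<in> U \<Longrightarrow> \<exists>B\<in>\<B>. x \<in> B \<and> closure B \<subseteq> U"
    using countable_precompact_basis[OF lc] by metis
  have sets_m: "sets m = sets borel" and fin: "\<And>K. compact K \<Longrightarrow> emeasure m K < \<infinity>"
    using m by (auto simp: radon_measure_def)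
  show ?thesis
  proof
    show "\<exists>A. countable A \<and> A \<subseteq> sets m \<and> \<Union> A = space m \<and> (\<forall>a\<in>A. emeasure m a \<noteq> \<infinity>)"
    proof (intro exI[of _ "closure ` \<B>"] conjI ballI)
      show "\<Union> (closure ` \<B>) = space m"
      proof -
        have "\<exists>B\<in>\<B>. x \<in> closure B" for x
          using \<B>(4)[of UNIV x] closure_subset by blast
        then show ?thesis
          using sets_eq_imp_space_eq[OF sets_m] by auto
      qed
      show "emeasure m a \<noteq> \<infinity>" if "a \<in> closure ` \<B>" for a
        using that fin[OF \<B>(3)] by (auto simp: less_top)
    qed (use \<B>(1) in \<open>auto simp: sets_m\<close>)
  qed
qed

section \<open>Measurability in the one-point compactification\<close>

lemma topspace_E_Delta [simp]: "topspace E_Delta = UNIV"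
  by (simp add: E_Delta_def UNIV_option_conv)

lemma space_borel_Delta [simp]: "space borel_Delta = UNIV"
  by (simp add: borel_of_def space_measure_of_conv)

lemma openin_sets_borel_of: "openin T U \<Longrightarrow> U \<in> sets (borel_of T)"
  unfolding borel_of_def by (subst sets_measure_of) (auto dest: openin_subset)

lemma measurable_borel_ofI:
  assumes "f \<in> space M \<rightarrow> topspace T" "\<And>U. openin T U \<Longrightarrow> f -` U \<inter> space M \<in> sets M"
  shows "f \<in> M \<rightarrow>\<^sub>M borel_of T"
  unfolding borel_of_def using assms by (intro measurable_measure_of) (auto dest: openin_subset)

text \<open>Open neighbourhoods of the cemetery are complements of closed subsets of
  \<open>E\<close>, so the preimages of open subsets of \<open>E\<close> decide
  measurability.\<close>

lemma measurable_borel_DeltaI: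
  fixes f :: "'w \<Rightarrow> 'a::topological_space option"
  assumes "\<And>U. open U \<Longrightarrow> f -` (Some ` U) \<inter> space M \<in> sets M"
  shows "f \<in> M \<rightarrow>\<^sub>M borel_Delta"
proof (rule measurable_borel_ofI)
  fix V :: "'a option set" assume "openin E_Delta V"
  then consider U where "open U" "V = Some ` U" | C where "closed C" "V = insert None (Some ` (- C))"
    by (auto simp: E_Delta_def openin_Alexandroff_compactification Compl_eq_Diff_UNIV)
  then show "f -` V \<inter> space M \<in> sets M"
  proof cases
    case 2
    have "f -` V \<inter> space M =
        space M - (f -` (Some ` UNIV) \<inter> space M - f -` (Some ` (- C)) \<inter> space M)" (is "_ = ?R")
    proof (intro set_eqI)
      fix x show "x \<in> f -` V \<inter> space M \<longleftrightarrow> x \<in> ?R"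
        by (cases "f x") (auto simp: 2)
    qed
    moreover have "?R \<in> sets M"
      by (intro sets.Diff sets.top assms) (use 2 in auto)
    ultimately show ?thesis by simp
  qed (use assms in auto)
qed simp

lemma sets_borel_Delta_Some:
  fixes A :: "'a::topological_space set"
  assumes "A \<in> sets borel"
  shows "Some ` A \<in> sets borel_Delta"
proof -
  let ?S = "{A. Some ` A \<in> sets borel_Delta}"
  have op: "Some ` U \<in> sets borel_Delta" if "open U" for U :: "'a set"
    using that by (intro openin_sets_borel_of) (auto simp: E_Delta_def)
  have "A \<in> sigma_sets UNIV {S. open S}"
    using assms by (simp add: borel_def)
  then show ?thesis
  proof induction
    case (Compl A)
    have "Some ` (UNIV - A) = Some ` UNIV - Some ` A" by auto
    then show ?case using Compl.IH op[of UNIV] by (simp only: sets.Diff open_UNIV)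
  next
    case (Union A)
    have "Some ` (\<Union> (range A)) = (\<Union>i. Some ` A i)" by auto
    then show ?case using Union.IH by auto
  qed (use op in auto)
qed

lemma sets_borel_Delta_None: "{None} \<in> sets (borel_Delta :: 'a::topological_space option measure)"
proof -
  have "space borel_Delta - Some ` (UNIV :: 'a set) \<in> sets borel_Delta"
    by (intro sets.compl_sets sets_borel_Delta_Some) simp
  moreover have "space borel_Delta - Some ` (UNIV :: 'a set) = {None}"
    by (simp add: set_eq_iff notin_range_Some)
  ultimately show ?thesis by (simp only:)
qed

definition ext0 :: "('a \<Rightarrow> ennreal) \<Rightarrow> 'a option \<Rightarrow> ennreal" where
  "ext0 u z = (case z of None \<Rightarrow> 0 | Some y \<Rightarrow> u y)"

lemma ext0_simps [simp]: "ext0 u None = 0" "ext0 u (Some y) = u y"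
  by (auto simp: ext0_def)

lemma measurable_ext0_Pair:
  fixes u :: "'x \<Rightarrow> 'b::topological_space \<Rightarrow> ennreal"
  assumes [measurable]: "case_prod u \<in> borel_measurable (N \<Otimes>\<^sub>M borel)"
  shows "(\<lambda>(x, z). ext0 (u x) z) \<in> borel_measurable (N \<Otimes>\<^sub>M borel_Delta)"
proof -
  \<comment> \<open>The value at \<open>None\<close> is arbitrary; it is masked below by the case
    distinction on \<open>{None}\<close>.\<close>
  define g where "g z = (case z of None \<Rightarrow> undefined | Some y \<Rightarrow> y)" for z :: "'b option"
  have [measurable]: "g \<in> borel_Delta \<rightarrow>\<^sub>M borel"
  proof (rule measurableI)
    fix A :: "'b set" assume A: "A \<in> sets borel"
    have "g -` A = Some ` A \<union> (if undefined \<in> A then {None} else {})"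
    proof (intro set_eqI)
      fix z show "z \<in> g -` A \<longleftrightarrow> z \<in> Some ` A \<union> (if undefined \<in> A then {None} else {})"
        by (cases z) (auto simp: g_def)
    qed
    moreover have "Some ` A \<union> (if undefined \<in> A then {None} else {}) \<in> sets borel_Delta"
      by (cases "undefined \<in> A") (simp_all only: if_True if_False sets.Un sets.empty_sets
          sets_borel_Delta_Some[OF A] sets_borel_Delta_None)
    ultimately show "g -` A \<inter> space borel_Delta \<in> sets borel_Delta"
      by simp
  qed simp
  have [measurable]: "{None} \<in> sets borel_Delta" by (rule sets_borel_Delta_None)
  have "(\<lambda>(x, z). if z \<in> {None} then 0 else u x (g z)) \<in> borel_measurable (N \<Otimes>\<^sub>M borel_Delta)"
    by measurable
  also have "(\<lambda>(x, z). if z \<in> {None} then 0 else u x (g z)) = (\<lambda>(x, z). ext0 (u x) z)"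
    by (auto simp: g_def ext0_def fun_eq_iff split: option.splits)
  finally show ?thesis .
qed

lemma measurable_ext0 [measurable (raw)]:
  assumes "case_prod u \<in> borel_measurable (N \<Otimes>\<^sub>M borel)" "f \<in> N \<rightarrow>\<^sub>M borel_Delta"
  shows "(\<lambda>x. ext0 (u x) (f x)) \<in> borel_measurable N"
  using measurable_compose[OF measurable_Pair[OF measurable_ident assms(2)] measurable_ext0_Pair[OF assms(1)]]
  by simp

text \<open>A right-continuous path is the limit of its values at grid points to the right. The
  limit is tested through compact closures, which remain closed in the compactification and
  therefore exclude an escape to the cemetery.\<close>

lemma measurable_path:
  fixes X :: "ennreal \<Rightarrow> 'w \<Rightarrow> 'a::{metric_space, second_countable_topology} option"
  assumes lc: "locally_compact_space (euclidean :: 'a topology)"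
    and X: "\<And>s. X s \<in> M \<rightarrow>\<^sub>M borel_Delta"
    and rc: "\<And>\<omega> t. \<omega> \<in> space M \<Longrightarrow> t < \<infinity> \<Longrightarrow> limitin E_Delta (\<lambda>s. X s \<omega>) (X t \<omega>) (at_right t)"
  shows "(\<lambda>(s, \<omega>). X (ennreal s) \<omega>) \<in> (borel \<Otimes>\<^sub>M M) \<rightarrow>\<^sub>M borel_Delta"
proof -
  obtain \<B> :: "'a set set" where \<B>: "countable \<B>" "\<And>B. B \<in> \<B> \<Longrightarrow> open B" "\<And>B. B \<in> \<B> \<Longrightarrow> compact (closure B)"
    "\<And>U x. open U \<Longrightarrow> x \<in> U \<Longrightarrow> \<exists>B\<in>\<B>. x \<in> B \<and> closure B \<subseteq> U"
    using countable_precompact_basis[OF lc] by metis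
  \<comment> \<open>The next point of the grid of mesh \<open>1 / (n + 1)\<close> strictly to the
    right of \<open>max s 0\<close>; strictness is what \<open>at_right\<close> requires. The
    maximum is taken because \<open>ennreal s\<close> is \<open>0\<close> for negative
    \<open>s\<close>.\<close>
  define a where "a n s = (real_of_int \<lfloor>max s 0 * real (Suc n)\<rfloor> + 1) / real (Suc n)" for n s
  have a: "max s 0 < a n s" "a n s \<le> max s 0 + 1 / real (Suc n)" for n s
  proof -
    have *: "b * real (Suc n) < real_of_int \<lfloor>b * real (Suc n)\<rfloor> + 1"
      "real_of_int \<lfloor>b * real (Suc n)\<rfloor> \<le> b * real (Suc n)" for b
      by linarith+
    have "b < (real_of_int \<lfloor>b * real (Suc n)\<rfloor> + 1) / real (Suc n)"
      "(real_of_int \<lfloor>b * real (Suc n)\<rfloor> + 1) / real (Suc n) \<le> b + 1 / real (Suc n)" for b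
      using *[of b] by (simp_all add: field_simps del: of_nat_Suc)
    then show "max s 0 < a n s" "a n s \<le> max s 0 + 1 / real (Suc n)"
      unfolding a_def by blast+
  qed
  have a_lim: "filterlim (\<lambda>n. ennreal (a n s)) (at_right (ennreal s)) sequentially" for s
  proof -
    have "(\<lambda>n. a n s) \<longlonglongrightarrow> max s 0"
    proof (rule tendsto_sandwich[where f = "\<lambda>_. max s 0"])
      show "\<forall>\<^sub>F n in sequentially. max s 0 \<le> a n s"
        using a(1) by (intro always_eventually allI less_imp_le)
      show "\<forall>\<^sub>F n in sequentially. a n s \<le> max s 0 + 1 / real (Suc n)"
        using a(2) by (intro always_eventually allI)
      show "(\<lambda>n. max s 0 + 1 / real (Suc n)) \<longlonglongrightarrow> max s 0"
        using tendsto_add[OF tendsto_const[of "max s 0"] LIMSEQ_Suc[OF lim_1_over_n]] by simp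
    qed simp
    then have "(\<lambda>n. ennreal (a n s)) \<longlonglongrightarrow> ennreal (max s 0)"
      by (rule tendsto_ennrealI)
    moreover have "ennreal (max s 0) = ennreal s"
      by (simp add: max_def ennreal_neg)
    moreover have "ennreal (max s 0) < ennreal (a n s)" for n
      using a(1)[of s n] by (intro ennreal_lessI) auto
    moreover have "ennreal (a n s) \<noteq> ennreal s" for n
      using calculation(2) calculation(3)[of n] by auto
    ultimately show ?thesis
      unfolding filterlim_at by (auto intro!: always_eventually)
  qed
  have X_lim: "limitin E_Delta (\<lambda>n. X (ennreal (a n s)) \<omega>) (X (ennreal s) \<omega>) sequentially"
    if "\<omega> \<in> space M" for s \<omega>
    using rc[OF that, of "ennreal s"] a_lim[of s] unfolding limitin_def
    by (auto simp: filterlim_iff)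
  have meas_a: "(\<lambda>(s, \<omega>). X (ennreal (a n s)) \<omega>) \<in> (borel \<Otimes>\<^sub>M M) \<rightarrow>\<^sub>M borel_Delta" for n
  proof -
    have "(\<lambda>x. X (ennreal ((real_of_int i + 1) / real (Suc n))) (snd x)) \<in> (borel \<Otimes>\<^sub>M M) \<rightarrow>\<^sub>M borel_Delta" for i
      by (rule measurable_compose[OF measurable_snd X])
    moreover have "(\<lambda>x. \<lfloor>max (fst x) 0 * real (Suc n)\<rfloor>) \<in> (borel \<Otimes>\<^sub>M M) \<rightarrow>\<^sub>M count_space UNIV"
      by measurable
    ultimately have "(\<lambda>x. X (ennreal ((real_of_int \<lfloor>max (fst x) 0 * real (Suc n)\<rfloor> + 1) / real (Suc n))) (snd x))
        \<in> (borel \<Otimes>\<^sub>M M) \<rightarrow>\<^sub>M borel_Delta"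
      by (rule measurable_compose_countable)
    then show ?thesis
      by (simp add: a_def case_prod_beta')
  qed
  show ?thesis
  proof (rule measurable_borel_DeltaI)
    fix U :: "'a set" assume U: "open U"
    let ?A = "\<lambda>n B. (\<lambda>(s, \<omega>). X (ennreal (a n s)) \<omega>) -` (Some ` closure B) \<inter> space (borel \<Otimes>\<^sub>M M)"
    have "(\<lambda>(s, \<omega>). X (ennreal s) \<omega>) -` (Some ` U) \<inter> space (borel \<Otimes>\<^sub>M M) =
      (\<Union>B\<in>{B\<in>\<B>. closure B \<subseteq> U}. \<Union>N. \<Inter>n\<in>{N..}. ?A n B)" (is "?L = ?R")
    proof (intro set_eqI iffI)
      fix x assume x: "x \<in> ?L"
      obtain s \<omega> where s\<omega>: "x = (s, \<omega>)" by (cases x)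
      have \<omega>: "\<omega> \<in> space M" using x s\<omega> by (auto simp: space_pair_measure)
      obtain y where y: "X (ennreal s) \<omega> = Some y" "y \<in> U" using x s\<omega> by auto
      obtain B where B: "B \<in> \<B>" "y \<in> B" "closure B \<subseteq> U" using \<B>(4)[OF U y(2)] by auto
      have "openin E_Delta (Some ` B)" using \<B>(2) B by (simp add: E_Delta_def)
      then have "\<forall>\<^sub>F n in sequentially. X (ennreal (a n s)) \<omega> \<in> Some ` B"
        using X_lim[OF \<omega>, of s] y B unfolding limitin_def by auto
      then obtain N where "\<forall>n\<ge>N. X (ennreal (a n s)) \<omega> \<in> Some ` B"
        by (auto simp: eventually_sequentially)
      then have "\<forall>n\<ge>N. X (ennreal (a n s)) \<omega> \<in> Some ` closure B"
        using closure_subset[of B] by blast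
      then show "x \<in> ?R" using B x s\<omega> by auto
    next
      fix x assume "x \<in> ?R"
      then obtain B N where BN: "B \<in> \<B>" "closure B \<subseteq> U" "\<And>n. n \<ge> N \<Longrightarrow> x \<in> ?A n B" by blast
      obtain s \<omega> where s\<omega>: "x = (s, \<omega>)" by (cases x)
      have \<omega>: "\<omega> \<in> space M" using BN(3)[of N] s\<omega> by (auto simp: space_pair_measure)
      have "X (ennreal s) \<omega> \<in> Some ` closure B"
      proof (rule ccontr)
        assume "\<not> ?thesis"
        moreover have "closedin E_Delta (Some ` closure B)"
          using \<B>(3) BN(1) by (simp add: E_Delta_def)
        ultimately have "\<forall>\<^sub>F n in sequentially. X (ennreal (a n s)) \<omega> \<in> UNIV - Some ` closure B"
          using X_lim[OF \<omega>, of s] unfolding limitin_def closedin_def by auto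
        then obtain N' where N': "\<And>n. n \<ge> N' \<Longrightarrow> X (ennreal (a n s)) \<omega> \<in> UNIV - Some ` closure B"
          by (auto simp: eventually_sequentially)
        show False
          using N'[of "max N N'"] BN(3)[of "max N N'"] s\<omega> by auto
      qed
      then show "x \<in> ?L" using BN(2) BN(3)[of N] s\<omega> by (auto simp: space_pair_measure)
    qed
    moreover have "?R \<in> sets (borel \<Otimes>\<^sub>M M)"
    proof (intro sets.countable_UN'' sets.countable_UN sets.countable_INT' image_subsetI countable_Collect \<B>(1))
      show "?A n B \<in> sets (borel \<Otimes>\<^sub>M M)" for n B
        by (intro measurable_sets[OF meas_a] sets_borel_Delta_Some) simp
    qed auto
    ultimately show "?L \<in> sets (borel \<Otimes>\<^sub>M M)" by simp
  qed
qed

section \<open>The semigroup of a process with densities\<close>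

locale density_process = hunt_process \<Omega> P X + sigma_finite_measure m
  for \<Omega> :: "'w measure" and P :: "'a::{metric_space, second_countable_topology} option \<Rightarrow> 'w measure"
    and X :: "ennreal \<Rightarrow> 'w \<Rightarrow> 'a option" and m :: "'a measure" +
  fixes q :: "real \<Rightarrow> 'a \<Rightarrow> 'a \<Rightarrow> ennreal"
  assumes lc: "locally_compact_space (euclidean :: 'a topology)"
    and sets_m [measurable_cong, simp]: "sets m = sets borel"
    and sym: "m_symmetric m P X"
    and dens: "transition_density m P X q"
begin

text \<open>Vanishing at nonpositive times gives a function that is measurable on the whole line and
  makes \<open>qq (u - s)\<close> select the order \<open>s < u\<close> without a side condition.
  Consequently \<open>K 0\<close> is the zero operator and not the identity, which affects only a
  null set of times.\<close>

definition qq :: "real \<Rightarrow> 'a \<Rightarrow> 'a \<Rightarrow> ennreal" where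
  "qq s x y = (if s > 0 then q s x y else 0)"

definition K :: "real \<Rightarrow> ('a \<Rightarrow> ennreal) \<Rightarrow> 'a \<Rightarrow> ennreal" where
  "K s u x = (\<integral>\<^sup>+y. qq s x y * u y \<partial>m)"

definition R :: "'a \<Rightarrow> 'a \<Rightarrow> ennreal" where
  "R x y = resolvent_density 1 q x y"

lemma space_m [simp]: "space m = UNIV"
  using sets_eq_imp_space_eq[OF sets_m] by simp

lemma sets_P [measurable_cong, simp]: "sets (P x) = sets \<Omega>" and space_P [simp]: "space (P x) = space \<Omega>"
  and prob_space_P: "prob_space (P x)"
  using prob_P[of x] by (auto simp: space_prob_algebra dest: sets_eq_imp_space_eq)

lemma measurable_X' [measurable]: "X t \<in> \<Omega> \<rightarrow>\<^sub>M borel_Delta"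
  by (rule measurable_X)

lemma measurable_qq_triple: "(\<lambda>(s, x, y). qq s x y) \<in> borel_measurable (borel \<Otimes>\<^sub>M borel \<Otimes>\<^sub>M borel)"
proof -
  \<comment> \<open>Nonpositive times are sent to the dummy time \<open>1\<close>, inside the domain
    on which \<open>q\<close> is measurable; the values there are discarded afterwards.\<close>
  define g where "g = (\<lambda>(s :: real, x :: 'a, y :: 'a). (if s > 0 then s else 1, x, y))"
  have [measurable]: "g \<in> (borel \<Otimes>\<^sub>M borel \<Otimes>\<^sub>M borel) \<rightarrow>\<^sub>M (restrict_space borel {0<..} \<Otimes>\<^sub>M borel \<Otimes>\<^sub>M borel)"
    unfolding g_def by (auto intro!: measurable_Pair measurable_restrict_space2 simp: case_prod_beta')
  have q: "(\<lambda>(s, x, y). q s x y) \<in> borel_measurable (restrict_space borel {0<..} \<Otimes>\<^sub>M borel \<Otimes>\<^sub>M borel)"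
    using dens by (simp add: transition_density_def)
  have "(\<lambda>z. if fst z > 0 then (\<lambda>(s, x, y). q s x y) (g z) else 0) \<in> borel_measurable (borel \<Otimes>\<^sub>M borel \<Otimes>\<^sub>M borel)"
    using measurable_compose[OF _ q, of g] by measurable
  also have "(\<lambda>z. if fst z > 0 then (\<lambda>(s, x, y). q s x y) (g z) else 0) = (\<lambda>(s, x, y). qq s x y)"
    by (auto simp: g_def qq_def fun_eq_iff)
  finally show ?thesis .
qed

lemma measurable_qq [measurable (raw)]:
  assumes "f \<in> borel_measurable N" "g \<in> borel_measurable N" "h \<in> borel_measurable N"
  shows "(\<lambda>z. qq (f z) (g z) (h z)) \<in> borel_measurable N"
  using measurable_compose[OF measurable_Pair[OF assms(1) measurable_Pair[OF assms(2,3)]] measurable_qq_triple]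
  by simp

lemma measurable_K [measurable (raw)]:
  assumes [measurable]: "f \<in> borel_measurable N" "g \<in> borel_measurable N"
    "(\<lambda>(z, y). u z y) \<in> borel_measurable (N \<Otimes>\<^sub>M borel)"
  shows "(\<lambda>z. K (f z) (u z) (g z)) \<in> borel_measurable N"
  unfolding K_def by measurable

lemma measurable_X_pair:
  assumes "\<And>s. X s \<in> N \<rightarrow>\<^sub>M borel_Delta" "space N \<subseteq> space \<Omega>"
  shows "(\<lambda>(s, \<omega>). X (ennreal s) \<omega>) \<in> (borel \<Otimes>\<^sub>M N) \<rightarrow>\<^sub>M borel_Delta"
  using assms right_continuous by (intro measurable_path lc) auto

lemma measurable_X_comp [measurable (raw)]:
  assumes "f \<in> borel_measurable N" "g \<in> N \<rightarrow>\<^sub>M \<Omega>"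
  shows "(\<lambda>z. X (ennreal (f z)) (g z)) \<in> N \<rightarrow>\<^sub>M borel_Delta"
  using measurable_compose[OF measurable_Pair[OF assms] measurable_X_pair[OF measurable_X order_refl]] by simp

lemma emeasure_transition:
  assumes s: "s > 0" and A: "A \<in> sets borel"
  shows "emeasure (P z) {\<omega>\<in>space \<Omega>. X (ennreal s) \<omega> \<in> Some ` A} = ext0 (K s (indicator A)) z"
proof (cases z)
  case None
  have "AE \<omega> in P None. X (ennreal s) \<omega> = None" by (rule cemetery)
  then have "AE \<omega> in P None. \<omega> \<notin> {\<omega>\<in>space \<Omega>. X (ennreal s) \<omega> \<in> Some ` A}"
    by eventually_elim auto
  moreover have "{\<omega>\<in>space \<Omega>. X (ennreal s) \<omega> \<in> Some ` A} \<in> sets (P None)"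
    using measurable_sets[OF measurable_X sets_borel_Delta_Some[OF A], of "ennreal s"]
    by (simp add: vimage_def Int_def conj_commute)
  ultimately show ?thesis
    using None by (auto simp: AE_iff_measurable[OF _ refl] cong: conj_cong)
next
  case (Some x)
  then show ?thesis
    using dens s A by (simp add: transition_density_def K_def qq_def)
qed

lemma K_add:
  assumes [measurable]: "u \<in> borel_measurable borel" "v \<in> borel_measurable borel"
  shows "K s (\<lambda>x. u x + v x) x = K s u x + K s v x"
  unfolding K_def by (simp add: distrib_left nn_integral_add)

lemma K_cmult:
  assumes [measurable]: "u \<in> borel_measurable borel"
  shows "K s (\<lambda>x. c * u x) x = c * K s u x"
  unfolding K_def by (simp add: mult.left_commute nn_integral_cmult)

lemma K_mono: "(\<And>x. u x \<le> v x) \<Longrightarrow> K s u x \<le> K s v x"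
  unfolding K_def by (intro nn_integral_mono mult_left_mono) auto

lemma K_SUP:
  assumes [measurable]: "\<And>i. U i \<in> borel_measurable borel" and "incseq U"
  shows "K s (SUP i. U i) x = (SUP i. K s (U i) x)"
proof -
  have "K s (SUP i. U i) x = (\<integral>\<^sup>+y. (SUP i. qq s x y * U i y) \<partial>m)"
    unfolding K_def by (simp add: SUP_mult_left_ennreal image_comp)
  also have "\<dots> = (SUP i. K s (U i) x)"
    unfolding K_def using assms(2)
    by (intro nn_integral_monotone_convergence_SUP) (auto simp: incseq_def le_fun_def intro!: mult_left_mono)
  finally show ?thesis .
qed

section \<open>The Markov property in integrated form\<close>

definition filt :: "ennreal \<Rightarrow> 'w measure" where
  "filt = (SOME F. admissible_filtration \<Omega> X F \<and>
          (\<forall>x t s. \<forall>B\<in>sets borel_Delta. t < \<infinity> \<and> s < \<infinity> \<longrightarrow>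
             (AE \<omega> in P (Some x).
                real_cond_exp (P (Some x)) (F t) (\<lambda>\<omega>. indicator B (X (t + s) \<omega>)) \<omega> =
                measure (P (X t \<omega>)) {\<omega>'\<in>space \<Omega>. X s \<omega>' \<in> B})))"

lemma filt:
  shows "admissible_filtration \<Omega> X filt"
    and "B \<in> sets borel_Delta \<Longrightarrow> t < \<infinity> \<Longrightarrow> s < \<infinity> \<Longrightarrow>
             (AE \<omega> in P (Some x).
                real_cond_exp (P (Some x)) (filt t) (\<lambda>\<omega>. indicator B (X (t + s) \<omega>)) \<omega> =
                measure (P (X t \<omega>)) {\<omega>'\<in>space \<Omega>. X s \<omega>' \<in> B})"
  using someI_ex[OF markov_property] unfolding filt_def[symmetric] by blast+

lemma space_filt [simp]: "space (filt t) = space \<Omega>"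
  using filt(1) unfolding admissible_filtration_def filtration_def by auto

lemma sets_filt: "sets (filt t) \<subseteq> sets \<Omega>"
  using filt(1) unfolding admissible_filtration_def by auto

lemma sets_filt_mono: "s \<le> t \<Longrightarrow> sets (filt s) \<subseteq> sets (filt t)"
  using filt(1) unfolding admissible_filtration_def filtration_def by auto

lemma measurable_filt_mono: "f \<in> filt s \<rightarrow>\<^sub>M N \<Longrightarrow> s \<le> t \<Longrightarrow> f \<in> filt t \<rightarrow>\<^sub>M N"
  using sets_filt_mono[of s t] by (auto simp: measurable_def)

lemma measurable_filt: "f \<in> filt s \<rightarrow>\<^sub>M N \<Longrightarrow> f \<in> \<Omega> \<rightarrow>\<^sub>M N"
  using sets_filt[of s] by (auto simp: measurable_def)

lemma measurable_X_filt [measurable]: "X t \<in> filt t \<rightarrow>\<^sub>M borel_Delta"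
  using filt(1) unfolding admissible_filtration_def by auto

text \<open>Integrating the conditional expectation over a past event turns the almost sure identity
  into one between integrals. A start at the cemetery is covered by \<open>ext0\<close>, since the
  probability of moving into \<open>E\<close> is then zero.\<close>

lemma emeasure_markov:
  assumes C: "C \<in> sets (filt (ennreal t))" and A: "A \<in> sets borel" and s: "s > 0" and t: "t \<ge> 0"
  shows "emeasure (P (Some x)) {\<omega>\<in>C. X (ennreal (t + s)) \<omega> \<in> Some ` A} =
    (\<integral>\<^sup>+\<omega>\<in>C. ext0 (K s (indicator A)) (X (ennreal t) \<omega>) \<partial>P (Some x))"
proof -
  interpret Px: prob_space "P (Some x)" by (rule prob_space_P)
  let ?F = "filt (ennreal t)" and ?B = "Some ` A" and ?M = "P (Some x)"
  have sub: "subalgebra ?M ?F"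
    using sets_filt by (auto simp: subalgebra_def)
  interpret F: finite_measure_subalgebra ?M ?F
    using sub by unfold_locales
  have C' [measurable]: "C \<in> sets ?M" and [measurable]: "?B \<in> sets borel_Delta"
    using C sets_filt sets_borel_Delta_Some[OF A] by auto
  let ?h = "\<lambda>\<omega>. indicator ?B (X (ennreal t + ennreal s) \<omega>) :: real"
  let ?g = "\<lambda>z. measure (P z) {\<omega>'\<in>space \<Omega>. X (ennreal s) \<omega>' \<in> ?B}"
  have g: "ennreal (?g z) = ext0 (K s (indicator A)) z" for z
  proof -
    interpret Pz: prob_space "P z" by (rule prob_space_P)
    show ?thesis
      using emeasure_transition[OF s A, of z] by (simp add: Pz.emeasure_eq_measure)
  qed
  have [measurable]: "(\<lambda>\<omega>. ext0 (K s (indicator A)) (X (ennreal t) \<omega>)) \<in> borel_measurable ?M"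
    using A by measurable
  have g_meas [measurable]: "(\<lambda>\<omega>. ?g (X (ennreal t) \<omega>)) \<in> borel_measurable ?M"
  proof -
    have "(\<lambda>\<omega>. enn2real (ext0 (K s (indicator A)) (X (ennreal t) \<omega>))) \<in> borel_measurable ?M"
      by measurable
    then show ?thesis
      by (simp flip: g)
  qed
  have int: "integrable ?M ?h"
    by (rule Px.integrable_const_bound[where B = 1]) (auto simp: indicator_def)
  have g_int: "integrable ?M (\<lambda>\<omega>. ?g (X (ennreal t) \<omega>))"
    by (rule Px.integrable_const_bound[where B = 1]) (auto simp: prob_space.prob_le_1[OF prob_space_P])
  have "measure ?M {\<omega>\<in>C. X (ennreal (t + s)) \<omega> \<in> ?B} = (\<integral>\<omega>\<in>C. ?h \<omega> \<partial>?M)"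
  proof -
    have "(\<integral>\<omega>\<in>C. ?h \<omega> \<partial>?M) = (\<integral>\<omega>. indicator {\<omega>\<in>C. X (ennreal (t + s)) \<omega> \<in> ?B} \<omega> \<partial>?M)"
      unfolding set_lebesgue_integral_def using s t
      by (intro Bochner_Integration.integral_cong) (auto simp: indicator_def)
    also have "\<dots> = measure ?M ({\<omega>\<in>C. X (ennreal (t + s)) \<omega> \<in> ?B} \<inter> space ?M)"
      by (rule Bochner_Integration.integral_indicator)
    also have "{\<omega>\<in>C. X (ennreal (t + s)) \<omega> \<in> ?B} \<inter> space ?M = {\<omega>\<in>C. X (ennreal (t + s)) \<omega> \<in> ?B}"
      using sets.sets_into_space[OF C] by auto
    finally show ?thesis by simp
  qed
  also have "\<dots> = (\<integral>\<omega>\<in>C. real_cond_exp ?M ?F ?h \<omega> \<partial>?M)"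
    by (intro F.real_cond_exp_intA int C)
  also have "\<dots> = (\<integral>\<omega>\<in>C. ?g (X (ennreal t) \<omega>) \<partial>?M)"
  proof (rule set_lebesgue_integral_cong_AE)
    show "AE \<omega>\<in>C in ?M. real_cond_exp ?M ?F ?h \<omega> = ?g (X (ennreal t) \<omega>)"
      using filt(2)[OF sets_borel_Delta_Some[OF A], of "ennreal t" "ennreal s" x] by auto
  qed (use C' sub in \<open>auto intro: measurable_from_subalg\<close>)
  finally have eq: "measure ?M {\<omega>\<in>C. X (ennreal (t + s)) \<omega> \<in> ?B} = (\<integral>\<omega>\<in>C. ?g (X (ennreal t) \<omega>) \<partial>?M)" .
  have "(\<integral>\<^sup>+\<omega>\<in>C. ext0 (K s (indicator A)) (X (ennreal t) \<omega>) \<partial>?M) =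
      (\<integral>\<^sup>+\<omega>. ennreal (indicator C \<omega> *\<^sub>R ?g (X (ennreal t) \<omega>)) \<partial>?M)"
    by (intro nn_integral_cong) (auto simp flip: g split: split_indicator)
  also have "\<dots> = ennreal (\<integral>\<omega>\<in>C. ?g (X (ennreal t) \<omega>) \<partial>?M)"
    unfolding set_lebesgue_integral_def
    by (intro nn_integral_eq_integral integrable_mult_indicator g_int C') auto
  finally show ?thesis
    by (simp add: Px.emeasure_eq_measure eq)
qed

lemma markov_set:
  assumes C: "C \<in> sets (filt (ennreal t))" and s: "s > 0" and t: "t \<ge> 0" and u [measurable]: "u \<in> borel_measurable borel"
  shows "(\<integral>\<^sup>+\<omega>. indicator C \<omega> * ext0 u (X (ennreal (t + s)) \<omega>) \<partial>P (Some x)) =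
    (\<integral>\<^sup>+\<omega>. indicator C \<omega> * ext0 (K s u) (X (ennreal t) \<omega>) \<partial>P (Some x))"
  using u
proof (induction u rule: borel_measurable_induct)
  case (cong f g)
  then show ?case by (simp add: fun_eq_iff[symmetric])
next
  case (set A)
  have C': "C \<subseteq> space \<Omega>"
    using sets.sets_into_space[OF C] by simp
  have "(\<integral>\<^sup>+\<omega>. indicator C \<omega> * ext0 (indicator A) (X (ennreal (t + s)) \<omega>) \<partial>P (Some x)) =
      (\<integral>\<^sup>+\<omega>. indicator {\<omega>\<in>C. X (ennreal (t + s)) \<omega> \<in> Some ` A} \<omega> \<partial>P (Some x))"
    by (intro nn_integral_cong) (auto simp: ext0_def indicator_def split: option.splits)
  also have "\<dots> = emeasure (P (Some x)) {\<omega>\<in>C. X (ennreal (t + s)) \<omega> \<in> Some ` A}"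
  proof (rule nn_integral_indicator)
    have "{\<omega>\<in>C. X (ennreal (t + s)) \<omega> \<in> Some ` A} = C \<inter> (X (ennreal (t + s)) -` (Some ` A) \<inter> space \<Omega>)"
      using C' by auto
    also have "\<dots> \<in> sets \<Omega>"
      using C sets_filt by (intro sets.Int measurable_sets[OF measurable_X] sets_borel_Delta_Some set) auto
    finally show "{\<omega>\<in>C. X (ennreal (t + s)) \<omega> \<in> Some ` A} \<in> sets (P (Some x))" by simp
  qed
  finally show ?case
    using emeasure_markov[OF C set s t] by (simp add: mult.commute)
next
  case (mult u c)
  have [measurable]: "C \<in> sets \<Omega>" using C sets_filt by auto
  have *: "ext0 (\<lambda>x. c * u x) z = c * ext0 u z" "ext0 (K s (\<lambda>x. c * u x)) z = c * ext0 (K s u) z" for z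
    using mult by (auto simp: ext0_def K_cmult split: option.splits)
  show ?case
    using mult by (simp add: * mult.left_commute[of _ c] nn_integral_cmult)
next
  case (add u v)
  have [measurable]: "C \<in> sets \<Omega>" using C sets_filt by auto
  have *: "ext0 (\<lambda>x. v x + u x) z = ext0 v z + ext0 u z"
      "ext0 (K s (\<lambda>x. v x + u x)) z = ext0 (K s v) z + ext0 (K s u) z" for z
    using add by (auto simp: ext0_def K_add split: option.splits)
  show ?case
    using add by (simp add: * distrib_left nn_integral_add)
next
  case (seq U)
  have [measurable]: "C \<in> sets \<Omega>" using C sets_filt by auto
  have *: "ext0 (SUP i. U i) z = (SUP i. ext0 (U i) z)" "ext0 (K s (SUP i. U i)) z = (SUP i. ext0 (K s (U i)) z)" for z
    using seq by (auto simp: ext0_def K_SUP image_comp split: option.splits)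
  have inc: "incseq (\<lambda>i \<omega>. indicator C \<omega> * ext0 (U i) (X (ennreal (t + s)) \<omega>) :: ennreal)"
    "incseq (\<lambda>i \<omega>. indicator C \<omega> * ext0 (K s (U i)) (X (ennreal t) \<omega>) :: ennreal)"
    using \<open>incseq U\<close> by (auto simp: incseq_def le_fun_def ext0_def intro!: mult_left_mono K_mono split: option.splits)
  have [measurable]: "U i \<in> borel_measurable borel" for i using seq by auto
  have "(\<integral>\<^sup>+\<omega>. indicator C \<omega> * ext0 (SUP i. U i) (X (ennreal (t + s)) \<omega>) \<partial>P (Some x)) =
      (SUP i. \<integral>\<^sup>+\<omega>. indicator C \<omega> * ext0 (U i) (X (ennreal (t + s)) \<omega>) \<partial>P (Some x))"
    unfolding * SUP_mult_left_ennreal by (intro nn_integral_monotone_convergence_SUP inc) measurable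
  also have "\<dots> = (SUP i. \<integral>\<^sup>+\<omega>. indicator C \<omega> * ext0 (K s (U i)) (X (ennreal t) \<omega>) \<partial>P (Some x))"
    using seq by simp
  also have "\<dots> = (\<integral>\<^sup>+\<omega>. indicator C \<omega> * ext0 (K s (SUP i. U i)) (X (ennreal t) \<omega>) \<partial>P (Some x))"
    unfolding * SUP_mult_left_ennreal by (intro nn_integral_monotone_convergence_SUP[symmetric] inc) measurable
  finally show ?case .
qed

text \<open>Monotone approximation of \<open>Z\<close> extends the identity from past events to past
  functionals, as \<open>markov_set\<close> did for \<open>u\<close>. The free factor
  \<open>Z\<close> is what allows repeated conditioning in the moment bounds.\<close>

lemma markov:
  assumes Z: "Z \<in> borel_measurable (filt (ennreal t))" and s: "s > 0" and t: "t \<ge> 0"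
    and u [measurable]: "u \<in> borel_measurable borel"
  shows "(\<integral>\<^sup>+\<omega>. Z \<omega> * ext0 u (X (ennreal (t + s)) \<omega>) \<partial>P (Some x)) =
    (\<integral>\<^sup>+\<omega>. Z \<omega> * ext0 (K s u) (X (ennreal t) \<omega>) \<partial>P (Some x))"
  using Z
proof (induction Z rule: borel_measurable_induct)
  case (cong f g)
  then show ?case by (simp cong: nn_integral_cong_simp)
next
  case (set C)
  then show ?case by (rule markov_set[OF _ s t u])
next
  case (mult Z c)
  have [measurable]: "Z \<in> borel_measurable \<Omega>" using mult measurable_filt by auto
  show ?case
    using mult by (simp add: mult.assoc nn_integral_cmult)
next
  case (add Z Y)
  have [measurable]: "Z \<in> borel_measurable \<Omega>" "Y \<in> borel_measurable \<Omega>" using add measurable_filt by auto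
  show ?case
    using add by (simp add: distrib_right nn_integral_add)
next
  case (seq U)
  have [measurable]: "U i \<in> borel_measurable \<Omega>" for i using seq(1)[of i] by (rule measurable_filt)
  have inc: "incseq (\<lambda>i \<omega>. U i \<omega> * ext0 u (X (ennreal (t + s)) \<omega>) :: ennreal)"
    "incseq (\<lambda>i \<omega>. U i \<omega> * ext0 (K s u) (X (ennreal t) \<omega>) :: ennreal)"
    using \<open>incseq U\<close> by (auto simp: incseq_def le_fun_def intro!: mult_right_mono)
  show ?case
    using seq inc by (simp add: image_comp SUP_mult_right_ennreal nn_integral_monotone_convergence_SUP)
qed


lemma measurable_const_filt: "(\<lambda>_. c) \<in> borel_measurable (filt t)"
  by simp

lemma nn_integral_X:
  assumes s: "s > 0" and [measurable]: "u \<in> borel_measurable borel"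
  shows "(\<integral>\<^sup>+\<omega>. ext0 u (X (ennreal s) \<omega>) \<partial>P (Some x)) = K s u x"
proof -
  interpret prob_space "P (Some x)" by (rule prob_space_P)
  have "(\<integral>\<^sup>+\<omega>. ext0 u (X (ennreal s) \<omega>) \<partial>P (Some x)) = (\<integral>\<^sup>+\<omega>. ext0 (K s u) (X 0 \<omega>) \<partial>P (Some x))"
    using markov[OF measurable_const_filt[of 1] s order_refl assms(2), of x]
    by (simp only: mult_1 add_0 ennreal_0)
  also have "\<dots> = (\<integral>\<^sup>+\<omega>. K s u x \<partial>P (Some x))"
    by (intro nn_integral_cong_AE AE_mp[OF normal[of x] AE_I2]) simp
  also have "\<dots> = K s u x"
    using emeasure_space_1 by simp
  finally show ?thesis .
qed

text \<open>Both sides are expectations under \<open>P (Some x)\<close>, so the semigroup law holds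
  at every point. It is an identity between operators; for the densities at given points it would be
  an additional assumption.\<close>

lemma K_K:
  assumes a: "a > 0" and b: "b > 0" and u [measurable]: "u \<in> borel_measurable borel"
  shows "K a (K b u) x = K (a + b) u x"
proof -
  have "K a (K b u) x = (\<integral>\<^sup>+\<omega>. ext0 (K b u) (X (ennreal a) \<omega>) \<partial>P (Some x))"
    using a by (intro nn_integral_X[symmetric]) auto
  also have "\<dots> = (\<integral>\<^sup>+\<omega>. ext0 u (X (ennreal (a + b)) \<omega>) \<partial>P (Some x))"
    using markov[OF measurable_const_filt[of 1] b less_imp_le[OF a] u, of x]
    by (simp only: mult_1)
  also have "\<dots> = K (a + b) u x"
    using a b by (intro nn_integral_X) auto
  finally show ?thesis .
qed

lemma K_1_le: "K s (\<lambda>_. 1) x \<le> 1"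
proof (cases "s > 0")
  case True
  interpret prob_space "P (Some x)" by (rule prob_space_P)
  have "K s (\<lambda>_. 1) x = (\<integral>\<^sup>+\<omega>. ext0 (\<lambda>_. 1) (X (ennreal s) \<omega>) \<partial>P (Some x))"
    using True by (intro nn_integral_X[symmetric]) auto
  also have "\<dots> \<le> (\<integral>\<^sup>+\<omega>. 1 \<partial>P (Some x))"
    by (intro nn_integral_mono) (auto simp: ext0_def split: option.splits)
  also have "\<dots> = 1" using emeasure_space_1 by simp
  finally show ?thesis .
qed (simp add: K_def qq_def)

lemma K_const_le: "K s (\<lambda>_. c) x \<le> c"
  using K_cmult[of "\<lambda>_. 1" s c x] mult_left_mono[OF K_1_le, of c s x] by simp

lemma nn_integral_qq_le: "(\<integral>\<^sup>+y. qq s x y \<partial>m) \<le> 1"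
  using K_1_le[of s x] by (simp add: K_def)

lemma K_power_le:
  assumes [measurable]: "u \<in> borel_measurable borel" and "n \<ge> 1"
  shows "K s u x ^ n \<le> K s (\<lambda>x. u x ^ n) x"
  unfolding K_def using assms(2) by (intro nn_integral_power_le nn_integral_qq_le) measurable

lemma K_sym:
  assumes s: "s > 0" and [measurable]: "u \<in> borel_measurable borel" "v \<in> borel_measurable borel"
  shows "(\<integral>\<^sup>+x. u x * K s v x \<partial>m) = (\<integral>\<^sup>+x. K s u x * v x \<partial>m)"
proof -
  have sg: "semigroup_nn P X s w x = K s w x" if "w \<in> borel_measurable borel" for w x
    using nn_integral_X[OF s that, of x] by (simp add: semigroup_nn_def ext0_def)
  show ?thesis
    using sym[unfolded m_symmetric_def, rule_format, OF s assms(2,3)]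
    by (simp only: sg[OF assms(2)] sg[OF assms(3)])
qed

text \<open>The adjoint kernel. It agrees with \<open>K\<close> almost everywhere only, because the symmetry of \<open>q\<close> holds
  only almost everywhere.\<close>

definition T :: "real \<Rightarrow> ('a \<Rightarrow> ennreal) \<Rightarrow> 'a \<Rightarrow> ennreal" where
  "T s u x = (\<integral>\<^sup>+y. qq s y x * u y \<partial>m)"

lemma measurable_T [measurable (raw)]:
  assumes [measurable]: "f \<in> borel_measurable N" "g \<in> borel_measurable N"
    "(\<lambda>(z, y). u z y) \<in> borel_measurable (N \<Otimes>\<^sub>M borel)"
  shows "(\<lambda>z. T (f z) (u z) (g z)) \<in> borel_measurable N"
  unfolding T_def by measurable

lemma pair_sf: "pair_sigma_finite m m"
  by (intro pair_sigma_finite.intro sigma_finite_measure_axioms)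

lemma K_T_adjoint:
  assumes [measurable]: "u \<in> borel_measurable borel" "v \<in> borel_measurable borel"
  shows "(\<integral>\<^sup>+x. u x * T s v x \<partial>m) = (\<integral>\<^sup>+x. K s u x * v x \<partial>m)"
proof -
  interpret pair_sigma_finite m m by (rule pair_sf)
  have "(\<integral>\<^sup>+x. u x * T s v x \<partial>m) = (\<integral>\<^sup>+x. \<integral>\<^sup>+y. u x * qq s y x * v y \<partial>m \<partial>m)"
    unfolding T_def by (simp add: nn_integral_cmult[symmetric] mult.assoc)
  also have "\<dots> = (\<integral>\<^sup>+y. \<integral>\<^sup>+x. u x * qq s y x * v y \<partial>m \<partial>m)"
    by (rule Fubini') measurable
  also have "\<dots> = (\<integral>\<^sup>+y. K s u y * v y \<partial>m)"
    unfolding K_def by (intro nn_integral_cong) (simp add: nn_integral_multc mult.commute[of "u _"])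
  finally show ?thesis .
qed

text \<open>When testing against indicators, adjointness moves the kernel onto the indicator and
  symmetry of the semigroup moves it back.\<close>

lemma AE_T_eq_K:
  assumes s: "s > 0" and [measurable]: "u \<in> borel_measurable borel"
  shows "AE x in m. T s u x = K s u x"
proof (rule density_unique2)
  fix A assume [measurable]: "A \<in> sets m"
  have "(\<integral>\<^sup>+x\<in>A. T s u x \<partial>m) = (\<integral>\<^sup>+x. indicator A x * T s u x \<partial>m)"
    by (simp add: mult.commute)
  also have "\<dots> = (\<integral>\<^sup>+x. K s (indicator A) x * u x \<partial>m)"
    by (rule K_T_adjoint) measurable
  also have "\<dots> = (\<integral>\<^sup>+x. indicator A x * K s u x \<partial>m)"
    using s by (intro K_sym[symmetric]) measurable
  finally show "(\<integral>\<^sup>+x\<in>A. T s u x \<partial>m) = (\<integral>\<^sup>+x\<in>A. K s u x \<partial>m)"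
    by (simp add: mult.commute)
qed measurable

text \<open>The mass of the kernel in its first variable is controlled only through symmetry, hence
  only almost everywhere. Jensen's inequality in this variable relies on it later.\<close>

lemma AE_nn_integral_qq_le: "AE x in m. (\<integral>\<^sup>+y. qq s y x \<partial>m) \<le> 1"
proof (cases "s > 0")
  case True
  have "AE x in m. T s (\<lambda>_. 1) x = K s (\<lambda>_. 1) x"
    by (rule AE_T_eq_K[OF True]) simp
  then show ?thesis
    by (rule AE_mp) (use K_1_le[of s] in \<open>auto simp: T_def\<close>)
qed (simp add: qq_def)

lemma measurable_R [measurable (raw)]:
  assumes [measurable]: "f \<in> borel_measurable N" "g \<in> borel_measurable N"
  shows "(\<lambda>z. R (f z) (g z)) \<in> borel_measurable N"
proof -
  have "R x y = (\<integral>\<^sup>+s. ennreal (exp (- s)) * qq s x y \<partial>lborel)" for x y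
    unfolding R_def resolvent_density_def by (intro nn_integral_cong) (auto simp: qq_def)
  then show ?thesis by simp
qed

lemma R_eq: "R x y = (\<integral>\<^sup>+s. ennreal (exp (- s)) * qq s x y \<partial>lborel)"
  unfolding R_def resolvent_density_def by (intro nn_integral_cong) (auto simp: qq_def)

lemma nn_integral_R:
  assumes [measurable]: "u \<in> borel_measurable borel"
  shows "(\<integral>\<^sup>+y. R x y * u y \<partial>m) = (\<integral>\<^sup>+s. ennreal (exp (- s)) * K s u x \<partial>lborel)"
proof -
  interpret pair_sigma_finite lborel m
    by (intro pair_sigma_finite.intro sigma_finite_measure_axioms sigma_finite_lborel)
  have "(\<integral>\<^sup>+y. R x y * u y \<partial>m) = (\<integral>\<^sup>+y. \<integral>\<^sup>+s. ennreal (exp (- s)) * (qq s x y * u y) \<partial>lborel \<partial>m)"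
    unfolding R_eq by (simp add: nn_integral_multc[symmetric] mult.assoc)
  also have "\<dots> = (\<integral>\<^sup>+s. \<integral>\<^sup>+y. ennreal (exp (- s)) * (qq s x y * u y) \<partial>m \<partial>lborel)"
    by (rule Fubini') measurable
  also have "\<dots> = (\<integral>\<^sup>+s. ennreal (exp (- s)) * K s u x \<partial>lborel)"
    unfolding K_def by (simp add: nn_integral_cmult)
  finally show ?thesis .
qed

end

lemma nn_integral_swap:
  assumes "sigma_finite_measure M" "sigma_finite_measure N"
    and "case_prod f \<in> borel_measurable (M \<Otimes>\<^sub>M N)"
  shows "(\<integral>\<^sup>+x. \<integral>\<^sup>+y. f x y \<partial>N \<partial>M) = (\<integral>\<^sup>+y. \<integral>\<^sup>+x. f x y \<partial>M \<partial>N)"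
proof -
  interpret pair_sigma_finite M N using assms by (intro pair_sigma_finite.intro)
  show ?thesis using Fubini'[OF assms(3)] by simp
qed

lemma nn_integral_mult_nn_integral:
  assumes [measurable]: "f \<in> borel_measurable M" "g \<in> borel_measurable N"
  shows "(\<integral>\<^sup>+x. f x \<partial>M) * (\<integral>\<^sup>+y. g y \<partial>N) = (\<integral>\<^sup>+x. \<integral>\<^sup>+y. f x * g y \<partial>N \<partial>M)"
  by (simp add: nn_integral_cmult nn_integral_multc)

context density_process
begin

section \<open>The semigroup acting on one of two variables\<close>

definition T1 :: "real \<Rightarrow> ('a \<times> 'a \<Rightarrow> ennreal) \<Rightarrow> 'a \<times> 'a \<Rightarrow> ennreal" where
  "T1 a u z = K a (\<lambda>x. u (x, snd z)) (fst z)"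

definition T2 :: "real \<Rightarrow> ('a \<times> 'a \<Rightarrow> ennreal) \<Rightarrow> 'a \<times> 'a \<Rightarrow> ennreal" where
  "T2 a u z = K a (\<lambda>y. u (fst z, y)) (snd z)"

lemma nn_integral_mm:
  assumes "f \<in> borel_measurable (m \<Otimes>\<^sub>M m)"
  shows "(\<integral>\<^sup>+z. f z \<partial>(m \<Otimes>\<^sub>M m)) = (\<integral>\<^sup>+x. \<integral>\<^sup>+y. f (x, y) \<partial>m \<partial>m)"
    "(\<integral>\<^sup>+z. f z \<partial>(m \<Otimes>\<^sub>M m)) = (\<integral>\<^sup>+y. \<integral>\<^sup>+x. f (x, y) \<partial>m \<partial>m)"
  using sigma_finite_measure.nn_integral_fst[OF sigma_finite_measure_axioms assms]
    pair_sigma_finite.nn_integral_snd[OF pair_sf assms] by simp_all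

lemma nn_integral_mm_swap:
  assumes [measurable]: "f \<in> borel_measurable (m \<Otimes>\<^sub>M m)"
  shows "(\<integral>\<^sup>+z. f (prod.swap z) \<partial>(m \<Otimes>\<^sub>M m)) = (\<integral>\<^sup>+z. f z \<partial>(m \<Otimes>\<^sub>M m))"
proof -
  have "(\<lambda>z. f (prod.swap z)) \<in> borel_measurable (m \<Otimes>\<^sub>M m)"
    unfolding prod.swap_def by measurable
  from nn_integral_mm(1)[OF this] nn_integral_mm(2)[OF assms] show ?thesis
    by simp
qed

lemma measurable_T1 [measurable]:
  assumes [measurable]: "u \<in> borel_measurable (m \<Otimes>\<^sub>M m)"
  shows "T1 a u \<in> borel_measurable (m \<Otimes>\<^sub>M m)"
  unfolding T1_def[abs_def] by measurable

lemma measurable_T2 [measurable]: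
  assumes [measurable]: "u \<in> borel_measurable (m \<Otimes>\<^sub>M m)"
  shows "T2 a u \<in> borel_measurable (m \<Otimes>\<^sub>M m)"
  unfolding T2_def[abs_def] by measurable

lemma T2_swap: "T2 a u z = T1 a (\<lambda>z. u (prod.swap z)) (prod.swap z)"
  by (simp add: T1_def T2_def)

lemma sigma_finite_mm: "sigma_finite_measure (m \<Otimes>\<^sub>M m)"
  by (intro sigma_finite_pair_measure sigma_finite_measure_axioms)

text \<open>All properties hold fibrewise with the second coordinate frozen. The semigroup in the
  other coordinate is handled by swapping coordinates, so that one instance suffices.\<close>

lemma symmetric_semigroup_T1: "symmetric_semigroup (m \<Otimes>\<^sub>M m) T1"
proof (intro symmetric_semigroup.intro symmetric_semigroup_axioms.intro sigma_finite_mm)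
  fix a b c :: real and u v :: "'a \<times> 'a \<Rightarrow> ennreal" and x :: "'a \<times> 'a" and n :: nat
  assume a: "0 < a"
  show "T1 a u \<in> borel_measurable (m \<Otimes>\<^sub>M m)" if "u \<in> borel_measurable (m \<Otimes>\<^sub>M m)"
    using that by measurable
  show "T1 a u x \<le> T1 a v x" if "\<And>x. u x \<le> v x"
    using that unfolding T1_def by (intro K_mono)
  show "T1 a (\<lambda>_. c) x \<le> c" for c
    unfolding T1_def by (rule K_const_le)
  assume u [measurable]: "u \<in> borel_measurable (m \<Otimes>\<^sub>M m)"
  show "T1 a (T1 b u) x = T1 (a + b) u x" if "0 < b"
    unfolding T1_def fst_conv snd_conv using a that by (intro K_K) measurable
  show "T1 a u x ^ n \<le> T1 a (\<lambda>x. u x ^ n) x" if "1 \<le> n"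
    unfolding T1_def using that by (intro K_power_le) measurable
  assume v [measurable]: "v \<in> borel_measurable (m \<Otimes>\<^sub>M m)"
  show "T1 a (\<lambda>x. u x + v x) x = T1 a u x + T1 a v x"
    unfolding T1_def by (intro K_add) measurable
  show "(\<integral>\<^sup>+x. u x * T1 a v x \<partial>(m \<Otimes>\<^sub>M m)) = (\<integral>\<^sup>+x. T1 a u x * v x \<partial>(m \<Otimes>\<^sub>M m))"
  proof -
    have "(\<integral>\<^sup>+x. u x * T1 a v x \<partial>(m \<Otimes>\<^sub>M m)) = (\<integral>\<^sup>+y. \<integral>\<^sup>+x. u (x, y) * K a (\<lambda>x. v (x, y)) x \<partial>m \<partial>m)"
      by (simp add: nn_integral_mm(2) T1_def)
    also have "\<dots> = (\<integral>\<^sup>+y. \<integral>\<^sup>+x. K a (\<lambda>x. u (x, y)) x * v (x, y) \<partial>m \<partial>m)"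
      by (intro nn_integral_cong K_sym a) measurable
    also have "\<dots> = (\<integral>\<^sup>+x. T1 a u x * v x \<partial>(m \<Otimes>\<^sub>M m))"
      by (simp add: nn_integral_mm(2) T1_def)
    finally show ?thesis .
  qed
qed

lemma measurable_swap_comp [measurable]:
  assumes [measurable]: "u \<in> borel_measurable (m \<Otimes>\<^sub>M m)"
  shows "(\<lambda>z. u (prod.swap z)) \<in> borel_measurable (m \<Otimes>\<^sub>M m)"
  unfolding prod.swap_def by measurable

lemma T1_T2_commute:
  assumes [measurable]: "u \<in> borel_measurable (m \<Otimes>\<^sub>M m)"
  shows "T1 a (T2 b u) z = T2 b (T1 a u) z"
proof -
  obtain x y where z: "z = (x, y)" by (cases z)
  have "T1 a (T2 b u) z = (\<integral>\<^sup>+x'. \<integral>\<^sup>+y'. qq a x x' * (qq b y y' * u (x', y')) \<partial>m \<partial>m)"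
    unfolding z T1_def T2_def K_def by (simp add: nn_integral_cmult)
  also have "\<dots> = (\<integral>\<^sup>+y'. \<integral>\<^sup>+x'. qq a x x' * (qq b y y' * u (x', y')) \<partial>m \<partial>m)"
    by (intro nn_integral_swap sigma_finite_measure_axioms) measurable
  also have "\<dots> = T2 b (T1 a u) z"
    unfolding z T1_def T2_def K_def by (simp add: nn_integral_cmult[symmetric] mult.left_commute)
  finally show ?thesis .
qed

lemma T2_sym:
  assumes a: "a > 0" and [measurable]: "u \<in> borel_measurable (m \<Otimes>\<^sub>M m)" "v \<in> borel_measurable (m \<Otimes>\<^sub>M m)"
  shows "(\<integral>\<^sup>+x. u x * T2 a v x \<partial>(m \<Otimes>\<^sub>M m)) = (\<integral>\<^sup>+x. T2 a u x * v x \<partial>(m \<Otimes>\<^sub>M m))"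
proof -
  have "(\<integral>\<^sup>+x. u x * T2 a v x \<partial>(m \<Otimes>\<^sub>M m)) = (\<integral>\<^sup>+x. \<integral>\<^sup>+y. u (x, y) * K a (\<lambda>y. v (x, y)) y \<partial>m \<partial>m)"
    by (simp add: nn_integral_mm(1) T2_def)
  also have "\<dots> = (\<integral>\<^sup>+x. \<integral>\<^sup>+y. K a (\<lambda>y. u (x, y)) y * v (x, y) \<partial>m \<partial>m)"
    by (intro nn_integral_cong K_sym a) measurable
  also have "\<dots> = (\<integral>\<^sup>+x. T2 a u x * v x \<partial>(m \<Otimes>\<^sub>M m))"
    by (simp add: nn_integral_mm(1) T2_def)
  finally show ?thesis .
qed

lemma nn_integral_T2_power_le:
  assumes a: "a > 0" and [measurable]: "v \<in> borel_measurable (m \<Otimes>\<^sub>M m)" and p1: "p \<ge> 1"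
  shows "(\<integral>\<^sup>+z. T2 a v z ^ p \<partial>(m \<Otimes>\<^sub>M m)) \<le> (\<integral>\<^sup>+z. v z ^ p \<partial>(m \<Otimes>\<^sub>M m))"
proof -
  interpret S1: symmetric_semigroup "m \<Otimes>\<^sub>M m" T1 by (rule symmetric_semigroup_T1)
  have "(\<integral>\<^sup>+z. T2 a v z ^ p \<partial>(m \<Otimes>\<^sub>M m)) = (\<integral>\<^sup>+z. T1 a (\<lambda>z. v (prod.swap z)) z ^ p \<partial>(m \<Otimes>\<^sub>M m))"
    using nn_integral_mm_swap[of "\<lambda>z. T1 a (\<lambda>z. v (prod.swap z)) z ^ p"] by (simp add: T2_swap)
  also have "\<dots> \<le> (\<integral>\<^sup>+z. v (prod.swap z) ^ p \<partial>(m \<Otimes>\<^sub>M m))"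
    using a p1 by (intro S1.nn_integral_T_power_le) auto
  also have "\<dots> = (\<integral>\<^sup>+z. v z ^ p \<partial>(m \<Otimes>\<^sub>M m))"
    using nn_integral_mm_swap[of "\<lambda>z. v z ^ p"] by simp
  finally show ?thesis .
qed

lemma nn_integral_T1_T2_power_le:
  assumes "a > 0" "b > 0" and [measurable]: "v \<in> borel_measurable (m \<Otimes>\<^sub>M m)" and "p \<ge> 1"
  shows "(\<integral>\<^sup>+z. T1 a (T2 b v) z ^ p \<partial>(m \<Otimes>\<^sub>M m)) \<le> (\<integral>\<^sup>+z. v z ^ p \<partial>(m \<Otimes>\<^sub>M m))"
proof -
  interpret S1: symmetric_semigroup "m \<Otimes>\<^sub>M m" T1 by (rule symmetric_semigroup_T1)
  show ?thesis
    using S1.nn_integral_T_power_le[of a "T2 b v" p] nn_integral_T2_power_le[of b v p] assms by simp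
qed

text \<open>One operator is changed at a time. Since \<open>T1\<close> and \<open>T2\<close>
  commute, the operator that is kept can be taken outermost, where it contracts; what is left is the
  continuity of a single semigroup.\<close>

lemma T1_T2_Cauchy:
  assumes h [measurable]: "h \<in> borel_measurable (m \<Otimes>\<^sub>M m)" and fin: "(\<integral>\<^sup>+z. h z ^ p \<partial>(m \<Otimes>\<^sub>M m)) < \<infinity>"
    and p: "p \<ge> 2" and \<eta>: "\<eta> > 0"
  shows "\<exists>r>0. \<forall>a b a' b'. 0 < a \<and> a < r \<and> 0 < b \<and> b < r \<and> 0 < a' \<and> a' < r \<and> 0 < b' \<and> b' < r \<longrightarrow>
    (\<integral>\<^sup>+z. ed (T1 a (T2 b h) z) (T1 a' (T2 b' h) z) ^ p \<partial>(m \<Otimes>\<^sub>M m)) \<le> ennreal \<eta>"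
proof -
  interpret S1: symmetric_semigroup "m \<Otimes>\<^sub>M m" T1 by (rule symmetric_semigroup_T1)
  define c where "c = (2::real) ^ p"
  have c: "c > 0" "2 ^ p = ennreal c" by (simp_all add: c_def flip: ennreal_power)
  define \<eta>' where "\<eta>' = \<eta> / (2 * c)"
  have \<eta>': "\<eta>' > 0" using c \<eta> by (simp add: \<eta>'_def)
  have p1: "p \<ge> 1" using p by simp
  obtain r1 where r1: "r1 > 0" "\<And>a b. 0 < a \<Longrightarrow> a < r1 \<Longrightarrow> 0 < b \<Longrightarrow> b < r1 \<Longrightarrow>
      (\<integral>\<^sup>+z. ed (T1 a h z) (T1 b h z) ^ p \<partial>(m \<Otimes>\<^sub>M m)) \<le> ennreal \<eta>'"
    using S1.T_Cauchy[OF h fin p \<eta>'] by blast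
  have fin': "(\<integral>\<^sup>+z. h (prod.swap z) ^ p \<partial>(m \<Otimes>\<^sub>M m)) < \<infinity>"
    using fin nn_integral_mm_swap[of "\<lambda>z. h z ^ p"] by simp
  obtain r2 where r2: "r2 > 0" "\<And>a b. 0 < a \<Longrightarrow> a < r2 \<Longrightarrow> 0 < b \<Longrightarrow> b < r2 \<Longrightarrow>
      (\<integral>\<^sup>+z. ed (T1 a (\<lambda>z. h (prod.swap z)) z) (T1 b (\<lambda>z. h (prod.swap z)) z) ^ p \<partial>(m \<Otimes>\<^sub>M m)) \<le> ennreal \<eta>'"
    using S1.T_Cauchy[OF measurable_swap_comp[OF h] fin' p \<eta>'] by blast
  have r2': "(\<integral>\<^sup>+z. ed (T2 a h z) (T2 b h z) ^ p \<partial>(m \<Otimes>\<^sub>M m)) \<le> ennreal \<eta>'"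
    if "0 < a" "a < r2" "0 < b" "b < r2" for a b
    using r2(2)[OF that] nn_integral_mm_swap[of "\<lambda>z. ed (T1 a (\<lambda>z. h (prod.swap z)) z) (T1 b (\<lambda>z. h (prod.swap z)) z) ^ p"]
    by (simp add: T2_swap)
  have ed_T2: "ed (T2 a u z) (T2 a v z) \<le> T2 a (\<lambda>z. ed (u z) (v z)) z"
    if "a > 0" and [measurable]: "u \<in> borel_measurable (m \<Otimes>\<^sub>M m)" "v \<in> borel_measurable (m \<Otimes>\<^sub>M m)" for a u v z
    unfolding T2_swap using that(1) by (intro S1.ed_T_le) (auto simp: space_pair_measure)
  have "(\<integral>\<^sup>+z. ed (T1 a (T2 b h) z) (T1 a' (T2 b' h) z) ^ p \<partial>(m \<Otimes>\<^sub>M m)) \<le> ennreal \<eta>"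
    if ab: "0 < a" "a < min r1 r2" "0 < b" "b < min r1 r2" "0 < a'" "a' < min r1 r2" "0 < b'" "b' < min r1 r2" for a b a' b'
  proof -
    let ?e1 = "\<lambda>z. ed (T1 a h z) (T1 a' h z)" and ?e2 = "\<lambda>z. ed (T2 b h z) (T2 b' h z)"
    have "ed (T1 a (T2 b h) z) (T1 a' (T2 b' h) z) ^ p \<le> ennreal c * (T1 a ?e2 z ^ p + T2 b' ?e1 z ^ p)" for z
    proof -
      have "ed (T1 a (T2 b h) z) (T1 a' (T2 b' h) z) \<le>
          ed (T1 a (T2 b h) z) (T1 a (T2 b' h) z) + ed (T1 a (T2 b' h) z) (T1 a' (T2 b' h) z)"
        by (rule ed_triangle)
      also have "\<dots> = ed (T1 a (T2 b h) z) (T1 a (T2 b' h) z) + ed (T2 b' (T1 a h) z) (T2 b' (T1 a' h) z)"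
        by (simp add: T1_T2_commute)
      also have "\<dots> \<le> T1 a ?e2 z + T2 b' ?e1 z"
        using ab by (intro add_mono S1.ed_T_le ed_T2) (auto simp: space_pair_measure)
      finally have "ed (T1 a (T2 b h) z) (T1 a' (T2 b' h) z) ^ p \<le> (T1 a ?e2 z + T2 b' ?e1 z) ^ p"
        by (rule power_mono_ennreal)
      also have "\<dots> \<le> ennreal c * (T1 a ?e2 z ^ p + T2 b' ?e1 z ^ p)"
        using power_add_le[of _ _ p] c by simp
      finally show ?thesis .
    qed
    then have "(\<integral>\<^sup>+z. ed (T1 a (T2 b h) z) (T1 a' (T2 b' h) z) ^ p \<partial>(m \<Otimes>\<^sub>M m)) \<le>
        (\<integral>\<^sup>+z. ennreal c * (T1 a ?e2 z ^ p + T2 b' ?e1 z ^ p) \<partial>(m \<Otimes>\<^sub>M m))"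
      by (rule nn_integral_mono)
    also have "\<dots> = ennreal c * ((\<integral>\<^sup>+z. T1 a ?e2 z ^ p \<partial>(m \<Otimes>\<^sub>M m)) + (\<integral>\<^sup>+z. T2 b' ?e1 z ^ p \<partial>(m \<Otimes>\<^sub>M m)))"
      by (simp add: nn_integral_cmult nn_integral_add)
    also have "\<dots> \<le> ennreal c * ((\<integral>\<^sup>+z. ?e2 z ^ p \<partial>(m \<Otimes>\<^sub>M m)) + (\<integral>\<^sup>+z. ?e1 z ^ p \<partial>(m \<Otimes>\<^sub>M m)))"
      using ab p1 by (intro mult_left_mono add_mono S1.nn_integral_T_power_le nn_integral_T2_power_le) auto
    also have "\<dots> \<le> ennreal c * (ennreal \<eta>' + ennreal \<eta>')"
      using ab by (intro mult_left_mono add_mono r1 r2') auto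
    also have "\<dots> = ennreal \<eta>"
      using c \<eta> by (simp add: \<eta>'_def field_simps flip: ennreal_mult ennreal_plus)
    finally show ?thesis .
  qed
  then show ?thesis
    using r1(1) r2(1) by (intro exI[of _ "min r1 r2"]) auto
qed

text \<open>Second moments of smoothed occupations produce the adjoint kernel in both variables,
  because the smoothing density carries the evaluation point as its second argument. Moving both
  kernels onto an indicator and using symmetry there recovers \<open>T1\<close> and
  \<open>T2\<close>.\<close>

lemma AE_T_T_eq:
  assumes a: "a > 0" and b: "b > 0" and [measurable]: "h \<in> borel_measurable (m \<Otimes>\<^sub>M m)"
  shows "AE z in m \<Otimes>\<^sub>M m. T a (\<lambda>y1. T b (\<lambda>y2. h (y1, y2)) (snd z)) (fst z) = T1 a (T2 b h) z"
proof -
  interpret mm: sigma_finite_measure "m \<Otimes>\<^sub>M m" by (rule sigma_finite_mm)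
  interpret S1: symmetric_semigroup "m \<Otimes>\<^sub>M m" T1 by (rule symmetric_semigroup_T1)
  let ?L = "\<lambda>z. T a (\<lambda>y1. T b (\<lambda>y2. h (y1, y2)) (snd z)) (fst z)"
  show ?thesis
  proof (rule mm.density_unique2)
    fix A assume [measurable]: "A \<in> sets (m \<Otimes>\<^sub>M m)"
    let ?u = "indicator A :: _ \<Rightarrow> ennreal"
    have "(\<integral>\<^sup>+z\<in>A. ?L z \<partial>(m \<Otimes>\<^sub>M m)) = (\<integral>\<^sup>+z. ?u z * ?L z \<partial>(m \<Otimes>\<^sub>M m))"
      by (simp add: mult.commute)
    also have "\<dots> = (\<integral>\<^sup>+y. \<integral>\<^sup>+x. ?u (x, y) * T a (\<lambda>y1. T b (\<lambda>y2. h (y1, y2)) y) x \<partial>m \<partial>m)"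
      by (simp add: nn_integral_mm(2))
    also have "\<dots> = (\<integral>\<^sup>+y. \<integral>\<^sup>+x. T1 a ?u (x, y) * T b (\<lambda>y2. h (x, y2)) y \<partial>m \<partial>m)"
      by (rule nn_integral_cong) (simp add: K_T_adjoint T1_def)
    also have "\<dots> = (\<integral>\<^sup>+x. \<integral>\<^sup>+y. T1 a ?u (x, y) * T b (\<lambda>y2. h (x, y2)) y \<partial>m \<partial>m)"
      by (intro nn_integral_swap sigma_finite_measure_axioms) measurable
    also have "\<dots> = (\<integral>\<^sup>+x. \<integral>\<^sup>+y. T2 b (T1 a ?u) (x, y) * h (x, y) \<partial>m \<partial>m)"
      by (rule nn_integral_cong) (simp add: K_T_adjoint T2_def)
    also have "\<dots> = (\<integral>\<^sup>+z. T2 b (T1 a ?u) z * h z \<partial>(m \<Otimes>\<^sub>M m))"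
      by (simp add: nn_integral_mm(1))
    also have "\<dots> = (\<integral>\<^sup>+z. T1 a ?u z * T2 b h z \<partial>(m \<Otimes>\<^sub>M m))"
      by (intro T2_sym[symmetric] b) measurable
    also have "\<dots> = (\<integral>\<^sup>+z. ?u z * T1 a (T2 b h) z \<partial>(m \<Otimes>\<^sub>M m))"
      by (intro S1.T_sym[symmetric] a) measurable
    finally show "(\<integral>\<^sup>+z\<in>A. ?L z \<partial>(m \<Otimes>\<^sub>M m)) = (\<integral>\<^sup>+z\<in>A. T1 a (T2 b h) z \<partial>(m \<Otimes>\<^sub>M m))"
      by (simp add: mult.commute)
  qed measurable
qed

end

context density_process
begin

section \<open>Occupation functionals and their moments\<close>

definition occ :: "real \<Rightarrow> ('a \<Rightarrow> ennreal) \<Rightarrow> 'w \<Rightarrow> ennreal" where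
  "occ t g \<omega> = (\<integral>\<^sup>+s\<in>{0..t}. ext0 g (X (ennreal s) \<omega>) \<partial>lborel)"

lemma measurable_occ [measurable (raw)]:
  assumes [measurable]: "case_prod g \<in> borel_measurable (N \<Otimes>\<^sub>M borel)" "f \<in> N \<rightarrow>\<^sub>M \<Omega>"
  shows "(\<lambda>z. occ t (g z) (f z)) \<in> borel_measurable N"
  unfolding occ_def by measurable

lemma sigma_finite_P: "sigma_finite_measure (P x)"
  using prob_space_P[of x] prob_space_imp_sigma_finite by blast

lemma nn_integral_occ:
  assumes [measurable]: "g \<in> borel_measurable borel"
  shows "(\<integral>\<^sup>+\<omega>. occ t g \<omega> \<partial>P (Some x)) = (\<integral>\<^sup>+s\<in>{0..t}. K s g x \<partial>lborel)"
proof -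
  have "(\<integral>\<^sup>+\<omega>. occ t g \<omega> \<partial>P (Some x)) = (\<integral>\<^sup>+s. \<integral>\<^sup>+\<omega>. ext0 g (X (ennreal s) \<omega>) * indicator {0..t} s \<partial>P (Some x) \<partial>lborel)"
    unfolding occ_def by (intro nn_integral_swap sigma_finite_P sigma_finite_lborel) measurable
  also have "\<dots> = (\<integral>\<^sup>+s\<in>{0..t}. K s g x \<partial>lborel)"
  proof (rule nn_integral_cong_AE)
    show "AE s in lborel. (\<integral>\<^sup>+\<omega>. ext0 g (X (ennreal s) \<omega>) * indicator {0..t} s \<partial>P (Some x)) = K s g x * indicator {0..t} s"
      \<comment> \<open>Time \<open>0\<close> is left out, since \<open>K 0\<close> vanishes whereas
        the initial position contributes its value.\<close>
      using AE_lborel_singleton[of 0]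
    proof eventually_elim
      fix s :: real assume "s \<noteq> 0"
      then show "(\<integral>\<^sup>+\<omega>. ext0 g (X (ennreal s) \<omega>) * indicator {0..t} s \<partial>P (Some x)) = K s g x * indicator {0..t} s"
        by (cases "s > 0") (auto simp: nn_integral_multc nn_integral_X)
    qed
  qed
  finally show ?thesis .
qed

text \<open>Density of the mean joint occupation at two points; the summands correspond to which of
  the points is visited first. The zero convention of \<open>qq\<close> leaves at most one of them
  nonzero for each pair of times.\<close>

definition H :: "real \<Rightarrow> 'a \<Rightarrow> 'a \<times> 'a \<Rightarrow> ennreal" where
  "H t x z = (\<integral>\<^sup>+s\<in>{0..t}. (\<integral>\<^sup>+u\<in>{0..t}.
     (qq s x (fst z) * qq (u - s) (fst z) (snd z) + qq u x (snd z) * qq (s - u) (snd z) (fst z)) \<partial>lborel) \<partial>lborel)"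

lemma measurable_H [measurable]: "H t x \<in> borel_measurable (m \<Otimes>\<^sub>M m)"
  unfolding H_def[abs_def] by measurable

lemma nn_integral_X_X:
  assumes s: "0 < s" "s < u" and [measurable]: "g \<in> borel_measurable borel" "g' \<in> borel_measurable borel"
  shows "(\<integral>\<^sup>+\<omega>. ext0 g (X (ennreal s) \<omega>) * ext0 g' (X (ennreal u) \<omega>) \<partial>P (Some x)) =
    (\<integral>\<^sup>+y. \<integral>\<^sup>+y'. (qq s x y * qq (u - s) y y') * (g y * g' y') \<partial>m \<partial>m)"
proof -
  have meas: "(\<lambda>\<omega>. ext0 g (X (ennreal s) \<omega>)) \<in> borel_measurable (filt (ennreal s))"
    by (rule measurable_ext0[OF _ measurable_X_filt]) measurable
  have "(\<integral>\<^sup>+\<omega>. ext0 g (X (ennreal s) \<omega>) * ext0 g' (X (ennreal u) \<omega>) \<partial>P (Some x)) =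
      (\<integral>\<^sup>+\<omega>. ext0 g (X (ennreal s) \<omega>) * ext0 (K (u - s) g') (X (ennreal s) \<omega>) \<partial>P (Some x))"
    using markov[OF meas, of "u - s" g' x] s by simp
  also have "\<dots> = (\<integral>\<^sup>+\<omega>. ext0 (\<lambda>y. g y * K (u - s) g' y) (X (ennreal s) \<omega>) \<partial>P (Some x))"
    by (intro nn_integral_cong) (simp add: ext0_def split: option.splits)
  also have "\<dots> = K s (\<lambda>y. g y * K (u - s) g' y) x"
    using s by (intro nn_integral_X) measurable
  also have "\<dots> = (\<integral>\<^sup>+y. \<integral>\<^sup>+y'. (qq s x y * qq (u - s) y y') * (g y * g' y') \<partial>m \<partial>m)"
    unfolding K_def by (rule nn_integral_cong) (simp add: nn_integral_cmult[symmetric] mult_ac)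
  finally show ?thesis .
qed

text \<open>For fixed times the Markov property is applied at the earlier one, and the two orders
  contribute the two summands of \<open>H\<close>. What remains is Tonelli, bringing the space
  integrals outside the time integrals.\<close>

lemma nn_integral_occ_occ:
  assumes [measurable]: "g \<in> borel_measurable borel" "g' \<in> borel_measurable borel"
  shows "(\<integral>\<^sup>+\<omega>. occ t g \<omega> * occ t g' \<omega> \<partial>P (Some x)) = (\<integral>\<^sup>+y. g y * (\<integral>\<^sup>+y'. g' y' * H t x (y, y') \<partial>m) \<partial>m)"
proof -
  let ?P = "P (Some x)"
  let ?I = "\<lambda>s. indicator {0..t} s :: ennreal"
  let ?p = "\<lambda>s u y y'. qq s x y * qq (u - s) y y' + qq u x y' * qq (s - u) y' y"
  note sf = sigma_finite_P sigma_finite_lborel sigma_finite_measure_axioms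
  have "(\<integral>\<^sup>+\<omega>. occ t g \<omega> * occ t g' \<omega> \<partial>?P) =
     (\<integral>\<^sup>+\<omega>. \<integral>\<^sup>+s. \<integral>\<^sup>+u. (ext0 g (X (ennreal s) \<omega>) * ?I s) * (ext0 g' (X (ennreal u) \<omega>) * ?I u) \<partial>lborel \<partial>lborel \<partial>?P)"
    unfolding occ_def by (intro nn_integral_cong nn_integral_mult_nn_integral) measurable
  also have "\<dots> = (\<integral>\<^sup>+s. \<integral>\<^sup>+\<omega>. \<integral>\<^sup>+u. (ext0 g (X (ennreal s) \<omega>) * ?I s) * (ext0 g' (X (ennreal u) \<omega>) * ?I u) \<partial>lborel \<partial>?P \<partial>lborel)"
    by (intro nn_integral_swap sf) measurable
  also have "\<dots> = (\<integral>\<^sup>+s. \<integral>\<^sup>+u. \<integral>\<^sup>+\<omega>. (ext0 g (X (ennreal s) \<omega>) * ?I s) * (ext0 g' (X (ennreal u) \<omega>) * ?I u) \<partial>?P \<partial>lborel \<partial>lborel)"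
    by (intro nn_integral_cong nn_integral_swap sf) measurable
  also have "\<dots> = (\<integral>\<^sup>+s. \<integral>\<^sup>+u. (\<integral>\<^sup>+y. \<integral>\<^sup>+y'. ?p s u y y' * ?I u * ?I s * (g y * g' y') \<partial>m \<partial>m) \<partial>lborel \<partial>lborel)"
  proof (intro nn_integral_cong_AE)
    show "AE s in lborel. (\<integral>\<^sup>+u. \<integral>\<^sup>+\<omega>. (ext0 g (X (ennreal s) \<omega>) * ?I s) * (ext0 g' (X (ennreal u) \<omega>) * ?I u) \<partial>?P \<partial>lborel) =
       (\<integral>\<^sup>+u. (\<integral>\<^sup>+y. \<integral>\<^sup>+y'. ?p s u y y' * ?I u * ?I s * (g y * g' y') \<partial>m \<partial>m) \<partial>lborel)"
      using AE_lborel_singleton[of 0]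
    proof eventually_elim
      fix s :: real assume s0: "s \<noteq> 0"
      show "(\<integral>\<^sup>+u. \<integral>\<^sup>+\<omega>. (ext0 g (X (ennreal s) \<omega>) * ?I s) * (ext0 g' (X (ennreal u) \<omega>) * ?I u) \<partial>?P \<partial>lborel) =
       (\<integral>\<^sup>+u. (\<integral>\<^sup>+y. \<integral>\<^sup>+y'. ?p s u y y' * ?I u * ?I s * (g y * g' y') \<partial>m \<partial>m) \<partial>lborel)"
      proof (intro nn_integral_cong_AE)
        show "AE u in lborel. (\<integral>\<^sup>+\<omega>. (ext0 g (X (ennreal s) \<omega>) * ?I s) * (ext0 g' (X (ennreal u) \<omega>) * ?I u) \<partial>?P) =
          (\<integral>\<^sup>+y. \<integral>\<^sup>+y'. ?p s u y y' * ?I u * ?I s * (g y * g' y') \<partial>m \<partial>m)"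
          \<comment> \<open>Coinciding times are a null set, so the diagonal contributes nothing and
            the two strict orders exhaust the positive times.\<close>
          using AE_lborel_singleton[of 0] AE_lborel_singleton[of s]
        proof eventually_elim
          fix u :: real assume u: "u \<noteq> 0" "u \<noteq> s"
          consider "0 < s" "s < u" | "0 < u" "u < s" | "s < 0 \<or> u < 0"
            using s0 u by linarith
          then show "(\<integral>\<^sup>+\<omega>. (ext0 g (X (ennreal s) \<omega>) * ?I s) * (ext0 g' (X (ennreal u) \<omega>) * ?I u) \<partial>?P) =
            (\<integral>\<^sup>+y. \<integral>\<^sup>+y'. ?p s u y y' * ?I u * ?I s * (g y * g' y') \<partial>m \<partial>m)"
          proof cases
            case 1
            have p: "?p s u y y' = qq s x y * qq (u - s) y y'" for y y'
              using 1 by (simp add: qq_def)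
            show ?thesis
              unfolding p using nn_integral_X_X[OF 1 assms, of x]
              by (cases "s \<in> {0..t} \<and> u \<in> {0..t}") auto
          next
            case 2
            have p: "?p s u y y' = qq u x y' * qq (s - u) y' y" for y y'
              using 2 by (simp add: qq_def)
            have "(\<integral>\<^sup>+\<omega>. ext0 g (X (ennreal s) \<omega>) * ext0 g' (X (ennreal u) \<omega>) \<partial>?P) =
                (\<integral>\<^sup>+y'. \<integral>\<^sup>+y. (qq u x y' * qq (s - u) y' y) * (g' y' * g y) \<partial>m \<partial>m)"
              using nn_integral_X_X[OF 2 assms(2,1), of x] by (simp add: mult.commute)
            also have "\<dots> = (\<integral>\<^sup>+y. \<integral>\<^sup>+y'. (qq u x y' * qq (s - u) y' y) * (g' y' * g y) \<partial>m \<partial>m)"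
              by (intro nn_integral_swap sf) measurable
            finally show ?thesis
              unfolding p
              by (cases "s \<in> {0..t} \<and> u \<in> {0..t}") (auto simp: mult.commute[of "g' _"])
          qed auto
        qed
      qed
    qed
  qed
  also have "\<dots> = (\<integral>\<^sup>+s. \<integral>\<^sup>+y. \<integral>\<^sup>+u. \<integral>\<^sup>+y'. ?p s u y y' * ?I u * ?I s * (g y * g' y') \<partial>m \<partial>lborel \<partial>m \<partial>lborel)"
    by (rule nn_integral_cong, rule nn_integral_swap[OF sigma_finite_lborel sigma_finite_measure_axioms]) measurable
  also have "\<dots> = (\<integral>\<^sup>+y. \<integral>\<^sup>+s. \<integral>\<^sup>+u. \<integral>\<^sup>+y'. ?p s u y y' * ?I u * ?I s * (g y * g' y') \<partial>m \<partial>lborel \<partial>lborel \<partial>m)"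
    by (rule nn_integral_swap[OF sigma_finite_lborel sigma_finite_measure_axioms]) measurable
  also have "\<dots> = (\<integral>\<^sup>+y. \<integral>\<^sup>+s. \<integral>\<^sup>+y'. \<integral>\<^sup>+u. ?p s u y y' * ?I u * ?I s * (g y * g' y') \<partial>lborel \<partial>m \<partial>lborel \<partial>m)"
    by (rule nn_integral_cong, rule nn_integral_cong, rule nn_integral_swap[OF sigma_finite_lborel sigma_finite_measure_axioms]) measurable
  also have "\<dots> = (\<integral>\<^sup>+y. \<integral>\<^sup>+y'. \<integral>\<^sup>+s. \<integral>\<^sup>+u. ?p s u y y' * ?I u * ?I s * (g y * g' y') \<partial>lborel \<partial>lborel \<partial>m \<partial>m)"
    by (rule nn_integral_cong, rule nn_integral_swap[OF sigma_finite_lborel sigma_finite_measure_axioms]) measurable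
  also have "\<dots> = (\<integral>\<^sup>+y. \<integral>\<^sup>+y'. H t x (y, y') * (g y * g' y') \<partial>m \<partial>m)"
    unfolding H_def by (simp add: nn_integral_multc)
  also have "\<dots> = (\<integral>\<^sup>+y. \<integral>\<^sup>+y'. g y * (g' y' * H t x (y, y')) \<partial>m \<partial>m)"
    by (simp only: mult_ac)
  also have "\<dots> = (\<integral>\<^sup>+y. g y * (\<integral>\<^sup>+y'. g' y' * H t x (y, y') \<partial>m) \<partial>m)"
    by (simp add: nn_integral_cmult)
  finally show ?thesis .
qed

text \<open>For \<open>u \<le> t\<close> the factor \<open>exp (t - u)\<close> is at least
  \<open>1\<close> and splits as \<open>exp t * exp (- s) * exp (- (u - s))\<close>. Releasing the
  time constraints then separates \<open>s\<close> and \<open>u - s\<close>, which leaves a product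
  of resolvent densities.\<close>

lemma H_le: "H t x (y, y') \<le> ennreal (exp t) * (R x y * R y y' + R x y' * R y' y)"
proof -
  have shift: "(\<integral>\<^sup>+u. f (u - s) \<partial>lborel) = (\<integral>\<^sup>+u. f u \<partial>lborel)" if "f \<in> borel_measurable borel"
    for f :: "real \<Rightarrow> ennreal" and s
    using nn_integral_real_affine[OF that, of 1 "- s"] by simp
  have le: "(\<integral>\<^sup>+s\<in>{0..t}. (\<integral>\<^sup>+u\<in>{0..t}. qq s x a * qq (u - s) a b \<partial>lborel) \<partial>lborel) \<le>
      ennreal (exp t) * (R x a * R a b)" for a b
  proof -
    have "(\<integral>\<^sup>+s\<in>{0..t}. (\<integral>\<^sup>+u\<in>{0..t}. qq s x a * qq (u - s) a b \<partial>lborel) \<partial>lborel) \<le>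
        (\<integral>\<^sup>+s. \<integral>\<^sup>+u. ennreal (exp t) * ((ennreal (exp (- s)) * qq s x a) * (ennreal (exp (- (u - s))) * qq (u - s) a b)) \<partial>lborel \<partial>lborel)"
    proof (rule nn_integral_mono)
      fix s :: real
      have "(\<integral>\<^sup>+u\<in>{0..t}. qq s x a * qq (u - s) a b \<partial>lborel) * indicator {0..t} s \<le>
          (\<integral>\<^sup>+u\<in>{0..t}. qq s x a * qq (u - s) a b \<partial>lborel)"
        by (simp split: split_indicator)
      also have "\<dots> \<le> (\<integral>\<^sup>+u. ennreal (exp t) * ((ennreal (exp (- s)) * qq s x a) * (ennreal (exp (- (u - s))) * qq (u - s) a b)) \<partial>lborel)"
      proof (rule nn_integral_mono)
        fix u :: real
        have "ennreal (exp t) * ((ennreal (exp (- s)) * qq s x a) * (ennreal (exp (- (u - s))) * qq (u - s) a b)) =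
           (ennreal (exp t) * ennreal (exp (- s)) * ennreal (exp (- (u - s)))) * (qq s x a * qq (u - s) a b)"
          by (simp only: mult_ac)
        also have "ennreal (exp t) * ennreal (exp (- s)) * ennreal (exp (- (u - s))) = ennreal (exp (t - u))"
          by (simp flip: ennreal_mult exp_add)
        finally have eq: "ennreal (exp t) * ((ennreal (exp (- s)) * qq s x a) * (ennreal (exp (- (u - s))) * qq (u - s) a b)) =
          ennreal (exp (t - u)) * (qq s x a * qq (u - s) a b)" .
        show "qq s x a * qq (u - s) a b * indicator {0..t} u \<le>
          ennreal (exp t) * ((ennreal (exp (- s)) * qq s x a) * (ennreal (exp (- (u - s))) * qq (u - s) a b))"
        proof (cases "u \<in> {0..t}")
          case True
          then have "1 * (qq s x a * qq (u - s) a b) \<le> ennreal (exp (t - u)) * (qq s x a * qq (u - s) a b)"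
            by (intro mult_right_mono) auto
          then show ?thesis unfolding eq using True by simp
        qed simp
      qed
      finally show "(\<integral>\<^sup>+u\<in>{0..t}. qq s x a * qq (u - s) a b \<partial>lborel) * indicator {0..t} s \<le>
        (\<integral>\<^sup>+u. ennreal (exp t) * ((ennreal (exp (- s)) * qq s x a) * (ennreal (exp (- (u - s))) * qq (u - s) a b)) \<partial>lborel)" .
    qed
    also have "\<dots> = (\<integral>\<^sup>+s. ennreal (exp t) * ((ennreal (exp (- s)) * qq s x a) * R a b) \<partial>lborel)"
    proof (rule nn_integral_cong)
      fix s :: real
      have "(\<integral>\<^sup>+u. ennreal (exp (- (u - s))) * qq (u - s) a b \<partial>lborel) = R a b"
        unfolding R_eq by (rule shift) measurable
      then show "(\<integral>\<^sup>+u. ennreal (exp t) * ((ennreal (exp (- s)) * qq s x a) * (ennreal (exp (- (u - s))) * qq (u - s) a b)) \<partial>lborel) =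
        ennreal (exp t) * ((ennreal (exp (- s)) * qq s x a) * R a b)"
        by (simp add: nn_integral_cmult)
    qed
    also have "\<dots> = ennreal (exp t) * (R x a * R a b)"
      unfolding R_eq[of x a] by (simp add: nn_integral_cmult nn_integral_multc)
    finally show ?thesis .
  qed
  have sf: "sigma_finite_measure (lborel :: real measure)" by (rule sigma_finite_lborel)
  let ?f = "\<lambda>s u. qq s x y * qq (u - s) y y' * indicator {0..t} u * indicator {0..t} s"
  let ?g = "\<lambda>s u. qq u x y' * qq (s - u) y' y * indicator {0..t} u * indicator {0..t} s"
  have "H t x (y, y') = (\<integral>\<^sup>+s. \<integral>\<^sup>+u. ?f s u + ?g s u \<partial>lborel \<partial>lborel)"
    unfolding H_def by (simp add: nn_integral_multc[symmetric] distrib_right)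
  also have "\<dots> = (\<integral>\<^sup>+s. \<integral>\<^sup>+u. ?f s u \<partial>lborel \<partial>lborel) + (\<integral>\<^sup>+s. \<integral>\<^sup>+u. ?g s u \<partial>lborel \<partial>lborel)"
    by (simp add: nn_integral_add)
  also have "(\<integral>\<^sup>+s. \<integral>\<^sup>+u. ?g s u \<partial>lborel \<partial>lborel) = (\<integral>\<^sup>+u. \<integral>\<^sup>+s. ?g s u \<partial>lborel \<partial>lborel)"
    by (intro nn_integral_swap sf) measurable
  also have "\<dots> = (\<integral>\<^sup>+s. \<integral>\<^sup>+u. qq s x y' * qq (u - s) y' y * indicator {0..t} u * indicator {0..t} s \<partial>lborel \<partial>lborel)"
    by (simp only: mult_ac)
  also have "\<dots> = (\<integral>\<^sup>+s\<in>{0..t}. (\<integral>\<^sup>+u\<in>{0..t}. qq s x y' * qq (u - s) y' y \<partial>lborel) \<partial>lborel)"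
    by (simp add: nn_integral_multc)
  also have "(\<integral>\<^sup>+s. \<integral>\<^sup>+u. ?f s u \<partial>lborel \<partial>lborel) = (\<integral>\<^sup>+s\<in>{0..t}. (\<integral>\<^sup>+u\<in>{0..t}. qq s x y * qq (u - s) y y' \<partial>lborel) \<partial>lborel)"
    by (simp add: nn_integral_multc[symmetric])
  finally show ?thesis
    unfolding distrib_left by (simp only: add_mono[OF le le])
qed

text \<open>The bound \<open>C\<close> is used twice: for the point visited first as a starting
  point of the second resolvent, and for \<open>x\<close> itself. The former use is where uniformity
  in the starting point enters.\<close>

lemma nn_integral_H_power:
  assumes C: "\<And>x. (\<integral>\<^sup>+y. R x y ^ p \<partial>m) \<le> C"
  shows "(\<integral>\<^sup>+z. H t x z ^ p \<partial>(m \<Otimes>\<^sub>M m)) \<le> ennreal (exp t) ^ p * (2 ^ p * (C * C + C * C))"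
proof -
  have le: "(\<integral>\<^sup>+y. \<integral>\<^sup>+y'. (R x y * R y y') ^ p \<partial>m \<partial>m) \<le> C * C"
  proof -
    have "(\<integral>\<^sup>+y. \<integral>\<^sup>+y'. (R x y * R y y') ^ p \<partial>m \<partial>m) = (\<integral>\<^sup>+y. R x y ^ p * (\<integral>\<^sup>+y'. R y y' ^ p \<partial>m) \<partial>m)"
      by (simp add: power_mult_distrib nn_integral_cmult)
    also have "\<dots> \<le> (\<integral>\<^sup>+y. R x y ^ p * C \<partial>m)"
      by (intro nn_integral_mono mult_left_mono C) auto
    also have "\<dots> \<le> C * C"
      using C by (simp add: nn_integral_multc mult_right_mono)
    finally show ?thesis .
  qed
  have "(\<integral>\<^sup>+z. H t x z ^ p \<partial>(m \<Otimes>\<^sub>M m)) = (\<integral>\<^sup>+y. \<integral>\<^sup>+y'. H t x (y, y') ^ p \<partial>m \<partial>m)"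
    by (rule nn_integral_mm) measurable
  also have "\<dots> \<le> (\<integral>\<^sup>+y. \<integral>\<^sup>+y'. ennreal (exp t) ^ p * (2 ^ p * ((R x y * R y y') ^ p + (R x y' * R y' y) ^ p)) \<partial>m \<partial>m)"
  proof (intro nn_integral_mono)
    fix y y'
    have "H t x (y, y') ^ p \<le> (ennreal (exp t) * (R x y * R y y' + R x y' * R y' y)) ^ p"
      by (intro power_mono_ennreal H_le)
    also have "\<dots> = ennreal (exp t) ^ p * (R x y * R y y' + R x y' * R y' y) ^ p"
      by (rule power_mult_distrib)
    also have "\<dots> \<le> ennreal (exp t) ^ p * (2 ^ p * ((R x y * R y y') ^ p + (R x y' * R y' y) ^ p))"
      by (intro mult_left_mono power_add_le) auto
    finally show "H t x (y, y') ^ p \<le> ennreal (exp t) ^ p * (2 ^ p * ((R x y * R y y') ^ p + (R x y' * R y' y) ^ p))" .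
  qed
  also have "\<dots> = ennreal (exp t) ^ p * (2 ^ p * ((\<integral>\<^sup>+y. \<integral>\<^sup>+y'. (R x y * R y y') ^ p \<partial>m \<partial>m) + (\<integral>\<^sup>+y. \<integral>\<^sup>+y'. (R x y' * R y' y) ^ p \<partial>m \<partial>m)))"
    by (simp add: nn_integral_cmult nn_integral_add)
  also have "(\<integral>\<^sup>+y. \<integral>\<^sup>+y'. (R x y' * R y' y) ^ p \<partial>m \<partial>m) = (\<integral>\<^sup>+y'. \<integral>\<^sup>+y. (R x y' * R y' y) ^ p \<partial>m \<partial>m)"
    by (intro nn_integral_swap sigma_finite_measure_axioms) measurable
  also have "ennreal (exp t) ^ p * (2 ^ p * ((\<integral>\<^sup>+y. \<integral>\<^sup>+y'. (R x y * R y y') ^ p \<partial>m \<partial>m) + (\<integral>\<^sup>+y'. \<integral>\<^sup>+y. (R x y' * R y' y) ^ p \<partial>m \<partial>m))) \<le>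
      ennreal (exp t) ^ p * (2 ^ p * (C * C + C * C))"
    by (intro mult_left_mono add_mono le) auto
  finally show ?thesis .
qed

end

section \<open>Joint moments of several occupation functionals\<close>

lemma pred_in_atLeast [measurable (raw)]:
  fixes f g :: "'x \<Rightarrow> real"
  assumes [measurable]: "f \<in> borel_measurable N" "g \<in> borel_measurable N"
  shows "Measurable.pred N (\<lambda>x. f x \<in> {g x..})"
  unfolding atLeast_iff by measurable

text \<open>Decomposition according to the index carrying the smallest time.\<close>

lemma prod_nn_integral_le_first:
  fixes f :: "'i \<Rightarrow> real \<Rightarrow> ennreal"
  assumes J: "finite J" "J \<noteq> {}" and [measurable]: "\<And>j. j \<in> J \<Longrightarrow> f j \<in> borel_measurable borel"
  shows "(\<Prod>j\<in>J. \<integral>\<^sup>+u. f j u \<partial>lborel) \<le>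
    (\<Sum>j\<in>J. \<integral>\<^sup>+s. f j s * (\<Prod>i\<in>J - {j}. \<integral>\<^sup>+u\<in>{s..}. f i u \<partial>lborel) \<partial>lborel)"
proof -
  interpret product_sigma_finite "\<lambda>_::'i. lborel :: real measure"
    by standard
  have "(\<Prod>j\<in>J. \<integral>\<^sup>+u. f j u \<partial>lborel) = (\<integral>\<^sup>+s. (\<Prod>j\<in>J. f j (s j)) \<partial>Pi\<^sub>M J (\<lambda>_. lborel))"
    using J by (intro product_nn_integral_prod[symmetric]) auto
  also have "\<dots> \<le> (\<integral>\<^sup>+s. (\<Sum>j\<in>J. f j (s j) * (\<Prod>i\<in>J - {j}. f i (s i) * indicator {s j..} (s i))) \<partial>Pi\<^sub>M J (\<lambda>_. lborel))"
  proof (rule nn_integral_mono)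
    fix s :: "'i \<Rightarrow> real"
    \<comment> \<open>The summand of a minimising index alone equals the whole product. Ties let
      several summands do so, whence the inequality.\<close>
    have "Min (s ` J) \<in> s ` J" using J by (intro Min_in) auto
    then obtain j where j: "j \<in> J" "s j = Min (s ` J)" by auto
    have "(\<Prod>i\<in>J. f i (s i)) = f j (s j) * (\<Prod>i\<in>J - {j}. f i (s i))"
      using J j by (simp add: prod.remove)
    also have "(\<Prod>i\<in>J - {j}. f i (s i)) = (\<Prod>i\<in>J - {j}. f i (s i) * indicator {s j..} (s i))"
      using J j by (intro prod.cong) auto
    also have "f j (s j) * (\<Prod>i\<in>J - {j}. f i (s i) * indicator {s j..} (s i)) \<le>
        (\<Sum>j\<in>J. f j (s j) * (\<Prod>i\<in>J - {j}. f i (s i) * indicator {s j..} (s i)))"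
      using J j by (intro member_le_sum) auto
    finally show "(\<Prod>i\<in>J. f i (s i)) \<le> (\<Sum>j\<in>J. f j (s j) * (\<Prod>i\<in>J - {j}. f i (s i) * indicator {s j..} (s i)))" .
  qed
  also have "\<dots> = (\<Sum>j\<in>J. \<integral>\<^sup>+s. f j (s j) * (\<Prod>i\<in>J - {j}. f i (s i) * indicator {s j..} (s i)) \<partial>Pi\<^sub>M J (\<lambda>_. lborel))"
    by (intro nn_integral_sum) measurable
  also have "\<dots> = (\<Sum>j\<in>J. \<integral>\<^sup>+s. f j s * (\<Prod>i\<in>J - {j}. \<integral>\<^sup>+u\<in>{s..}. f i u \<partial>lborel) \<partial>lborel)"
  proof (rule sum.cong[OF refl])
    fix j assume j: "j \<in> J"
    then have J_eq: "insert j (J - {j}) = J" by auto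
    have [measurable]: "f j \<in> borel_measurable borel" using j by auto
    let ?g = "\<lambda>s. f j (s j) * (\<Prod>i\<in>J - {j}. f i (s i) * indicator {s j..} (s i))"
    have "(\<integral>\<^sup>+s. ?g s \<partial>Pi\<^sub>M (insert j (J - {j})) (\<lambda>_. lborel)) =
        (\<integral>\<^sup>+u. \<integral>\<^sup>+s. ?g (s(j := u)) \<partial>Pi\<^sub>M (J - {j}) (\<lambda>_. lborel) \<partial>lborel)"
    proof (rule product_nn_integral_insert_rev)
      show "?g \<in> borel_measurable (Pi\<^sub>M (insert j (J - {j})) (\<lambda>_. lborel))"
        using j unfolding J_eq by measurable
    qed (use J in auto)
    also have "\<dots> = (\<integral>\<^sup>+u. f j u * (\<integral>\<^sup>+s. (\<Prod>i\<in>J - {j}. f i (s i) * indicator {u..} (s i)) \<partial>Pi\<^sub>M (J - {j}) (\<lambda>_. lborel)) \<partial>lborel)"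
    proof (rule nn_integral_cong)
      fix u :: real
      have "?g (s(j := u)) = f j u * (\<Prod>i\<in>J - {j}. f i (s i) * indicator {u..} (s i))" for s
        by (auto intro!: arg_cong2[where f = "(*)"] prod.cong)
      then show "(\<integral>\<^sup>+s. ?g (s(j := u)) \<partial>Pi\<^sub>M (J - {j}) (\<lambda>_. lborel)) =
          f j u * (\<integral>\<^sup>+s. (\<Prod>i\<in>J - {j}. f i (s i) * indicator {u..} (s i)) \<partial>Pi\<^sub>M (J - {j}) (\<lambda>_. lborel))"
        by (simp only:) (intro nn_integral_cmult, measurable)
    qed
    also have "\<dots> = (\<integral>\<^sup>+u. f j u * (\<Prod>i\<in>J - {j}. \<integral>\<^sup>+v\<in>{u..}. f i v \<partial>lborel) \<partial>lborel)"
    proof (rule nn_integral_cong, rule arg_cong2[where f = "(*)", OF refl])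
      fix u :: real
      show "(\<integral>\<^sup>+s. (\<Prod>i\<in>J - {j}. f i (s i) * indicator {u..} (s i)) \<partial>Pi\<^sub>M (J - {j}) (\<lambda>_. lborel)) =
          (\<Prod>i\<in>J - {j}. \<integral>\<^sup>+v\<in>{u..}. f i v \<partial>lborel)"
        using J by (intro product_nn_integral_prod[where f = "\<lambda>i v. f i v * indicator {u..} v"]) auto
    qed
    finally show "(\<integral>\<^sup>+s. ?g s \<partial>Pi\<^sub>M J (\<lambda>_. lborel)) = (\<integral>\<^sup>+s. f j s * (\<Prod>i\<in>J - {j}. \<integral>\<^sup>+u\<in>{s..}. f i u \<partial>lborel) \<partial>lborel)"
      by (simp only: J_eq)
  qed
  finally show ?thesis .
qed

context density_process
begin

text \<open>Occupation after time \<open>r\<close>, discounted from \<open>r\<close> on. The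
  discount turns the time integral of the semigroup into the resolvent density and removes the
  horizon \<open>t\<close>, which would otherwise shrink at every use of the Markov
  property.\<close>

definition docc :: "real \<Rightarrow> ('a \<Rightarrow> ennreal) \<Rightarrow> 'w \<Rightarrow> ennreal" where
  "docc r g \<omega> = (\<integral>\<^sup>+s\<in>{r..}. ennreal (exp (- (s - r))) * ext0 g (X (ennreal s) \<omega>) \<partial>lborel)"

lemma measurable_docc [measurable (raw)]:
  assumes [measurable]: "case_prod g \<in> borel_measurable (N \<Otimes>\<^sub>M borel)" "f \<in> N \<rightarrow>\<^sub>M \<Omega>" "h \<in> borel_measurable N"
  shows "(\<lambda>z. docc (h z) (g z) (f z)) \<in> borel_measurable N"
  unfolding docc_def by measurable

lemma occ_le_docc:
  assumes [measurable]: "g \<in> borel_measurable borel" "\<omega> \<in> space \<Omega>"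
  shows "occ t g \<omega> \<le> ennreal (exp t) * docc 0 g \<omega>"
proof -
  have "occ t g \<omega> \<le> (\<integral>\<^sup>+s. ennreal (exp t) * (ennreal (exp (- (s - 0))) * ext0 g (X (ennreal s) \<omega>) * indicator {0..} s) \<partial>lborel)"
    unfolding occ_def
  proof (rule nn_integral_mono)
    fix s :: real
    have eq: "ennreal (exp t) * (ennreal (exp (- (s - 0))) * ext0 g (X (ennreal s) \<omega>) * indicator {0..} s) =
      ennreal (exp (t - s)) * (ext0 g (X (ennreal s) \<omega>) * indicator {0..} s)"
      by (simp add: mult.assoc[symmetric] exp_diff exp_minus divide_inverse flip: ennreal_mult)
    show "ext0 g (X (ennreal s) \<omega>) * indicator {0..t} s \<le>
      ennreal (exp t) * (ennreal (exp (- (s - 0))) * ext0 g (X (ennreal s) \<omega>) * indicator {0..} s)"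
    proof (cases "s \<in> {0..t}")
      case True
      then have "1 * (ext0 g (X (ennreal s) \<omega>) * indicator {0..} s) \<le> ennreal (exp (t - s)) * (ext0 g (X (ennreal s) \<omega>) * indicator {0..} s)"
        by (intro mult_right_mono) auto
      then show ?thesis unfolding eq using True by simp
    qed simp
  qed
  also have "\<dots> = ennreal (exp t) * docc 0 g \<omega>"
    unfolding docc_def by (intro nn_integral_cmult) measurable
  finally show ?thesis .
qed

text \<open>The kernel bounding the joint moments of \<open>docc\<close>, obtained by applying the Markov property at the
  first of the \<open>n\<close> times.\<close>

fun \<Gamma> :: "nat \<Rightarrow> real \<Rightarrow> nat set \<Rightarrow> (nat \<Rightarrow> 'a) \<Rightarrow> 'a \<Rightarrow> ennreal" where
  "\<Gamma> 0 \<epsilon> J x y = 1"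
| "\<Gamma> (Suc n) \<epsilon> J x y = (\<Sum>j\<in>J. \<integral>\<^sup>+z. R y z * (qq \<epsilon> z (x j) * \<Gamma> n \<epsilon> (J - {j}) x z) \<partial>m)"

text \<open>\<open>I\<close> may be larger than \<open>J\<close>, because the recursion removes
  indices from \<open>J\<close> while the points \<open>x\<close> stay in one product space.\<close>

lemma measurable_\<Gamma>:
  assumes "J \<subseteq> I"
  shows "(\<lambda>(x, y). \<Gamma> n \<epsilon> J x y) \<in> borel_measurable (Pi\<^sub>M I (\<lambda>_. borel) \<Otimes>\<^sub>M borel)"
  using assms
proof (induction n arbitrary: J)
  case 0
  show ?case unfolding \<Gamma>.simps(1)[abs_def] by simp
next
  case (Suc n)
  have "(\<lambda>p. \<integral>\<^sup>+z. R (snd p) z * (qq \<epsilon> z (fst p j) * \<Gamma> n \<epsilon> (J - {j}) (fst p) z) \<partial>m)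
      \<in> borel_measurable (Pi\<^sub>M I (\<lambda>_. borel) \<Otimes>\<^sub>M borel)" if "j \<in> J" for j
  proof -
    have [measurable]: "(\<lambda>(x, y). \<Gamma> n \<epsilon> (J - {j}) x y) \<in> borel_measurable (Pi\<^sub>M I (\<lambda>_. borel) \<Otimes>\<^sub>M borel)"
      using Suc.prems by (intro Suc.IH) auto
    have [measurable]: "j \<in> I" using that Suc.prems by auto
    show ?thesis by measurable
  qed
  then show ?case
    unfolding \<Gamma>.simps case_prod_beta by (intro borel_measurable_sum)
qed

lemma measurable_\<Gamma>_snd [measurable]: "\<Gamma> n \<epsilon> J x \<in> borel_measurable borel"
proof (induction n arbitrary: J)
  case 0
  show ?case unfolding \<Gamma>.simps(1)[abs_def] by simp
next
  case (Suc n)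
  note [measurable] = Suc.IH
  show ?case unfolding \<Gamma>.simps(2)[abs_def] by measurable
qed

lemma \<Gamma>_upd: "j \<notin> J \<Longrightarrow> \<Gamma> n \<epsilon> J (x(j := a)) y = \<Gamma> n \<epsilon> J x y"
proof (induction n arbitrary: J y)
  case (Suc n)
  have eq: "\<Gamma> n \<epsilon> (J - {i}) (x(j := a)) z = \<Gamma> n \<epsilon> (J - {i}) x z" for i z
    using Suc.prems by (intro Suc.IH) auto
  have "(x(j := a)) i = x i" if "i \<in> J" for i
    using that Suc.prems by auto
  then show ?case
    unfolding \<Gamma>.simps eq by (intro sum.cong refl nn_integral_cong) (simp only:)
qed simp

lemma lborel_shift:
  fixes f :: "real \<Rightarrow> ennreal"
  assumes "f \<in> borel_measurable borel"
  shows "(\<integral>\<^sup>+u. f (u - s) \<partial>lborel) = (\<integral>\<^sup>+u. f u \<partial>lborel)"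
  using nn_integral_real_affine[OF assms, of 1 "- s"] by simp

text \<open>The discount restarted at the later time \<open>s\<close> is weaker. Restarting gives
  away \<open>exp (- (s - r))\<close> but leaves the remaining factors in the form required by the
  induction on their number.\<close>

lemma docc_shift_le:
  assumes "r \<le> s" and [measurable]: "g \<in> borel_measurable borel" "\<omega> \<in> space \<Omega>"
  shows "(\<integral>\<^sup>+u\<in>{s..}. (ennreal (exp (- (u - r))) * ext0 g (X (ennreal u) \<omega>) * indicator {r..} u) \<partial>lborel) \<le>
    docc s g \<omega>"
  unfolding docc_def
proof (rule nn_integral_mono)
  fix u :: real
  show "ennreal (exp (- (u - r))) * ext0 g (X (ennreal u) \<omega>) * indicator {r..} u * indicator {s..} u \<le>
      ennreal (exp (- (u - s))) * ext0 g (X (ennreal u) \<omega>) * indicator {s..} u"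
    using assms(1) by (auto intro!: mult_right_mono ennreal_leI split: split_indicator)
qed

lemma nn_integral_R_shift:
  assumes [measurable]: "w \<in> borel_measurable borel"
  shows "(\<integral>\<^sup>+s. ennreal (exp (- (s - r))) * K (s - r) w y \<partial>lborel) = (\<integral>\<^sup>+z. R y z * w z \<partial>m)"
  unfolding nn_integral_R[OF assms] by (rule lborel_shift) measurable

text \<open>The first time \<open>s\<close> and its factor are absorbed into the past functional
  \<open>Z\<close>, the induction hypothesis is applied from \<open>s\<close> on, and the Markov
  property returns to \<open>r\<close>; integrating over \<open>s\<close> yields the resolvent
  density. With no factor left the value is \<open>1\<close> even if the process has died, which
  explains the distinction \<open>n = 0\<close>.\<close>

lemma moment_docc_le:
  assumes "finite J" "card J = n" "r \<ge> 0" "Z \<in> borel_measurable (filt (ennreal r))"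
  shows "(\<integral>\<^sup>+\<omega>. Z \<omega> * (\<Prod>j\<in>J. docc r (\<lambda>y. qq \<epsilon> y (x j)) \<omega>) \<partial>P (Some x0)) \<le>
    (\<integral>\<^sup>+\<omega>. Z \<omega> * (if n = 0 then 1 else ext0 (\<Gamma> n \<epsilon> J x) (X (ennreal r) \<omega>)) \<partial>P (Some x0))"
  using assms
proof (induction n arbitrary: J r Z)
  case 0
  then show ?case by simp
next
  case (Suc n)
  let ?P = "P (Some x0)"
  define g where "g j = (\<lambda>y. qq \<epsilon> y (x j))" for j
  have [measurable]: "g j \<in> borel_measurable borel" for j
    unfolding g_def by measurable
  define w where "w j = (\<lambda>z. g j z * \<Gamma> n \<epsilon> (J - {j}) x z)" for j
  have [measurable]: "w j \<in> borel_measurable borel" for j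
    unfolding w_def by measurable
  have Z [measurable]: "Z \<in> borel_measurable \<Omega>"
    using Suc.prems(4) by (rule measurable_filt)
  have J: "finite J" "J \<noteq> {}" using Suc.prems by auto
  let ?e = "\<lambda>s. ennreal (exp (- (s - r))) * indicator {r..} s"
  have prod_le: "(\<Prod>j\<in>J. docc r (g j) \<omega>) \<le>
      (\<Sum>j\<in>J. \<integral>\<^sup>+s. ?e s * (ext0 (g j) (X (ennreal s) \<omega>) * (\<Prod>i\<in>J - {j}. docc s (g i) \<omega>)) \<partial>lborel)"
    if [measurable]: "\<omega> \<in> space \<Omega>" for \<omega>
  proof -
    let ?f = "\<lambda>j u. ennreal (exp (- (u - r))) * ext0 (g j) (X (ennreal u) \<omega>) * indicator {r..} u"
    have "(\<Prod>j\<in>J. docc r (g j) \<omega>) \<le>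
        (\<Sum>j\<in>J. \<integral>\<^sup>+s. ?f j s * (\<Prod>i\<in>J - {j}. \<integral>\<^sup>+u\<in>{s..}. ?f i u \<partial>lborel) \<partial>lborel)"
      unfolding docc_def using J by (intro prod_nn_integral_le_first) measurable
    also have "\<dots> \<le> (\<Sum>j\<in>J. \<integral>\<^sup>+s. ?e s * (ext0 (g j) (X (ennreal s) \<omega>) * (\<Prod>i\<in>J - {j}. docc s (g i) \<omega>)) \<partial>lborel)"
    proof (intro sum_mono nn_integral_mono)
      fix j and s :: real
      show "?f j s * (\<Prod>i\<in>J - {j}. \<integral>\<^sup>+u\<in>{s..}. ?f i u \<partial>lborel) \<le>
          ?e s * (ext0 (g j) (X (ennreal s) \<omega>) * (\<Prod>i\<in>J - {j}. docc s (g i) \<omega>))"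
      proof (cases "r \<le> s")
        case True
        then have "(\<Prod>i\<in>J - {j}. \<integral>\<^sup>+u\<in>{s..}. ?f i u \<partial>lborel) \<le> (\<Prod>i\<in>J - {j}. docc s (g i) \<omega>)"
          using that by (intro prod_mono_ennreal docc_shift_le) measurable
        then show ?thesis
          using True by (auto simp: mult.assoc intro!: mult_left_mono)
      qed simp
    qed
    finally show ?thesis .
  qed
  have "(\<integral>\<^sup>+\<omega>. Z \<omega> * (\<Prod>j\<in>J. docc r (g j) \<omega>) \<partial>?P) \<le>
      (\<integral>\<^sup>+\<omega>. Z \<omega> * (\<Sum>j\<in>J. \<integral>\<^sup>+s. ?e s * (ext0 (g j) (X (ennreal s) \<omega>) * (\<Prod>i\<in>J - {j}. docc s (g i) \<omega>)) \<partial>lborel) \<partial>?P)"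
    using prod_le by (intro nn_integral_mono mult_left_mono) auto
  also have "\<dots> = (\<integral>\<^sup>+\<omega>. (\<Sum>j\<in>J. \<integral>\<^sup>+s. ?e s * ((Z \<omega> * ext0 (g j) (X (ennreal s) \<omega>)) * (\<Prod>i\<in>J - {j}. docc s (g i) \<omega>)) \<partial>lborel) \<partial>?P)"
    by (intro nn_integral_cong) (simp add: sum_distrib_left nn_integral_cmult[symmetric] mult_ac)
  also have "\<dots> = (\<Sum>j\<in>J. \<integral>\<^sup>+\<omega>. \<integral>\<^sup>+s. ?e s * ((Z \<omega> * ext0 (g j) (X (ennreal s) \<omega>)) * (\<Prod>i\<in>J - {j}. docc s (g i) \<omega>)) \<partial>lborel \<partial>?P)"
    by (intro nn_integral_sum) measurable
  also have "\<dots> = (\<Sum>j\<in>J. \<integral>\<^sup>+s. \<integral>\<^sup>+\<omega>. ?e s * ((Z \<omega> * ext0 (g j) (X (ennreal s) \<omega>)) * (\<Prod>i\<in>J - {j}. docc s (g i) \<omega>)) \<partial>?P \<partial>lborel)"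
    by (intro sum.cong refl nn_integral_swap sigma_finite_P sigma_finite_lborel) measurable
  also have "\<dots> = (\<Sum>j\<in>J. \<integral>\<^sup>+s. ?e s * (\<integral>\<^sup>+\<omega>. (Z \<omega> * ext0 (g j) (X (ennreal s) \<omega>)) * (\<Prod>i\<in>J - {j}. docc s (g i) \<omega>) \<partial>?P) \<partial>lborel)"
    by (intro sum.cong refl nn_integral_cong nn_integral_cmult) measurable
  also have "\<dots> \<le> (\<Sum>j\<in>J. \<integral>\<^sup>+s. ennreal (exp (- (s - r))) * (\<integral>\<^sup>+\<omega>. Z \<omega> * ext0 (K (s - r) (w j)) (X (ennreal r) \<omega>) \<partial>?P) \<partial>lborel)"
  proof (intro sum_mono nn_integral_mono_AE)
    fix j assume j: "j \<in> J"
    show "AE s in lborel. ?e s * (\<integral>\<^sup>+\<omega>. (Z \<omega> * ext0 (g j) (X (ennreal s) \<omega>)) * (\<Prod>i\<in>J - {j}. docc s (g i) \<omega>) \<partial>?P) \<le>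
        ennreal (exp (- (s - r))) * (\<integral>\<^sup>+\<omega>. Z \<omega> * ext0 (K (s - r) (w j)) (X (ennreal r) \<omega>) \<partial>?P)"
      using AE_lborel_singleton[of r]
    proof eventually_elim
      fix s assume "s \<noteq> r"
      show "?e s * (\<integral>\<^sup>+\<omega>. (Z \<omega> * ext0 (g j) (X (ennreal s) \<omega>)) * (\<Prod>i\<in>J - {j}. docc s (g i) \<omega>) \<partial>?P) \<le>
        ennreal (exp (- (s - r))) * (\<integral>\<^sup>+\<omega>. Z \<omega> * ext0 (K (s - r) (w j)) (X (ennreal r) \<omega>) \<partial>?P)"
      proof (cases "r < s")
        case True
        have Z_s: "Z \<in> borel_measurable (filt (ennreal s))"
          using Suc.prems(4) True by (rule_tac measurable_filt_mono) (auto intro: ennreal_leI)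
        have gX: "(\<lambda>\<omega>. ext0 (g j) (X (ennreal s) \<omega>)) \<in> borel_measurable (filt (ennreal s))"
          by (rule measurable_ext0[OF _ measurable_X_filt]) measurable
        have "(\<integral>\<^sup>+\<omega>. (Z \<omega> * ext0 (g j) (X (ennreal s) \<omega>)) * (\<Prod>i\<in>J - {j}. docc s (g i) \<omega>) \<partial>?P) \<le>
            (\<integral>\<^sup>+\<omega>. (Z \<omega> * ext0 (g j) (X (ennreal s) \<omega>)) * (if n = 0 then 1 else ext0 (\<Gamma> n \<epsilon> (J - {j}) x) (X (ennreal s) \<omega>)) \<partial>?P)"
          unfolding g_def
        proof (rule Suc.IH)
          show "(\<lambda>\<omega>. Z \<omega> * ext0 (\<lambda>y. qq \<epsilon> y (x j)) (X (ennreal s) \<omega>)) \<in> borel_measurable (filt (ennreal s))"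
            using Z_s gX unfolding g_def by (rule borel_measurable_times_ennreal)
        qed (use Suc.prems j True in auto)
        \<comment> \<open>Both cases of the distinction agree with \<open>w j\<close>: the factor
          \<open>ext0 (g j)\<close> already vanishes at the cemetery, and \<open>\<Gamma> 0\<close>
          is \<open>1\<close>.\<close>
        also have "\<dots> = (\<integral>\<^sup>+\<omega>. Z \<omega> * ext0 (w j) (X (ennreal s) \<omega>) \<partial>?P)"
          by (intro nn_integral_cong) (auto simp: w_def ext0_def mult.assoc split: option.splits)
        also have "\<dots> = (\<integral>\<^sup>+\<omega>. Z \<omega> * ext0 (K (s - r) (w j)) (X (ennreal r) \<omega>) \<partial>?P)"
          using markov[OF Suc.prems(4), of "s - r" "w j" x0] True Suc.prems(3) by simp
        finally show ?thesis
          using True by (auto intro!: mult_left_mono)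
      qed (use \<open>s \<noteq> r\<close> in simp)
    qed
  qed
  also have "\<dots> = (\<Sum>j\<in>J. \<integral>\<^sup>+s. \<integral>\<^sup>+\<omega>. ennreal (exp (- (s - r))) * (Z \<omega> * ext0 (K (s - r) (w j)) (X (ennreal r) \<omega>)) \<partial>?P \<partial>lborel)"
    by (intro sum.cong refl nn_integral_cong nn_integral_cmult[symmetric]) measurable
  also have "\<dots> = (\<Sum>j\<in>J. \<integral>\<^sup>+\<omega>. \<integral>\<^sup>+s. ennreal (exp (- (s - r))) * (Z \<omega> * ext0 (K (s - r) (w j)) (X (ennreal r) \<omega>)) \<partial>lborel \<partial>?P)"
    by (intro sum.cong refl nn_integral_swap sigma_finite_P sigma_finite_lborel) measurable
  also have "\<dots> = (\<Sum>j\<in>J. \<integral>\<^sup>+\<omega>. Z \<omega> * ext0 (\<lambda>y. \<integral>\<^sup>+z. R y z * w j z \<partial>m) (X (ennreal r) \<omega>) \<partial>?P)"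
  proof (intro sum.cong refl nn_integral_cong)
    fix j \<omega>
    show "(\<integral>\<^sup>+s. ennreal (exp (- (s - r))) * (Z \<omega> * ext0 (K (s - r) (w j)) (X (ennreal r) \<omega>)) \<partial>lborel) =
        Z \<omega> * ext0 (\<lambda>y. \<integral>\<^sup>+z. R y z * w j z \<partial>m) (X (ennreal r) \<omega>)"
    proof (cases "X (ennreal r) \<omega>")
      case (Some y)
      have "(\<integral>\<^sup>+s. ennreal (exp (- (s - r))) * (Z \<omega> * K (s - r) (w j) y) \<partial>lborel) =
          (\<integral>\<^sup>+s. Z \<omega> * (ennreal (exp (- (s - r))) * K (s - r) (w j) y) \<partial>lborel)"
        by (intro nn_integral_cong) (rule mult.left_commute)
      also have "\<dots> = Z \<omega> * (\<integral>\<^sup>+z. R y z * w j z \<partial>m)"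
        by (simp add: nn_integral_cmult nn_integral_R_shift del: minus_diff_eq)
      finally show ?thesis using Some by simp
    qed simp
  qed
  also have "\<dots> = (\<integral>\<^sup>+\<omega>. (\<Sum>j\<in>J. Z \<omega> * ext0 (\<lambda>y. \<integral>\<^sup>+z. R y z * w j z \<partial>m) (X (ennreal r) \<omega>)) \<partial>?P)"
    by (intro nn_integral_sum[symmetric]) measurable
  also have "\<dots> = (\<integral>\<^sup>+\<omega>. Z \<omega> * ext0 (\<Gamma> (Suc n) \<epsilon> J x) (X (ennreal r) \<omega>) \<partial>?P)"
  proof (rule nn_integral_cong)
    fix \<omega>
    show "(\<Sum>j\<in>J. Z \<omega> * ext0 (\<lambda>y. \<integral>\<^sup>+z. R y z * w j z \<partial>m) (X (ennreal r) \<omega>)) =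
        Z \<omega> * ext0 (\<Gamma> (Suc n) \<epsilon> J x) (X (ennreal r) \<omega>)"
      by (cases "X (ennreal r) \<omega>") (simp_all add: w_def g_def sum_distrib_left)
  qed
  finally show ?case
    unfolding g_def by simp
qed

text \<open>Each step of the recursion contributes \<open>C\<close> for one resolvent density, the
  number of summands, and the \<open>p\<close>-th power of that number from raising a sum to the
  power \<open>p\<close>.\<close>

fun \<Gamma>_bound :: "nat \<Rightarrow> ennreal \<Rightarrow> nat \<Rightarrow> ennreal" where
  "\<Gamma>_bound p C 0 = 1"
| "\<Gamma>_bound p C (Suc n) = of_nat (Suc n) ^ p * (of_nat (Suc n) * (C * \<Gamma>_bound p C n))"

text \<open>The coordinate \<open>x j\<close> is integrated out by Jensen's inequality in the first
  variable of the smoothing kernel, followed by Tonelli and the mass bound in its second variable.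
  The smoothing thereby disappears, and the bound does not depend on
  \<open>\<epsilon>\<close>.\<close>

lemma nn_integral_\<Gamma>_power_le:
  assumes C: "\<And>x. (\<integral>\<^sup>+y. R x y ^ p \<partial>m) \<le> C" and p: "p \<ge> 1"
    and J: "finite J" "card J = n"
  shows "(\<integral>\<^sup>+x. \<Gamma> n \<epsilon> J x y ^ p \<partial>Pi\<^sub>M J (\<lambda>_. m)) \<le> \<Gamma>_bound p C n"
  using J
proof (induction n arbitrary: J y)
  case 0
  then show ?case using p by (simp add: PiM_empty)
next
  case (Suc n)
  interpret product_sigma_finite "\<lambda>_::nat. m"
    by (intro product_sigma_finite.intro sigma_finite_measure_axioms)
  have J: "finite J" "J \<noteq> {}" using Suc.prems by auto
  let ?a = "\<lambda>j x. \<integral>\<^sup>+z. R y z * (qq \<epsilon> z (x j) * \<Gamma> n \<epsilon> (J - {j}) x z) \<partial>m"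
  have meas_\<Gamma>: "(\<lambda>(x, y). \<Gamma> n \<epsilon> (J - {j}) x y) \<in> borel_measurable (Pi\<^sub>M I (\<lambda>_. m) \<Otimes>\<^sub>M borel)" if "J - {j} \<subseteq> I" for j I
    using measurable_\<Gamma>[OF that, of n \<epsilon>]
    by (simp cong: measurable_cong_sets sets_pair_measure_cong sets_PiM_cong)
  have a_meas: "?a j \<in> borel_measurable (Pi\<^sub>M J (\<lambda>_. m))" if "j \<in> J" for j
  proof -
    note [measurable] = meas_\<Gamma>[of j J]
    show ?thesis using that by measurable
  qed
  have a_le: "(\<integral>\<^sup>+x. ?a j x ^ p \<partial>Pi\<^sub>M J (\<lambda>_. m)) \<le> C * \<Gamma>_bound p C n" if j: "j \<in> J" for j
  proof -
    let ?J = "J - {j}"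
    have J_eq: "insert j ?J = J" using j by auto
    note [measurable] = meas_\<Gamma>[of j ?J]
    have "(\<integral>\<^sup>+x. ?a j x ^ p \<partial>Pi\<^sub>M (insert j ?J) (\<lambda>_. m)) = (\<integral>\<^sup>+x. \<integral>\<^sup>+a. ?a j (x(j := a)) ^ p \<partial>m \<partial>Pi\<^sub>M ?J (\<lambda>_. m))"
    proof (rule product_nn_integral_insert)
      show "(\<lambda>x. ?a j x ^ p) \<in> borel_measurable (Pi\<^sub>M (insert j ?J) (\<lambda>_. m))"
        unfolding J_eq using a_meas[OF j] by (rule borel_measurable_power_ennreal)
    qed (use J in auto)
    also have "\<dots> = (\<integral>\<^sup>+x. \<integral>\<^sup>+a. (\<integral>\<^sup>+z. qq \<epsilon> z a * (R y z * \<Gamma> n \<epsilon> ?J x z) \<partial>m) ^ p \<partial>m \<partial>Pi\<^sub>M ?J (\<lambda>_. m))"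
    proof -
      have "?a j (x(j := a)) = (\<integral>\<^sup>+z. qq \<epsilon> z a * (R y z * \<Gamma> n \<epsilon> ?J x z) \<partial>m)" for x a
        by (intro nn_integral_cong) (simp add: \<Gamma>_upd mult.left_commute del: fun_upd_apply, simp)
      then show ?thesis by (simp only:)
    qed
    also have "\<dots> \<le> (\<integral>\<^sup>+x. \<integral>\<^sup>+a. (\<integral>\<^sup>+z. qq \<epsilon> z a * (R y z * \<Gamma> n \<epsilon> ?J x z) ^ p \<partial>m) \<partial>m \<partial>Pi\<^sub>M ?J (\<lambda>_. m))"
    \<comment> \<open>The points \<open>a\<close> at which the kernel has mass above
      \<open>1\<close> in its first variable form a null set for the integration over
      \<open>a\<close>.\<close>
    proof (rule nn_integral_mono, rule nn_integral_mono_AE)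
      fix x
      show "AE a in m. (\<integral>\<^sup>+z. qq \<epsilon> z a * (R y z * \<Gamma> n \<epsilon> ?J x z) \<partial>m) ^ p \<le> (\<integral>\<^sup>+z. qq \<epsilon> z a * (R y z * \<Gamma> n \<epsilon> ?J x z) ^ p \<partial>m)"
        using AE_nn_integral_qq_le[of \<epsilon>]
      proof eventually_elim
        fix a assume "(\<integral>\<^sup>+z. qq \<epsilon> z a \<partial>m) \<le> 1"
        then show "(\<integral>\<^sup>+z. qq \<epsilon> z a * (R y z * \<Gamma> n \<epsilon> ?J x z) \<partial>m) ^ p \<le> (\<integral>\<^sup>+z. qq \<epsilon> z a * (R y z * \<Gamma> n \<epsilon> ?J x z) ^ p \<partial>m)"
          using p by (intro nn_integral_power_le) measurable
      qed
    qed
    also have "\<dots> = (\<integral>\<^sup>+x. \<integral>\<^sup>+z. (\<integral>\<^sup>+a. qq \<epsilon> z a * (R y z * \<Gamma> n \<epsilon> ?J x z) ^ p \<partial>m) \<partial>m \<partial>Pi\<^sub>M ?J (\<lambda>_. m))"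
      by (intro nn_integral_cong nn_integral_swap sigma_finite_measure_axioms) measurable
    also have "\<dots> \<le> (\<integral>\<^sup>+x. \<integral>\<^sup>+z. (R y z * \<Gamma> n \<epsilon> ?J x z) ^ p \<partial>m \<partial>Pi\<^sub>M ?J (\<lambda>_. m))"
    proof (intro nn_integral_mono)
      fix x z
      have "(\<integral>\<^sup>+a. qq \<epsilon> z a * (R y z * \<Gamma> n \<epsilon> ?J x z) ^ p \<partial>m) = (\<integral>\<^sup>+a. qq \<epsilon> z a \<partial>m) * (R y z * \<Gamma> n \<epsilon> ?J x z) ^ p"
        by (intro nn_integral_multc) measurable
      also have "\<dots> \<le> 1 * (R y z * \<Gamma> n \<epsilon> ?J x z) ^ p"
        by (intro mult_right_mono nn_integral_qq_le) auto
      finally show "(\<integral>\<^sup>+a. qq \<epsilon> z a * (R y z * \<Gamma> n \<epsilon> ?J x z) ^ p \<partial>m) \<le> (R y z * \<Gamma> n \<epsilon> ?J x z) ^ p"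
        by simp
    qed
    also have "\<dots> = (\<integral>\<^sup>+z. \<integral>\<^sup>+x. (R y z * \<Gamma> n \<epsilon> ?J x z) ^ p \<partial>Pi\<^sub>M ?J (\<lambda>_. m) \<partial>m)"
      using J by (intro nn_integral_swap sigma_finite_measure_axioms sigma_finite) measurable
    also have "\<dots> = (\<integral>\<^sup>+z. R y z ^ p * (\<integral>\<^sup>+x. \<Gamma> n \<epsilon> ?J x z ^ p \<partial>Pi\<^sub>M ?J (\<lambda>_. m)) \<partial>m)"
      unfolding power_mult_distrib by (intro nn_integral_cong nn_integral_cmult) measurable
    also have "\<dots> \<le> (\<integral>\<^sup>+z. R y z ^ p * \<Gamma>_bound p C n \<partial>m)"
    proof (rule nn_integral_mono)
      fix z
      have "(\<integral>\<^sup>+x. \<Gamma> n \<epsilon> ?J x z ^ p \<partial>Pi\<^sub>M ?J (\<lambda>_. m)) \<le> \<Gamma>_bound p C n"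
        using Suc.prems j by (intro Suc.IH) (auto simp: card_Diff_singleton)
      then show "R y z ^ p * (\<integral>\<^sup>+x. \<Gamma> n \<epsilon> ?J x z ^ p \<partial>Pi\<^sub>M ?J (\<lambda>_. m)) \<le> R y z ^ p * \<Gamma>_bound p C n"
        by (rule mult_left_mono) simp
    qed
    also have "\<dots> = (\<integral>\<^sup>+z. R y z ^ p \<partial>m) * \<Gamma>_bound p C n"
      by (intro nn_integral_multc) measurable
    also have "\<dots> \<le> C * \<Gamma>_bound p C n"
      by (intro mult_right_mono C) auto
    finally show ?thesis by (simp only: J_eq)
  qed
  have "(\<integral>\<^sup>+x. \<Gamma> (Suc n) \<epsilon> J x y ^ p \<partial>Pi\<^sub>M J (\<lambda>_. m)) \<le> (\<integral>\<^sup>+x. of_nat (card J) ^ p * (\<Sum>j\<in>J. ?a j x ^ p) \<partial>Pi\<^sub>M J (\<lambda>_. m))"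
    unfolding \<Gamma>.simps using J by (intro nn_integral_mono power_sum_le)
  also have "\<dots> = of_nat (card J) ^ p * (\<Sum>j\<in>J. \<integral>\<^sup>+x. ?a j x ^ p \<partial>Pi\<^sub>M J (\<lambda>_. m))"
  proof -
    have *: "(\<lambda>x. ?a j x ^ p) \<in> borel_measurable (Pi\<^sub>M J (\<lambda>_. m))" if "j \<in> J" for j
      using a_meas[OF that] by (rule borel_measurable_power_ennreal)
    have "(\<integral>\<^sup>+x. (\<Sum>j\<in>J. ?a j x ^ p) \<partial>Pi\<^sub>M J (\<lambda>_. m)) = (\<Sum>j\<in>J. \<integral>\<^sup>+x. ?a j x ^ p \<partial>Pi\<^sub>M J (\<lambda>_. m))"
      by (intro nn_integral_sum *)
    moreover have "(\<integral>\<^sup>+x. of_nat (card J) ^ p * (\<Sum>j\<in>J. ?a j x ^ p) \<partial>Pi\<^sub>M J (\<lambda>_. m)) =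
        of_nat (card J) ^ p * (\<integral>\<^sup>+x. (\<Sum>j\<in>J. ?a j x ^ p) \<partial>Pi\<^sub>M J (\<lambda>_. m))"
      by (rule nn_integral_cmult, rule borel_measurable_sum, rule *)
    ultimately show ?thesis by (simp only:)
  qed
  also have "\<dots> \<le> of_nat (card J) ^ p * (\<Sum>j\<in>J. C * \<Gamma>_bound p C n)"
    by (intro mult_left_mono sum_mono a_le) auto
  also have "\<dots> = \<Gamma>_bound p C (Suc n)"
    using Suc.prems by simp
  finally show ?case .
qed

lemma nn_integral_moment_power_le:
  assumes C: "\<And>x. (\<integral>\<^sup>+y. R x y ^ p \<partial>m) \<le> C" and p: "p \<ge> 1"
    and J: "finite (J :: nat set)" "J \<noteq> {}"
  shows "(\<integral>\<^sup>+x. (\<integral>\<^sup>+\<omega>. (\<Prod>j\<in>J. occ t (\<lambda>y. qq \<epsilon> y (x j)) \<omega>) \<partial>P (Some x0)) ^ p \<partial>Pi\<^sub>M J (\<lambda>_. m)) \<le>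
    (ennreal (exp t) ^ card J) ^ p * \<Gamma>_bound p C (card J)"
proof -
  have le: "(\<integral>\<^sup>+\<omega>. (\<Prod>j\<in>J. occ t (\<lambda>y. qq \<epsilon> y (x j)) \<omega>) \<partial>P (Some x0)) \<le> ennreal (exp t) ^ card J * \<Gamma> (card J) \<epsilon> J x x0" for x
  proof -
    interpret prob_space "P (Some x0)" by (rule prob_space_P)
    have "(\<integral>\<^sup>+\<omega>. (\<Prod>j\<in>J. occ t (\<lambda>y. qq \<epsilon> y (x j)) \<omega>) \<partial>P (Some x0)) \<le>
       (\<integral>\<^sup>+\<omega>. (\<Prod>j\<in>J. ennreal (exp t) * docc 0 (\<lambda>y. qq \<epsilon> y (x j)) \<omega>) \<partial>P (Some x0))"
      by (intro nn_integral_mono prod_mono_ennreal occ_le_docc) auto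
    also have "\<dots> = (\<integral>\<^sup>+\<omega>. ennreal (exp t) ^ card J * (1 * (\<Prod>j\<in>J. docc 0 (\<lambda>y. qq \<epsilon> y (x j)) \<omega>)) \<partial>P (Some x0))"
      by (simp add: prod.distrib)
    also have "\<dots> = ennreal (exp t) ^ card J * (\<integral>\<^sup>+\<omega>. 1 * (\<Prod>j\<in>J. docc 0 (\<lambda>y. qq \<epsilon> y (x j)) \<omega>) \<partial>P (Some x0))"
      by (intro nn_integral_cmult) measurable
    also have "\<dots> \<le> ennreal (exp t) ^ card J *
        (\<integral>\<^sup>+\<omega>. 1 * (if card J = 0 then 1 else ext0 (\<Gamma> (card J) \<epsilon> J x) (X (ennreal 0) \<omega>)) \<partial>P (Some x0))"
      using J by (intro mult_left_mono moment_docc_le measurable_const_filt) auto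
    also have "(\<integral>\<^sup>+\<omega>. 1 * (if card J = 0 then 1 else ext0 (\<Gamma> (card J) \<epsilon> J x) (X (ennreal 0) \<omega>)) \<partial>P (Some x0)) =
        (\<integral>\<^sup>+\<omega>. \<Gamma> (card J) \<epsilon> J x x0 \<partial>P (Some x0))"
      using J by (intro nn_integral_cong_AE AE_mp[OF normal[of x0] AE_I2]) auto
    also have "\<dots> = \<Gamma> (card J) \<epsilon> J x x0"
      using emeasure_space_1 by simp
    finally show ?thesis .
  qed
  have meas: "(\<lambda>x. \<Gamma> (card J) \<epsilon> J x x0) \<in> borel_measurable (Pi\<^sub>M J (\<lambda>_. m))"
  proof -
    have "(\<lambda>x. \<Gamma> (card J) \<epsilon> J x x0) \<in> borel_measurable (Pi\<^sub>M J (\<lambda>_. borel))"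
      using measurable_\<Gamma>[of J J "card J" \<epsilon>] by measurable
    then show ?thesis
      by (simp cong: measurable_cong_sets sets_PiM_cong)
  qed
  have "(\<integral>\<^sup>+x. (\<integral>\<^sup>+\<omega>. (\<Prod>j\<in>J. occ t (\<lambda>y. qq \<epsilon> y (x j)) \<omega>) \<partial>P (Some x0)) ^ p \<partial>Pi\<^sub>M J (\<lambda>_. m)) \<le>
    (\<integral>\<^sup>+x. (ennreal (exp t) ^ card J * \<Gamma> (card J) \<epsilon> J x x0) ^ p \<partial>Pi\<^sub>M J (\<lambda>_. m))"
    by (intro nn_integral_mono power_mono_ennreal le)
  also have "\<dots> = (ennreal (exp t) ^ card J) ^ p * (\<integral>\<^sup>+x. \<Gamma> (card J) \<epsilon> J x x0 ^ p \<partial>Pi\<^sub>M J (\<lambda>_. m))"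
    unfolding power_mult_distrib using meas by (intro nn_integral_cmult borel_measurable_power_ennreal)
  also have "\<dots> \<le> (ennreal (exp t) ^ card J) ^ p * \<Gamma>_bound p C (card J)"
    using J by (intro mult_left_mono nn_integral_\<Gamma>_power_le C p) auto
  finally show ?thesis .
qed

lemma \<Gamma>_bound_finite: "C < \<infinity> \<Longrightarrow> \<Gamma>_bound p C n < \<infinity>"
  by (induction n) (auto simp: ennreal_mult_less_top power_less_top_ennreal of_nat_less_top simp del: of_nat_Suc)

end

section \<open>Products of Cauchy families\<close>

text \<open>Exchanging the factors one by one produces terms with one small factor and bounded
  others. The weighted product inequality treats them with two parameters: \<open>c\<close> is
  chosen from the uniform bound, and only then \<open>\<eta>'\<close> depending on \<open>c\<close>.
  A one-sided estimate suffices because \<open>a\<close> and \<open>b\<close> play symmetric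
  roles.\<close>

lemma nn_integral_prod_Cauchy:
  fixes G :: "'i \<Rightarrow> 'e \<Rightarrow> 'z \<Rightarrow> ennreal" and small :: "real \<Rightarrow> 'e \<Rightarrow> bool"
  assumes I: "finite I" "card I \<ge> 1"
    and meas [measurable]: "\<And>i a. i \<in> I \<Longrightarrow> G i a \<in> borel_measurable N" "F \<in> borel_measurable N"
    and F: "\<And>z. F z \<le> 1"
    and B: "B < \<infinity>" "\<And>i a r. i \<in> I \<Longrightarrow> small r a \<Longrightarrow> (\<integral>\<^sup>+z. G i a z ^ card I \<partial>N) \<le> B"
    and Cauchy: "\<And>i \<eta>. i \<in> I \<Longrightarrow> \<eta> > 0 \<Longrightarrow> \<exists>r>0. \<forall>a b. small r a \<and> small r b \<longrightarrow> (\<integral>\<^sup>+z. ed (G i a z) (G i b z) ^ card I \<partial>N) \<le> ennreal \<eta>"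
    and small: "\<And>r r' a. small r a \<Longrightarrow> r \<le> r' \<Longrightarrow> small r' a"
    and \<eta>: "\<eta> > 0"
  shows "\<exists>r>0. \<forall>a b. small r a \<and> small r b \<longrightarrow>
    (\<integral>\<^sup>+z. F z * (\<Prod>i\<in>I. G i a z) \<partial>N) \<le> (\<integral>\<^sup>+z. F z * (\<Prod>i\<in>I. G i b z) \<partial>N) + ennreal \<eta>"
proof -
  define p where "p = card I"
  obtain b0 where b0: "B = ennreal b0" "b0 \<ge> 0" using B(1) by (cases B) auto
  \<comment> \<open>Total size of the bounded factors: \<open>p\<close> terms, each with
    \<open>p\<close> powers of sums bounded by \<open>2 ^ p * (2 * b0)\<close>. Adding
    \<open>1\<close> keeps it positive.\<close>
  define K where "K = real p * real p * 2 ^ p * (2 * b0) + 1"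
  have K: "K > 0" unfolding K_def using b0 by (intro add_nonneg_pos mult_nonneg_nonneg) auto
  define c where "c = min 1 (\<eta> / (2 * K))"
  have c: "c > 0" "c \<le> 1" "c * K \<le> \<eta> / 2"
    using \<eta> K by (auto simp: c_def min_def field_simps)
  have cp: "c ^ p * K \<le> \<eta> / 2"
  proof -
    have "c ^ p \<le> c ^ 1" using c I by (intro power_decreasing) (auto simp: p_def)
    then have "c ^ p * K \<le> c * K" using K by simp
    then show ?thesis using c by linarith
  qed
  \<comment> \<open>Total coefficient of the small factors, again kept positive by adding
    \<open>1\<close>.\<close>
  define D where "D = real p * (1 / c) ^ ((p - 1) * p) + 1"
  have D: "D > 0" unfolding D_def using c by (intro add_nonneg_pos) auto
  define \<eta>' where "\<eta>' = \<eta> / (2 * D)"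
  have \<eta>': "\<eta>' > 0" using \<eta> D by (simp add: \<eta>'_def)
  have "\<forall>i\<in>I. \<exists>r>0. \<forall>a b. small r a \<and> small r b \<longrightarrow> (\<integral>\<^sup>+z. ed (G i a z) (G i b z) ^ p \<partial>N) \<le> ennreal \<eta>'"
    using Cauchy[OF _ \<eta>'] unfolding p_def by blast
  then obtain r where r: "\<And>i. i \<in> I \<Longrightarrow> r i > 0"
    "\<And>i a b. i \<in> I \<Longrightarrow> small (r i) a \<Longrightarrow> small (r i) b \<Longrightarrow> (\<integral>\<^sup>+z. ed (G i a z) (G i b z) ^ p \<partial>N) \<le> ennreal \<eta>'"
    by metis
  define r0 where "r0 = Min (r ` I)"
  have I_ne: "I \<noteq> {}" using I by auto
  have r0: "r0 > 0" "\<And>i. i \<in> I \<Longrightarrow> r0 \<le> r i"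
    using r I I_ne by (auto simp: r0_def)
  have "(\<integral>\<^sup>+z. F z * (\<Prod>i\<in>I. G i a z) \<partial>N) \<le> (\<integral>\<^sup>+z. F z * (\<Prod>i\<in>I. G i b z) \<partial>N) + ennreal \<eta>"
    if ab: "small r0 a" "small r0 b" for a b
  proof -
    let ?e = "\<lambda>i z. ed (G i a z) (G i b z)"
    let ?s = "\<lambda>i z. G i a z + G i b z"
    let ?M = "ennreal (1 / c) ^ ((p - 1) * p)"
    have pt: "F z * (\<Prod>i\<in>I. G i a z) \<le> F z * (\<Prod>i\<in>I. G i b z) +
        (\<Sum>i\<in>I. ?M * ?e i z ^ p + ennreal c ^ p * (\<Sum>l\<in>I. ?s l z ^ p))" for z
    proof -
      have "F z * (\<Prod>i\<in>I. G i a z) \<le> F z * ((\<Prod>i\<in>I. G i b z) + (\<Sum>i\<in>I. ?e i z * (\<Prod>l\<in>I - {i}. ?s l z)))"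
        using I by (intro mult_left_mono prod_le_prod_add_ed) auto
      also have "\<dots> = F z * (\<Prod>i\<in>I. G i b z) + F z * (\<Sum>i\<in>I. ?e i z * (\<Prod>l\<in>I - {i}. ?s l z))"
        by (rule distrib_left)
      also have "\<dots> \<le> F z * (\<Prod>i\<in>I. G i b z) + 1 * (\<Sum>i\<in>I. ?e i z * (\<Prod>l\<in>I - {i}. ?s l z))"
        by (intro add_left_mono mult_right_mono F) auto
      also have "\<dots> \<le> F z * (\<Prod>i\<in>I. G i b z) + (\<Sum>i\<in>I. ?M * ?e i z ^ p + ennreal c ^ p * (\<Sum>l\<in>I. ?s l z ^ p))"
        unfolding mult_1
      proof (intro add_left_mono sum_mono)
        fix i assume i: "i \<in> I"
        have card: "card (I - {i}) = p - 1" "Suc (p - 1) = p"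
          using I i by (auto simp: p_def)
        have "?e i z * (\<Prod>l\<in>I - {i}. ?s l z) \<le> ?M * ?e i z ^ p + ennreal c ^ p * (\<Sum>l\<in>I - {i}. ?s l z ^ p)"
          using mult_prod_le_weighted[of "I - {i}" c "?e i z" "\<lambda>l. ?s l z"] I c(1) unfolding card by simp
        also have "\<dots> \<le> ?M * ?e i z ^ p + ennreal c ^ p * (\<Sum>l\<in>I. ?s l z ^ p)"
          using I by (intro add_left_mono mult_left_mono sum_mono2) auto
        finally show "?e i z * (\<Prod>l\<in>I - {i}. ?s l z) \<le> ?M * ?e i z ^ p + ennreal c ^ p * (\<Sum>l\<in>I. ?s l z ^ p)" .
      qed
      finally show ?thesis .
    qed
    have e_le: "(\<integral>\<^sup>+z. ?e i z ^ p \<partial>N) \<le> ennreal \<eta>'" if "i \<in> I" for i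
      using that ab r0 small by (intro r) blast+
    have s_le: "(\<integral>\<^sup>+z. ?s i z ^ p \<partial>N) \<le> ennreal (2 ^ p * (2 * b0))" if i: "i \<in> I" for i
    proof -
      have [measurable]: "G i a \<in> borel_measurable N" "G i b \<in> borel_measurable N" using i by auto
      have "(\<integral>\<^sup>+z. ?s i z ^ p \<partial>N) \<le> (\<integral>\<^sup>+z. 2 ^ p * (G i a z ^ p + G i b z ^ p) \<partial>N)"
        by (intro nn_integral_mono power_add_le)
      also have "\<dots> = 2 ^ p * ((\<integral>\<^sup>+z. G i a z ^ p \<partial>N) + (\<integral>\<^sup>+z. G i b z ^ p \<partial>N))"
        by (simp add: nn_integral_cmult nn_integral_add)
      also have "\<dots> \<le> 2 ^ p * (B + B)"
        using B(2)[OF i ab(1)] B(2)[OF i ab(2)] unfolding p_def by (intro mult_left_mono add_mono) auto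
      also have "\<dots> = ennreal (2 ^ p) * ennreal (2 * b0)"
        using b0 by (simp flip: ennreal_plus ennreal_power)
      also have "\<dots> = ennreal (2 ^ p * (2 * b0))"
        using b0 by (simp flip: ennreal_mult)
      finally show ?thesis .
    qed
    have "(\<integral>\<^sup>+z. F z * (\<Prod>i\<in>I. G i a z) \<partial>N) \<le> (\<integral>\<^sup>+z. F z * (\<Prod>i\<in>I. G i b z) +
        (\<Sum>i\<in>I. ?M * ?e i z ^ p + ennreal c ^ p * (\<Sum>l\<in>I. ?s l z ^ p)) \<partial>N)"
      by (intro nn_integral_mono pt)
    also have "\<dots> = (\<integral>\<^sup>+z. F z * (\<Prod>i\<in>I. G i b z) \<partial>N) +
        (\<Sum>i\<in>I. ?M * (\<integral>\<^sup>+z. ?e i z ^ p \<partial>N) + ennreal c ^ p * (\<Sum>l\<in>I. \<integral>\<^sup>+z. ?s l z ^ p \<partial>N))"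
      by (simp add: nn_integral_add nn_integral_sum nn_integral_cmult cong: sum.cong)
    also have "\<dots> \<le> (\<integral>\<^sup>+z. F z * (\<Prod>i\<in>I. G i b z) \<partial>N) +
        (\<Sum>i\<in>I. ?M * ennreal \<eta>' + ennreal c ^ p * (\<Sum>l\<in>I. ennreal (2 ^ p * (2 * b0))))"
      by (intro add_left_mono sum_mono add_mono mult_left_mono e_le s_le) auto
    also have "(\<Sum>i\<in>I. ?M * ennreal \<eta>' + ennreal c ^ p * (\<Sum>l\<in>I. ennreal (2 ^ p * (2 * b0)))) =
        ennreal (real p * ((1 / c) ^ ((p - 1) * p) * \<eta>' + c ^ p * (real p * (2 ^ p * (2 * b0)))))"
    proof -
      define v where "v = (1 / c) ^ ((p - 1) * p) * \<eta>' + c ^ p * (real p * (2 ^ p * (2 * b0)))"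
      have v: "v \<ge> 0" using c \<eta>' b0 by (simp add: v_def)
      have "?M * ennreal \<eta>' + ennreal c ^ p * (of_nat p * ennreal (2 ^ p * (2 * b0))) = ennreal v"
        using c \<eta>' b0 by (simp add: v_def ennreal_power ennreal_of_nat_eq_real_of_nat flip: ennreal_mult ennreal_plus)
      then have "(\<Sum>i\<in>I. ?M * ennreal \<eta>' + ennreal c ^ p * (\<Sum>l\<in>I. ennreal (2 ^ p * (2 * b0)))) = of_nat p * ennreal v"
        by (simp only: sum_constant p_def[symmetric])
      also have "\<dots> = ennreal (real p * v)"
        unfolding ennreal_of_nat_eq_real_of_nat using v by (intro ennreal_mult[symmetric]) auto
      finally show ?thesis unfolding v_def .
    qed
    also have "\<dots> \<le> ennreal \<eta>"
    proof (rule ennreal_leI)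
      have "real p * (1 / c) ^ ((p - 1) * p) * \<eta>' \<le> D * \<eta>'"
        using \<eta>' by (intro mult_right_mono) (auto simp: D_def)
      also have "\<dots> = \<eta> / 2" using D by (simp add: \<eta>'_def)
      finally have 1: "real p * (1 / c) ^ ((p - 1) * p) * \<eta>' \<le> \<eta> / 2" .
      have "c ^ p * (real p * real p * 2 ^ p * (2 * b0)) \<le> c ^ p * K"
        using c by (intro mult_left_mono) (auto simp: K_def)
      with cp have 2: "c ^ p * (real p * real p * 2 ^ p * (2 * b0)) \<le> \<eta> / 2" by linarith
      show "real p * ((1 / c) ^ ((p - 1) * p) * \<eta>' + c ^ p * (real p * (2 ^ p * (2 * b0)))) \<le> \<eta>"
        using 1 2 by (simp add: algebra_simps)
    qed
    finally show ?thesis by (simp add: add_left_mono)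
  qed
  then show ?thesis using r0(1) by blast
qed

section \<open>Path measurability and domination in mean\<close>

context density_process
begin

text \<open>Independence concerns the sigma-algebras generated by the paths. Occupation functionals
  therefore have to be measurable for any sigma-algebra that makes all \<open>X s\<close>
  measurable, and right-continuity provides this.\<close>

lemma measurable_occ_sub:
  assumes X: "\<And>s. X s \<in> N \<rightarrow>\<^sub>M borel_Delta" and sp: "space N = space \<Omega>" and [measurable]: "g \<in> borel_measurable borel"
  shows "occ t g \<in> borel_measurable N"
proof -
  have [measurable]: "(\<lambda>(s, \<omega>). X (ennreal s) \<omega>) \<in> (borel \<Otimes>\<^sub>M N) \<rightarrow>\<^sub>M borel_Delta"
    using X sp by (intro measurable_X_pair) auto
  have [measurable]: "(\<lambda>z. ext0 g (X (ennreal (snd z)) (fst z))) \<in> borel_measurable (N \<Otimes>\<^sub>M lborel)"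
  proof -
    have "(\<lambda>z. (\<lambda>(s, \<omega>). X (ennreal s) \<omega>) (snd z, fst z)) \<in> (N \<Otimes>\<^sub>M lborel) \<rightarrow>\<^sub>M borel_Delta"
      by measurable
    then show ?thesis by (intro measurable_ext0) auto
  qed
  show ?thesis
    unfolding occ_def[abs_def] by measurable
qed

text \<open>By Chapman--Kolmogorov, smoothing replaces the time \<open>s \<in> [0, t]\<close> by \<open>s + \<epsilon> \<le> t + 1\<close>, whence the factor.\<close>

lemma AE_nn_integral_occ_le:
  assumes \<epsilon>: "0 < \<epsilon>" "\<epsilon> \<le> 1"
  shows "AE x in m. (\<integral>\<^sup>+\<omega>. occ t (\<lambda>y. qq \<epsilon> y x) \<omega> \<partial>P (Some x0)) \<le> ennreal (exp (t + 1)) * R x0 x"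
proof (rule AE_le_of_set_nn_integral_le)
  have occ_eq: "(\<integral>\<^sup>+\<omega>. occ t (\<lambda>y. qq \<epsilon> y x) \<omega> \<partial>P (Some x0)) = (\<integral>\<^sup>+s\<in>{0..t}. K s (\<lambda>y. qq \<epsilon> y x) x0 \<partial>lborel)" for x
    by (intro nn_integral_occ) measurable
  show "(\<lambda>x. \<integral>\<^sup>+\<omega>. occ t (\<lambda>y. qq \<epsilon> y x) \<omega> \<partial>P (Some x0)) \<in> borel_measurable m"
    unfolding occ_eq by measurable
  fix A assume A [measurable]: "A \<in> sets m"
  have "(\<integral>\<^sup>+x\<in>A. (\<integral>\<^sup>+\<omega>. occ t (\<lambda>y. qq \<epsilon> y x) \<omega> \<partial>P (Some x0)) \<partial>m) =
      (\<integral>\<^sup>+x. \<integral>\<^sup>+s. K s (\<lambda>y. qq \<epsilon> y x) x0 * indicator {0..t} s * indicator A x \<partial>lborel \<partial>m)"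
    unfolding occ_eq by (intro nn_integral_cong nn_integral_multc[symmetric]) measurable
  also have "\<dots> = (\<integral>\<^sup>+s. \<integral>\<^sup>+x. K s (\<lambda>y. qq \<epsilon> y x) x0 * indicator {0..t} s * indicator A x \<partial>m \<partial>lborel)"
    by (intro nn_integral_swap sigma_finite_measure_axioms sigma_finite_lborel) measurable
  also have "\<dots> \<le> (\<integral>\<^sup>+s. ennreal (exp (t + 1)) * (ennreal (exp (- (s + \<epsilon>))) * K (s + \<epsilon>) (indicator A) x0) \<partial>lborel)"
  proof (intro nn_integral_mono_AE)
    show "AE s in lborel. (\<integral>\<^sup>+x. K s (\<lambda>y. qq \<epsilon> y x) x0 * indicator {0..t} s * indicator A x \<partial>m) \<le>
      ennreal (exp (t + 1)) * (ennreal (exp (- (s + \<epsilon>))) * K (s + \<epsilon>) (indicator A) x0)"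
      using AE_lborel_singleton[of 0]
    proof eventually_elim
      fix s :: real assume "s \<noteq> 0"
      show "(\<integral>\<^sup>+x. K s (\<lambda>y. qq \<epsilon> y x) x0 * indicator {0..t} s * indicator A x \<partial>m) \<le>
        ennreal (exp (t + 1)) * (ennreal (exp (- (s + \<epsilon>))) * K (s + \<epsilon>) (indicator A) x0)"
      proof (cases "0 < s \<and> s \<le> t")
        case True
        have "(\<integral>\<^sup>+x. K s (\<lambda>y. qq \<epsilon> y x) x0 * indicator {0..t} s * indicator A x \<partial>m) =
            (\<integral>\<^sup>+x. \<integral>\<^sup>+y. qq s x0 y * (qq \<epsilon> y x * indicator A x) \<partial>m \<partial>m)"
          using True unfolding K_def by (simp add: nn_integral_multc[symmetric] mult.assoc)
        also have "\<dots> = (\<integral>\<^sup>+y. \<integral>\<^sup>+x. qq s x0 y * (qq \<epsilon> y x * indicator A x) \<partial>m \<partial>m)"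
          by (intro nn_integral_swap sigma_finite_measure_axioms) measurable
        also have "\<dots> = K s (K \<epsilon> (indicator A)) x0"
          unfolding K_def by (simp add: nn_integral_cmult)
        also have "\<dots> = K (s + \<epsilon>) (indicator A) x0"
          using True \<epsilon> by (intro K_K) measurable
        also have "\<dots> = 1 * K (s + \<epsilon>) (indicator A) x0" by simp
        also have "\<dots> \<le> (ennreal (exp (t + 1)) * ennreal (exp (- (s + \<epsilon>)))) * K (s + \<epsilon>) (indicator A) x0"
        proof (intro mult_right_mono)
          have "ennreal (exp (t + 1)) * ennreal (exp (- (s + \<epsilon>))) = ennreal (exp (t + 1 - (s + \<epsilon>)))"
            by (simp only: exp_diff exp_minus divide_inverse ennreal_mult[symmetric] exp_ge_zero inverse_nonnegative_iff_nonnegative)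
          also have "\<dots> \<ge> 1" using True \<epsilon> by simp
          finally show "1 \<le> ennreal (exp (t + 1)) * ennreal (exp (- (s + \<epsilon>)))" .
        qed auto
        finally show ?thesis by (simp only: mult.assoc)
      next
        case False
        then have "s \<notin> {0..t}" using \<open>s \<noteq> 0\<close> by auto
        then show ?thesis by simp
      qed
    qed
  qed
  also have "\<dots> = ennreal (exp (t + 1)) * (\<integral>\<^sup>+s. ennreal (exp (- (s + \<epsilon>))) * K (s + \<epsilon>) (indicator A) x0 \<partial>lborel)"
    by (intro nn_integral_cmult) measurable
  also have "(\<integral>\<^sup>+s. ennreal (exp (- (s + \<epsilon>))) * K (s + \<epsilon>) (indicator A) x0 \<partial>lborel) = (\<integral>\<^sup>+z. R x0 z * indicator A z \<partial>m)"
    using nn_integral_R_shift[of "indicator A" "- \<epsilon>" x0] A by simp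
  also have "ennreal (exp (t + 1)) * (\<integral>\<^sup>+z. R x0 z * indicator A z \<partial>m) = (\<integral>\<^sup>+x\<in>A. (ennreal (exp (t + 1)) * R x0 x) \<partial>m)"
    by (subst nn_integral_cmult[symmetric]) (measurable, simp add: mult.assoc)
  finally show "(\<integral>\<^sup>+x\<in>A. (\<integral>\<^sup>+\<omega>. occ t (\<lambda>y. qq \<epsilon> y x) \<omega> \<partial>P (Some x0)) \<partial>m) \<le> (\<integral>\<^sup>+x\<in>A. (ennreal (exp (t + 1)) * R x0 x) \<partial>m)" .
qed measurable

lemma nn_integral_smoothed_occ_occ:
  "(\<integral>\<^sup>+\<omega>. occ t (\<lambda>y. qq \<epsilon> y x) \<omega> * occ t (\<lambda>y. qq \<delta> y x') \<omega> \<partial>P (Some x0)) =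
    T \<epsilon> (\<lambda>y. T \<delta> (\<lambda>y'. H t x0 (y, y')) x') x"
  unfolding T_def by (subst nn_integral_occ_occ) auto

end

section \<open>The smoothed intersection measure\<close>

locale intersection = prob_space \<P> + sigma_finite_measure m
  for \<P> :: "'w measure" and m :: "'a::{metric_space, second_countable_topology} measure" +
  fixes p :: nat and P :: "nat \<Rightarrow> 'a option \<Rightarrow> 'w measure" and X :: "nat \<Rightarrow> ennreal \<Rightarrow> 'w \<Rightarrow> 'a option"
    and q :: "nat \<Rightarrow> real \<Rightarrow> 'a \<Rightarrow> 'a \<Rightarrow> ennreal" and x0 :: "nat \<Rightarrow> 'a" and t :: real and C :: ennreal
  assumes p: "p \<ge> 2"
    and process: "\<And>i. i \<in> {1..p} \<Longrightarrow> density_process \<P> (P i) (X i) m (q i)"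
    and start: "\<And>i. i \<in> {1..p} \<Longrightarrow> P i (Some (x0 i)) = \<P>"
    and indep: "independent_processes \<P> p X"
    and resolvent: "\<And>i x. i \<in> {1..p} \<Longrightarrow> (\<integral>\<^sup>+y. resolvent_density 1 (q i) x y ^ p \<partial>m) \<le> C"
    and C: "C < \<infinity>"
begin

lemma sets_m [measurable_cong, simp]: "sets m = sets borel"
proof -
  interpret density_process \<P> "P 1" "X 1" m "q 1" using p by (intro process) auto
  show ?thesis by (rule sets_m)
qed

lemma space_m [simp]: "space m = UNIV"
  using sets_eq_imp_space_eq[OF sets_m] by simp

definition A :: "nat \<Rightarrow> real \<Rightarrow> 'a \<Rightarrow> 'w \<Rightarrow> ennreal" where
  "A i \<epsilon> x = density_process.occ (X i) t (\<lambda>y. density_process.qq (q i) \<epsilon> y x)"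

lemma measurable_A [measurable (raw)]:
  assumes i: "i \<in> {1..p}" and [measurable]: "f \<in> borel_measurable N" "g \<in> N \<rightarrow>\<^sub>M \<P>"
  shows "(\<lambda>z. A i \<epsilon> (f z) (g z)) \<in> borel_measurable N"
proof -
  interpret density_process \<P> "P i" "X i" m "q i" using i by (rule process)
  show ?thesis unfolding A_def by measurable
qed

text \<open>The integral of a product over \<open>[0, t] ^ p\<close> factorises, so for
  \<open>\<epsilon> > 0\<close> this is the density of the approximated intersection measure with
  respect to \<open>m\<close>; see \<open>approx_intersection_measure_eq\<close>.\<close>

definition Z :: "real \<Rightarrow> 'w \<Rightarrow> 'a \<Rightarrow> ennreal" where
  "Z \<epsilon> \<omega> x = (\<Prod>i\<in>{1..p}. A i \<epsilon> x \<omega>)"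

lemma measurable_Z [measurable (raw)]:
  assumes [measurable]: "f \<in> borel_measurable N" "g \<in> N \<rightarrow>\<^sub>M \<P>"
  shows "(\<lambda>z. Z \<epsilon> (g z) (f z)) \<in> borel_measurable N"
  unfolding Z_def by measurable

definition W :: "real \<Rightarrow> ('a \<Rightarrow> ennreal) \<Rightarrow> 'w \<Rightarrow> ennreal" where
  "W \<epsilon> f \<omega> = (\<integral>\<^sup>+x. f x * Z \<epsilon> \<omega> x \<partial>m)"

lemma measurable_W [measurable]:
  assumes [measurable]: "f \<in> borel_measurable borel"
  shows "W \<epsilon> f \<in> borel_measurable \<P>"
  unfolding W_def[abs_def] by measurable

text \<open>The information on which independence is assumed, pulled back to the sample space, where
  functionals of the path are given as functions of \<open>\<omega>\<close>.\<close>

definition path_algebra :: "nat \<Rightarrow> 'w measure" where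
  "path_algebra i = vimage_algebra (space \<P>) (\<lambda>\<omega> t. X i t \<omega>) (\<Pi>\<^sub>M t\<in>UNIV. borel_Delta)"

lemma measurable_path_algebra: "(\<lambda>\<omega>. X i s \<omega>) \<in> path_algebra i \<rightarrow>\<^sub>M borel_Delta"
proof -
  have "(\<lambda>\<omega> t. X i t \<omega>) \<in> path_algebra i \<rightarrow>\<^sub>M (\<Pi>\<^sub>M t\<in>UNIV. borel_Delta)"
    unfolding path_algebra_def by (intro measurable_vimage_algebra1) (auto simp: space_PiM)
  from measurable_compose[OF this measurable_component_singleton[of s]] show ?thesis by simp
qed

text \<open>The sigma-algebra generated by \<open>G i\<close> is contained in
  \<open>path_algebra i\<close>, and independence passes to smaller families of events. This avoids
  exhibiting \<open>G i\<close> as a measurable function on path space.\<close>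

lemma nn_integral_prod_indep:
  fixes G :: "nat \<Rightarrow> 'w \<Rightarrow> ennreal"
  assumes G: "\<And>i. i \<in> {1..p} \<Longrightarrow> G i \<in> borel_measurable (path_algebra i)"
  shows "(\<integral>\<^sup>+\<omega>. (\<Prod>i\<in>{1..p}. G i \<omega>) \<partial>\<P>) = (\<Prod>i\<in>{1..p}. \<integral>\<^sup>+\<omega>. G i \<omega> \<partial>\<P>)"
proof (rule indep_vars_nn_integral)
  have X: "indep_vars (\<lambda>_. \<Pi>\<^sub>M t\<in>(UNIV::ennreal set). borel_Delta) (\<lambda>i \<omega> t. X i t \<omega>) {1..p}"
    using indep by (simp add: independent_processes_def)
  have sets: "sets (path_algebra i) = {(\<lambda>\<omega> t. X i t \<omega>) -` B \<inter> space \<P> | B. B \<in> sets (\<Pi>\<^sub>M t\<in>(UNIV::ennreal set). borel_Delta)}" for i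
    unfolding path_algebra_def by (intro sets_vimage_algebra2) (auto simp: space_PiM)
  have sub: "{G i -` B \<inter> space \<P> | B. B \<in> sets borel} \<subseteq> sets (path_algebra i)" if "i \<in> {1..p}" for i
    using measurable_sets[OF G[OF that]] by (auto simp: path_algebra_def)
  have ev: "sets (path_algebra i) \<subseteq> events" if "i \<in> {1..p}" for i
    unfolding sets using X that by (auto simp: indep_vars_def2 indep_sets_def)
  have "indep_sets (\<lambda>i. {G i -` B \<inter> space \<P> | B. B \<in> sets borel}) {1..p}"
  proof (rule indep_sets_mono_sets)
    show "indep_sets (\<lambda>i. sets (path_algebra i)) {1..p}"
      unfolding sets using X by (simp add: indep_vars_def2)
  qed (use sub in auto)
  moreover have "G i \<in> borel_measurable \<P>" if "i \<in> {1..p}" for i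
    using G[OF that] ev[OF that] by (auto simp: measurable_def path_algebra_def)
  ultimately show "indep_vars (\<lambda>_. borel) G {1..p}"
    by (simp add: indep_vars_def2)
qed auto

lemma measurable_A_path_algebra:
  assumes i: "i \<in> {1..p}"
  shows "A i \<epsilon> x \<in> borel_measurable (path_algebra i)"
proof -
  interpret density_process \<P> "P i" "X i" m "q i" using i by (rule process)
  show ?thesis
    unfolding A_def using measurable_path_algebra by (intro measurable_occ_sub) (auto simp: path_algebra_def)
qed

lemma pair_m: "pair_sigma_finite m m" "sigma_finite_measure (m \<Otimes>\<^sub>M m)"
  by (auto intro!: pair_sigma_finite.intro sigma_finite_pair_measure sigma_finite_measure_axioms)

lemma sigma_finite_\<P>: "sigma_finite_measure \<P>"
  by (rule prob_space_imp_sigma_finite) (rule prob_space_axioms)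

lemma sigma_finite_m: "sigma_finite_measure m"
  by (rule sigma_finite_measure_axioms)

definition G :: "nat \<Rightarrow> real \<times> real \<Rightarrow> 'a \<times> 'a \<Rightarrow> ennreal" where
  "G i ab = density_process.T1 m (q i) (fst ab) (density_process.T2 m (q i) (snd ab) (density_process.H (q i) t (x0 i)))"

definition small :: "real \<Rightarrow> real \<times> real \<Rightarrow> bool" where
  "small r ab \<longleftrightarrow> 0 < fst ab \<and> fst ab < r \<and> 0 < snd ab \<and> snd ab < r"

lemma G:
  assumes i: "i \<in> {1..p}"
  shows measurable_G: "G i ab \<in> borel_measurable (m \<Otimes>\<^sub>M m)"
    and G_power_le: "small r ab \<Longrightarrow> (\<integral>\<^sup>+z. G i ab z ^ p \<partial>(m \<Otimes>\<^sub>M m)) \<le> ennreal (exp t) ^ p * (2 ^ p * (C * C + C * C))"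
    and G_Cauchy: "\<eta> > 0 \<Longrightarrow> \<exists>r>0. \<forall>a b. small r a \<and> small r b \<longrightarrow>
      (\<integral>\<^sup>+z. ed (G i a z) (G i b z) ^ p \<partial>(m \<Otimes>\<^sub>M m)) \<le> ennreal \<eta>"
    and AE_G: "0 < \<epsilon> \<Longrightarrow> 0 < \<delta> \<Longrightarrow> AE z in m \<Otimes>\<^sub>M m. (\<integral>\<^sup>+\<omega>. A i \<epsilon> (fst z) \<omega> * A i \<delta> (snd z) \<omega> \<partial>\<P>) = G i (\<epsilon>, \<delta>) z"
proof -
  interpret D: density_process \<P> "P i" "X i" m "q i" using i by (rule process)
  have G_eq: "G i ab = D.T1 (fst ab) (D.T2 (snd ab) (D.H t (x0 i)))" for ab
    by (simp add: G_def)
  have H: "(\<integral>\<^sup>+z. D.H t (x0 i) z ^ p \<partial>(m \<Otimes>\<^sub>M m)) \<le> ennreal (exp t) ^ p * (2 ^ p * (C * C + C * C))"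
    by (rule D.nn_integral_H_power) (use resolvent[OF i] in \<open>simp add: D.R_def\<close>)
  also have "\<dots> < \<infinity>"
    using C by (auto simp: ennreal_mult_less_top power_less_top_ennreal)
  finally have H_fin: "(\<integral>\<^sup>+z. D.H t (x0 i) z ^ p \<partial>(m \<Otimes>\<^sub>M m)) < \<infinity>" .
  show "G i ab \<in> borel_measurable (m \<Otimes>\<^sub>M m)"
    unfolding G_eq by (intro D.measurable_T1 D.measurable_T2 D.measurable_H)
  show "(\<integral>\<^sup>+z. G i ab z ^ p \<partial>(m \<Otimes>\<^sub>M m)) \<le> ennreal (exp t) ^ p * (2 ^ p * (C * C + C * C))" if "small r ab"
    using D.nn_integral_T1_T2_power_le[of "fst ab" "snd ab" "D.H t (x0 i)" p] H that p D.measurable_H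
    unfolding G_eq small_def by auto
  show "\<exists>r>0. \<forall>a b. small r a \<and> small r b \<longrightarrow> (\<integral>\<^sup>+z. ed (G i a z) (G i b z) ^ p \<partial>(m \<Otimes>\<^sub>M m)) \<le> ennreal \<eta>" if \<eta>: "\<eta> > 0"
  proof -
    obtain r where "r > 0" "\<And>a b a' b'. 0 < a \<and> a < r \<and> 0 < b \<and> b < r \<and> 0 < a' \<and> a' < r \<and> 0 < b' \<and> b' < r \<Longrightarrow>
      (\<integral>\<^sup>+z. ed (D.T1 a (D.T2 b (D.H t (x0 i))) z) (D.T1 a' (D.T2 b' (D.H t (x0 i))) z) ^ p \<partial>(m \<Otimes>\<^sub>M m)) \<le> ennreal \<eta>"
      using D.T1_T2_Cauchy[OF D.measurable_H H_fin p \<eta>] by blast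
    then show ?thesis
      unfolding G_eq small_def by (intro exI[of _ r]) simp
  qed
  assume \<epsilon>: "0 < \<epsilon>" "0 < \<delta>"
  have eq: "(\<integral>\<^sup>+\<omega>. A i \<epsilon> (fst z) \<omega> * A i \<delta> (snd z) \<omega> \<partial>\<P>) =
      D.T \<epsilon> (\<lambda>y. D.T \<delta> (\<lambda>y'. D.H t (x0 i) (y, y')) (snd z)) (fst z)" for z
    using D.nn_integral_smoothed_occ_occ[of "x0 i" t \<epsilon> "fst z" \<delta> "snd z"] by (simp add: A_def start[OF i])
  show "AE z in m \<Otimes>\<^sub>M m. (\<integral>\<^sup>+\<omega>. A i \<epsilon> (fst z) \<omega> * A i \<delta> (snd z) \<omega> \<partial>\<P>) = G i (\<epsilon>, \<delta>) z"
    unfolding eq G_eq fst_conv snd_conv by (intro D.AE_T_T_eq \<epsilon> D.measurable_H)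
qed

text \<open>Independence splits the second moment at each pair of points into one factor per
  process, and almost everywhere each factor is the doubly smoothed joint occupation density
  \<open>G i\<close>.\<close>

lemma nn_integral_W_W:
  assumes \<epsilon>: "0 < \<epsilon>" "0 < \<delta>" and f [measurable]: "f \<in> borel_measurable borel"
  shows "(\<integral>\<^sup>+\<omega>. W \<epsilon> f \<omega> * W \<delta> f \<omega> \<partial>\<P>) = (\<integral>\<^sup>+z. (f (fst z) * f (snd z)) * (\<Prod>i\<in>{1..p}. G i (\<epsilon>, \<delta>) z) \<partial>(m \<Otimes>\<^sub>M m))"
proof -
  interpret pair_sigma_finite m m by (rule pair_m)
  let ?A = "\<lambda>\<omega> z. \<Prod>i\<in>{1..p}. A i \<epsilon> (fst z) \<omega> * A i \<delta> (snd z) \<omega>"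
  have "W \<epsilon> f \<omega> * W \<delta> f \<omega> = (\<integral>\<^sup>+z. (f (fst z) * f (snd z)) * ?A \<omega> z \<partial>(m \<Otimes>\<^sub>M m))" if [measurable]: "\<omega> \<in> space \<P>" for \<omega>
  proof -
    have "W \<epsilon> f \<omega> * W \<delta> f \<omega> = (\<integral>\<^sup>+x. \<integral>\<^sup>+x'. (f x * Z \<epsilon> \<omega> x) * (f x' * Z \<delta> \<omega> x') \<partial>m \<partial>m)"
      unfolding W_def by (intro nn_integral_mult_nn_integral) measurable
    also have "\<dots> = (\<integral>\<^sup>+x. \<integral>\<^sup>+x'. (f x * f x') * ?A \<omega> (x, x') \<partial>m \<partial>m)"
      by (simp add: Z_def prod.distrib mult_ac)
    also have "\<dots> = (\<integral>\<^sup>+z. (f (fst z) * f (snd z)) * ?A \<omega> z \<partial>(m \<Otimes>\<^sub>M m))"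
    proof -
      have "(\<lambda>z. (f (fst z) * f (snd z)) * ?A \<omega> z) \<in> borel_measurable (m \<Otimes>\<^sub>M m)"
        by measurable
      from sigma_finite_measure.nn_integral_fst[OF sigma_finite_m this] show ?thesis by simp
    qed
    finally show ?thesis .
  qed
  then have "(\<integral>\<^sup>+\<omega>. W \<epsilon> f \<omega> * W \<delta> f \<omega> \<partial>\<P>) = (\<integral>\<^sup>+\<omega>. \<integral>\<^sup>+z. (f (fst z) * f (snd z)) * ?A \<omega> z \<partial>(m \<Otimes>\<^sub>M m) \<partial>\<P>)"
    by (rule nn_integral_cong)
  also have "\<dots> = (\<integral>\<^sup>+z. \<integral>\<^sup>+\<omega>. (f (fst z) * f (snd z)) * ?A \<omega> z \<partial>\<P> \<partial>(m \<Otimes>\<^sub>M m))"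
    by (intro nn_integral_swap pair_m sigma_finite_\<P>) measurable
  also have "\<dots> = (\<integral>\<^sup>+z. (f (fst z) * f (snd z)) * (\<integral>\<^sup>+\<omega>. ?A \<omega> z \<partial>\<P>) \<partial>(m \<Otimes>\<^sub>M m))"
    by (intro nn_integral_cong nn_integral_cmult) measurable
  also have "\<dots> = (\<integral>\<^sup>+z. (f (fst z) * f (snd z)) * (\<Prod>i\<in>{1..p}. \<integral>\<^sup>+\<omega>. A i \<epsilon> (fst z) \<omega> * A i \<delta> (snd z) \<omega> \<partial>\<P>) \<partial>(m \<Otimes>\<^sub>M m))"
    by (intro nn_integral_cong arg_cong2[where f = "(*)"] refl nn_integral_prod_indep
        borel_measurable_times_ennreal measurable_A_path_algebra)
  also have "\<dots> = (\<integral>\<^sup>+z. (f (fst z) * f (snd z)) * (\<Prod>i\<in>{1..p}. G i (\<epsilon>, \<delta>) z) \<partial>(m \<Otimes>\<^sub>M m))"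
  proof (rule nn_integral_cong_AE)
    have "AE z in m \<Otimes>\<^sub>M m. \<forall>i\<in>{1..p}. (\<integral>\<^sup>+\<omega>. A i \<epsilon> (fst z) \<omega> * A i \<delta> (snd z) \<omega> \<partial>\<P>) = G i (\<epsilon>, \<delta>) z"
      by (intro AE_finite_allI AE_G \<epsilon>) auto
    then show "AE z in m \<Otimes>\<^sub>M m. (f (fst z) * f (snd z)) * (\<Prod>i\<in>{1..p}. \<integral>\<^sup>+\<omega>. A i \<epsilon> (fst z) \<omega> * A i \<delta> (snd z) \<omega> \<partial>\<P>) =
        (f (fst z) * f (snd z)) * (\<Prod>i\<in>{1..p}. G i (\<epsilon>, \<delta>) z)"
    proof eventually_elim
      fix z assume *: "\<forall>i\<in>{1..p}. (\<integral>\<^sup>+\<omega>. A i \<epsilon> (fst z) \<omega> * A i \<delta> (snd z) \<omega> \<partial>\<P>) = G i (\<epsilon>, \<delta>) z"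
      show "(f (fst z) * f (snd z)) * (\<Prod>i\<in>{1..p}. \<integral>\<^sup>+\<omega>. A i \<epsilon> (fst z) \<omega> * A i \<delta> (snd z) \<omega> \<partial>\<P>) =
          (f (fst z) * f (snd z)) * (\<Prod>i\<in>{1..p}. G i (\<epsilon>, \<delta>) z)"
        by (intro arg_cong2[where f = "(*)"] refl prod.cong) (use * in blast)
    qed
  qed
  finally show ?thesis .
qed

text \<open>\<open>E (W a - W b)\<^sup>2 = E (W a)\<^sup>2 - 2 E (W a W b) + E (W b)\<^sup>2\<close>, where the three terms approach a common limit.\<close>

lemma W_Cauchy_L2:
  assumes f [measurable]: "f \<in> borel_measurable borel" and f_le: "\<And>x. f x \<le> 1" and \<eta>: "\<eta> > 0"
  shows "\<exists>r>0. \<forall>a b. 0 < a \<and> a < r \<and> 0 < b \<and> b < r \<longrightarrow> (\<integral>\<^sup>+\<omega>. ed (W a f \<omega>) (W b f \<omega>) ^ 2 \<partial>\<P>) \<le> ennreal \<eta>"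
proof -
  define F where "F z = f (fst z) * f (snd z)" for z
  have [measurable]: "F \<in> borel_measurable (m \<Otimes>\<^sub>M m)" unfolding F_def by measurable
  have F_le: "F z \<le> 1" for z
    unfolding F_def using mult_mono[OF f_le f_le, of "snd z" "fst z"] by simp
  have card: "card {1..p} = p" by simp
  define I where "I ab = (\<integral>\<^sup>+z. F z * (\<Prod>i\<in>{1..p}. G i ab z) \<partial>(m \<Otimes>\<^sub>M m))" for ab
  have B: "ennreal (exp t) ^ p * (2 ^ p * (C * C + C * C)) < \<infinity>"
    using C by (auto simp: ennreal_mult_less_top power_less_top_ennreal)
  have "\<exists>r>0. \<forall>a b. small r a \<and> small r b \<longrightarrow> I a \<le> I b + ennreal (\<eta> / 2)"
    unfolding I_def
  proof (rule nn_integral_prod_Cauchy[where B = "ennreal (exp t) ^ p * (2 ^ p * (C * C + C * C))"])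
    show "(\<integral>\<^sup>+z. G i a z ^ card {1..p} \<partial>(m \<Otimes>\<^sub>M m)) \<le> ennreal (exp t) ^ p * (2 ^ p * (C * C + C * C))"
      if "i \<in> {1..p}" "small r a" for i a r
      using G_power_le[OF that] by simp
    show "\<exists>r>0. \<forall>a b. small r a \<and> small r b \<longrightarrow> (\<integral>\<^sup>+z. ed (G i a z) (G i b z) ^ card {1..p} \<partial>(m \<Otimes>\<^sub>M m)) \<le> ennreal \<eta>"
      if "i \<in> {1..p}" "\<eta> > 0" for i \<eta>
      using G_Cauchy[OF that] by simp
    show "small r' a" if "small r a" "r \<le> r'" for r r' a
      using that by (auto simp: small_def)
  qed (use p \<eta> F_le B measurable_G in auto)
  then obtain r where r: "r > 0" "\<And>a b. small r a \<Longrightarrow> small r b \<Longrightarrow> I a \<le> I b + ennreal (\<eta> / 2)"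
    by blast
  have I_W: "(\<integral>\<^sup>+\<omega>. W a f \<omega> * W b f \<omega> \<partial>\<P>) = I (a, b)" if "0 < a" "0 < b" for a b
    unfolding I_def F_def using that by (intro nn_integral_W_W) auto
  have I_fin: "I ab < \<infinity>" if ab: "small r ab" for ab
  proof -
    have "I ab \<le> (\<integral>\<^sup>+z. (\<Sum>i\<in>{1..p}. G i ab z ^ p) \<partial>(m \<Otimes>\<^sub>M m))"
      unfolding I_def
    proof (rule nn_integral_mono)
      fix z
      have "F z * (\<Prod>i\<in>{1..p}. G i ab z) \<le> 1 * (\<Prod>i\<in>{1..p}. G i ab z)"
        by (intro mult_right_mono F_le) auto
      also have "\<dots> \<le> (\<Sum>i\<in>{1..p}. G i ab z ^ p)"
        using prod_le_sum_power[of "{1..p}" "\<lambda>i. G i ab z"] p by simp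
      finally show "F z * (\<Prod>i\<in>{1..p}. G i ab z) \<le> (\<Sum>i\<in>{1..p}. G i ab z ^ p)" .
    qed
    also have "\<dots> = (\<Sum>i\<in>{1..p}. \<integral>\<^sup>+z. G i ab z ^ p \<partial>(m \<Otimes>\<^sub>M m))"
      by (intro nn_integral_sum borel_measurable_power_ennreal measurable_G)
    also have "\<dots> \<le> (\<Sum>i\<in>{1..p}. ennreal (exp t) ^ p * (2 ^ p * (C * C + C * C)))"
      using ab by (intro sum_mono G_power_le)
    also have "\<dots> < \<infinity>"
      using B by (simp add: ennreal_mult_less_top of_nat_less_top)
    finally show ?thesis .
  qed
  have "(\<integral>\<^sup>+\<omega>. ed (W a f \<omega>) (W b f \<omega>) ^ 2 \<partial>\<P>) \<le> ennreal \<eta>" if ab: "0 < a" "a < r" "0 < b" "b < r" for a b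
  proof -
    have s: "small r (a, a)" "small r (b, b)" "small r (a, b)" using ab by (auto simp: small_def)
    have "(\<integral>\<^sup>+\<omega>. ed (W a f \<omega>) (W b f \<omega>) ^ 2 \<partial>\<P>) + 2 * I (a, b) =
        (\<integral>\<^sup>+\<omega>. ed (W a f \<omega>) (W b f \<omega>) ^ 2 + 2 * (W a f \<omega> * W b f \<omega>) \<partial>\<P>)"
      using ab by (simp add: I_W[symmetric] nn_integral_add nn_integral_cmult)
    also have "\<dots> = (\<integral>\<^sup>+\<omega>. W a f \<omega> * W a f \<omega> + W b f \<omega> * W b f \<omega> \<partial>\<P>)"
      by (simp only: ed_square) (simp add: power2_eq_square)
    also have "\<dots> = I (a, a) + I (b, b)"
      using ab by (simp add: I_W[symmetric] nn_integral_add)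
    also have "\<dots> \<le> (I (a, b) + ennreal (\<eta> / 2)) + (I (a, b) + ennreal (\<eta> / 2))"
      by (intro add_mono r s)
    also have "\<dots> = (ennreal (\<eta> / 2) + ennreal (\<eta> / 2)) + 2 * I (a, b)"
      by (simp only: mult_2 ac_simps)
    also have "ennreal (\<eta> / 2) + ennreal (\<eta> / 2) = ennreal \<eta>"
      using \<eta> by (simp flip: ennreal_plus)
    finally have "2 * I (a, b) + (\<integral>\<^sup>+\<omega>. ed (W a f \<omega>) (W b f \<omega>) ^ 2 \<partial>\<P>) \<le> 2 * I (a, b) + ennreal \<eta>"
      by (simp only: add.commute)
    then show ?thesis
      using I_fin[OF s(3)] by (auto simp: ennreal_add_left_cancel_le ennreal_mult_eq_top_iff)
  qed
  then show ?thesis using r(1) by blast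
qed

lemma W_Cauchy:
  assumes f [measurable]: "f \<in> borel_measurable borel" and f_le: "\<And>x. f x \<le> 1" and \<eta>: "\<eta> > 0"
  shows "\<exists>r>0. \<forall>a b. 0 < a \<and> a < r \<and> 0 < b \<and> b < r \<longrightarrow> (\<integral>\<^sup>+\<omega>. ed (W a f \<omega>) (W b f \<omega>) \<partial>\<P>) \<le> ennreal \<eta>"
proof -
  \<comment> \<open>This choice makes \<open>(2 / \<eta>) * \<eta>'\<close> equal to
    \<open>\<eta> / 2\<close> in the elementary bound of \<open>x\<close> by \<open>x ^ 2\<close>
    below.\<close>
  define \<eta>' where "\<eta>' = (\<eta> / 2)\<^sup>2"
  have "\<eta>' > 0" using \<eta> by (simp add: \<eta>'_def)
  from W_Cauchy_L2[OF f f_le this] obtain r where r: "r > 0"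
    "\<And>a b. 0 < a \<Longrightarrow> a < r \<Longrightarrow> 0 < b \<Longrightarrow> b < r \<Longrightarrow> (\<integral>\<^sup>+\<omega>. ed (W a f \<omega>) (W b f \<omega>) ^ 2 \<partial>\<P>) \<le> ennreal \<eta>'"
    by blast
  have le: "x \<le> ennreal (\<eta> / 2) + ennreal (2 / \<eta>) * x ^ 2" for x
  proof (cases "x \<le> ennreal (\<eta> / 2)")
    case False
    then have "ennreal (2 / \<eta>) * (ennreal (\<eta> / 2) * x) \<le> ennreal (2 / \<eta>) * (x * x)"
      by (intro mult_left_mono mult_right_mono) auto
    also have "ennreal (2 / \<eta>) * (ennreal (\<eta> / 2) * x) = x"
      using \<eta> by (simp add: mult.assoc[symmetric] flip: ennreal_mult)
    finally show ?thesis by (simp add: power2_eq_square add_increasing)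
  qed (simp add: add_increasing2)
  have "(\<integral>\<^sup>+\<omega>. ed (W a f \<omega>) (W b f \<omega>) \<partial>\<P>) \<le> ennreal \<eta>" if ab: "0 < a" "a < r" "0 < b" "b < r" for a b
  proof -
    have "(\<integral>\<^sup>+\<omega>. ed (W a f \<omega>) (W b f \<omega>) \<partial>\<P>) \<le> (\<integral>\<^sup>+\<omega>. ennreal (\<eta> / 2) + ennreal (2 / \<eta>) * ed (W a f \<omega>) (W b f \<omega>) ^ 2 \<partial>\<P>)"
      by (intro nn_integral_mono le)
    also have "\<dots> = ennreal (\<eta> / 2) + ennreal (2 / \<eta>) * (\<integral>\<^sup>+\<omega>. ed (W a f \<omega>) (W b f \<omega>) ^ 2 \<partial>\<P>)"
      by (simp add: nn_integral_add nn_integral_cmult emeasure_space_1)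
    also have "\<dots> \<le> ennreal (\<eta> / 2) + ennreal (2 / \<eta>) * ennreal \<eta>'"
      by (intro add_left_mono mult_left_mono r ab) auto
    also have "\<dots> = ennreal \<eta>"
      using \<eta> by (simp add: \<eta>'_def power2_eq_square field_simps flip: ennreal_mult ennreal_plus)
    finally show ?thesis .
  qed
  then show ?thesis using r(1) by blast
qed

text \<open>The \<open>k\<close>-th power is an integral over \<open>k\<close> points. Exchanging
  the two products groups the factors by process, so independence leaves joint moments of a single
  process, whose bounds do not involve \<open>\<epsilon>\<close>.\<close>

lemma W_moment:
  "\<exists>B<\<infinity>. \<forall>\<epsilon>. (\<integral>\<^sup>+\<omega>. W \<epsilon> (\<lambda>_. 1) \<omega> ^ k \<partial>\<P>) \<le> B"
proof (cases "k = 0")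
  case True
  then show ?thesis by (intro exI[of _ 1]) (simp add: emeasure_space_1)
next
  case False
  interpret PS: product_sigma_finite "\<lambda>_::nat. m"
    by (intro product_sigma_finite.intro sigma_finite_m)
  let ?J = "{..<k}"
  have J: "finite ?J" "?J \<noteq> {}" "card ?J = k" using False by auto
  define B where "B = of_nat p * ((ennreal (exp t) ^ k) ^ p * density_process.\<Gamma>_bound p C k)"
  have sfJ: "sigma_finite_measure (Pi\<^sub>M ?J (\<lambda>_. m))"
    by (intro PS.sigma_finite) simp
  have "(\<integral>\<^sup>+\<omega>. W \<epsilon> (\<lambda>_. 1) \<omega> ^ k \<partial>\<P>) \<le> B" for \<epsilon>
  proof -
    have "W \<epsilon> (\<lambda>_. 1) \<omega> ^ k = (\<integral>\<^sup>+x. (\<Prod>i\<in>{1..p}. \<Prod>j\<in>?J. A i \<epsilon> (x j) \<omega>) \<partial>Pi\<^sub>M ?J (\<lambda>_. m))"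
      if [measurable]: "\<omega> \<in> space \<P>" for \<omega>
    proof -
      have "W \<epsilon> (\<lambda>_. 1) \<omega> ^ k = (\<Prod>j\<in>?J. \<integral>\<^sup>+x. Z \<epsilon> \<omega> x \<partial>m)"
        by (simp add: W_def)
      also have "\<dots> = (\<integral>\<^sup>+x. (\<Prod>j\<in>?J. Z \<epsilon> \<omega> (x j)) \<partial>Pi\<^sub>M ?J (\<lambda>_. m))"
        by (intro PS.product_nn_integral_prod[symmetric]) (simp, measurable)
      also have "\<dots> = (\<integral>\<^sup>+x. (\<Prod>i\<in>{1..p}. \<Prod>j\<in>?J. A i \<epsilon> (x j) \<omega>) \<partial>Pi\<^sub>M ?J (\<lambda>_. m))"
        unfolding Z_def by (intro nn_integral_cong prod.swap)
      finally show ?thesis .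
    qed
    then have "(\<integral>\<^sup>+\<omega>. W \<epsilon> (\<lambda>_. 1) \<omega> ^ k \<partial>\<P>) = (\<integral>\<^sup>+\<omega>. \<integral>\<^sup>+x. (\<Prod>i\<in>{1..p}. \<Prod>j\<in>?J. A i \<epsilon> (x j) \<omega>) \<partial>Pi\<^sub>M ?J (\<lambda>_. m) \<partial>\<P>)"
      by (rule nn_integral_cong)
    also have "\<dots> = (\<integral>\<^sup>+x. \<integral>\<^sup>+\<omega>. (\<Prod>i\<in>{1..p}. \<Prod>j\<in>?J. A i \<epsilon> (x j) \<omega>) \<partial>\<P> \<partial>Pi\<^sub>M ?J (\<lambda>_. m))"
      by (intro nn_integral_swap sigma_finite_\<P> sfJ) measurable
    also have "\<dots> = (\<integral>\<^sup>+x. (\<Prod>i\<in>{1..p}. \<integral>\<^sup>+\<omega>. (\<Prod>j\<in>?J. A i \<epsilon> (x j) \<omega>) \<partial>\<P>) \<partial>Pi\<^sub>M ?J (\<lambda>_. m))"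
      by (intro nn_integral_cong nn_integral_prod_indep borel_measurable_prod_ennreal measurable_A_path_algebra)
    also have "\<dots> \<le> (\<integral>\<^sup>+x. (\<Sum>i\<in>{1..p}. (\<integral>\<^sup>+\<omega>. (\<Prod>j\<in>?J. A i \<epsilon> (x j) \<omega>) \<partial>\<P>) ^ p) \<partial>Pi\<^sub>M ?J (\<lambda>_. m))"
    proof (rule nn_integral_mono)
      fix x
      show "(\<Prod>i\<in>{1..p}. \<integral>\<^sup>+\<omega>. (\<Prod>j\<in>?J. A i \<epsilon> (x j) \<omega>) \<partial>\<P>) \<le> (\<Sum>i\<in>{1..p}. (\<integral>\<^sup>+\<omega>. (\<Prod>j\<in>?J. A i \<epsilon> (x j) \<omega>) \<partial>\<P>) ^ p)"
        using prod_le_sum_power[of "{1..p}" "\<lambda>i. \<integral>\<^sup>+\<omega>. (\<Prod>j\<in>?J. A i \<epsilon> (x j) \<omega>) \<partial>\<P>"] p by simp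
    qed
    also have "\<dots> = (\<Sum>i\<in>{1..p}. \<integral>\<^sup>+x. (\<integral>\<^sup>+\<omega>. (\<Prod>j\<in>?J. A i \<epsilon> (x j) \<omega>) \<partial>\<P>) ^ p \<partial>Pi\<^sub>M ?J (\<lambda>_. m))"
      by (intro nn_integral_sum) measurable
    also have "\<dots> \<le> (\<Sum>i\<in>{1..p}. (ennreal (exp t) ^ k) ^ p * density_process.\<Gamma>_bound p C k)"
    proof (rule sum_mono)
      fix i assume i: "i \<in> {1..p}"
      interpret D: density_process \<P> "P i" "X i" m "q i" using i by (rule process)
      have "(\<integral>\<^sup>+y. D.R x y ^ p \<partial>m) \<le> C" for x
        using resolvent[OF i] by (simp add: D.R_def)
      then show "(\<integral>\<^sup>+x. (\<integral>\<^sup>+\<omega>. (\<Prod>j\<in>?J. A i \<epsilon> (x j) \<omega>) \<partial>\<P>) ^ p \<partial>Pi\<^sub>M ?J (\<lambda>_. m)) \<le>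
          (ennreal (exp t) ^ k) ^ p * D.\<Gamma>_bound p C k"
        using D.nn_integral_moment_power_le[of p C ?J "x0 i" t \<epsilon>] J p by (simp add: A_def start[OF i])
    qed
    also have "\<dots> = B" by (simp add: B_def)
    finally show ?thesis .
  qed
  moreover have "B < \<infinity>"
  proof -
    interpret D: density_process \<P> "P 1" "X 1" m "q 1" using p by (intro process) auto
    show ?thesis
      unfolding B_def using D.\<Gamma>_bound_finite[OF C, of p k]
      by (auto simp: ennreal_mult_less_top power_less_top_ennreal of_nat_less_top)
  qed
  ultimately show ?thesis by blast
qed

text \<open>The measure that dominates the approximations in mean for
  \<open>0 < \<epsilon> \<le> 1\<close>; the exponential factor is the one from
  \<open>AE_nn_integral_occ_le\<close>. Its finiteness again comes from the resolvent
  condition.\<close>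

definition \<nu> :: "'a measure" where
  "\<nu> = density m (\<lambda>x. \<Prod>i\<in>{1..p}. ennreal (exp (t + 1)) * resolvent_density 1 (q i) (x0 i) x)"

lemma measurable_resolvent: "i \<in> {1..p} \<Longrightarrow> (\<lambda>x. resolvent_density 1 (q i) (x0 i) x) \<in> borel_measurable borel"
proof -
  assume "i \<in> {1..p}"
  then interpret D: density_process \<P> "P i" "X i" m "q i" by (rule process)
  have "(\<lambda>x. D.R (x0 i) x) \<in> borel_measurable borel" by measurable
  then show ?thesis by (simp add: D.R_def)
qed

lemma sets_\<nu> [simp, measurable_cong]: "sets \<nu> = sets borel"
  by (simp add: \<nu>_def)

lemma finite_measure_\<nu>: "finite_measure \<nu>"
proof
  note [measurable] = measurable_resolvent
  let ?R = "\<lambda>i x. resolvent_density 1 (q i) (x0 i) x"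
  have "emeasure \<nu> (space \<nu>) = (\<integral>\<^sup>+x. (\<Prod>i\<in>{1..p}. ennreal (exp (t + 1)) * ?R i x) \<partial>m)"
    by (simp add: \<nu>_def emeasure_density)
  also have "\<dots> \<le> (\<integral>\<^sup>+x. (\<Sum>i\<in>{1..p}. (ennreal (exp (t + 1)) * ?R i x) ^ p) \<partial>m)"
  proof (rule nn_integral_mono)
    fix x show "(\<Prod>i\<in>{1..p}. ennreal (exp (t + 1)) * ?R i x) \<le> (\<Sum>i\<in>{1..p}. (ennreal (exp (t + 1)) * ?R i x) ^ p)"
      using prod_le_sum_power[of "{1..p}" "\<lambda>i. ennreal (exp (t + 1)) * ?R i x"] p by simp
  qed
  also have "\<dots> = (\<Sum>i\<in>{1..p}. ennreal (exp (t + 1)) ^ p * (\<integral>\<^sup>+x. ?R i x ^ p \<partial>m))"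
    unfolding power_mult_distrib by (subst nn_integral_sum) (auto intro!: nn_integral_cmult sum.cong)
  also have "\<dots> \<le> (\<Sum>i\<in>{1..p}. ennreal (exp (t + 1)) ^ p * C)"
    by (intro sum_mono mult_left_mono resolvent) auto
  also have "\<dots> < \<infinity>"
    using C by (simp add: ennreal_mult_less_top power_less_top_ennreal of_nat_less_top)
  finally show "emeasure \<nu> (space \<nu>) \<noteq> \<infinity>" by simp
qed

lemma nn_integral_W_le:
  assumes \<epsilon>: "0 < \<epsilon>" "\<epsilon> \<le> 1" and f [measurable]: "f \<in> borel_measurable borel"
  shows "(\<integral>\<^sup>+\<omega>. W \<epsilon> f \<omega> \<partial>\<P>) \<le> (\<integral>\<^sup>+x. f x \<partial>\<nu>)"
proof -
  note [measurable] = measurable_resolvent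
  have "(\<integral>\<^sup>+\<omega>. W \<epsilon> f \<omega> \<partial>\<P>) = (\<integral>\<^sup>+x. \<integral>\<^sup>+\<omega>. f x * Z \<epsilon> \<omega> x \<partial>\<P> \<partial>m)"
    unfolding W_def by (intro nn_integral_swap sigma_finite_\<P> sigma_finite_m) measurable
  also have "\<dots> = (\<integral>\<^sup>+x. f x * (\<integral>\<^sup>+\<omega>. Z \<epsilon> \<omega> x \<partial>\<P>) \<partial>m)"
    by (intro nn_integral_cong nn_integral_cmult) measurable
  also have "\<dots> = (\<integral>\<^sup>+x. f x * (\<Prod>i\<in>{1..p}. \<integral>\<^sup>+\<omega>. A i \<epsilon> x \<omega> \<partial>\<P>) \<partial>m)"
    unfolding Z_def by (intro nn_integral_cong arg_cong2[where f = "(*)"] refl nn_integral_prod_indep measurable_A_path_algebra)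
  also have "\<dots> \<le> (\<integral>\<^sup>+x. (\<Prod>i\<in>{1..p}. ennreal (exp (t + 1)) * resolvent_density 1 (q i) (x0 i) x) * f x \<partial>m)"
  proof (rule nn_integral_mono_AE)
    have "AE x in m. \<forall>i\<in>{1..p}. (\<integral>\<^sup>+\<omega>. A i \<epsilon> x \<omega> \<partial>\<P>) \<le> ennreal (exp (t + 1)) * resolvent_density 1 (q i) (x0 i) x"
    proof (rule AE_finite_allI)
      fix i assume i: "i \<in> {1..p}"
      interpret D: density_process \<P> "P i" "X i" m "q i" using i by (rule process)
      show "AE x in m. (\<integral>\<^sup>+\<omega>. A i \<epsilon> x \<omega> \<partial>\<P>) \<le> ennreal (exp (t + 1)) * resolvent_density 1 (q i) (x0 i) x"
        using D.AE_nn_integral_occ_le[OF \<epsilon>, of "x0 i" t] by (simp add: A_def start[OF i] D.R_def)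
    qed simp
    then show "AE x in m. f x * (\<Prod>i\<in>{1..p}. \<integral>\<^sup>+\<omega>. A i \<epsilon> x \<omega> \<partial>\<P>) \<le>
        (\<Prod>i\<in>{1..p}. ennreal (exp (t + 1)) * resolvent_density 1 (q i) (x0 i) x) * f x"
    proof eventually_elim
      fix x assume "\<forall>i\<in>{1..p}. (\<integral>\<^sup>+\<omega>. A i \<epsilon> x \<omega> \<partial>\<P>) \<le> ennreal (exp (t + 1)) * resolvent_density 1 (q i) (x0 i) x"
      then show "f x * (\<Prod>i\<in>{1..p}. \<integral>\<^sup>+\<omega>. A i \<epsilon> x \<omega> \<partial>\<P>) \<le>
        (\<Prod>i\<in>{1..p}. ennreal (exp (t + 1)) * resolvent_density 1 (q i) (x0 i) x) * f x"
        by (subst mult.commute) (intro mult_right_mono prod_mono_ennreal, auto)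
    qed
  qed
  also have "\<dots> = (\<integral>\<^sup>+x. f x \<partial>\<nu>)"
    unfolding \<nu>_def by (intro nn_integral_density[symmetric]) measurable
  finally show ?thesis .
qed

end

section \<open>Borel embedding into the unit interval\<close>

text \<open>The bound \<open>1 / 3\<close> is below \<open>1\<close>, so the tail of an expansion
  never reaches the next integer.\<close>

lemma suminf_base4_tail:
  fixes b :: "nat \<Rightarrow> bool"
  shows "summable (\<lambda>i. of_bool (b i) / 4 ^ Suc i :: real)"
    and "0 \<le> (\<Sum>i. of_bool (b i) / 4 ^ Suc i :: real)" "(\<Sum>i. of_bool (b i) / 4 ^ Suc i :: real) \<le> 1 / 3"
proof -
  have s: "(\<lambda>i. (1 / 4) * (1 / 4) ^ i :: real) sums ((1 / 4) * (1 / (1 - 1 / 4)))"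
    by (intro sums_mult geometric_sums) simp
  have le: "of_bool (b i) / 4 ^ Suc i \<le> (1 / 4) * (1 / 4 :: real) ^ i" for i
    by (simp add: of_bool_def power_one_over)
  show summ: "summable (\<lambda>i. of_bool (b i) / 4 ^ Suc i :: real)"
    using le by (intro summable_comparison_test'[OF sums_summable[OF s]]) auto
  show "0 \<le> (\<Sum>i. of_bool (b i) / 4 ^ Suc i :: real)"
    by (intro suminf_nonneg summ) auto
  have "(\<Sum>i. of_bool (b i) / 4 ^ Suc i :: real) \<le> (\<Sum>i. (1 / 4) * (1 / 4) ^ i)"
    using le summ by (intro suminf_le sums_summable[OF s]) auto
  also have "\<dots> = 1 / 3" using sums_unique[OF s] by simp
  finally show "(\<Sum>i. of_bool (b i) / 4 ^ Suc i :: real) \<le> 1 / 3" .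
qed

text \<open>Base \<open>4\<close> leaves a gap between the expansions with digits \<open>0\<close> and \<open>1\<close>, so the digits can be read off.\<close>

lemma odd_floor_base4:
  fixes b :: "nat \<Rightarrow> bool"
  shows "odd \<lfloor>4 ^ Suc j * (\<Sum>i. of_bool (b i) / 4 ^ Suc i :: real)\<rfloor> \<longleftrightarrow> b j"
proof -
  let ?f = "\<lambda>i. of_bool (b i) / 4 ^ Suc i :: real"
  \<comment> \<open>The digits before position \<open>j\<close> contribute multiples of
    \<open>4\<close>, the digit at \<open>j\<close> contributes itself, and the tail is below
    \<open>1\<close>; hence the parity of the integer part is that digit.\<close>
  define N where "N = (\<Sum>i<j. of_bool (b i) * 4 ^ (j - i) :: int)"
  define r where "r = (\<Sum>i. of_bool (b (i + Suc j)) / 4 ^ Suc i :: real)"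
  have r: "0 \<le> r" "r \<le> 1 / 3"
    unfolding r_def by (rule suminf_base4_tail)+
  have "(\<Sum>i. ?f i) = (\<Sum>i. ?f (i + Suc j)) + (\<Sum>i<Suc j. ?f i)"
    by (intro suminf_split_initial_segment suminf_base4_tail)
  then have "4 ^ Suc j * (\<Sum>i. ?f i) = 4 ^ Suc j * (\<Sum>i. ?f (i + Suc j)) + (\<Sum>i<Suc j. 4 ^ Suc j * ?f i)"
    by (simp only: distrib_left sum_distrib_left)
  also have "4 ^ Suc j * (\<Sum>i. ?f (i + Suc j)) = r"
  proof -
    have "?f (i + Suc j) = (1 / 4 ^ Suc j) * (of_bool (b (i + Suc j)) / 4 ^ Suc i)" for i
      by (simp add: power_add)
    then have "(\<Sum>i. ?f (i + Suc j)) = (1 / 4 ^ Suc j) * r"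
      unfolding r_def by (subst suminf_mult[OF suminf_base4_tail(1), symmetric]) (simp only:)
    then show ?thesis by simp
  qed
  also have "(\<Sum>i<Suc j. 4 ^ Suc j * ?f i) = real_of_int N + of_bool (b j)"
  proof -
    have "4 ^ Suc j * ?f i = of_bool (b i) * 4 ^ (j - i)" if "i < j" for i
      using that by (simp add: power_diff)
    then show ?thesis
      by (simp add: N_def)
  qed
  finally have eq: "4 ^ Suc j * (\<Sum>i. ?f i) = r + (real_of_int (N + of_bool (b j)))"
    by simp
  have "\<lfloor>4 ^ Suc j * (\<Sum>i. ?f i)\<rfloor> = N + of_bool (b j)"
    unfolding eq using r by (intro floor_unique) auto
  moreover have "even N"
    unfolding N_def by (intro dvd_sum dvd_mult) auto
  ultimately show ?thesis by (simp del: power_Suc)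
qed

text \<open>In place of completeness there is a compact set that the sequence approaches. Nearest
  points in \<open>K\<close> have a convergent subsequence, and the Cauchy property extends this to
  the whole sequence.\<close>

lemma Cauchy_convergent_of_infdist_compact:
  fixes y :: "nat \<Rightarrow> 'a::metric_space"
  assumes y: "Cauchy y" and K: "compact K" "K \<noteq> {}"
    and inf: "\<And>e. e > 0 \<Longrightarrow> \<exists>N. \<forall>n\<ge>N. infdist (y n) K < e"
  shows "convergent y"
proof -
  have "\<exists>z. z \<in> K \<and> infdist (y n) K = dist (y n) z" for n
  proof -
    have "continuous_on K (dist (y n))" by (intro continuous_intros)
    then obtain z where z: "z \<in> K" "\<And>w. w \<in> K \<Longrightarrow> dist (y n) z \<le> dist (y n) w"
      using continuous_attains_inf[OF K] by blast
    then have "infdist (y n) K = dist (y n) z"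
      unfolding infdist_notempty[OF K(2)] by (intro antisym cINF_lower2[where x = z] cINF_greatest K) auto
    then show ?thesis using z by blast
  qed
  then obtain z where z: "\<And>n. z n \<in> K" "\<And>n. infdist (y n) K = dist (y n) (z n)"
    by metis
  obtain l s where s: "strict_mono s" "(z \<circ> s) \<longlonglongrightarrow> l"
    using K(1) z(1) unfolding compact_def by blast
  have "(\<lambda>n. dist (y n) (z n)) \<longlonglongrightarrow> 0"
    using inf unfolding z(2) by (intro metric_LIMSEQ_I) (auto simp: dist_real_def)
  then have "(\<lambda>n. dist (y (s n)) (z (s n))) \<longlonglongrightarrow> 0"
    using s(1) LIMSEQ_subseq_LIMSEQ[of "\<lambda>n. dist (y n) (z n)" 0 s] by (simp add: comp_def)
  moreover have "(\<lambda>n. dist (z (s n)) l) \<longlonglongrightarrow> 0"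
    using iffD1[OF tendsto_dist_iff s(2)] by (simp only: comp_def)
  ultimately have "(\<lambda>n. dist (y (s n)) (z (s n)) + dist (z (s n)) l) \<longlonglongrightarrow> 0 + 0"
    by (rule tendsto_add)
  then have "(\<lambda>n. dist (y (s n)) (z (s n)) + dist (z (s n)) l) \<longlonglongrightarrow> 0"
    by (simp only: add_0)
  then have "(\<lambda>n. dist (y (s n)) l) \<longlonglongrightarrow> 0"
    by (rule Lim_null_comparison[rotated]) (simp add: dist_triangle)
  then have "(y \<circ> s) \<longlonglongrightarrow> l"
    unfolding comp_def by (rule iffD2[OF tendsto_dist_iff])
  from Cauchy_converges_subseq[OF y s(1) this] show ?thesis
    by (rule convergentI)
qed

text \<open>A point is encoded by the dense points in its \<open>1 / (n + 1)\<close>-neighbourhoods. \<open>\<psi>\<close> decodes this as a limit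
  of dense points; the set of codes with a limit is Borel because \<open>E\<close> is \<open>\<sigma>\<close>-compact.\<close>

lemma borel_embedding:
  assumes lc: "locally_compact_space (euclidean :: 'a::{metric_space, second_countable_topology} topology)"
  obtains \<phi> :: "'a::{metric_space, second_countable_topology} \<Rightarrow> real" and \<psi> :: "real \<Rightarrow> 'a"
  where "\<phi> \<in> borel_measurable borel" "\<psi> \<in> borel_measurable borel" "\<And>x. 0 \<le> \<phi> x" "\<And>x. \<phi> x \<le> 1" "\<And>x. \<psi> (\<phi> x) = x"
proof -
  obtain \<B> :: "'a set set" where \<B>: "countable \<B>" "\<And>B. B \<in> \<B> \<Longrightarrow> open B" "\<And>B. B \<in> \<B> \<Longrightarrow> compact (closure B)"
    "\<And>U x. open U \<Longrightarrow> x \<in> U \<Longrightarrow> \<exists>B\<in>\<B>. x \<in> B \<and> closure B \<subseteq> U"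
    using countable_precompact_basis[OF lc] by metis
  define \<K> where "\<K> = closure ` \<B> - {{}}"
  have \<K>: "countable \<K>" "\<And>K. K \<in> \<K> \<Longrightarrow> compact K \<and> K \<noteq> {}" "\<And>x. \<exists>K\<in>\<K>. x \<in> K"
  proof -
    show "\<exists>K\<in>\<K>. x \<in> K" for x
    proof -
      obtain B where "B \<in> \<B>" "x \<in> B" using \<B>(4)[of UNIV x] by auto
      then show ?thesis using closure_subset[of B] by (intro bexI[of _ "closure B"]) (auto simp: \<K>_def)
    qed
  qed (use \<B> in \<open>auto simp: \<K>_def\<close>)
  obtain D :: "'a set" where D: "countable D" "\<And>X. open X \<Longrightarrow> X \<noteq> {} \<Longrightarrow> \<exists>d\<in>D. d \<in> X"
    using countable_dense_setE by metis
  have D_ne: "D \<noteq> {}" using D(2)[of UNIV] by auto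
  define d where "d = from_nat_into D"
  have d: "\<exists>k. dist x (d k) < e" if e: "e > 0" for x e
  proof -
    obtain z where z: "z \<in> D" "z \<in> ball x e" using D(2)[of "ball x e"] e by auto
    then obtain k where "z = d k" unfolding d_def using from_nat_into_surj[OF D(1)] by metis
    then show ?thesis using z by auto
  qed
  \<comment> \<open>The index \<open>j\<close> encodes a radius together with a dense point; the bit
    records whether \<open>x\<close> lies in the corresponding ball.\<close>
  define c where "c j x = (dist x (d (snd (prod_decode j))) < 1 / real (Suc (fst (prod_decode j))))" for j x
  define \<phi> where "\<phi> x = (\<Sum>j. of_bool (c j x) / 4 ^ Suc j :: real)" for x
  \<comment> \<open>Index of the first dense point whose bit for the radius
    \<open>1 / (n + 1)\<close> is set in the code \<open>r\<close>.\<close>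
  define k where "k n r = (LEAST k. odd \<lfloor>4 ^ Suc (prod_encode (n, k)) * r\<rfloor>)" for n and r :: real
  define y where "y n r = d (k n r)" for n r
  have [measurable]: "y n \<in> borel_measurable borel" for n
  proof -
    have "k n \<in> borel \<rightarrow>\<^sub>M count_space UNIV"
      unfolding k_def by measurable
    then show ?thesis
      unfolding y_def by (intro measurable_compose[of "k n" borel "count_space UNIV" d]) auto
  qed
  \<comment> \<open>Being Cauchy and approaching one of countably many compact sets is a countable
    combination of Borel conditions, and it implies convergence.\<close>
  define S where "S = {r. Cauchy (\<lambda>n. y n r) \<and> (\<exists>K\<in>\<K>. \<forall>i::nat. \<exists>N. \<forall>n\<in>{N..}. infdist (y n r) K < 1 / real (Suc i))}"
  have [measurable]: "S \<in> sets borel"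
  proof -
    have 1: "{r\<in>space borel. Cauchy (\<lambda>n. y n r)} \<in> sets borel"
      by (rule sets_Collect_Cauchy) measurable
    have inf: "(\<lambda>r. infdist (y n r) K) \<in> borel_measurable borel" for n K
      by (rule measurable_compose[of "y n" borel borel]) (auto intro!: borel_measurable_continuous_onI continuous_on_infdist continuous_on_id)
    have "(\<Union>K\<in>\<K>. \<Inter>i::nat. \<Union>N. \<Inter>n\<in>{N..}. {r\<in>space borel. infdist (y n r) K < 1 / real (Suc i)}) \<in> sets borel"
      using inf by (intro sets.countable_UN'' sets.countable_UN sets.countable_INT' \<K>(1) image_subsetI borel_measurable_less) auto
    also have "(\<Union>K\<in>\<K>. \<Inter>i::nat. \<Union>N. \<Inter>n\<in>{N..}. {r\<in>space borel. infdist (y n r) K < 1 / real (Suc i)}) =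
        {r\<in>space borel. \<exists>K\<in>\<K>. \<forall>i::nat. \<exists>N. \<forall>n\<in>{N..}. infdist (y n r) K < 1 / real (Suc i)}"
      by (intro set_eqI) (simp del: of_nat_Suc)
    finally have 2: "{r\<in>space borel. \<exists>K\<in>\<K>. \<forall>i::nat. \<exists>N. \<forall>n\<in>{N..}. infdist (y n r) K < 1 / real (Suc i)} \<in> sets borel" .
    from sets.Int[OF 1 2] show ?thesis
      by (simp add: S_def Collect_conj_eq)
  qed
  have y_\<phi>: "(\<lambda>n. y n (\<phi> x)) \<longlonglongrightarrow> x" for x
  proof (rule metric_LIMSEQ_I)
    fix e :: real assume "e > 0"
    then obtain N where N: "1 / real (Suc N) < e" using nat_approx_posE by blast
    have "dist (y n (\<phi> x)) x < e" if "n \<ge> N" for n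
    proof -
      have odd: "odd \<lfloor>4 ^ Suc (prod_encode (n, k)) * \<phi> x\<rfloor> \<longleftrightarrow> dist x (d k) < 1 / real (Suc n)" for k
        unfolding \<phi>_def odd_floor_base4 by (simp add: c_def)
      obtain k0 where "dist x (d k0) < 1 / real (Suc n)" using d[of "1 / real (Suc n)" x] by auto
      then have "dist x (y n (\<phi> x)) < 1 / real (Suc n)"
        unfolding y_def k_def odd by (rule LeastI)
      also have "\<dots> \<le> 1 / real (Suc N)" using that by (auto intro!: divide_left_mono)
      finally show ?thesis using N by (simp add: dist_commute)
    qed
    then show "\<exists>N. \<forall>n\<ge>N. dist (y n (\<phi> x)) x < e" by blast
  qed
  have S_\<phi>: "\<phi> x \<in> S" for x
  proof -
    obtain K where K: "K \<in> \<K>" "x \<in> K" using \<K>(3) by blast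
    have "\<exists>N. \<forall>n\<in>{N..}. infdist (y n (\<phi> x)) K < 1 / real (Suc i)" for i :: nat
    proof -
      obtain N where N: "\<forall>n\<ge>N. dist (y n (\<phi> x)) x < 1 / real (Suc i)"
        using metric_LIMSEQ_D[OF y_\<phi>[of x], of "1 / real (Suc i)"] by auto
      have "infdist (y n (\<phi> x)) K < 1 / real (Suc i)" if "n \<ge> N" for n
        using infdist_le[OF K(2), of "y n (\<phi> x)"] N that by (meson le_less_trans)
      then show ?thesis by auto
    qed
    then show ?thesis
      using K y_\<phi>[of x] LIMSEQ_imp_Cauchy unfolding S_def by blast
  qed
  \<comment> \<open>Off \<open>S\<close> the sequence is constant, so it converges for every
    \<open>r\<close> and its limit is Borel as a pointwise limit.\<close>
  define z where "z n r = (if r \<in> S then y n r else d 0)" for n r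
  define \<psi> where "\<psi> r = lim (\<lambda>n. z n r)" for r
  have "convergent (\<lambda>n. z n r)" for r
  proof (cases "r \<in> S")
    case True
    then obtain K where K: "K \<in> \<K>" "\<And>i::nat. \<exists>N. \<forall>n\<in>{N..}. infdist (y n r) K < 1 / real (Suc i)"
      unfolding S_def by blast
    have "convergent (\<lambda>n. y n r)"
    proof (rule Cauchy_convergent_of_infdist_compact)
      show "\<exists>N. \<forall>n\<ge>N. infdist (y n r) K < e" if e: "e > 0" for e
      proof -
        obtain i where "1 / real (Suc i) < e" using nat_approx_posE[OF e] by blast
        then show ?thesis using K(2)[of i] by (meson atLeast_iff less_trans)
      qed
    qed (use True K \<K>(2) in \<open>auto simp: S_def\<close>)
    then show ?thesis using True by (simp add: z_def)
  qed (simp add: z_def convergent_const)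
  then have z_\<psi>: "(\<lambda>n. z n r) \<longlonglongrightarrow> \<psi> r" for r
    unfolding \<psi>_def by (simp add: convergent_LIMSEQ_iff)
  show thesis
  proof (rule that)
    show "\<phi> \<in> borel_measurable borel"
      unfolding \<phi>_def c_def by measurable
    have "z n \<in> borel_measurable borel" for n
      unfolding z_def[abs_def] by measurable
    then show "\<psi> \<in> borel_measurable borel"
      using z_\<psi> by (intro borel_measurable_LIMSEQ_metric[of z borel \<psi>]) auto
    show "0 \<le> \<phi> x" "\<phi> x \<le> 1" for x
      using suminf_base4_tail(2,3)[of "\<lambda>j. c j x"] unfolding \<phi>_def by auto
    show "\<psi> (\<phi> x) = x" for x
      using z_\<psi>[of "\<phi> x"] y_\<phi>[of x] S_\<phi>[of x] LIMSEQ_unique by (simp add: z_def)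
  qed
qed

section \<open>Limits of random measures converging setwise in mean\<close>

text \<open>The approximations enter only as functionals on Borel functions, dominated in mean by
  one finite measure. The Cauchy property is required for all Borel functions bounded by
  \<open>1\<close>, which is what makes limits on sets possible.\<close>

locale random_measures = prob_space \<P> + nu: finite_measure \<nu>
  for \<P> :: "'w measure" and \<nu> :: "'a::{metric_space, second_countable_topology} measure" +
  fixes W :: "real \<Rightarrow> ('a \<Rightarrow> ennreal) \<Rightarrow> 'w \<Rightarrow> ennreal"
  assumes lc: "locally_compact_space (euclidean :: 'a topology)"
    and sets_\<nu> [measurable_cong, simp]: "sets \<nu> = sets borel"
    and measurable_W [measurable]: "f \<in> borel_measurable borel \<Longrightarrow> W \<epsilon> f \<in> borel_measurable \<P>"
    and W_mono: "(\<And>x. f x \<le> g x) \<Longrightarrow> W \<epsilon> f \<omega> \<le> W \<epsilon> g \<omega>"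
    and W_add: "f \<in> borel_measurable borel \<Longrightarrow> g \<in> borel_measurable borel \<Longrightarrow> \<omega> \<in> space \<P> \<Longrightarrow>
        W \<epsilon> (\<lambda>x. f x + g x) \<omega> = W \<epsilon> f \<omega> + W \<epsilon> g \<omega>"
    and W_cmult: "f \<in> borel_measurable borel \<Longrightarrow> \<omega> \<in> space \<P> \<Longrightarrow> W \<epsilon> (\<lambda>x. c * f x) \<omega> = c * W \<epsilon> f \<omega>"
    and W_le: "0 < \<epsilon> \<Longrightarrow> \<epsilon> \<le> 1 \<Longrightarrow> f \<in> borel_measurable borel \<Longrightarrow> (\<integral>\<^sup>+\<omega>. W \<epsilon> f \<omega> \<partial>\<P>) \<le> (\<integral>\<^sup>+x. f x \<partial>\<nu>)"
    and Cauchy: "f \<in> borel_measurable borel \<Longrightarrow> (\<And>x. f x \<le> 1) \<Longrightarrow> \<eta> > 0 \<Longrightarrow>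
        \<exists>r>0. \<forall>a b. 0 < a \<and> a < r \<and> 0 < b \<and> b < r \<longrightarrow> (\<integral>\<^sup>+\<omega>. ed (W a f \<omega>) (W b f \<omega>) \<partial>\<P>) \<le> ennreal \<eta>"
begin

lemma space_\<nu> [simp]: "space \<nu> = UNIV"
  using sets_eq_imp_space_eq[OF sets_\<nu>] by simp

text \<open>Convergence in mean, phrased with \<open>ed\<close> so that neither side has to be
  finite.\<close>

definition conv :: "('a \<Rightarrow> ennreal) \<Rightarrow> ('w \<Rightarrow> ennreal) \<Rightarrow> bool" where
  "conv f Y \<longleftrightarrow> f \<in> borel_measurable borel \<and> Y \<in> borel_measurable \<P> \<and>
     (\<forall>\<eta>>0. \<exists>r>0. \<forall>\<epsilon>. 0 < \<epsilon> \<and> \<epsilon> < r \<longrightarrow> (\<integral>\<^sup>+\<omega>. ed (W \<epsilon> f \<omega>) (Y \<omega>) \<partial>\<P>) \<le> ennreal \<eta>)"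

lemma convD:
  assumes "conv f Y"
  shows "f \<in> borel_measurable borel" "Y \<in> borel_measurable \<P>"
    "\<eta> > 0 \<Longrightarrow> \<exists>r>0. \<forall>\<epsilon>. 0 < \<epsilon> \<and> \<epsilon> < r \<longrightarrow> (\<integral>\<^sup>+\<omega>. ed (W \<epsilon> f \<omega>) (Y \<omega>) \<partial>\<P>) \<le> ennreal \<eta>"
  using assms unfolding conv_def by blast+

text \<open>Completeness of \<open>L^1\<close> by hand: along a rapidly decreasing sequence the
  increments are summable in mean, and the Cauchy property carries the limit over to all small
  \<open>\<epsilon>\<close>.\<close>

lemma conv_exists:
  assumes f [measurable]: "f \<in> borel_measurable borel" and f_le: "\<And>x. f x \<le> 1"
  shows "\<exists>Y. conv f Y"
proof -
  have "\<exists>r. 0 < r \<and> (\<forall>a b. 0 < a \<and> a < r \<and> 0 < b \<and> b < r \<longrightarrow> (\<integral>\<^sup>+\<omega>. ed (W a f \<omega>) (W b f \<omega>) \<partial>\<P>) \<le> ennreal ((1 / 2) ^ n))" for n :: nat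
    using Cauchy[OF f f_le, of "(1 / 2) ^ n"] by auto
  then obtain r where r: "\<And>n. 0 < r n"
    "\<And>n a b. 0 < a \<Longrightarrow> a < r n \<Longrightarrow> 0 < b \<Longrightarrow> b < r n \<Longrightarrow> (\<integral>\<^sup>+\<omega>. ed (W a f \<omega>) (W b f \<omega>) \<partial>\<P>) \<le> ennreal ((1 / 2) ^ n)"
    by metis
  \<comment> \<open>Half of the smallest of the first \<open>n + 1\<close> radii, hence below
    \<open>r k\<close> for all \<open>k \<le> n\<close> at once.\<close>
  define a where "a n = Min (r ` {..n}) / 2" for n
  have a: "0 < a n" "a n < r k" if "k \<le> n" for n k
  proof -
    have "0 < Min (r ` {..n})" using r(1) by auto
    then show "0 < a n" by (simp add: a_def)
    have "Min (r ` {..n}) \<le> r k" using that by (intro Min_le) auto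
    then show "a n < r k" using r(1)[of k] unfolding a_def by linarith
  qed
  define e where "e n \<omega> = ed (W (a n) f \<omega>) (W (a (Suc n)) f \<omega>)" for n \<omega>
  have [measurable]: "e n \<in> borel_measurable \<P>" for n unfolding e_def by measurable
  have e_le: "(\<integral>\<^sup>+\<omega>. e n \<omega> \<partial>\<P>) \<le> ennreal ((1 / 2) ^ n)" for n
    unfolding e_def using a[of n n] a[of n "Suc n"] by (intro r) auto
  define S where "S n \<omega> = (\<Sum>k. e (k + n) \<omega>)" for n \<omega>
  have [measurable]: "S n \<in> borel_measurable \<P>" for n unfolding S_def by measurable
  have S_le: "(\<integral>\<^sup>+\<omega>. S n \<omega> \<partial>\<P>) \<le> ennreal (2 * (1 / 2) ^ n)" for n
  proof -
    have "(\<integral>\<^sup>+\<omega>. S n \<omega> \<partial>\<P>) = (\<Sum>k. \<integral>\<^sup>+\<omega>. e (k + n) \<omega> \<partial>\<P>)"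
      unfolding S_def by (intro nn_integral_suminf) measurable
    also have "\<dots> \<le> (\<Sum>k. ennreal ((1 / 2) ^ n * (1 / 2) ^ k))"
    proof (rule suminf_le)
      show "(\<integral>\<^sup>+\<omega>. e (k + n) \<omega> \<partial>\<P>) \<le> ennreal ((1 / 2) ^ n * (1 / 2) ^ k)" for k
        using e_le[of "k + n"] by (simp only: power_add mult.commute)
    qed auto
    also have "\<dots> = ennreal (2 * (1 / 2) ^ n)"
    proof (rule suminf_ennreal_eq)
      show "(\<lambda>k. (1 / 2) ^ n * (1 / 2) ^ k :: real) sums (2 * (1 / 2) ^ n)"
        using sums_mult[OF geometric_sums[of "1 / 2 :: real"], of "(1 / 2) ^ n"] by (simp add: mult.commute)
    qed simp
    finally show ?thesis .
  qed
  \<comment> \<open>The lower limit is a measurable candidate defined without an exceptional set;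
    where \<open>S n\<close> is infinite the estimate \<open>Y_near\<close> is void.\<close>
  define Y where "Y \<omega> = liminf (\<lambda>n. W (a n) f \<omega>)" for \<omega>
  have Y [measurable]: "Y \<in> borel_measurable \<P>" unfolding Y_def by measurable
  have partial: "ed (W (a n) f \<omega>) (W (a (n + N)) f \<omega>) \<le> S n \<omega>" for n N \<omega>
  proof -
    have "ed (W (a n) f \<omega>) (W (a (n + N)) f \<omega>) \<le> (\<Sum>k<N. e (k + n) \<omega>)"
    proof (induction N)
      case (Suc N)
      have "ed (W (a n) f \<omega>) (W (a (n + Suc N)) f \<omega>) \<le> ed (W (a n) f \<omega>) (W (a (n + N)) f \<omega>) + e (N + n) \<omega>"
        unfolding e_def by (simp add: ed_triangle add.commute)
      also have "\<dots> \<le> (\<Sum>k<N. e (k + n) \<omega>) + e (N + n) \<omega>"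
        by (intro add_right_mono Suc)
      finally show ?case by simp
    qed simp
    also have "\<dots> \<le> S n \<omega>"
      unfolding S_def by (intro sum_le_suminf) auto
    finally show ?thesis .
  qed
  have Y_near: "ed (W (a n) f \<omega>) (Y \<omega>) \<le> S n \<omega>" for n \<omega>
  proof (cases "S n \<omega> = \<top>")
    case False
    have le: "W (a n) f \<omega> \<le> W (a N) f \<omega> + S n \<omega>" "W (a N) f \<omega> \<le> W (a n) f \<omega> + S n \<omega>" if "N \<ge> n" for N
      using partial[of n \<omega> "N - n"] that by (auto simp: ed_le_iff)
    show ?thesis
      unfolding ed_le_iff
    proof
      have "W (a n) f \<omega> - S n \<omega> \<le> Y \<omega>"
        unfolding Y_def
      proof (rule Liminf_bounded)
        have "W (a n) f \<omega> - S n \<omega> \<le> W (a N) f \<omega>" if "N \<ge> n" for N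
          using le(1)[OF that] False by (simp add: ennreal_minus_le_iff add.commute)
        then show "\<forall>\<^sub>F N in sequentially. W (a n) f \<omega> - S n \<omega> \<le> W (a N) f \<omega>"
          by (auto simp: eventually_sequentially)
      qed
      then show "W (a n) f \<omega> \<le> Y \<omega> + S n \<omega>"
        using False by (simp add: ennreal_minus_le_iff add.commute)
      show "Y \<omega> \<le> W (a n) f \<omega> + S n \<omega>"
      proof -
        have "Y \<omega> \<le> liminf (\<lambda>N. W (a n) f \<omega> + S n \<omega>)"
          unfolding Y_def using le(2) by (intro Liminf_mono) (auto simp: eventually_sequentially)
        then show ?thesis by (simp add: Liminf_const)
      qed
    qed
  qed simp
  have "conv f Y"
    unfolding conv_def
  proof (intro conjI allI impI f Y)
    fix \<eta> :: real assume \<eta>: "\<eta> > 0"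
    obtain n :: nat where n: "(1 / 2) ^ n < \<eta> / 3"
      using real_arch_pow_inv[of "\<eta> / 3" "1 / 2"] \<eta> by auto
    have "(\<integral>\<^sup>+\<omega>. ed (W \<epsilon> f \<omega>) (Y \<omega>) \<partial>\<P>) \<le> ennreal \<eta>" if \<epsilon>: "0 < \<epsilon>" "\<epsilon> < r n" for \<epsilon>
    proof -
      have "(\<integral>\<^sup>+\<omega>. ed (W \<epsilon> f \<omega>) (Y \<omega>) \<partial>\<P>) \<le> (\<integral>\<^sup>+\<omega>. ed (W \<epsilon> f \<omega>) (W (a n) f \<omega>) + S n \<omega> \<partial>\<P>)"
        by (intro nn_integral_mono order_trans[OF ed_triangle add_left_mono] Y_near)
      also have "\<dots> = (\<integral>\<^sup>+\<omega>. ed (W \<epsilon> f \<omega>) (W (a n) f \<omega>) \<partial>\<P>) + (\<integral>\<^sup>+\<omega>. S n \<omega> \<partial>\<P>)"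
        by (intro nn_integral_add) measurable
      also have "\<dots> \<le> ennreal ((1 / 2) ^ n) + ennreal (2 * (1 / 2) ^ n)"
        using \<epsilon> a[of n n] by (intro add_mono r S_le) auto
      also have "\<dots> = ennreal (3 * (1 / 2) ^ n)"
        by (simp flip: ennreal_plus)
      also have "\<dots> \<le> ennreal \<eta>" using n by (intro ennreal_leI) simp
      finally show ?thesis .
    qed
    then show "\<exists>r>0. \<forall>\<epsilon>. 0 < \<epsilon> \<and> \<epsilon> < r \<longrightarrow> (\<integral>\<^sup>+\<omega>. ed (W \<epsilon> f \<omega>) (Y \<omega>) \<partial>\<P>) \<le> ennreal \<eta>"
      using r(1)[of n] by blast
  qed
  then show ?thesis by blast
qed

text \<open>\<open>D\<close> is the positive part of \<open>Y - Y'\<close>. Monotonicity before the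
  limit bounds it by the sum of the two approximation errors, whose means become arbitrarily
  small.\<close>

lemma conv_mono_AE:
  assumes c: "conv f Y" "conv g Y'" and le: "\<And>x. f x \<le> g x"
  shows "AE \<omega> in \<P>. Y \<omega> \<le> Y' \<omega>"
proof -
  note [measurable] = convD(1,2)[OF c(1)] convD(1,2)[OF c(2)]
  define D where "D \<omega> = (if Y \<omega> \<le> Y' \<omega> then 0 else ed (Y \<omega>) (Y' \<omega>))" for \<omega>
  have [measurable]: "D \<in> borel_measurable \<P>" unfolding D_def by measurable
  have D_le: "D \<omega> \<le> ed (W \<epsilon> f \<omega>) (Y \<omega>) + ed (W \<epsilon> g \<omega>) (Y' \<omega>)" for \<epsilon> \<omega>
  proof (cases "Y \<omega> \<le> Y' \<omega>")
    case False
    have "Y \<omega> \<le> W \<epsilon> f \<omega> + ed (W \<epsilon> f \<omega>) (Y \<omega>)" by (rule ed_upper')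
    also have "\<dots> \<le> W \<epsilon> g \<omega> + ed (W \<epsilon> f \<omega>) (Y \<omega>)"
      by (intro add_right_mono W_mono le)
    also have "\<dots> \<le> (Y' \<omega> + ed (W \<epsilon> g \<omega>) (Y' \<omega>)) + ed (W \<epsilon> f \<omega>) (Y \<omega>)"
      by (intro add_right_mono ed_upper)
    finally have "Y \<omega> \<le> Y' \<omega> + (ed (W \<epsilon> f \<omega>) (Y \<omega>) + ed (W \<epsilon> g \<omega>) (Y' \<omega>))"
      by (simp only: ac_simps)
    then show ?thesis
      using False by (auto simp: D_def ed_le_iff intro: add_increasing2)
  qed (simp add: D_def)
  have "(\<integral>\<^sup>+\<omega>. D \<omega> \<partial>\<P>) \<le> 0 + ennreal \<eta>" if \<eta>: "\<eta> > 0" for \<eta>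
  proof -
    obtain r1 where r1: "r1 > 0" "\<And>\<epsilon>. 0 < \<epsilon> \<Longrightarrow> \<epsilon> < r1 \<Longrightarrow> (\<integral>\<^sup>+\<omega>. ed (W \<epsilon> f \<omega>) (Y \<omega>) \<partial>\<P>) \<le> ennreal (\<eta> / 2)"
      using convD(3)[OF c(1), of "\<eta> / 2"] \<eta> by auto
    obtain r2 where r2: "r2 > 0" "\<And>\<epsilon>. 0 < \<epsilon> \<Longrightarrow> \<epsilon> < r2 \<Longrightarrow> (\<integral>\<^sup>+\<omega>. ed (W \<epsilon> g \<omega>) (Y' \<omega>) \<partial>\<P>) \<le> ennreal (\<eta> / 2)"
      using convD(3)[OF c(2), of "\<eta> / 2"] \<eta> by auto
    define \<epsilon> where "\<epsilon> = min r1 r2 / 2"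
    have \<epsilon>: "0 < \<epsilon>" "\<epsilon> < r1" "\<epsilon> < r2" using r1(1) r2(1) by (auto simp: \<epsilon>_def min_def)
    have "(\<integral>\<^sup>+\<omega>. D \<omega> \<partial>\<P>) \<le> (\<integral>\<^sup>+\<omega>. ed (W \<epsilon> f \<omega>) (Y \<omega>) + ed (W \<epsilon> g \<omega>) (Y' \<omega>) \<partial>\<P>)"
      by (intro nn_integral_mono D_le)
    also have "\<dots> = (\<integral>\<^sup>+\<omega>. ed (W \<epsilon> f \<omega>) (Y \<omega>) \<partial>\<P>) + (\<integral>\<^sup>+\<omega>. ed (W \<epsilon> g \<omega>) (Y' \<omega>) \<partial>\<P>)"
      by (intro nn_integral_add) measurable
    also have "\<dots> \<le> ennreal (\<eta> / 2) + ennreal (\<eta> / 2)"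
      by (intro add_mono r1 r2 \<epsilon>)
    also have "\<dots> = 0 + ennreal \<eta>" using \<eta> by (simp flip: ennreal_plus)
    finally show ?thesis .
  qed
  then have "(\<integral>\<^sup>+\<omega>. D \<omega> \<partial>\<P>) \<le> 0"
    by (rule ennreal_le_epsilon)
  then have "AE \<omega> in \<P>. D \<omega> = 0"
    by (simp add: nn_integral_0_iff_AE)
  then show ?thesis
    by (rule AE_mp) (intro AE_I2, auto simp: D_def ed_eq_0_iff split: if_splits)
qed

lemma conv_unique: "conv f Y \<Longrightarrow> conv f Y' \<Longrightarrow> AE \<omega> in \<P>. Y \<omega> = Y' \<omega>"
  using conv_mono_AE[of f Y f Y'] conv_mono_AE[of f Y' f Y] by (auto elim: eventually_elim2)

lemma conv_cong_AE:
  assumes c: "conv f Y" and eq: "AE \<omega> in \<P>. Y \<omega> = Y' \<omega>" and [measurable]: "Y' \<in> borel_measurable \<P>"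
  shows "conv f Y'"
proof -
  have "(\<integral>\<^sup>+\<omega>. ed (W \<epsilon> f \<omega>) (Y' \<omega>) \<partial>\<P>) = (\<integral>\<^sup>+\<omega>. ed (W \<epsilon> f \<omega>) (Y \<omega>) \<partial>\<P>)" for \<epsilon>
    using eq by (intro nn_integral_cong_AE) auto
  then show ?thesis
    using c assms(3) unfolding conv_def by simp
qed

lemma conv_add:
  assumes c: "conv f Y" "conv g Y'"
  shows "conv (\<lambda>x. f x + g x) (\<lambda>\<omega>. Y \<omega> + Y' \<omega>)"
  unfolding conv_def
proof (intro conjI allI impI)
  note [measurable] = convD(1,2)[OF c(1)] convD(1,2)[OF c(2)]
  show "(\<lambda>x. f x + g x) \<in> borel_measurable borel" "(\<lambda>\<omega>. Y \<omega> + Y' \<omega>) \<in> borel_measurable \<P>" by measurable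
  fix \<eta> :: real assume \<eta>: "\<eta> > 0"
  obtain r1 where r1: "r1 > 0" "\<And>\<epsilon>. 0 < \<epsilon> \<Longrightarrow> \<epsilon> < r1 \<Longrightarrow> (\<integral>\<^sup>+\<omega>. ed (W \<epsilon> f \<omega>) (Y \<omega>) \<partial>\<P>) \<le> ennreal (\<eta> / 2)"
    using convD(3)[OF c(1), of "\<eta> / 2"] \<eta> by auto
  obtain r2 where r2: "r2 > 0" "\<And>\<epsilon>. 0 < \<epsilon> \<Longrightarrow> \<epsilon> < r2 \<Longrightarrow> (\<integral>\<^sup>+\<omega>. ed (W \<epsilon> g \<omega>) (Y' \<omega>) \<partial>\<P>) \<le> ennreal (\<eta> / 2)"
    using convD(3)[OF c(2), of "\<eta> / 2"] \<eta> by auto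
  have "(\<integral>\<^sup>+\<omega>. ed (W \<epsilon> (\<lambda>x. f x + g x) \<omega>) (Y \<omega> + Y' \<omega>) \<partial>\<P>) \<le> ennreal \<eta>" if "0 < \<epsilon>" "\<epsilon> < min r1 r2" for \<epsilon>
  proof -
    have "(\<integral>\<^sup>+\<omega>. ed (W \<epsilon> (\<lambda>x. f x + g x) \<omega>) (Y \<omega> + Y' \<omega>) \<partial>\<P>) \<le> (\<integral>\<^sup>+\<omega>. ed (W \<epsilon> f \<omega>) (Y \<omega>) + ed (W \<epsilon> g \<omega>) (Y' \<omega>) \<partial>\<P>)"
      by (intro nn_integral_mono) (simp add: W_add ed_add_le)
    also have "\<dots> = (\<integral>\<^sup>+\<omega>. ed (W \<epsilon> f \<omega>) (Y \<omega>) \<partial>\<P>) + (\<integral>\<^sup>+\<omega>. ed (W \<epsilon> g \<omega>) (Y' \<omega>) \<partial>\<P>)"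
      by (intro nn_integral_add) measurable
    also have "\<dots> \<le> ennreal (\<eta> / 2) + ennreal (\<eta> / 2)"
      using that by (intro add_mono r1 r2) auto
    also have "\<dots> = ennreal \<eta>" using \<eta> by (simp flip: ennreal_plus)
    finally show ?thesis .
  qed
  then show "\<exists>r>0. \<forall>\<epsilon>. 0 < \<epsilon> \<and> \<epsilon> < r \<longrightarrow> (\<integral>\<^sup>+\<omega>. ed (W \<epsilon> (\<lambda>x. f x + g x) \<omega>) (Y \<omega> + Y' \<omega>) \<partial>\<P>) \<le> ennreal \<eta>"
    using r1(1) r2(1) by (intro exI[of _ "min r1 r2"]) auto
qed

lemma ed_cmult: "ed (c * a) (c * b) \<le> c * ed a b" for c :: ennreal
  unfolding ed_le_iff distrib_left[symmetric] by (intro conjI mult_left_mono ed_upper ed_upper') auto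

lemma conv_cmult:
  assumes c: "conv f Y" and k: "k < \<top>"
  shows "conv (\<lambda>x. k * f x) (\<lambda>\<omega>. k * Y \<omega>)"
  unfolding conv_def
proof (intro conjI allI impI)
  note [measurable] = convD(1,2)[OF c(1)]
  show "(\<lambda>x. k * f x) \<in> borel_measurable borel" "(\<lambda>\<omega>. k * Y \<omega>) \<in> borel_measurable \<P>" by measurable
  fix \<eta> :: real assume \<eta>: "\<eta> > 0"
  obtain l where l: "k = ennreal l" "l \<ge> 0" using k by (cases k) auto
  obtain r where r: "r > 0" "\<And>\<epsilon>. 0 < \<epsilon> \<Longrightarrow> \<epsilon> < r \<Longrightarrow> (\<integral>\<^sup>+\<omega>. ed (W \<epsilon> f \<omega>) (Y \<omega>) \<partial>\<P>) \<le> ennreal (\<eta> / (l + 1))"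
    using convD(3)[OF c(1), of "\<eta> / (l + 1)"] \<eta> l by auto
  have "(\<integral>\<^sup>+\<omega>. ed (W \<epsilon> (\<lambda>x. k * f x) \<omega>) (k * Y \<omega>) \<partial>\<P>) \<le> ennreal \<eta>" if "0 < \<epsilon>" "\<epsilon> < r" for \<epsilon>
  proof -
    have "(\<integral>\<^sup>+\<omega>. ed (W \<epsilon> (\<lambda>x. k * f x) \<omega>) (k * Y \<omega>) \<partial>\<P>) \<le> (\<integral>\<^sup>+\<omega>. k * ed (W \<epsilon> f \<omega>) (Y \<omega>) \<partial>\<P>)"
      by (intro nn_integral_mono) (simp add: W_cmult ed_cmult)
    also have "\<dots> = k * (\<integral>\<^sup>+\<omega>. ed (W \<epsilon> f \<omega>) (Y \<omega>) \<partial>\<P>)"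
      by (intro nn_integral_cmult) measurable
    also have "\<dots> \<le> ennreal l * ennreal (\<eta> / (l + 1))"
      unfolding l(1) using that by (intro mult_left_mono r) auto
    also have "\<dots> = ennreal (l * (\<eta> / (l + 1)))" using l \<eta> by (intro ennreal_mult[symmetric]) auto
    also have "\<dots> \<le> ennreal \<eta>" using l \<eta> by (intro ennreal_leI) (simp add: field_simps)
    finally show ?thesis .
  qed
  then show "\<exists>r>0. \<forall>\<epsilon>. 0 < \<epsilon> \<and> \<epsilon> < r \<longrightarrow> (\<integral>\<^sup>+\<omega>. ed (W \<epsilon> (\<lambda>x. k * f x) \<omega>) (k * Y \<omega>) \<partial>\<P>) \<le> ennreal \<eta>"
    using r(1) by blast
qed

lemma conv_le:
  assumes c: "conv f Y"
  shows "(\<integral>\<^sup>+\<omega>. Y \<omega> \<partial>\<P>) \<le> (\<integral>\<^sup>+x. f x \<partial>\<nu>)"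
proof (rule ennreal_le_epsilon)
  note [measurable] = convD(1,2)[OF c(1)]
  fix e :: real assume e: "e > 0"
  obtain r where r: "r > 0" "\<And>\<epsilon>. 0 < \<epsilon> \<Longrightarrow> \<epsilon> < r \<Longrightarrow> (\<integral>\<^sup>+\<omega>. ed (W \<epsilon> f \<omega>) (Y \<omega>) \<partial>\<P>) \<le> ennreal e"
    using convD(3)[OF c e] by auto
  define \<epsilon> where "\<epsilon> = min 1 (r / 2)"
  have \<epsilon>: "0 < \<epsilon>" "\<epsilon> < r" "\<epsilon> \<le> 1" using r(1) by (auto simp: \<epsilon>_def min_def)
  have "(\<integral>\<^sup>+\<omega>. Y \<omega> \<partial>\<P>) \<le> (\<integral>\<^sup>+\<omega>. W \<epsilon> f \<omega> + ed (W \<epsilon> f \<omega>) (Y \<omega>) \<partial>\<P>)"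
    by (intro nn_integral_mono ed_upper')
  also have "\<dots> = (\<integral>\<^sup>+\<omega>. W \<epsilon> f \<omega> \<partial>\<P>) + (\<integral>\<^sup>+\<omega>. ed (W \<epsilon> f \<omega>) (Y \<omega>) \<partial>\<P>)"
    by (intro nn_integral_add) measurable
  also have "\<dots> \<le> (\<integral>\<^sup>+x. f x \<partial>\<nu>) + ennreal e"
    using \<epsilon> by (intro add_mono r W_le) auto
  finally show "(\<integral>\<^sup>+\<omega>. Y \<omega> \<partial>\<P>) \<le> (\<integral>\<^sup>+x. f x \<partial>\<nu>) + ennreal e" .
qed

lemma SUP_diff_small:
  fixes g :: "nat \<Rightarrow> ennreal"
  assumes "incseq g" "(SUP n. g n) < \<top>" "\<eta> > 0"
  shows "\<exists>n. (SUP n. g n) \<le> g n + ennreal \<eta>"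
proof (cases "(SUP n. g n) = 0")
  case False
  then have "(SUP n. g n) - ennreal \<eta> < (SUP n. g n)"
    using assms by (intro ennreal_between) (auto simp: zero_less_iff_neq_zero)
  then obtain n where "(SUP n. g n) - ennreal \<eta> < g n"
    unfolding less_SUP_iff by auto
  then have "(SUP n. g n) - ennreal \<eta> \<le> g n"
    by (rule less_imp_le)
  then have "(SUP n. g n) \<le> g n + ennreal \<eta>"
    by (simp add: ennreal_minus_le_iff add.commute)
  then show ?thesis by blast
qed auto

text \<open>The domination by \<open>\<nu>\<close> makes the errors \<open>W \<epsilon> (f - f n)\<close> small uniformly in \<open>\<epsilon>\<close>.\<close>

lemma conv_SUP:
  assumes c: "\<And>n. conv (f n) (Y n)" and f: "incseq f" and Y: "\<And>\<omega>. incseq (\<lambda>n. Y n \<omega>)"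
    and fin: "(\<integral>\<^sup>+x. (SUP n. f n x) \<partial>\<nu>) < \<infinity>"
  shows "conv (\<lambda>x. SUP n. f n x) (\<lambda>\<omega>. SUP n. Y n \<omega>)"
  unfolding conv_def
proof (intro conjI allI impI)
  note [measurable] = convD(1,2)[OF c]
  let ?f = "\<lambda>x. SUP n. f n x" and ?Y = "\<lambda>\<omega>. SUP n. Y n \<omega>"
  show "?f \<in> borel_measurable borel" "?Y \<in> borel_measurable \<P>" by measurable
  have f_SUP: "(\<integral>\<^sup>+x. ?f x \<partial>\<nu>) = (SUP n. \<integral>\<^sup>+x. f n x \<partial>\<nu>)"
    using f by (intro nn_integral_monotone_convergence_SUP) auto
  have Y_SUP: "(\<integral>\<^sup>+\<omega>. ?Y \<omega> \<partial>\<P>) = (SUP n. \<integral>\<^sup>+\<omega>. Y n \<omega> \<partial>\<P>)"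
    using Y by (intro nn_integral_monotone_convergence_SUP) (auto simp: incseq_def le_fun_def)
  have f_inc: "incseq (\<lambda>n. \<integral>\<^sup>+x. f n x \<partial>\<nu>)"
    using f by (auto simp: incseq_def le_fun_def intro!: nn_integral_mono)
  have Y_inc: "incseq (\<lambda>n. \<integral>\<^sup>+\<omega>. Y n \<omega> \<partial>\<P>)"
    using Y by (auto simp: incseq_def intro!: nn_integral_mono)
  have Y_fin: "(\<integral>\<^sup>+\<omega>. ?Y \<omega> \<partial>\<P>) < \<infinity>"
  proof -
    have "(\<integral>\<^sup>+\<omega>. ?Y \<omega> \<partial>\<P>) \<le> (\<integral>\<^sup>+x. ?f x \<partial>\<nu>)"
      unfolding Y_SUP f_SUP by (intro SUP_mono) (auto intro: conv_le[OF c])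
    with fin show ?thesis by auto
  qed
  fix \<eta> :: real assume \<eta>: "\<eta> > 0"
  obtain n1 where n1: "(SUP n. \<integral>\<^sup>+x. f n x \<partial>\<nu>) \<le> (\<integral>\<^sup>+x. f n1 x \<partial>\<nu>) + ennreal (\<eta> / 3)"
    using SUP_diff_small[OF f_inc, of "\<eta> / 3"] fin \<eta> unfolding f_SUP by auto
  obtain n2 where n2: "(SUP n. \<integral>\<^sup>+\<omega>. Y n \<omega> \<partial>\<P>) \<le> (\<integral>\<^sup>+\<omega>. Y n2 \<omega> \<partial>\<P>) + ennreal (\<eta> / 3)"
    using SUP_diff_small[OF Y_inc, of "\<eta> / 3"] Y_fin \<eta> unfolding Y_SUP by auto
  \<comment> \<open>A common index at which both monotone limits are nearly attained, so that the
    remainders \<open>hf\<close> and \<open>hY\<close> have small integrals.\<close>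
  define n where "n = max n1 n2"
  have f_n: "(\<integral>\<^sup>+x. ?f x \<partial>\<nu>) \<le> (\<integral>\<^sup>+x. f n x \<partial>\<nu>) + ennreal (\<eta> / 3)"
    unfolding f_SUP using n1 incseqD[OF f_inc, of n1 n] by (auto simp: n_def intro: order_trans add_right_mono)
  have Y_n: "(\<integral>\<^sup>+\<omega>. ?Y \<omega> \<partial>\<P>) \<le> (\<integral>\<^sup>+\<omega>. Y n \<omega> \<partial>\<P>) + ennreal (\<eta> / 3)"
    unfolding Y_SUP using n2 incseqD[OF Y_inc, of n2 n] by (auto simp: n_def intro: order_trans add_right_mono)
  have diff: "(\<integral>\<^sup>+x. h x \<partial>N) \<le> ennreal e"
    if le: "(\<integral>\<^sup>+x. u x \<partial>N) \<le> (\<integral>\<^sup>+x. v x \<partial>N) + ennreal e" and fin: "(\<integral>\<^sup>+x. u x \<partial>N) < \<infinity>"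
      and eq: "\<And>x. u x = v x + h x" and [measurable]: "v \<in> borel_measurable N" "h \<in> borel_measurable N"
    for N :: "'z measure" and u v h and e :: real
  proof -
    have "(\<integral>\<^sup>+x. u x \<partial>N) = (\<integral>\<^sup>+x. v x \<partial>N) + (\<integral>\<^sup>+x. h x \<partial>N)"
      unfolding eq by (intro nn_integral_add) auto
    then show ?thesis
      using le fin by (auto simp: ennreal_add_left_cancel_le)
  qed
  define hf where "hf x = ?f x - f n x" for x
  define hY where "hY \<omega> = ?Y \<omega> - Y n \<omega>" for \<omega>
  have [measurable]: "hf \<in> borel_measurable borel" "hY \<in> borel_measurable \<P>"
    unfolding hf_def hY_def by measurable
  have hf: "?f x = f n x + hf x" for x
    unfolding hf_def by (rule add_diff_inverse_ennreal[symmetric]) (rule SUP_upper, simp)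
  have hY: "?Y \<omega> = Y n \<omega> + hY \<omega>" for \<omega>
    unfolding hY_def by (rule add_diff_inverse_ennreal[symmetric]) (rule SUP_upper, simp)
  have hf_le: "(\<integral>\<^sup>+x. hf x \<partial>\<nu>) \<le> ennreal (\<eta> / 3)"
    by (rule diff[OF f_n fin hf]) measurable
  have hY_le: "(\<integral>\<^sup>+\<omega>. hY \<omega> \<partial>\<P>) \<le> ennreal (\<eta> / 3)"
    by (rule diff[OF Y_n Y_fin hY]) measurable
  obtain r where r: "r > 0" "\<And>\<epsilon>. 0 < \<epsilon> \<Longrightarrow> \<epsilon> < r \<Longrightarrow> (\<integral>\<^sup>+\<omega>. ed (W \<epsilon> (f n) \<omega>) (Y n \<omega>) \<partial>\<P>) \<le> ennreal (\<eta> / 3)"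
    using convD(3)[OF c[of n], of "\<eta> / 3"] \<eta> by auto
  have "(\<integral>\<^sup>+\<omega>. ed (W \<epsilon> ?f \<omega>) (?Y \<omega>) \<partial>\<P>) \<le> ennreal \<eta>" if \<epsilon>: "0 < \<epsilon>" "\<epsilon> < min r 1" for \<epsilon>
  proof -
    have "(\<integral>\<^sup>+\<omega>. ed (W \<epsilon> ?f \<omega>) (?Y \<omega>) \<partial>\<P>) \<le> (\<integral>\<^sup>+\<omega>. ed (W \<epsilon> (f n) \<omega>) (Y n \<omega>) + (W \<epsilon> hf \<omega> + hY \<omega>) \<partial>\<P>)"
    proof (rule nn_integral_mono)
      fix \<omega> assume "\<omega> \<in> space \<P>"
      then have "W \<epsilon> ?f \<omega> = W \<epsilon> (f n) \<omega> + W \<epsilon> hf \<omega>"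
        unfolding hf by (intro W_add) measurable
      then have "ed (W \<epsilon> ?f \<omega>) (?Y \<omega>) \<le> ed (W \<epsilon> (f n) \<omega>) (Y n \<omega>) + ed (W \<epsilon> hf \<omega>) (hY \<omega>)"
        by (simp add: hY ed_add_le)
      also have "ed (W \<epsilon> hf \<omega>) (hY \<omega>) \<le> W \<epsilon> hf \<omega> + hY \<omega>"
        by (rule order_trans[OF ed_le_max]) (auto simp: add_increasing add_increasing2)
      finally show "ed (W \<epsilon> ?f \<omega>) (?Y \<omega>) \<le> ed (W \<epsilon> (f n) \<omega>) (Y n \<omega>) + (W \<epsilon> hf \<omega> + hY \<omega>)"
        by (simp add: add_left_mono)
    qed
    also have "\<dots> = (\<integral>\<^sup>+\<omega>. ed (W \<epsilon> (f n) \<omega>) (Y n \<omega>) \<partial>\<P>) + ((\<integral>\<^sup>+\<omega>. W \<epsilon> hf \<omega> \<partial>\<P>) + (\<integral>\<^sup>+\<omega>. hY \<omega> \<partial>\<P>))"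
      by (simp add: nn_integral_add)
    also have "\<dots> \<le> ennreal (\<eta> / 3) + (ennreal (\<eta> / 3) + ennreal (\<eta> / 3))"
      using \<epsilon> by (intro add_mono r hY_le order_trans[OF W_le hf_le]) auto
    also have "\<dots> = ennreal \<eta>" using \<eta> by (simp flip: ennreal_plus)
    finally show ?thesis .
  qed
  then show "\<exists>r>0. \<forall>\<epsilon>. 0 < \<epsilon> \<and> \<epsilon> < r \<longrightarrow> (\<integral>\<^sup>+\<omega>. ed (W \<epsilon> ?f \<omega>) (?Y \<omega>) \<partial>\<P>) \<le> ennreal \<eta>"
    using r(1) by (intro exI[of _ "min r 1"]) auto
qed

end

section \<open>Regularisation of the setwise limits to a random measure\<close>

context random_measures
begin

lemma conv_indicator_exists: "B \<in> sets borel \<Longrightarrow> \<exists>Y. conv (indicator B) Y"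
  by (intro conv_exists) (auto simp: indicator_def)

text \<open>The limit for \<open>B - A\<close> exists on its own. Adding the limit for
  \<open>A\<close> gives the one for \<open>B\<close> almost surely, and almost sure finiteness of
  \<open>Y\<close> permits the subtraction.\<close>

lemma conv_indicator_Diff:
  assumes A: "conv (indicator A) Y" "A \<in> sets borel" and B: "conv (indicator B) Y'" "B \<in> sets borel" and sub: "A \<subseteq> B"
  shows "conv (indicator (B - A)) (\<lambda>\<omega>. Y' \<omega> - Y \<omega>)"
proof -
  note [measurable] = A(2) B(2) convD(2)[OF A(1)] convD(2)[OF B(1)]
  obtain Z where Z: "conv (indicator (B - A)) Z"
    using conv_indicator_exists[of "B - A"] by auto
  have "(\<lambda>x. indicator (B - A) x + indicator A x :: ennreal) = indicator B"
    using sub by (auto simp: indicator_def fun_eq_iff)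
  then have "AE \<omega> in \<P>. Z \<omega> + Y \<omega> = Y' \<omega>"
    using conv_unique[OF conv_add[OF Z A(1)], of Y'] B(1) by simp
  moreover have "AE \<omega> in \<P>. Y \<omega> \<noteq> \<top>"
  proof -
    have "(\<integral>\<^sup>+\<omega>. Y \<omega> \<partial>\<P>) \<le> (\<integral>\<^sup>+x. indicator A x \<partial>\<nu>)" by (rule conv_le[OF A(1)])
    also have "\<dots> < \<infinity>" by (simp add: nu.emeasure_finite less_top[symmetric])
    finally show ?thesis
      using nn_integral_PInf_AE[of Y \<P>] by simp
  qed
  ultimately have "AE \<omega> in \<P>. Z \<omega> = Y' \<omega> - Y \<omega>"
  proof eventually_elim
    fix \<omega> assume "Z \<omega> + Y \<omega> = Y' \<omega>" "Y \<omega> \<noteq> \<top>"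
    then show "Z \<omega> = Y' \<omega> - Y \<omega>"
      by (metis ennreal_add_diff_cancel_right)
  qed
  then show ?thesis
    by (rule conv_cong_AE[OF Z]) measurable
qed

text \<open>The limits \<open>Z B\<close> are chosen separately for each set, and their exceptional
  sets cannot be united over all sets. Apart from \<open>{}\<close> and the whole space, only the
  sets \<open>{x. \<phi> x \<le> q}\<close> with rational \<open>q\<close> enter the definition of
  \<open>F\<close>. The distribution function then determines a measure for every
  \<open>\<omega>\<close>, and the other sets are recovered one at a time.\<close>

theorem limit_measure_exists:
  obtains L :: "'w \<Rightarrow> 'a measure" where "\<And>\<omega>. sets (L \<omega>) = sets borel" "\<And>\<omega>. finite_measure (L \<omega>)"
    "\<And>f. f \<in> borel_measurable borel \<Longrightarrow> (\<integral>\<^sup>+x. f x \<partial>\<nu>) < \<infinity> \<Longrightarrow> conv f (\<lambda>\<omega>. \<integral>\<^sup>+x. f x \<partial>L \<omega>)"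
proof -
  obtain \<phi> :: "'a \<Rightarrow> real" and \<psi> :: "real \<Rightarrow> 'a" where
    [measurable]: "\<phi> \<in> borel_measurable borel" "\<psi> \<in> borel_measurable borel"
    and \<phi>: "\<And>x. 0 \<le> \<phi> x" "\<And>x. \<phi> x \<le> 1" and \<psi>\<phi>: "\<And>x. \<psi> (\<phi> x) = x"
    using borel_embedding[OF lc] by metis
  define Z where "Z B = (SOME Y. conv (indicator B) Y)" for B
  have Z: "conv (indicator B) (Z B)" if [measurable]: "B \<in> sets borel" for B
    unfolding Z_def by (rule someI_ex[OF conv_indicator_exists[OF that]])
  define G where "G r = Z {x. \<phi> x \<le> r}" for r
  have set_le [measurable]: "{x. \<phi> x \<le> r} \<in> sets borel" for r
    by measurable
  have G: "conv (indicator {x. \<phi> x \<le> r}) (G r)" for r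
    unfolding G_def by (rule Z[OF set_le])
  have [measurable]: "G r \<in> borel_measurable \<P>" "Z UNIV \<in> borel_measurable \<P>" "Z {} \<in> borel_measurable \<P>" for r
    using convD(2)[OF G] convD(2)[OF Z] by auto
  have G_ge1: "G r = Z UNIV" if "r \<ge> 1" for r
  proof -
    have "{x. \<phi> x \<le> r} = UNIV" using that \<phi>(2) order_trans by blast
    then show ?thesis by (simp add: G_def)
  qed
  have G_neg: "G r = Z {}" if "r < 0" for r
  proof -
    have "{x. \<phi> x \<le> r} = {}" using that \<phi>(1) by (auto simp: not_le intro: less_le_trans)
    then show ?thesis by (simp add: G_def)
  qed
  \<comment> \<open>Off this event \<open>F\<close> is set to zero, so that
    \<open>interval_measure\<close> is applied to a bounded distribution function for every
    \<open>\<omega>\<close>.\<close>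
  define good where "good \<omega> \<longleftrightarrow> Z {} \<omega> = 0 \<and> Z UNIV \<omega> \<noteq> \<top>" for \<omega>
  have [measurable]: "Measurable.pred \<P> good"
    unfolding good_def[abs_def] by measurable
  have AE_good: "AE \<omega> in \<P>. good \<omega>"
  proof -
    have "AE \<omega> in \<P>. Z {} \<omega> = 0"
    proof -
      have "(\<integral>\<^sup>+\<omega>. Z {} \<omega> \<partial>\<P>) \<le> (\<integral>\<^sup>+x. indicator {} x \<partial>\<nu>)"
        by (rule conv_le[OF Z]) simp
      then show ?thesis by (simp add: nn_integral_0_iff_AE)
    qed
    moreover have "AE \<omega> in \<P>. Z UNIV \<omega> \<noteq> \<top>"
    proof -
      have "(\<integral>\<^sup>+\<omega>. Z UNIV \<omega> \<partial>\<P>) \<le> (\<integral>\<^sup>+x. indicator UNIV x \<partial>\<nu>)"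
        by (rule conv_le[OF Z]) simp
      also have "\<dots> < \<infinity>"
        using nu.emeasure_finite[of UNIV] by (simp add: less_top[symmetric])
      finally show ?thesis using nn_integral_PInf_AE[of "Z UNIV" \<P>] by simp
    qed
    ultimately show ?thesis unfolding good_def by eventually_elim blast
  qed
  \<comment> \<open>The infimum over rationals strictly above \<open>r\<close> enforces monotonicity
    and right-continuity for every \<open>\<omega>\<close>, whatever versions \<open>G q\<close>
    were chosen.\<close>
  define Fe where "Fe \<omega> r = (INF q\<in>{q\<in>\<rat>. r < q}. G q \<omega>)" for \<omega> and r :: real
  define F where "F \<omega> r = (if good \<omega> then enn2real (Fe \<omega> r) else 0)" for \<omega> and r :: real
  have rat: "\<exists>q\<in>\<rat>. r < q \<and> q < s" if "r < s" for r s :: real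
    using Rats_dense_in_real[OF that] by blast
  have Fe_meas [measurable]: "(\<lambda>\<omega>. Fe \<omega> r) \<in> borel_measurable \<P>" for r
    unfolding Fe_def by (intro borel_measurable_INF) (auto intro: countable_subset[OF _ countable_rat])
  have F_meas [measurable]: "(\<lambda>\<omega>. F \<omega> r) \<in> borel_measurable \<P>" for r
    unfolding F_def by measurable
  have Fe_fin: "Fe \<omega> r \<noteq> \<top>" if "good \<omega>" for \<omega> r
  proof -
    obtain q where q: "q \<in> \<rat>" "max r 1 < q" using rat[of "max r 1" "max r 1 + 1"] by auto
    then have "Fe \<omega> r \<le> G q \<omega>" unfolding Fe_def by (intro INF_lower) auto
    also have "\<dots> = Z UNIV \<omega>" using q G_ge1[of q] by auto
    finally show ?thesis using that by (auto simp: good_def top_unique)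
  qed
  have F_eq: "ennreal (F \<omega> r) = Fe \<omega> r" if "good \<omega>" for \<omega> r
    using Fe_fin[OF that] that by (simp add: F_def ennreal_enn2real less_top)
  have F_mono: "F \<omega> r \<le> F \<omega> s" if "r \<le> s" for \<omega> r s
  proof (cases "good \<omega>")
    case True
    have "Fe \<omega> r \<le> Fe \<omega> s" unfolding Fe_def using that by (intro INF_superset_mono) auto
    then show ?thesis using True Fe_fin[OF True] by (simp add: F_def enn2real_mono less_top)
  qed (simp add: F_def)
  have F_rc: "continuous (at_right r) (F \<omega>)" for r \<omega>
  proof (rule iffD2[OF continuous_at_right_real_increasing[of "F \<omega>" r]], erule F_mono, intro allI impI)
    fix e :: real assume e: "e > 0"
    show "\<exists>\<delta>>0. F \<omega> (r + \<delta>) - F \<omega> r < e"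
    proof (cases "good \<omega>")
      case True
      have "Fe \<omega> r < ennreal (F \<omega> r + e)"
        unfolding F_eq[OF True, symmetric] using e by (intro ennreal_lessI) (auto simp: F_def add_nonneg_pos)
      then obtain q where q: "q \<in> \<rat>" "r < q" "G q \<omega> < ennreal (F \<omega> r + e)"
        unfolding Fe_def INF_less_iff by auto
      obtain s where s: "r < s" "s < q" using dense[OF q(2)] by blast
      have "ennreal (F \<omega> s) \<le> G q \<omega>"
        unfolding F_eq[OF True] Fe_def using q s by (intro INF_lower) auto
      also note q(3)
      finally have "F \<omega> s < F \<omega> r + e"
        by (subst (asm) ennreal_less_iff) (auto simp: F_def)
      then show ?thesis using s by (intro exI[of _ "s - r"]) auto
    qed (use e in \<open>auto simp: F_def intro: exI[of _ 1]\<close>)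
  qed
  have F_ge1: "ennreal (F \<omega> r) = Z UNIV \<omega>" if "good \<omega>" "r \<ge> 1" for \<omega> r
  proof -
    have "Fe \<omega> r = (INF q\<in>{q\<in>\<rat>. r < q}. Z UNIV \<omega>)"
      unfolding Fe_def using that G_ge1 by (intro INF_cong refl) auto
    also have "\<dots> = Z UNIV \<omega>" using rat[of r "r + 1"] by (intro INF_const) auto
    finally show ?thesis using F_eq[OF that(1)] by simp
  qed
  have F_neg: "F \<omega> r = 0" if "r < 0" for \<omega> r
  proof (cases "good \<omega>")
    case True
    obtain q where q: "q \<in> \<rat>" "r < q" "q < 0" using rat[of r 0] \<open>r < 0\<close> by blast
    then have "Fe \<omega> r \<le> G q \<omega>" unfolding Fe_def by (intro INF_lower) auto
    also have "\<dots> = 0" using q G_neg[of q] True by (simp add: good_def)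
    finally show ?thesis by (simp add: F_def)
  qed (simp add: F_def)
  \<comment> \<open>The infimum lies above \<open>G r\<close> almost surely. Its mean is no larger,
    because the strips \<open>{x. r < \<phi> x \<and> \<phi> x \<le> r + 1 / (n + 1)}\<close> have
    vanishing \<open>\<nu>\<close>-mass, and this forces equality.\<close>
  have AE_F: "AE \<omega> in \<P>. ennreal (F \<omega> r) = G r \<omega>" for r
  proof -
    have 1: "AE \<omega> in \<P>. G r \<omega> \<le> Fe \<omega> r"
    proof -
      have "AE \<omega> in \<P>. \<forall>q\<in>{q\<in>\<rat>. r < q}. G r \<omega> \<le> G q \<omega>"
      proof (subst AE_ball_countable)
        show "countable {q\<in>\<rat>. r < q}" by (rule countable_subset[OF _ countable_rat]) auto
        show "\<forall>q\<in>{q\<in>\<rat>. r < q}. AE \<omega> in \<P>. G r \<omega> \<le> G q \<omega>"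
          by (intro ballI conv_mono_AE[OF G G]) (auto simp: indicator_def)
      qed
      then show ?thesis unfolding Fe_def by eventually_elim (auto intro: INF_greatest)
    qed
    have 2: "(\<integral>\<^sup>+\<omega>. Fe \<omega> r \<partial>\<P>) \<le> (\<integral>\<^sup>+\<omega>. G r \<omega> \<partial>\<P>)"
    proof (rule ennreal_le_epsilon)
      fix e :: real assume e: "e > 0"
      let ?B = "\<lambda>n::nat. {x. r < \<phi> x \<and> \<phi> x \<le> r + 1 / real (Suc n)}"
      have B_meas [measurable]: "?B n \<in> sets borel" for n by measurable
      have "(\<lambda>n. emeasure \<nu> (?B n)) \<longlonglongrightarrow> emeasure \<nu> (\<Inter>n. ?B n)"
      proof (rule Lim_emeasure_decseq)
        show "decseq ?B"
        proof (intro decseq_SucI subsetI)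
          fix n x assume "x \<in> ?B (Suc n)"
          moreover have "1 / real (Suc (Suc n)) \<le> 1 / real (Suc n)" by (simp add: frac_le)
          ultimately show "x \<in> ?B n" by (auto simp del: of_nat_Suc)
        qed
      qed auto
      also have "(\<Inter>n. ?B n) = {}"
      proof -
        have False if x: "\<And>n. x \<in> ?B n" for x
        proof -
          have "0 < \<phi> x - r" using x[of 0] by simp
          then obtain n where "1 / real (Suc n) < \<phi> x - r" using nat_approx_posE by blast
          then show False using x[of n] by (simp del: of_nat_Suc)
        qed
        then show ?thesis by blast
      qed
      finally have "\<forall>\<^sub>F n in sequentially. emeasure \<nu> (?B n) < ennreal e"
        using e by (intro order_tendstoD(2)) auto
      then obtain n where n: "emeasure \<nu> (?B n) < ennreal e"
        by (meson eventually_sequentially order_refl)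
      obtain q where q: "q \<in> \<rat>" "r < q" "q < r + 1 / real (Suc n)"
        using rat[of r "r + 1 / real (Suc n)"] by auto
      let ?C = "{x. r < \<phi> x \<and> \<phi> x \<le> q}"
      have C_meas [measurable]: "?C \<in> sets borel" by measurable
      have [measurable]: "Z ?C \<in> borel_measurable \<P>" using convD(2)[OF Z[OF C_meas]] .
      have "(\<lambda>x. indicator {x. \<phi> x \<le> r} x + indicator ?C x :: ennreal) = indicator {x. \<phi> x \<le> q}"
        using q by (auto simp: indicator_def fun_eq_iff)
      then have eq: "AE \<omega> in \<P>. G r \<omega> + Z ?C \<omega> = G q \<omega>"
        using conv_unique[OF conv_add[OF G Z[OF C_meas]], of r] G[of q] by simp
      have "(\<integral>\<^sup>+\<omega>. Fe \<omega> r \<partial>\<P>) \<le> (\<integral>\<^sup>+\<omega>. G q \<omega> \<partial>\<P>)"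
        unfolding Fe_def using q by (intro nn_integral_mono INF_lower) auto
      also have "\<dots> = (\<integral>\<^sup>+\<omega>. G r \<omega> + Z ?C \<omega> \<partial>\<P>)"
        using eq by (intro nn_integral_cong_AE) auto
      also have "\<dots> = (\<integral>\<^sup>+\<omega>. G r \<omega> \<partial>\<P>) + (\<integral>\<^sup>+\<omega>. Z ?C \<omega> \<partial>\<P>)"
        by (intro nn_integral_add) measurable
      also have "(\<integral>\<^sup>+\<omega>. Z ?C \<omega> \<partial>\<P>) \<le> (\<integral>\<^sup>+x. indicator ?C x \<partial>\<nu>)"
        by (rule conv_le[OF Z[OF C_meas]])
      also have "\<dots> = emeasure \<nu> ?C" by (rule nn_integral_indicator) simp
      also have "\<dots> \<le> emeasure \<nu> (?B n)"
        using q by (intro emeasure_mono) (auto simp del: of_nat_Suc)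
      also have "\<dots> \<le> ennreal e" using n by simp
      finally show "(\<integral>\<^sup>+\<omega>. Fe \<omega> r \<partial>\<P>) \<le> (\<integral>\<^sup>+\<omega>. G r \<omega> \<partial>\<P>) + ennreal e"
        by (simp add: add_left_mono)
    qed
    have "(\<integral>\<^sup>+\<omega>. G r \<omega> \<partial>\<P>) \<le> (\<integral>\<^sup>+x. indicator {x. \<phi> x \<le> r} x \<partial>\<nu>)"
      by (rule conv_le[OF G])
    also have "\<dots> < \<infinity>" by (simp add: nu.emeasure_finite less_top[symmetric])
    finally have G_fin: "(\<integral>\<^sup>+\<omega>. G r \<omega> \<partial>\<P>) < \<infinity>" .
    have "(\<integral>\<^sup>+\<omega>. Fe \<omega> r - G r \<omega> \<partial>\<P>) = (\<integral>\<^sup>+\<omega>. Fe \<omega> r \<partial>\<P>) - (\<integral>\<^sup>+\<omega>. G r \<omega> \<partial>\<P>)"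
      using G_fin 1 by (intro nn_integral_diff) auto
    also have "\<dots> = 0" using 2 G_fin by (simp add: diff_eq_0_iff_ennreal less_top)
    finally have "AE \<omega> in \<P>. Fe \<omega> r - G r \<omega> = 0"
      by (simp add: nn_integral_0_iff_AE)
    then show ?thesis
      using 1 AE_good
    proof eventually_elim
      fix \<omega> assume "Fe \<omega> r - G r \<omega> = 0" "G r \<omega> \<le> Fe \<omega> r" "good \<omega>"
      then show "ennreal (F \<omega> r) = G r \<omega>"
        using F_eq[of \<omega> r] Fe_fin[of \<omega> r] by (auto simp: diff_eq_0_iff_ennreal)
    qed
  qed
  define \<mu> where "\<mu> \<omega> = interval_measure (F \<omega>)" for \<omega>
  have \<mu>_Ioc: "emeasure (\<mu> \<omega>) {a<..b} = ennreal (F \<omega> b - F \<omega> a)" if "a \<le> b" for \<omega> a b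
    unfolding \<mu>_def by (rule emeasure_interval_measure_Ioc[of a b "F \<omega>", OF that F_mono F_rc])
  have \<mu>_UNIV: "emeasure (\<mu> \<omega>) UNIV = ennreal (F \<omega> 1)" for \<omega>
  proof -
    let ?I = "\<lambda>n::nat. {- real (Suc n)<..real (Suc n)}"
    have F1: "F \<omega> r = F \<omega> 1" if "r \<ge> 1" for r
    proof (cases "good \<omega>")
      case True
      have "ennreal (F \<omega> r) = ennreal (F \<omega> 1)" using F_ge1[OF True that] F_ge1[OF True, of 1] by simp
      then show ?thesis using True by (subst (asm) ennreal_inj) (auto simp: F_def)
    qed (simp add: F_def)
    have "(\<Union>n. ?I n) = UNIV"
    proof -
      have "\<exists>n. x \<in> ?I n" for x :: real
      proof -
        obtain n :: nat where "\<bar>x\<bar> < real n" using reals_Archimedean2 by blast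
        then show ?thesis by (intro exI[of _ n]) auto
      qed
      then show ?thesis by blast
    qed
    then have "emeasure (\<mu> \<omega>) UNIV = emeasure (\<mu> \<omega>) (\<Union>n. ?I n)" by simp
    also have "\<dots> = (SUP n. emeasure (\<mu> \<omega>) (?I n))"
      by (intro SUP_emeasure_incseq[symmetric]) (auto simp: \<mu>_def incseq_def)
    also have "\<dots> = (SUP n::nat. ennreal (F \<omega> 1))"
    proof (rule SUP_cong[OF refl])
      fix n :: nat
      show "emeasure (\<mu> \<omega>) (?I n) = ennreal (F \<omega> 1)"
        using \<mu>_Ioc[of "- real (Suc n)" "real (Suc n)" \<omega>] F1[of "real (Suc n)"] F_neg[of "- real (Suc n)" \<omega>]
        by simp
    qed
    finally show ?thesis by simp
  qed
  have sets_\<mu> [simp]: "sets (\<mu> \<omega>) = sets borel" and space_\<mu> [simp]: "space (\<mu> \<omega>) = UNIV" for \<omega>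
    by (simp_all add: \<mu>_def)
  have fin_\<mu>: "finite_measure (\<mu> \<omega>)" for \<omega>
    by (rule finite_measureI) (simp add: \<mu>_UNIV)
  \<comment> \<open>The identification concerns limits in mean for one set at a time, so the Dynkin
    system argument runs over this predicate and not over a fixed \<open>\<omega>\<close>.\<close>
  define D where "D B \<longleftrightarrow> conv (indicator (\<phi> -` B)) (\<lambda>\<omega>. emeasure (\<mu> \<omega>) B)" for B
  have [measurable]: "\<phi> -` B \<in> sets borel" if "B \<in> sets borel" for B
    using measurable_sets[of \<phi> borel borel B] that by simp
  have D_empty: "D {}"
  proof -
    have "(\<lambda>x. 0 * indicator UNIV x) = (indicator {} :: 'a \<Rightarrow> ennreal)"
      by (auto simp: fun_eq_iff)
    then have "conv (indicator {}) (\<lambda>\<omega>. 0 * Z UNIV \<omega>)"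
      using conv_cmult[OF Z[of UNIV], of 0] by simp
    then show ?thesis
      by (simp only: D_def vimage_empty emeasure_empty mult_zero_left)
  qed
  have D_UNIV: "D UNIV"
    unfolding D_def \<mu>_UNIV vimage_UNIV
    using AE_good by (intro conv_cong_AE[OF Z[of UNIV]]) (auto simp: F_ge1)
  have D_Ioc: "D {a<..b}" if "a \<le> b" for a b
  proof -
    have F: "conv (indicator {x. \<phi> x \<le> r}) (\<lambda>\<omega>. ennreal (F \<omega> r))" for r
      using AE_F[of r] by (intro conv_cong_AE[OF G]) auto
    have "conv (indicator ({x. \<phi> x \<le> b} - {x. \<phi> x \<le> a})) (\<lambda>\<omega>. ennreal (F \<omega> b) - ennreal (F \<omega> a))"
      using that by (intro conv_indicator_Diff F set_le) auto
    moreover have "{x. \<phi> x \<le> b} - {x. \<phi> x \<le> a} = \<phi> -` {a<..b}" by auto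
    moreover have "ennreal (F \<omega> b) - ennreal (F \<omega> a) = ennreal (F \<omega> b - F \<omega> a)" for \<omega>
      by (intro ennreal_minus) (auto simp: F_def)
    ultimately show ?thesis by (simp add: D_def \<mu>_Ioc[OF that])
  qed
  have D_all: "D B" if B: "B \<in> sets borel" for B
  proof -
    have sets_eq: "sigma_sets UNIV (range (\<lambda>(a, b). {a <.. b::real})) = sets borel"
      by (simp add: borel_sigma_sets_Ioc)
    have int: "Int_stable (range (\<lambda>(a, b). {a <.. b::real}))"
      by (auto simp: Int_stable_def)
    have B': "B \<in> sigma_sets UNIV (range (\<lambda>(a, b). {a <.. b::real}))"
      using B by (simp only: sets_eq)
    have sub: "range (\<lambda>(a, b). {a <.. b::real}) \<subseteq> Pow UNIV"
      by simp
    show ?thesis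
      using int sub B'
    proof (induction rule: sigma_sets_induct_disjoint)
      case (basic A)
      then obtain a b where A: "A = {a<..b}" by auto
      show ?case
        using D_Ioc[of a b] D_empty by (cases "a \<le> b") (auto simp: A)
    next
      case empty
      show ?case by (rule D_empty)
    next
      case (compl A)
      then have A: "A \<in> sets borel" by (simp only: sets_eq)
      interpret fm: finite_measure "\<mu> \<omega>" for \<omega> by (rule fin_\<mu>)
      have "conv (indicator (UNIV - \<phi> -` A)) (\<lambda>\<omega>. emeasure (\<mu> \<omega>) UNIV - emeasure (\<mu> \<omega>) A)"
        using compl.IH D_UNIV A unfolding D_def by (intro conv_indicator_Diff) auto
      moreover have "emeasure (\<mu> \<omega>) UNIV - emeasure (\<mu> \<omega>) A = emeasure (\<mu> \<omega>) (UNIV - A)" for \<omega>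
        using emeasure_compl[of A "\<mu> \<omega>"] A fm.emeasure_finite by simp
      ultimately show ?case by (simp add: D_def vimage_Diff)
    next
      case (union A)
      then have A: "A i \<in> sets borel" for i unfolding sets_eq by auto
      let ?U = "\<lambda>n::nat. \<Union>i<n. A i"
      have U_meas: "?U n \<in> sets borel" for n using A by auto
      have D_U: "D (?U n)" for n
      proof (induction n)
        case (Suc n)
        have "A n \<inter> A i = {}" if "i < n" for i
          using union.hyps(1) that by (simp add: disjoint_family_on_def)
        then have disj: "A n \<inter> ?U n = {}" by blast
        have "conv (\<lambda>x. indicator (\<phi> -` A n) x + indicator (\<phi> -` ?U n) x) (\<lambda>\<omega>. emeasure (\<mu> \<omega>) (A n) + emeasure (\<mu> \<omega>) (?U n))"
          using union.IH[of n] Suc unfolding D_def by (intro conv_add)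
        moreover have "(\<lambda>x. indicator (\<phi> -` A n) x + indicator (\<phi> -` ?U n) x :: ennreal) = indicator (\<phi> -` ?U (Suc n))"
          using disj by (auto simp: indicator_def fun_eq_iff lessThan_Suc)
        moreover have "emeasure (\<mu> \<omega>) (A n) + emeasure (\<mu> \<omega>) (?U n) = emeasure (\<mu> \<omega>) (?U (Suc n))" for \<omega>
          using A U_meas[of n] disj by (subst plus_emeasure) (auto simp: lessThan_Suc)
        ultimately show ?case by (simp add: D_def)
      qed (use D_empty in simp)
      have inc: "incseq ?U" by (force simp: incseq_def)
      have "conv (\<lambda>x. SUP n. indicator (\<phi> -` ?U n) x) (\<lambda>\<omega>. SUP n. emeasure (\<mu> \<omega>) (?U n))"
      proof (rule conv_SUP)
        show "conv (indicator (\<phi> -` ?U n)) (\<lambda>\<omega>. emeasure (\<mu> \<omega>) (?U n))" for n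
          using D_U[of n] by (simp add: D_def)
        show "incseq (\<lambda>n. indicator (\<phi> -` ?U n) :: 'a \<Rightarrow> ennreal)"
          using inc by (auto simp: incseq_def le_fun_def indicator_def)
        show "incseq (\<lambda>n. emeasure (\<mu> \<omega>) (?U n))" for \<omega>
          using U_meas by (intro incseq_emeasure inc) auto
        have "(\<integral>\<^sup>+x. (SUP n. indicator (\<phi> -` ?U n) x) \<partial>\<nu>) \<le> (\<integral>\<^sup>+x. 1 \<partial>\<nu>)"
          by (intro nn_integral_mono SUP_least) (auto simp: indicator_def)
        also have "\<dots> < \<infinity>" using nu.emeasure_finite[of UNIV] by (simp add: less_top[symmetric])
        finally show "(\<integral>\<^sup>+x. (SUP n. indicator (\<phi> -` ?U n) x) \<partial>\<nu>) < \<infinity>" .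
      qed
      moreover have "(SUP n. indicator (\<phi> -` ?U n) x :: ennreal) = indicator (\<phi> -` (\<Union>i. A i)) x" for x
      proof (rule antisym)
        show "(SUP n. indicator (\<phi> -` ?U n) x :: ennreal) \<le> indicator (\<phi> -` (\<Union>i. A i)) x"
          by (intro SUP_least) (auto simp: indicator_def)
        show "indicator (\<phi> -` (\<Union>i. A i)) x \<le> (SUP n. indicator (\<phi> -` ?U n) x :: ennreal)"
        proof (cases "x \<in> \<phi> -` (\<Union>i. A i)")
          case True
          then obtain i where "\<phi> x \<in> A i" by auto
          then show ?thesis by (intro SUP_upper2[of "Suc i"]) (auto simp: indicator_def)
        qed simp
      qed
      moreover have "(SUP n. emeasure (\<mu> \<omega>) (?U n)) = emeasure (\<mu> \<omega>) (\<Union>i. A i)" for \<omega>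
      proof -
        have "(SUP n. emeasure (\<mu> \<omega>) (?U n)) = emeasure (\<mu> \<omega>) (\<Union>n. ?U n)"
          using U_meas inc by (intro SUP_emeasure_incseq) auto
        also have "(\<Union>n. ?U n) = (\<Union>i. A i)" by blast
        finally show ?thesis .
      qed
      ultimately show ?case by (simp add: D_def)
    qed
  qed
  \<comment> \<open>Since \<open>\<psi>\<close> inverts \<open>\<phi>\<close> from the left, taking
    preimages under \<open>\<psi>\<close> and then under \<open>\<phi>\<close> gives back the
    original set. The limits transfer without asking whether \<open>\<mu>\<close> is carried by the
    range of \<open>\<phi>\<close>.\<close>
  define L where "L \<omega> = distr (\<mu> \<omega>) borel \<psi>" for \<omega>
  have sets_L [simp, measurable_cong]: "sets (L \<omega>) = sets borel" for \<omega> by (simp add: L_def)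
  have space_L [simp]: "space (L \<omega>) = UNIV" for \<omega> by (simp add: L_def)
  have \<psi>_\<mu>: "\<psi> \<in> \<mu> \<omega> \<rightarrow>\<^sub>M borel" for \<omega>
    by (simp add: \<mu>_def)
  have L_set: "conv (indicator A) (\<lambda>\<omega>. emeasure (L \<omega>) A)" if A: "A \<in> sets borel" for A
  proof -
    have "\<psi> -` A \<in> sets borel" using measurable_sets[of \<psi> borel borel A] A by simp
    from D_all[OF this] have "conv (indicator (\<phi> -` (\<psi> -` A))) (\<lambda>\<omega>. emeasure (\<mu> \<omega>) (\<psi> -` A))"
      by (simp add: D_def)
    moreover have "\<phi> -` (\<psi> -` A) = A" using \<psi>\<phi> by auto
    moreover have "emeasure (L \<omega>) A = emeasure (\<mu> \<omega>) (\<psi> -` A)" for \<omega>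
      unfolding L_def using A by (subst emeasure_distr[OF \<psi>_\<mu>]) auto
    ultimately show ?thesis by simp
  qed
  show thesis
  proof (rule that[of L])
    show "finite_measure (L \<omega>)" for \<omega>
      unfolding L_def by (intro finite_measure.finite_measure_distr fin_\<mu> \<psi>_\<mu>)
    fix f :: "'a \<Rightarrow> ennreal" assume "f \<in> borel_measurable borel" "(\<integral>\<^sup>+x. f x \<partial>\<nu>) < \<infinity>"
    then show "conv f (\<lambda>\<omega>. \<integral>\<^sup>+x. f x \<partial>L \<omega>)"
    proof (induction f rule: borel_measurable_induct)
      case (cong f g)
      then have "f = g" by auto
      then show ?case using cong by simp
    next
      case (set A)
      then show ?case using L_set[of A] by simp
    next
      case (mult u c)
      show ?case
      \<comment> \<open>For \<open>c = 0\<close> finiteness of the product says nothing about the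
        integral of \<open>u\<close>, so the induction hypothesis is out of reach.\<close>
      proof (cases "c = 0")
        case True
        then show ?thesis
          using conv_cmult[OF Z[of UNIV], of 0] by simp
      next
        case False
        have "c * (\<integral>\<^sup>+x. u x \<partial>\<nu>) < \<infinity>"
          using mult by (simp add: nn_integral_cmult)
        then have "(\<integral>\<^sup>+x. u x \<partial>\<nu>) < \<infinity>"
          using False by (auto simp: ennreal_mult_less_top)
        then have "conv (\<lambda>x. c * u x) (\<lambda>\<omega>. c * (\<integral>\<^sup>+x. u x \<partial>L \<omega>))"
          using mult by (intro conv_cmult) (auto simp: less_top)
        then show ?thesis using mult by (simp add: nn_integral_cmult)
      qed
    next
      case (add u v)
      then have "(\<integral>\<^sup>+x. v x \<partial>\<nu>) + (\<integral>\<^sup>+x. u x \<partial>\<nu>) < \<infinity>"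
        by (simp add: nn_integral_add)
      then have "conv (\<lambda>x. v x + u x) (\<lambda>\<omega>. (\<integral>\<^sup>+x. v x \<partial>L \<omega>) + (\<integral>\<^sup>+x. u x \<partial>L \<omega>))"
        using add by (intro conv_add) auto
      then show ?case using add by (simp add: nn_integral_add)
    next
      case (seq U)
      have fin: "(\<integral>\<^sup>+x. U i x \<partial>\<nu>) < \<infinity>" for i
      proof -
        have "(\<integral>\<^sup>+x. U i x \<partial>\<nu>) \<le> (\<integral>\<^sup>+x. (SUP i. U i) x \<partial>\<nu>)"
          by (intro nn_integral_mono) (auto intro: SUP_upper)
        then show ?thesis using seq.prems by auto
      qed
      have "conv (\<lambda>x. SUP i. U i x) (\<lambda>\<omega>. SUP i. \<integral>\<^sup>+x. U i x \<partial>L \<omega>)"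
      proof (rule conv_SUP)
        show "conv (U i) (\<lambda>\<omega>. \<integral>\<^sup>+x. U i x \<partial>L \<omega>)" for i
          using seq.IH[OF fin] .
        show "incseq (\<lambda>i. \<integral>\<^sup>+x. U i x \<partial>L \<omega>)" for \<omega>
          using seq.hyps by (auto simp: incseq_def le_fun_def intro!: nn_integral_mono)
      qed (use seq in \<open>auto simp: image_comp\<close>)
      moreover have "(SUP i. \<integral>\<^sup>+x. U i x \<partial>L \<omega>) = (\<integral>\<^sup>+x. (SUP i. U i x) \<partial>L \<omega>)" for \<omega>
        using seq.hyps by (intro nn_integral_monotone_convergence_SUP[symmetric]) auto
      ultimately show ?case by (simp add: image_comp)
    qed
  qed simp
qed

end

section \<open>The vague topology\<close>

lemma vague_topspace [simp]: "topspace vague_topology = finite_measures"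
  by (auto simp: vague_topology_def topspace_pullback_topology)

lemma Cc_support:
  assumes "f \<in> Cc"
  shows "continuous_on UNIV f" "compact (closure {x. f x \<noteq> 0})"
  using assms by (auto simp: Cc_def)

lemma Cc_measurable [measurable_dest]: "f \<in> Cc \<Longrightarrow> f \<in> borel_measurable borel"
  by (auto simp: Cc_def intro: borel_measurable_continuous_onI)

lemma Cc_bounded:
  fixes f :: "'a::topological_space \<Rightarrow> real"
  assumes "f \<in> Cc"
  obtains b where "\<And>x. \<bar>f x\<bar> \<le> b"
proof -
  let ?K = "closure {x. f x \<noteq> 0}"
  have "compact (f ` ?K)"
    using Cc_support[OF assms] by (intro compact_continuous_image) (auto intro: continuous_on_subset)
  then have "bounded (f ` ?K)" by (rule compact_imp_bounded)
  then obtain b where b: "\<And>y. y \<in> f ` ?K \<Longrightarrow> norm y \<le> b"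
    unfolding bounded_iff by blast
  have "\<bar>f x\<bar> \<le> max b 0" for x
  proof (cases "f x = 0")
    case False
    then have "x \<in> ?K" using closure_subset[of "{x. f x \<noteq> 0}"] by blast
    then show ?thesis using b[of "f x"] by auto
  qed simp
  then show thesis by (rule that)
qed

lemma Cc_integrable:
  assumes "f \<in> Cc" "\<mu> \<in> finite_measures"
  shows "integrable \<mu> f"
proof -
  interpret finite_measure \<mu> using assms by (auto simp: finite_measures_def)
  obtain b where "\<And>x. \<bar>f x\<bar> \<le> b" using Cc_bounded[OF assms(1)] by metis
  moreover have "sets \<mu> = sets borel" using assms by (auto simp: finite_measures_def)
  ultimately show ?thesis
    using assms(1) Cc_measurable[of f]
    by (intro integrable_const_bound[of f b]) (auto cong: measurable_cong_sets)
qed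

lemma Urysohn_Cc:
  fixes K U :: "'a::metric_space set"
  assumes "compact K" "K \<subseteq> U" "open U"
  shows "\<exists>u :: 'a \<Rightarrow> real. continuous_on UNIV u \<and> (\<forall>x. 0 \<le> u x \<and> u x \<le> 1) \<and> (\<forall>x\<in>K. u x = 1) \<and> (\<forall>x. x \<notin> U \<longrightarrow> u x = 0)"
proof -
  have "normal_space (euclidean :: 'a topology)"
    by (intro metrizable_imp_normal_space metrizable_space_euclidean)
  moreover have "closedin euclidean K" "closedin euclidean (- U)"
    using assms compact_imp_closed by auto
  moreover have "disjnt (- U) K" using assms by (auto simp: disjnt_def)
  ultimately obtain u where u: "continuous_map euclidean (top_of_set {0..1::real}) u" "u ` (- U) \<subseteq> {0}" "u ` K \<subseteq> {1}"
    using Urysohn_lemma[of "euclidean :: 'a topology" "- U" K 0 1] by auto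
  have "continuous_on UNIV u" "\<And>x. u x \<in> {0..1}"
    using u(1) by (auto simp: continuous_map_in_subtopology continuous_map_iff_continuous2 image_subset_iff)
  then show ?thesis using u by (intro exI[of _ u]) auto
qed

text \<open>Finite unions of base sets interpolate: covering \<open>K\<close>, and then the compact
  set so obtained, both within \<open>U\<close>, leads to one of countably many pairs, and each pair
  has its own Urysohn function.\<close>

lemma countable_Urysohn_family:
  assumes lc: "locally_compact_space (euclidean :: 'a::{metric_space, second_countable_topology} topology)"
  obtains D :: "nat \<Rightarrow> 'a::{metric_space, second_countable_topology} \<Rightarrow> real" where "\<And>n. D n \<in> Cc" "\<And>n x. 0 \<le> D n x" "\<And>n x. D n x \<le> 1"
    "\<And>K U. compact K \<Longrightarrow> open U \<Longrightarrow> K \<subseteq> U \<Longrightarrow> \<exists>n. (\<forall>x\<in>K. D n x = 1) \<and> (\<forall>x. x \<notin> U \<longrightarrow> D n x = 0)"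
proof -
  obtain \<B> :: "'a set set" where \<B>: "countable \<B>" "\<And>B. B \<in> \<B> \<Longrightarrow> open B" "\<And>B. B \<in> \<B> \<Longrightarrow> compact (closure B)"
    "\<And>U x. open U \<Longrightarrow> x \<in> U \<Longrightarrow> \<exists>B\<in>\<B>. x \<in> B \<and> closure B \<subseteq> U"
    using countable_precompact_basis[OF lc] by metis
  define \<F> where "\<F> = {F. finite F \<and> F \<subseteq> \<B>}"
  define V where "V F = \<Union> (closure ` F)" for F :: "'a set set"
  have V: "compact (V F)" "open (\<Union> F)" "\<Union> F \<subseteq> V F" if "F \<in> \<F>" for F
  proof -
    show "compact (V F)"
      using that \<B>(3) unfolding V_def \<F>_def by (intro compact_Union) auto
    show "open (\<Union> F)" using that \<B>(2) by (auto simp: \<F>_def)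
    show "\<Union> F \<subseteq> V F" unfolding V_def using closure_subset by blast
  qed
  have cover: "\<exists>F\<in>\<F>. K \<subseteq> \<Union> F \<and> V F \<subseteq> U" if K: "compact K" and U: "open U" "K \<subseteq> U" for K U :: "'a set"
  proof -
    let ?\<C> = "{B\<in>\<B>. closure B \<subseteq> U}"
    have "K \<subseteq> \<Union> ?\<C>"
    proof
      fix x assume "x \<in> K"
      then obtain B where "B \<in> \<B>" "x \<in> B" "closure B \<subseteq> U" using \<B>(4)[OF U(1), of x] U(2) by auto
      then show "x \<in> \<Union> ?\<C>" by blast
    qed
    moreover have "open B" if "B \<in> ?\<C>" for B using \<B>(2) that by simp
    ultimately obtain F where F: "F \<subseteq> ?\<C>" "finite F" "K \<subseteq> \<Union> F"
      by (rule compactE[OF K])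
    have "V F \<subseteq> U"
      unfolding V_def using F(1) by blast
    then show ?thesis using F by (intro bexI[of _ F]) (auto simp: \<F>_def)
  qed
  define P where "P = {(F, F'). F \<in> \<F> \<and> F' \<in> \<F> \<and> V F \<subseteq> \<Union> F'}"
  have "countable \<F>"
    unfolding \<F>_def using \<B>(1) by (rule countable_Collect_finite_subset)
  then have "countable (\<F> \<times> \<F>)"
    by (intro countable_SIGMA) auto
  moreover have "P \<subseteq> \<F> \<times> \<F>" by (auto simp: P_def)
  ultimately have cP: "countable P"
    by (rule countable_subset[rotated])
  have "({}, {}) \<in> P" by (auto simp: P_def \<F>_def V_def)
  then have P_ne: "P \<noteq> {}" by auto
  have "\<exists>u :: 'a \<Rightarrow> real. continuous_on UNIV u \<and> (\<forall>x. 0 \<le> u x \<and> u x \<le> 1) \<and> (\<forall>x\<in>V (fst p). u x = 1) \<and> (\<forall>x. x \<notin> \<Union> (snd p) \<longrightarrow> u x = 0)"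
    if p: "p \<in> P" for p
  proof -
    have "compact (V (fst p))" "V (fst p) \<subseteq> \<Union> (snd p)" "open (\<Union> (snd p))"
      using p V(1)[of "fst p"] V(2)[of "snd p"] unfolding P_def by (simp_all add: case_prod_beta)
    then show ?thesis by (rule Urysohn_Cc)
  qed
  then obtain u :: "'a set set \<times> 'a set set \<Rightarrow> 'a \<Rightarrow> real" where u: "\<And>p. p \<in> P \<Longrightarrow> continuous_on UNIV (u p)"
    "\<And>p x. p \<in> P \<Longrightarrow> 0 \<le> u p x \<and> u p x \<le> 1" "\<And>p x. p \<in> P \<Longrightarrow> x \<in> V (fst p) \<Longrightarrow> u p x = 1"
    "\<And>p x. p \<in> P \<Longrightarrow> x \<notin> \<Union> (snd p) \<Longrightarrow> u p x = 0"
    by metis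
  define e where "e = from_nat_into P"
  have e: "e n \<in> P" for n unfolding e_def by (rule from_nat_into[OF P_ne])
  show thesis
  proof (rule that[of "\<lambda>n. u (e n)"])
    fix n
    show "u (e n) \<in> Cc"
      unfolding Cc_def
    proof (intro CollectI conjI u(1) e)
      have sub: "{x. u (e n) x \<noteq> 0} \<subseteq> V (snd (e n))"
      proof
        fix x assume "x \<in> {x. u (e n) x \<noteq> 0}"
        then have "x \<in> \<Union> (snd (e n))" using u(4)[OF e] by blast
        moreover have "snd (e n) \<in> \<F>" using e[of n] by (auto simp: P_def)
        ultimately show "x \<in> V (snd (e n))" using V(3) by blast
      qed
      have cV: "compact (V (snd (e n)))"
        using e[of n] by (intro V(1)) (auto simp: P_def)
      have "closure {x. u (e n) x \<noteq> 0} \<subseteq> V (snd (e n))"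
        by (rule closure_minimal[OF sub compact_imp_closed[OF cV]])
      with cV show "compact (closure {x. u (e n) x \<noteq> 0})"
        by (metis closed_closure compact_Int_closed inf.absorb_iff2)
    qed
    show "0 \<le> u (e n) x" "u (e n) x \<le> 1" for x using u(2)[OF e] by auto
  next
    fix K U :: "'a set" assume K: "compact K" and U: "open U" "K \<subseteq> U"
    obtain F where F: "F \<in> \<F>" "K \<subseteq> \<Union> F" "V F \<subseteq> U" using cover[OF K U] by blast
    obtain F' where F': "F' \<in> \<F>" "V F \<subseteq> \<Union> F'" "V F' \<subseteq> U"
      using cover[OF V(1)[OF F(1)] U(1) F(3)] by blast
    have p: "(F, F') \<in> P" using F F' by (auto simp: P_def)
    then obtain n where n: "e n = (F, F')"
      unfolding e_def using from_nat_into_surj[OF cP] by metis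
    have "\<forall>x\<in>K. u (e n) x = 1"
      using u(3)[OF p] V(3)[OF F(1)] F(2) unfolding n fst_conv by blast
    moreover have "\<forall>x. x \<notin> U \<longrightarrow> u (e n) x = 0"
      using u(4)[OF p] V(3)[OF F'(1)] F'(3) unfolding n snd_conv by blast
    ultimately show "\<exists>n. (\<forall>x\<in>K. u (e n) x = 1) \<and> (\<forall>x. x \<notin> U \<longrightarrow> u (e n) x = 0)" by blast
  qed
qed

text \<open>Layer cake: \<open>D (n l)\<close> separates the level sets \<open>{f \<ge> (l + 1) \<eta>}\<close> and \<open>{f > l \<eta>}\<close>.\<close>

lemma Urysohn_family_approx:
  fixes D :: "nat \<Rightarrow> 'a::metric_space \<Rightarrow> real"
  assumes D: "\<And>n x. 0 \<le> D n x" "\<And>n x. D n x \<le> 1"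
    "\<And>K U. compact K \<Longrightarrow> open U \<Longrightarrow> K \<subseteq> U \<Longrightarrow> \<exists>n. (\<forall>x\<in>K. D n x = 1) \<and> (\<forall>x. x \<notin> U \<longrightarrow> D n x = 0)"
    and f: "f \<in> Cc" "\<And>x. 0 \<le> f x"
  obtains g where "\<And>\<eta>. \<eta> > 0 \<Longrightarrow> \<exists>(N::nat) n. \<forall>x. \<bar>f x - (\<Sum>l<N. \<eta> * D (n l) x)\<bar> \<le> \<eta> * D g x"
proof -
  let ?K = "closure {x. f x \<noteq> 0}"
  \<comment> \<open>A function equal to \<open>1\<close> on the support turns the uniform error
    \<open>\<eta>\<close> into a multiple of a member of the family, whose integral depends
    continuously on the measure.\<close>
  obtain g where g: "\<And>x. x \<in> ?K \<Longrightarrow> D g x = 1"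
    using D(3)[of ?K UNIV] Cc_support(2)[OF f(1)] by auto
  obtain b where b: "\<And>x. \<bar>f x\<bar> \<le> b" using Cc_bounded[OF f(1)] by metis
  have cont: "continuous_on UNIV f" by (rule Cc_support[OF f(1)])
  have "\<exists>(N::nat) n. \<forall>x. \<bar>f x - (\<Sum>l<N. \<eta> * D (n l) x)\<bar> \<le> \<eta> * D g x" if \<eta>: "\<eta> > 0" for \<eta>
  proof -
    have ex: "\<exists>n. (\<forall>x\<in>{x. real (Suc l) * \<eta> \<le> f x}. D n x = 1) \<and> (\<forall>x. x \<notin> {x. real l * \<eta> < f x} \<longrightarrow> D n x = 0)" for l :: nat
    proof (rule D(3))
      show "open {x. real l * \<eta> < f x}"
        using cont by (intro open_Collect_less continuous_on_const)
      have pos: "0 < real (Suc l) * \<eta>" using \<eta> by simp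
      have "{x. real (Suc l) * \<eta> \<le> f x} \<subseteq> ?K"
      proof
        fix x assume "x \<in> {x. real (Suc l) * \<eta> \<le> f x}"
        then have "real (Suc l) * \<eta> \<le> f x" by (rule CollectD)
        with pos have "f x \<noteq> 0" by linarith
        then show "x \<in> ?K" by (intro subsetD[OF closure_subset] CollectI)
      qed
      moreover have "closed {x. real (Suc l) * \<eta> \<le> f x}"
        using cont by (intro closed_Collect_le continuous_on_const)
      ultimately show "compact {x. real (Suc l) * \<eta> \<le> f x}"
        using Cc_support(2)[OF f(1)] by (metis compact_Int_closed inf.absorb_iff2)
      show "{x. real (Suc l) * \<eta> \<le> f x} \<subseteq> {x. real l * \<eta> < f x}"
      proof
        fix x assume "x \<in> {x. real (Suc l) * \<eta> \<le> f x}"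
        then have "real (Suc l) * \<eta> \<le> f x" by (rule CollectD)
        moreover have "real l * \<eta> < real (Suc l) * \<eta>" using \<eta> by simp
        ultimately have "real l * \<eta> < f x" by linarith
        then show "x \<in> {x. real l * \<eta> < f x}" by (rule CollectI)
      qed
    qed
    define n where "n l = (SOME n. (\<forall>x\<in>{x. real (Suc l) * \<eta> \<le> f x}. D n x = 1) \<and> (\<forall>x. x \<notin> {x. real l * \<eta> < f x} \<longrightarrow> D n x = 0))" for l
    have n: "real (Suc l) * \<eta> \<le> f x \<Longrightarrow> D (n l) x = 1" "\<not> real l * \<eta> < f x \<Longrightarrow> D (n l) x = 0" for l x
      using someI_ex[OF ex[of l]] unfolding n_def by blast+
    \<comment> \<open>Enough levels to exceed the maximum of \<open>f\<close>.\<close>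
    obtain N :: nat where N: "b / \<eta> < real N" using reals_Archimedean2 by blast
    have "\<bar>f x - (\<Sum>l<N. \<eta> * D (n l) x)\<bar> \<le> \<eta> * D g x" for x
    proof (cases "f x = 0")
      case True
      then have "D (n l) x = 0" for l using \<eta> by (intro n(2)) (simp add: mult_nonneg_nonneg not_less)
      then show ?thesis using True \<eta> D(1) by simp
    next
      case False
      then have "x \<in> ?K" using closure_subset[of "{x. f x \<noteq> 0}"] by blast
      then have gx: "D g x = 1" by (rule g)
      \<comment> \<open>The level of \<open>x\<close>: lower levels contribute \<open>\<eta>\<close>
        each, higher ones nothing, and level \<open>k\<close> itself something between
        \<open>0\<close> and \<open>\<eta>\<close>.\<close>
      define k where "k = nat \<lfloor>f x / \<eta>\<rfloor>"
      have fx: "0 \<le> f x / \<eta>" using f(2)[of x] \<eta> by simp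
      have k: "real k * \<eta> \<le> f x" "f x < real (Suc k) * \<eta>"
      proof -
        have "real k = real_of_int \<lfloor>f x / \<eta>\<rfloor>" using fx by (simp add: k_def)
        then have "real k \<le> f x / \<eta>" "f x / \<eta> < real k + 1" by linarith+
        with \<eta> show "real k * \<eta> \<le> f x" "f x < real (Suc k) * \<eta>" by (simp_all add: field_simps)
      qed
      have kN: "k < N"
      proof -
        have "real k * \<eta> < real N * \<eta>"
        proof -
          have "b < real N * \<eta>" using N \<eta> by (simp add: pos_divide_less_eq)
          then show ?thesis using k(1) b[of x] by linarith
        qed
        then show ?thesis using \<eta> by simp
      qed
      have D1: "D (n l) x = 1" if "l < k" for l
      proof (rule n(1))
        have "real (Suc l) * \<eta> \<le> real k * \<eta>" using that \<eta> by (intro mult_right_mono) auto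
        then show "real (Suc l) * \<eta> \<le> f x" using k(1) by linarith
      qed
      have D0: "D (n l) x = 0" if "k < l" for l
      proof (rule n(2))
        have "real (Suc k) * \<eta> \<le> real l * \<eta>" using that \<eta> by (intro mult_right_mono) auto
        then show "\<not> real l * \<eta> < f x" using k(2) by linarith
      qed
      have "(\<Sum>l<N. \<eta> * D (n l) x) = (\<Sum>l<Suc k. \<eta> * D (n l) x)"
        using kN D0 by (intro sum.mono_neutral_right) auto
      also have "\<dots> = (\<Sum>l<k. \<eta>) + \<eta> * D (n k) x"
        using D1 by simp
      finally have "(\<Sum>l<N. \<eta> * D (n l) x) = real k * \<eta> + \<eta> * D (n k) x"
        by simp
      moreover have "0 \<le> \<eta> * D (n k) x" "\<eta> * D (n k) x \<le> \<eta>"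
        using D(1,2)[of "n k" x] \<eta> by (auto simp: mult_left_le)
      moreover have "real (Suc k) * \<eta> = real k * \<eta> + \<eta>" by (simp add: algebra_simps)
      ultimately show ?thesis using k unfolding gx by linarith
    qed
    then show ?thesis by (intro exI[of _ N] exI[of _ n] allI)
  qed
  then show thesis by (rule that)
qed


section \<open>The vague topology in countably many coordinates\<close>

locale vague_family =
  fixes D :: "nat \<Rightarrow> 'a::{metric_space, second_countable_topology} \<Rightarrow> real"
  assumes D_Cc: "D n \<in> Cc" and D_nonneg: "0 \<le> D n x" and D_le: "D n x \<le> 1"
    and D_sep: "compact K \<Longrightarrow> open U \<Longrightarrow> K \<subseteq> U \<Longrightarrow> \<exists>n. (\<forall>x\<in>K. D n x = 1) \<and> (\<forall>x. x \<notin> U \<longrightarrow> D n x = 0)"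
begin

text \<open>These integrals serve as coordinates: they map finite measures into the space of real
  sequences, whose Borel sets are generated by countably many coordinates.\<close>

definition ev :: "'a measure \<Rightarrow> nat \<Rightarrow> real" where
  "ev \<mu> n = (\<integral>x. D n x \<partial>\<mu>)"

abbreviation ev_topology :: "'a measure topology" where
  "ev_topology \<equiv> pullback_topology finite_measures ev euclidean"

text \<open>Sums from the family approximate \<open>f\<close> up to \<open>\<eta> * D g\<close>, so
  the error of the integral is controlled by \<open>ev \<mu>' g\<close>. This quantity is continuous
  and hence bounded near \<open>\<mu>\<close>.\<close>

lemma continuous_map_integral_nonneg:
  assumes f: "f \<in> Cc" "\<And>x. 0 \<le> f x"
  shows "continuous_map ev_topology euclideanreal (\<lambda>\<mu>. \<integral>x. f x \<partial>\<mu>)"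
proof -
  obtain g where g: "\<And>\<eta>. \<eta> > 0 \<Longrightarrow> \<exists>(N::nat) n. \<forall>x. \<bar>f x - (\<Sum>l<N. \<eta> * D (n l) x)\<bar> \<le> \<eta> * D g x"
    using Urysohn_family_approx[of D f] D_nonneg D_le D_sep f by metis
  have ev_cont: "continuous_map ev_topology euclideanreal (\<lambda>\<mu>. ev \<mu> n)" for n
  proof -
    have "continuous_map ev_topology euclidean ev"
      by (intro continuous_map_pullback[of euclidean euclidean id, simplified])
    then show ?thesis
      by (rule continuous_map_compose[of _ _ ev _ "\<lambda>h. h n", unfolded comp_def])
        (auto intro: continuous_on_product_coordinates)
  qed
  show ?thesis
    unfolding continuous_map_atin
  proof (intro ballI)
    fix \<mu> assume \<mu>: "\<mu> \<in> topspace ev_topology"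
    then have \<mu>_fin: "\<mu> \<in> finite_measures" by (simp add: topspace_pullback_topology)
    have lim: "((\<lambda>\<mu>. ev \<mu> n) \<longlongrightarrow> ev \<mu> n) (atin ev_topology \<mu>)" for n
      using ev_cont[of n] \<mu> unfolding continuous_map_atin by (simp add: limitin_canonical_iff)
    have ev_fin: "\<forall>\<^sub>F \<mu>' in atin ev_topology \<mu>. \<mu>' \<in> finite_measures"
      by (auto simp: eventually_atin topspace_pullback_topology intro!: exI[of _ "topspace ev_topology"])
    have "((\<lambda>\<mu>. \<integral>x. f x \<partial>\<mu>) \<longlongrightarrow> (\<integral>x. f x \<partial>\<mu>)) (atin ev_topology \<mu>)"
    proof (rule tendstoI)
      fix e :: real assume e: "e > 0"
      \<comment> \<open>A bound for \<open>ev \<mu>' g\<close> at \<open>\<mu>\<close> and, by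
        continuity, near it. It fixes \<open>\<eta>\<close> so that each approximation error is at
        most \<open>e / 3\<close>.\<close>
      define c where "c = ev \<mu> g + 1"
      have ev_nonneg: "0 \<le> ev \<mu>' n" for \<mu>' n
        unfolding ev_def by (intro integral_nonneg_AE) (simp add: D_nonneg)
      have c: "c > 0" using ev_nonneg[of \<mu> g] by (simp add: c_def)
      define \<eta> where "\<eta> = e / (3 * c)"
      have \<eta>: "\<eta> > 0" using e c by (simp add: \<eta>_def)
      obtain N :: nat and n where "\<forall>x. \<bar>f x - (\<Sum>l<N. \<eta> * D (n l) x)\<bar> \<le> \<eta> * D g x"
        using g[OF \<eta>] by (elim exE) (rule that)
      then have Nn: "\<bar>f x - (\<Sum>l<N. \<eta> * D (n l) x)\<bar> \<le> \<eta> * D g x" for x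
        by (rule spec)
      have approx: "\<bar>(\<integral>x. f x \<partial>\<mu>') - (\<Sum>l<N. \<eta> * ev \<mu>' (n l))\<bar> \<le> \<eta> * ev \<mu>' g" if fm: "\<mu>' \<in> finite_measures" for \<mu>'
      proof -
        have int: "integrable \<mu>' f" "integrable \<mu>' (D k)" for k
          using f D_Cc fm by (auto intro: Cc_integrable)
        have "(\<integral>x. f x \<partial>\<mu>') - (\<Sum>l<N. \<eta> * ev \<mu>' (n l)) = (\<integral>x. f x - (\<Sum>l<N. \<eta> * D (n l) x) \<partial>\<mu>')"
          using int by (simp add: ev_def)
        also have "\<bar>\<dots>\<bar> \<le> (\<integral>x. \<bar>f x - (\<Sum>l<N. \<eta> * D (n l) x)\<bar> \<partial>\<mu>')"
          by (rule integral_abs_bound)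
        also have "\<dots> \<le> (\<integral>x. \<eta> * D g x \<partial>\<mu>')"
          using int Nn by (intro integral_mono) auto
        finally show ?thesis by (simp add: ev_def)
      qed
      have sum_lim: "((\<lambda>\<mu>. \<Sum>l<N. \<eta> * ev \<mu> (n l)) \<longlongrightarrow> (\<Sum>l<N. \<eta> * ev \<mu> (n l))) (atin ev_topology \<mu>)"
        by (intro tendsto_sum tendsto_mult tendsto_const lim)
      have "\<forall>\<^sub>F \<mu>' in atin ev_topology \<mu>. dist (\<Sum>l<N. \<eta> * ev \<mu>' (n l)) (\<Sum>l<N. \<eta> * ev \<mu> (n l)) < e / 3"
        using e by (intro tendstoD[OF sum_lim]) auto
      moreover have "\<forall>\<^sub>F \<mu>' in atin ev_topology \<mu>. ev \<mu>' g < c"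
        by (intro order_tendstoD(2)[OF lim]) (simp add: c_def)
      ultimately show "\<forall>\<^sub>F \<mu>' in atin ev_topology \<mu>. dist (\<integral>x. f x \<partial>\<mu>') (\<integral>x. f x \<partial>\<mu>) < e"
        using ev_fin
      proof eventually_elim
        fix \<mu>' assume h: "dist (\<Sum>l<N. \<eta> * ev \<mu>' (n l)) (\<Sum>l<N. \<eta> * ev \<mu> (n l)) < e / 3" "ev \<mu>' g < c" "\<mu>' \<in> finite_measures"
        have "\<eta> * ev \<mu>' g \<le> \<eta> * c" "\<eta> * ev \<mu> g \<le> \<eta> * c"
          using h(2) \<eta> by (auto simp: c_def)
        moreover have "\<eta> * c = e / 3" using c by (simp add: \<eta>_def)
        ultimately show "dist (\<integral>x. f x \<partial>\<mu>') (\<integral>x. f x \<partial>\<mu>) < e"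
          using approx[OF h(3)] approx[OF \<mu>_fin] h(1) unfolding dist_real_def by linarith
      qed
    qed
    then show "limitin euclideanreal (\<lambda>\<mu>. \<integral>x. f x \<partial>\<mu>) (\<integral>x. f x \<partial>\<mu>) (atin ev_topology \<mu>)"
      by (simp add: limitin_canonical_iff)
  qed
qed

lemma Cc_pos_part:
  fixes f :: "'a \<Rightarrow> real"
  assumes "f \<in> Cc"
  shows "(\<lambda>x. max 0 (f x)) \<in> Cc" "(\<lambda>x. max 0 (- f x)) \<in> Cc"
proof -
  have "compact (closure {x. h x \<noteq> 0})" if "{x. h x \<noteq> 0} \<subseteq> {x. f x \<noteq> 0}" for h :: "'a \<Rightarrow> real"
    using Cc_support(2)[OF assms] closure_mono[OF that]
    by (metis closed_closure compact_Int_closed inf.absorb_iff2)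
  note supp = this
  have "compact (closure {x. max 0 (f x) \<noteq> 0})" "compact (closure {x. max 0 (- f x) \<noteq> 0})"
    by (rule supp, auto)+
  then show "(\<lambda>x. max 0 (f x)) \<in> Cc" "(\<lambda>x. max 0 (- f x)) \<in> Cc"
    using Cc_support(1)[OF assms] unfolding Cc_def by (auto intro!: continuous_intros)
qed

lemma continuous_map_integral:
  assumes f: "f \<in> Cc"
  shows "continuous_map ev_topology euclideanreal (\<lambda>\<mu>. \<integral>x. f x \<partial>\<mu>)"
proof -
  have "continuous_map ev_topology euclideanreal (\<lambda>\<mu>. (\<integral>x. max 0 (f x) \<partial>\<mu>) - (\<integral>x. max 0 (- f x) \<partial>\<mu>))"
    using f by (intro continuous_map_diff continuous_map_integral_nonneg Cc_pos_part) auto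
  then show ?thesis
  proof (rule continuous_map_eq)
    fix \<mu> assume "\<mu> \<in> topspace ev_topology"
    then have "\<mu> \<in> finite_measures" by (simp add: topspace_pullback_topology)
    then have "(\<integral>x. max 0 (f x) \<partial>\<mu>) - (\<integral>x. max 0 (- f x) \<partial>\<mu>) = (\<integral>x. max 0 (f x) - max 0 (- f x) \<partial>\<mu>)"
      using f by (intro Bochner_Integration.integral_diff[symmetric] Cc_integrable Cc_pos_part)
    also have "\<dots> = (\<integral>x. f x \<partial>\<mu>)"
      by (intro Bochner_Integration.integral_cong) auto
    finally show "(\<integral>x. max 0 (f x) \<partial>\<mu>) - (\<integral>x. max 0 (- f x) \<partial>\<mu>) = (\<integral>x. f x \<partial>\<mu>)" .
  qed
qed

text \<open>Integrals of all \<open>Cc\<close> functions are continuous in the coordinates, so a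
  vaguely open set is the preimage of an open set of sequences. Measurability and sequential
  continuity for the vague topology both reduce to coordinates in this way.\<close>

lemma openin_vague_imp_ev:
  assumes "openin vague_topology V"
  obtains O' where "open O'" "V = ev -` O' \<inter> finite_measures"
proof -
  let ?h = "\<lambda>\<mu>. \<lambda>f\<in>Cc. \<integral>x. f x \<partial>\<mu>" and ?T = "product_topology (\<lambda>_. euclideanreal) Cc"
  obtain U where U: "openin ?T U" "V = ?h -` U \<inter> finite_measures"
    using assms unfolding vague_topology_def openin_pullback_topology by auto
  have "continuous_map ev_topology ?T ?h"
    unfolding continuous_map_componentwise
  proof (intro conjI ballI)
    show "continuous_map ev_topology euclideanreal (\<lambda>\<mu>. ?h \<mu> f)" if "f \<in> Cc" for f
      using continuous_map_integral[OF that] that by simp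
  qed auto
  then have "openin ev_topology {\<mu>\<in>topspace ev_topology. ?h \<mu> \<in> U}"
    using U(1) by (rule openin_continuous_map_preimage)
  also have "{\<mu>\<in>topspace ev_topology. ?h \<mu> \<in> U} = V"
    using U(2) by (auto simp: topspace_pullback_topology)
  finally show thesis
    using that unfolding openin_pullback_topology by auto
qed

lemma measurable_vague:
  assumes L: "\<And>\<omega>. \<omega> \<in> space N \<Longrightarrow> L \<omega> \<in> finite_measures"
    and meas: "\<And>n. (\<lambda>\<omega>. ev (L \<omega>) n) \<in> borel_measurable N"
  shows "L \<in> N \<rightarrow>\<^sub>M borel_of vague_topology"
proof (rule measurable_borel_ofI)
  fix V :: "'a measure set" assume "openin vague_topology V"
  then obtain O' where O': "open O'" "V = ev -` O' \<inter> finite_measures"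
    by (rule openin_vague_imp_ev)
  have "(\<lambda>\<omega>. ev (L \<omega>)) \<in> borel_measurable N"
    by (rule measurable_coordinatewise_then_product) (rule meas)
  then have "(\<lambda>\<omega>. ev (L \<omega>)) -` O' \<inter> space N \<in> sets N"
    using O'(1) by (intro measurable_sets) auto
  also have "(\<lambda>\<omega>. ev (L \<omega>)) -` O' \<inter> space N = L -` V \<inter> space N"
    using L O'(2) by auto
  finally show "L -` V \<inter> space N \<in> sets N" .
qed (use L in auto)

lemma continuous_vague_tendsto:
  assumes \<Phi>: "continuous_map vague_topology euclideanreal \<Phi>"
    and \<mu>: "\<And>k. \<mu> k \<in> finite_measures" "\<mu>0 \<in> finite_measures"
    and lim: "\<And>n. (\<lambda>k. ev (\<mu> k) n) \<longlonglongrightarrow> ev \<mu>0 n"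
  shows "(\<lambda>k. \<Phi> (\<mu> k)) \<longlonglongrightarrow> \<Phi> \<mu>0"
proof (rule topological_tendstoI)
  fix S :: "real set" assume S: "open S" "\<Phi> \<mu>0 \<in> S"
  have "openin vague_topology {\<mu>\<in>topspace vague_topology. \<Phi> \<mu> \<in> S}"
    using \<Phi> S(1) by (intro openin_continuous_map_preimage) auto
  then obtain O' where O': "open O'" "{\<mu>\<in>topspace vague_topology. \<Phi> \<mu> \<in> S} = ev -` O' \<inter> finite_measures"
    by (rule openin_vague_imp_ev)
  have "ev \<mu>0 \<in> O'" using O'(2) S(2) \<mu>(2) by auto
  moreover have "(\<lambda>k. ev (\<mu> k)) \<longlonglongrightarrow> ev \<mu>0"
  proof -
    have "limitin (product_topology (\<lambda>_. euclideanreal) UNIV) (\<lambda>k. ev (\<mu> k)) (ev \<mu>0) sequentially"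
      by (simp add: limitin_componentwise lim)
    then show ?thesis
      by (simp only: euclidean_product_topology limitin_canonical_iff)
  qed
  ultimately have "\<forall>\<^sub>F k in sequentially. ev (\<mu> k) \<in> O'"
    using O'(1) by (auto dest: topological_tendstoD)
  then show "\<forall>\<^sub>F k in sequentially. \<Phi> (\<mu> k) \<in> S"
    by eventually_elim (use O'(2) \<mu>(1) in auto)
qed

end

section \<open>Vague convergence of the limiting random measure\<close>

lemma enn2real_diff_le_ed: "ennreal \<bar>enn2real a - enn2real b\<bar> \<le> ed a b"
proof (cases "a = \<top> \<or> b = \<top>")
  case True
  then show ?thesis by (auto simp: ed_def)
next
  case False
  then obtain x y where "a = ennreal x" "b = ennreal y" "x \<ge> 0" "y \<ge> 0"
    by (metis ennreal_cases)
  then show ?thesis by (simp add: ed_ennreal)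
qed

lemma measurable_continuous_map:
  assumes "continuous_map T euclideanreal \<Phi>"
  shows "\<Phi> \<in> borel_of T \<rightarrow>\<^sub>M borel"
proof (rule borel_measurableI)
  fix S :: "real set" assume "open S"
  then have "openin T {x\<in>topspace T. \<Phi> x \<in> S}"
    using assms by (intro openin_continuous_map_preimage) auto
  then have "{x\<in>topspace T. \<Phi> x \<in> S} \<in> sets (borel_of T)"
    by (rule openin_sets_borel_of)
  moreover have "\<Phi> -` S \<inter> space (borel_of T) = {x\<in>topspace T. \<Phi> x \<in> S}"
    by (auto simp: borel_of_def space_measure_of_conv)
  ultimately show "\<Phi> -` S \<inter> space (borel_of T) \<in> sets (borel_of T)"
    by simp
qed

lemma AE_tendsto_0_of_summable:
  fixes g :: "nat \<Rightarrow> 'w \<Rightarrow> ennreal"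
  assumes [measurable]: "\<And>k. g k \<in> borel_measurable M"
    and le: "\<And>k. k \<ge> n \<Longrightarrow> (\<integral>\<^sup>+\<omega>. g k \<omega> \<partial>M) \<le> ennreal ((1 / 2) ^ k)"
  shows "AE \<omega> in M. (\<lambda>k. g k \<omega>) \<longlonglongrightarrow> 0"
proof -
  have "(\<integral>\<^sup>+\<omega>. (\<Sum>k. g (k + n) \<omega>) \<partial>M) = (\<Sum>k. \<integral>\<^sup>+\<omega>. g (k + n) \<omega> \<partial>M)"
    by (intro nn_integral_suminf) measurable
  also have "\<dots> \<le> (\<Sum>k. ennreal ((1 / 2) ^ k))"
  proof (intro suminf_le)
    fix k
    have "(\<integral>\<^sup>+\<omega>. g (k + n) \<omega> \<partial>M) \<le> ennreal ((1 / 2) ^ (k + n))" by (intro le) simp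
    also have "\<dots> \<le> ennreal ((1 / 2) ^ k)" by (intro ennreal_leI power_decreasing) auto
    finally show "(\<integral>\<^sup>+\<omega>. g (k + n) \<omega> \<partial>M) \<le> ennreal ((1 / 2) ^ k)" .
  qed auto
  also have "\<dots> = ennreal (\<Sum>k. (1 / 2) ^ k)"
    by (intro suminf_ennreal2) (auto intro: summable_geometric)
  finally have "(\<integral>\<^sup>+\<omega>. (\<Sum>k. g (k + n) \<omega>) \<partial>M) \<noteq> \<infinity>"
    by (auto simp: top_unique)
  then have "AE \<omega> in M. (\<Sum>k. g (k + n) \<omega>) \<noteq> \<infinity>"
    by (intro nn_integral_noteq_infinite) measurable
  then show ?thesis
  proof eventually_elim
    fix \<omega> assume fin: "(\<Sum>k. g (k + n) \<omega>) \<noteq> \<infinity>"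
    define h where "h k = enn2real (g (k + n) \<omega>)" for k
    have g: "g (k + n) \<omega> = ennreal (h k)" for k
    proof -
      have "g (k + n) \<omega> \<le> (\<Sum>k. g (k + n) \<omega>)"
        using sum_le_suminf[of "\<lambda>k. g (k + n) \<omega>" "{k}"] by simp
      then have "g (k + n) \<omega> < \<top>" using fin by (simp add: less_top order_le_less_trans)
      then show ?thesis by (simp add: h_def)
    qed
    have "summable h"
      using fin unfolding g by (intro summable_suminf_not_top) (auto simp: h_def)
    then have "h \<longlonglongrightarrow> 0" by (rule summable_LIMSEQ_zero)
    then have "(\<lambda>k. ennreal (h k)) \<longlonglongrightarrow> 0"
      by (subst ennreal_tendsto_0_iff) (auto simp: h_def)
    then have "(\<lambda>k. g (k + n) \<omega>) \<longlonglongrightarrow> 0" by (simp add: g)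
    then show "(\<lambda>k. g k \<omega>) \<longlonglongrightarrow> 0" by (rule LIMSEQ_offset)
  qed
qed

text \<open>\<open>N\<close> stands for the conditioned law. The bound by a constant multiple of
  \<open>\<P>\<close> transfers null sets and moment estimates to it, so these are all obtained
  under \<open>\<P>\<close>. \<open>L\<close> is the regularised limit and \<open>Y\<close> the
  approximations as actual measures.\<close>

locale random_measure_limit = random_measures \<P> \<nu> W
  for \<P> :: "'w measure" and \<nu> :: "'a::{metric_space, second_countable_topology} measure" and W +
  fixes L :: "'w \<Rightarrow> 'a measure" and Y :: "real \<Rightarrow> 'w \<Rightarrow> 'a measure" and N :: "'w measure" and c :: ennreal
  assumes sets_L [simp]: "sets (L \<omega>) = sets borel" and finite_L: "finite_measure (L \<omega>)"
    and conv_L: "f \<in> borel_measurable borel \<Longrightarrow> (\<integral>\<^sup>+x. f x \<partial>\<nu>) < \<infinity> \<Longrightarrow> conv f (\<lambda>\<omega>. \<integral>\<^sup>+x. f x \<partial>L \<omega>)"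
    and sets_Y [simp]: "sets (Y \<epsilon> \<omega>) = sets borel"
    and nn_integral_Y: "0 < \<epsilon> \<Longrightarrow> \<omega> \<in> space \<P> \<Longrightarrow> f \<in> borel_measurable borel \<Longrightarrow> (\<integral>\<^sup>+x. f x \<partial>Y \<epsilon> \<omega>) = W \<epsilon> f \<omega>"
    and moment: "\<exists>B<\<infinity>. \<forall>\<epsilon>. (\<integral>\<^sup>+\<omega>. W \<epsilon> (\<lambda>_. 1) \<omega> ^ k \<partial>\<P>) \<le> B"
    and sets_N [measurable_cong, simp]: "sets N = sets \<P>"
    and N_le: "g \<in> borel_measurable \<P> \<Longrightarrow> (\<integral>\<^sup>+\<omega>. g \<omega> \<partial>N) \<le> c * (\<integral>\<^sup>+\<omega>. g \<omega> \<partial>\<P>)"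
    and c: "c < \<infinity>"
begin

lemma space_N [simp]: "space N = space \<P>"
  using sets_eq_imp_space_eq[OF sets_N] .

lemma finite_measure_N: "finite_measure N"
proof
  have "(\<integral>\<^sup>+\<omega>. 1 \<partial>N) \<le> c * (\<integral>\<^sup>+\<omega>. 1 \<partial>\<P>)" by (rule N_le) simp
  then have "emeasure N (space N) \<le> c" by (simp add: emeasure_space_1)
  then show "emeasure N (space N) \<noteq> \<infinity>" using c by (auto simp: top_unique)
qed

lemma AE_N: assumes "AE \<omega> in \<P>. Q \<omega>" shows "AE \<omega> in N. Q \<omega>"
proof -
  obtain S where S: "{\<omega>\<in>space \<P>. \<not> Q \<omega>} \<subseteq> S" "emeasure \<P> S = 0" "S \<in> sets \<P>"
    using assms by (rule AE_E)
  have "(\<integral>\<^sup>+\<omega>. indicator S \<omega> \<partial>N) \<le> c * (\<integral>\<^sup>+\<omega>. indicator S \<omega> \<partial>\<P>)"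
    using S(3) by (intro N_le) simp
  then have "emeasure N S = 0" using S(2,3) by simp
  then show ?thesis using S by (intro AE_I[of _ _ S]) auto
qed

lemma L_finite_measures: "L \<omega> \<in> finite_measures"
  using sets_L finite_L by (simp add: finite_measures_def)

lemma nn_integral_L_finite:
  assumes "f \<in> borel_measurable borel" "\<And>x. f x \<le> ennreal b"
  shows "(\<integral>\<^sup>+x. f x \<partial>L \<omega>) < \<infinity>" "(\<integral>\<^sup>+x. f x \<partial>\<nu>) < \<infinity>"
proof -
  have *: "(\<integral>\<^sup>+x. f x \<partial>\<mu>) < \<infinity>" if "finite_measure \<mu>" for \<mu> :: "'a measure"
  proof -
    interpret finite_measure \<mu> by fact
    have "emeasure \<mu> (space \<mu>) < \<top>"
      using emeasure_finite[of "space \<mu>"] unfolding infinity_ennreal_def less_top .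
    then have fin: "ennreal b * emeasure \<mu> (space \<mu>) < \<infinity>"
      by (simp add: ennreal_mult_less_top)
    have "(\<integral>\<^sup>+x. f x \<partial>\<mu>) \<le> (\<integral>\<^sup>+x. ennreal b \<partial>\<mu>)" by (intro nn_integral_mono assms(2))
    also have "\<dots> < \<infinity>" using fin by simp
    finally show ?thesis .
  qed
  show "(\<integral>\<^sup>+x. f x \<partial>L \<omega>) < \<infinity>" by (rule *[OF finite_L])
  show "(\<integral>\<^sup>+x. f x \<partial>\<nu>) < \<infinity>" by (rule *) unfold_locales
qed

definition Wr :: "real \<Rightarrow> ('a \<Rightarrow> real) \<Rightarrow> 'w \<Rightarrow> real" where
  "Wr \<epsilon> f \<omega> = enn2real (W \<epsilon> (\<lambda>x. ennreal (f x)) \<omega>)"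

definition Lr :: "('a \<Rightarrow> real) \<Rightarrow> 'w \<Rightarrow> real" where
  "Lr f \<omega> = enn2real (\<integral>\<^sup>+x. ennreal (f x) \<partial>L \<omega>)"

lemma integral_Y:
  assumes f: "f \<in> Cc" "\<And>x. 0 \<le> f x" and "0 < \<epsilon>" "\<omega> \<in> space \<P>"
  shows "(\<integral>x. f x \<partial>Y \<epsilon> \<omega>) = Wr \<epsilon> f \<omega>"
proof -
  have [measurable]: "f \<in> borel_measurable borel" using f(1) by (rule Cc_measurable)
  have "f \<in> borel_measurable (Y \<epsilon> \<omega>)" by (simp cong: measurable_cong_sets)
  then show ?thesis
    using assms by (simp add: integral_eq_nn_integral Wr_def nn_integral_Y)
qed

lemma integral_L:
  assumes f: "f \<in> Cc" "\<And>x. 0 \<le> f x"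
  shows "(\<integral>x. f x \<partial>L \<omega>) = Lr f \<omega>"
proof -
  have [measurable]: "f \<in> borel_measurable borel" using f(1) by (rule Cc_measurable)
  have "f \<in> borel_measurable (L \<omega>)" by (simp cong: measurable_cong_sets)
  then show ?thesis
    using f by (simp add: integral_eq_nn_integral Lr_def)
qed

lemma conv_Cc:
  assumes f: "f \<in> Cc" "\<And>x. 0 \<le> f x"
  shows "conv (\<lambda>x. ennreal (f x)) (\<lambda>\<omega>. \<integral>\<^sup>+x. ennreal (f x) \<partial>L \<omega>)"
proof -
  have [measurable]: "f \<in> borel_measurable borel" using f(1) by (rule Cc_measurable)
  obtain b where b: "\<And>x. \<bar>f x\<bar> \<le> b" using Cc_bounded[OF f(1)] by blast
  have "ennreal (f x) \<le> ennreal b" for x using b[of x] by (intro ennreal_leI) linarith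
  then have "(\<integral>\<^sup>+x. ennreal (f x) \<partial>\<nu>) < \<infinity>" by (intro nn_integral_L_finite(2)) auto
  then show ?thesis by (intro conv_L) auto
qed

lemma measurable_Wr: "f \<in> Cc \<Longrightarrow> Wr \<epsilon> f \<in> borel_measurable \<P>"
proof -
  assume "f \<in> Cc"
  then have [measurable]: "f \<in> borel_measurable borel" by (rule Cc_measurable)
  show "Wr \<epsilon> f \<in> borel_measurable \<P>" unfolding Wr_def[abs_def] by measurable
qed

lemma measurable_Lr: "f \<in> Cc \<Longrightarrow> (\<And>x. 0 \<le> f x) \<Longrightarrow> Lr f \<in> borel_measurable \<P>"
  using convD(2)[OF conv_Cc, of f] unfolding Lr_def[abs_def] by simp

lemma AE_W_finite:
  assumes "0 < \<epsilon>" "\<epsilon> \<le> 1"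
  shows "AE \<omega> in \<P>. W \<epsilon> (\<lambda>_. 1) \<omega> < \<infinity>"
proof -
  have "(\<integral>\<^sup>+\<omega>. W \<epsilon> (\<lambda>_. 1) \<omega> \<partial>\<P>) \<le> (\<integral>\<^sup>+x. 1 \<partial>\<nu>)" using assms by (intro W_le) auto
  also have "\<dots> < \<infinity>" using nn_integral_L_finite(2)[of "\<lambda>_. 1" 1] by simp
  finally have "(\<integral>\<^sup>+\<omega>. W \<epsilon> (\<lambda>_. 1) \<omega> \<partial>\<P>) \<noteq> \<infinity>" by simp
  then have "AE \<omega> in \<P>. W \<epsilon> (\<lambda>_. 1) \<omega> \<noteq> \<infinity>" by (intro nn_integral_noteq_infinite) simp_all
  then show ?thesis by (simp add: less_top)
qed

text \<open>The predicate \<open>Q\<close> allows the sequence to be picked among prescribed values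
  of \<open>\<epsilon>\<close>, as an argument by contradiction requires. Simultaneous almost sure
  convergence for all \<open>f n\<close> comes from summable errors.\<close>

lemma AE_convergent_choice:
  fixes f :: "nat \<Rightarrow> 'a \<Rightarrow> real"
  assumes Q: "\<And>b. b > 0 \<Longrightarrow> \<exists>\<epsilon>>0. \<epsilon> < b \<and> Q \<epsilon>"
    and f: "\<And>n. f n \<in> Cc" "\<And>n x. 0 \<le> f n x"
  shows "\<exists>a :: nat \<Rightarrow> real. (\<forall>k. 0 < a k \<and> a k < 1 \<and> Q (a k)) \<and>
    (AE \<omega> in \<P>. \<forall>n. (\<lambda>k. Wr (a k) (f n) \<omega>) \<longlonglongrightarrow> Lr (f n) \<omega>)"
proof -
  let ?e = "\<lambda>n \<epsilon> \<omega>. ed (W \<epsilon> (\<lambda>x. ennreal (f n x)) \<omega>) (\<integral>\<^sup>+x. ennreal (f n x) \<partial>L \<omega>)"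
  have [measurable]: "f n \<in> borel_measurable borel" for n using f(1) by (rule Cc_measurable)
  have [measurable]: "(\<lambda>\<omega>. \<integral>\<^sup>+x. ennreal (f n x) \<partial>L \<omega>) \<in> borel_measurable \<P>" for n
    using f by (intro convD(2)[OF conv_Cc])
  have "\<exists>r>0. \<forall>\<epsilon>. 0 < \<epsilon> \<and> \<epsilon> < r \<longrightarrow> (\<integral>\<^sup>+\<omega>. ?e n \<epsilon> \<omega> \<partial>\<P>) \<le> ennreal ((1 / 2) ^ k)" for n k
    using f by (intro convD(3)[OF conv_Cc]) auto
  then obtain r where r: "\<And>n k. 0 < r n k"
    "\<And>n k \<epsilon>. 0 < \<epsilon> \<Longrightarrow> \<epsilon> < r n k \<Longrightarrow> (\<integral>\<^sup>+\<omega>. ?e n \<epsilon> \<omega> \<partial>\<P>) \<le> ennreal ((1 / 2) ^ k)"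
    by metis
  \<comment> \<open>At stage \<open>k\<close> the errors of the first \<open>k + 1\<close> functions
    are controlled, so each fixed function is covered from some stage on.\<close>
  define r' where "r' k = min 1 (Min ((\<lambda>n. r n k) ` {..k}))" for k
  have r'_pos: "0 < r' k" for k using r(1) by (auto simp: r'_def)
  have "\<exists>\<epsilon>>0. \<epsilon> < r' k \<and> Q \<epsilon>" for k by (rule Q[OF r'_pos])
  then obtain a where a: "\<And>k. 0 < a k" "\<And>k. a k < r' k" "\<And>k. Q (a k)" by metis
  have "AE \<omega> in \<P>. (\<lambda>k. ?e n (a k) \<omega>) \<longlonglongrightarrow> 0" for n
  proof (rule AE_tendsto_0_of_summable)
    fix k assume "n \<le> k"
    then have "a k < r n k" using a(2)[of k] by (auto simp: r'_def)
    then show "(\<integral>\<^sup>+\<omega>. ?e n (a k) \<omega> \<partial>\<P>) \<le> ennreal ((1 / 2) ^ k)" by (intro r(2) a(1))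
  qed measurable
  then have "AE \<omega> in \<P>. \<forall>n. (\<lambda>k. ?e n (a k) \<omega>) \<longlonglongrightarrow> 0"
    unfolding AE_all_countable ..
  then have "AE \<omega> in \<P>. \<forall>n. (\<lambda>k. Wr (a k) (f n) \<omega>) \<longlonglongrightarrow> Lr (f n) \<omega>"
  proof eventually_elim
    fix \<omega> assume lim: "\<forall>n. (\<lambda>k. ?e n (a k) \<omega>) \<longlonglongrightarrow> 0"
    show "\<forall>n. (\<lambda>k. Wr (a k) (f n) \<omega>) \<longlonglongrightarrow> Lr (f n) \<omega>"
    proof
      fix n
      have "(\<lambda>k. ennreal \<bar>Wr (a k) (f n) \<omega> - Lr (f n) \<omega>\<bar>) \<longlonglongrightarrow> 0"
        by (rule tendsto_sandwich[OF _ _ tendsto_const lim[rule_format, of n]])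
          (auto simp: Wr_def Lr_def enn2real_diff_le_ed)
      then have "(\<lambda>k. \<bar>Wr (a k) (f n) \<omega> - Lr (f n) \<omega>\<bar>) \<longlonglongrightarrow> 0"
        by (rule ennreal_tendsto_0_iff[THEN iffD1, rotated]) simp
      then show "(\<lambda>k. Wr (a k) (f n) \<omega>) \<longlonglongrightarrow> Lr (f n) \<omega>"
        unfolding tendsto_rabs_zero_iff by (rule LIM_zero_cancel)
    qed
  qed
  moreover have "a k < 1" for k using a(2)[of k] by (simp add: r'_def)
  ultimately show ?thesis using a(1,3) by (intro exI[of _ a] conjI allI)
qed

text \<open>Almost sure convergence is available only along sequences, whereas the limit runs over
  all \<open>\<epsilon>\<close>. If the expectations failed to converge, a sequence of bad values
  could be chosen with almost surely convergent coordinates, and dominated convergence would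
  contradict the choice.\<close>

lemma measurable_L_and_converges_in_distribution:
  shows "L \<in> N \<rightarrow>\<^sub>M borel_of vague_topology"
    and "converges_in_distribution N vague_topology Y L (at_right 0)"
proof -
  obtain D :: "nat \<Rightarrow> 'a \<Rightarrow> real" where D: "\<And>n. D n \<in> Cc" "\<And>n x. 0 \<le> D n x" "\<And>n x. D n x \<le> 1"
    "\<And>K U. compact K \<Longrightarrow> open U \<Longrightarrow> K \<subseteq> U \<Longrightarrow> \<exists>n. (\<forall>x\<in>K. D n x = 1) \<and> (\<forall>x. x \<notin> U \<longrightarrow> D n x = 0)"
    using countable_Urysohn_family[OF lc] by metis
  interpret vague_family D by standard (use D in blast)+
  interpret N: finite_measure N by (rule finite_measure_N)
  have ev_L: "ev (L \<omega>) n = Lr (D n) \<omega>" for \<omega> n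
    unfolding ev_def by (rule integral_L[OF D(1,2)])
  show L: "L \<in> N \<rightarrow>\<^sub>M borel_of vague_topology"
  proof (rule measurable_vague)
    show "(\<lambda>\<omega>. ev (L \<omega>) n) \<in> borel_measurable N" for n
      unfolding ev_L using measurable_Lr[OF D(1,2), of n] by (simp cong: measurable_cong_sets)
  qed (rule L_finite_measures)
  \<comment> \<open>An approximation of infinite mass is no element of the vague space. For
    \<open>\<epsilon> < 1\<close> this happens with probability zero, and substituting the null
    measure there yields a genuine version.\<close>
  define Y' where "Y' \<epsilon> \<omega> = (if W \<epsilon> (\<lambda>_. 1) \<omega> < \<infinity> then Y \<epsilon> \<omega> else null_measure borel)" for \<epsilon> \<omega>
  have Y'_fin: "Y' \<epsilon> \<omega> \<in> finite_measures" if "0 < \<epsilon>" "\<omega> \<in> space \<P>" for \<epsilon> \<omega>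
  proof (cases "W \<epsilon> (\<lambda>_. 1) \<omega> < \<infinity>")
    case True
    have "emeasure (Y \<epsilon> \<omega>) (space (Y \<epsilon> \<omega>)) = W \<epsilon> (\<lambda>_. 1) \<omega>"
      using nn_integral_Y[OF that, of "\<lambda>_. 1"] by simp
    with True have "finite_measure (Y \<epsilon> \<omega>)" by (intro finite_measureI) auto
    then show ?thesis using True by (simp add: Y'_def finite_measures_def)
  next
    case False
    then show ?thesis by (simp add: Y'_def finite_measures_def finite_measureI)
  qed
  have ev_Y': "ev (Y' \<epsilon> \<omega>) n = (if W \<epsilon> (\<lambda>_. 1) \<omega> < \<infinity> then Wr \<epsilon> (D n) \<omega> else 0)"
    if "0 < \<epsilon>" "\<omega> \<in> space \<P>" for \<epsilon> \<omega> n
  proof -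
    have "D n \<in> borel_measurable (null_measure borel)"
      using Cc_measurable[OF D(1)] by (simp cong: measurable_cong_sets)
    then have "(\<integral>x. D n x \<partial>null_measure borel) = 0"
      using D(2) by (subst integral_eq_nn_integral) auto
    then show ?thesis
      using that integral_Y[OF D(1,2)] by (simp add: ev_def Y'_def)
  qed
  have Y'_meas: "Y' \<epsilon> \<in> N \<rightarrow>\<^sub>M borel_of vague_topology" if "0 < \<epsilon>" for \<epsilon>
  proof (rule measurable_vague)
    fix n
    have [measurable]: "Wr \<epsilon> (D n) \<in> borel_measurable \<P>" by (rule measurable_Wr[OF D(1)])
    have "(\<lambda>\<omega>. if W \<epsilon> (\<lambda>_. 1) \<omega> < \<infinity> then Wr \<epsilon> (D n) \<omega> else 0) \<in> borel_measurable N"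
      by measurable
    then show "(\<lambda>\<omega>. ev (Y' \<epsilon> \<omega>) n) \<in> borel_measurable N"
      by (subst measurable_cong[OF ev_Y'[OF that]]) simp_all
  qed (use Y'_fin[OF that] in simp)
  have Y'_ae: "AE \<omega> in \<P>. W \<epsilon> (\<lambda>_. 1) \<omega> < \<infinity> \<and> Y \<epsilon> \<omega> = Y' \<epsilon> \<omega>" if "0 < \<epsilon>" "\<epsilon> < 1" for \<epsilon>
    using AE_W_finite[OF that(1) less_imp_le[OF that(2)]] by eventually_elim (simp add: Y'_def)
  have lim: "((\<lambda>\<epsilon>. \<integral>\<omega>. \<Phi> (Y' \<epsilon> \<omega>) \<partial>N) \<longlongrightarrow> (\<integral>\<omega>. \<Phi> (L \<omega>) \<partial>N)) (at_right 0)"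
    if \<Phi>: "continuous_map vague_topology euclideanreal \<Phi>" "bounded (\<Phi> ` topspace vague_topology)" for \<Phi>
  proof (rule ccontr)
    assume "\<not> ?thesis"
    then obtain e where e: "e > 0"
      "\<not> (\<forall>\<^sub>F \<epsilon> in at_right 0. dist (\<integral>\<omega>. \<Phi> (Y' \<epsilon> \<omega>) \<partial>N) (\<integral>\<omega>. \<Phi> (L \<omega>) \<partial>N) < e)"
      unfolding tendsto_iff by blast
    have ex: "\<exists>\<epsilon>>0. \<epsilon> < b \<and> \<not> dist (\<integral>\<omega>. \<Phi> (Y' \<epsilon> \<omega>) \<partial>N) (\<integral>\<omega>. \<Phi> (L \<omega>) \<partial>N) < e" if "b > 0" for b
      using e(2) that unfolding eventually_at_right_field by blast
    have "\<exists>a :: nat \<Rightarrow> real. (\<forall>k. 0 < a k \<and> a k < 1 \<and> \<not> dist (\<integral>\<omega>. \<Phi> (Y' (a k) \<omega>) \<partial>N) (\<integral>\<omega>. \<Phi> (L \<omega>) \<partial>N) < e) \<and>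
        (AE \<omega> in \<P>. \<forall>n. (\<lambda>k. Wr (a k) (D n) \<omega>) \<longlonglongrightarrow> Lr (D n) \<omega>)"
      by (rule AE_convergent_choice[where f = D and
          Q = "\<lambda>\<epsilon>. \<not> dist (\<integral>\<omega>. \<Phi> (Y' \<epsilon> \<omega>) \<partial>N) (\<integral>\<omega>. \<Phi> (L \<omega>) \<partial>N) < e"]) (rule ex D; assumption?)+
    then obtain a where a': "\<forall>k. 0 < a k \<and> a k < 1 \<and> \<not> dist (\<integral>\<omega>. \<Phi> (Y' (a k) \<omega>) \<partial>N) (\<integral>\<omega>. \<Phi> (L \<omega>) \<partial>N) < e"
      and a_lim: "AE \<omega> in \<P>. \<forall>n. (\<lambda>k. Wr (a k) (D n) \<omega>) \<longlonglongrightarrow> Lr (D n) \<omega>"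
      by (elim exE conjE) (rule that)
    have a: "0 < a k" "a k < 1" "\<not> dist (\<integral>\<omega>. \<Phi> (Y' (a k) \<omega>) \<partial>N) (\<integral>\<omega>. \<Phi> (L \<omega>) \<partial>N) < e" for k
      using a' by blast+
    obtain b where b: "\<And>\<mu>. \<mu> \<in> finite_measures \<Longrightarrow> norm (\<Phi> \<mu>) \<le> b"
      using \<Phi>(2) unfolding bounded_iff by auto
    note [measurable] = measurable_compose[OF L measurable_continuous_map[OF \<Phi>(1)]]
      measurable_compose[OF Y'_meas measurable_continuous_map[OF \<Phi>(1)]]
    have "(\<lambda>k. \<integral>\<omega>. \<Phi> (Y' (a k) \<omega>) \<partial>N) \<longlonglongrightarrow> (\<integral>\<omega>. \<Phi> (L \<omega>) \<partial>N)"
    proof (rule integral_dominated_convergence)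
      show "integrable N (\<lambda>_. b)" by simp
      have "AE \<omega> in \<P>. \<forall>k. W (a k) (\<lambda>_. 1) \<omega> < \<infinity> \<and> Y (a k) \<omega> = Y' (a k) \<omega>"
        unfolding AE_all_countable by (intro allI Y'_ae a)
      then have "AE \<omega> in \<P>. (\<lambda>k. \<Phi> (Y' (a k) \<omega>)) \<longlonglongrightarrow> \<Phi> (L \<omega>)"
        using a_lim AE_space
      proof eventually_elim
        fix \<omega> assume *: "\<forall>k. W (a k) (\<lambda>_. 1) \<omega> < \<infinity> \<and> Y (a k) \<omega> = Y' (a k) \<omega>"
          "\<forall>n. (\<lambda>k. Wr (a k) (D n) \<omega>) \<longlonglongrightarrow> Lr (D n) \<omega>" "\<omega> \<in> space \<P>"
        show "(\<lambda>k. \<Phi> (Y' (a k) \<omega>)) \<longlonglongrightarrow> \<Phi> (L \<omega>)"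
        proof (rule continuous_vague_tendsto[OF \<Phi>(1)])
          show "Y' (a k) \<omega> \<in> finite_measures" for k by (rule Y'_fin[OF a(1) *(3)])
          show "(\<lambda>k. ev (Y' (a k) \<omega>) n) \<longlonglongrightarrow> ev (L \<omega>) n" for n
            using * ev_Y'[OF a(1) *(3)] by (simp add: ev_L)
        qed (rule L_finite_measures)
      qed
      then show "AE \<omega> in N. (\<lambda>k. \<Phi> (Y' (a k) \<omega>)) \<longlonglongrightarrow> \<Phi> (L \<omega>)" by (rule AE_N)
      show "AE \<omega> in N. norm (\<Phi> (Y' (a k) \<omega>)) \<le> b" for k
        by (rule AE_I2) (use b Y'_fin[OF a(1)] in simp)
      show "(\<lambda>\<omega>. \<Phi> (Y' (a k) \<omega>)) \<in> borel_measurable N" for k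
        using measurable_compose[OF Y'_meas[OF a(1)] measurable_continuous_map[OF \<Phi>(1)]] .
    qed measurable
    then have "\<forall>\<^sub>F k in sequentially. dist (\<integral>\<omega>. \<Phi> (Y' (a k) \<omega>) \<partial>N) (\<integral>\<omega>. \<Phi> (L \<omega>) \<partial>N) < e"
      using e(1) by (rule tendstoD)
    then show False using a(3) by (simp add: eventually_sequentially)
  qed
  show "converges_in_distribution N vague_topology Y L (at_right 0)"
    unfolding converges_in_distribution_def
  proof (intro conjI L exI[of _ Y'] allI impI)
    show "\<forall>\<^sub>F \<epsilon> in at_right 0. Y' \<epsilon> \<in> N \<rightarrow>\<^sub>M borel_of vague_topology \<and> (AE \<omega> in N. Y \<epsilon> \<omega> = Y' \<epsilon> \<omega>)"
      unfolding eventually_at_right_field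
    proof (intro exI[of _ 1] conjI allI impI)
      fix \<epsilon> :: real assume \<epsilon>: "0 < \<epsilon>" "\<epsilon> < 1"
      show "Y' \<epsilon> \<in> N \<rightarrow>\<^sub>M borel_of vague_topology" by (rule Y'_meas[OF \<epsilon>(1)])
      show "AE \<omega> in N. Y \<epsilon> \<omega> = Y' \<epsilon> \<omega>"
        by (rule AE_N) (use Y'_ae[OF \<epsilon>] in eventually_elim, simp)
    qed simp
  qed (use lim in blast)
qed

lemma converges_in_Lk_Cc:
  assumes f: "f \<in> Cc" "\<And>x. 0 \<le> f x" and k: "k \<ge> 1"
  shows "converges_in_Lk N k (\<lambda>\<epsilon> \<omega>. \<integral>x. f x \<partial>Y \<epsilon> \<omega>) (\<lambda>\<omega>. \<integral>x. f x \<partial>L \<omega>) (at_right 0)"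
proof -
  let ?F = "\<lambda>x. ennreal (f x)"
  define V where "V \<omega> = (\<integral>\<^sup>+x. ?F x \<partial>L \<omega>)" for \<omega>
  have f_meas [measurable]: "f \<in> borel_measurable borel" using f(1) by (rule Cc_measurable)
  have [measurable]: "V \<in> borel_measurable \<P>"
    unfolding V_def[abs_def] using f by (intro convD(2)[OF conv_Cc])
  obtain b where b: "\<And>x. \<bar>f x\<bar> \<le> b" using Cc_bounded[OF f(1)] by blast
  have F_le: "?F x \<le> ennreal b" for x using b[of x] by (intro ennreal_leI) linarith
  have U_le: "W \<epsilon> ?F \<omega> \<le> ennreal b * W \<epsilon> (\<lambda>_. 1) \<omega>" if "\<omega> \<in> space \<P>" for \<epsilon> \<omega>
  proof -
    have "W \<epsilon> ?F \<omega> \<le> W \<epsilon> (\<lambda>x. ennreal b * 1) \<omega>" using F_le by (intro W_mono) simp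
    also have "\<dots> = ennreal b * W \<epsilon> (\<lambda>_. 1) \<omega>" using that by (intro W_cmult) auto
    finally show ?thesis .
  qed
  have U_moment: "\<exists>B<\<infinity>. \<forall>\<epsilon>. (\<integral>\<^sup>+\<omega>. W \<epsilon> ?F \<omega> ^ j \<partial>\<P>) \<le> B" for j
  proof -
    obtain B where B: "B < \<infinity>" "\<And>\<epsilon>. (\<integral>\<^sup>+\<omega>. W \<epsilon> (\<lambda>_. 1) \<omega> ^ j \<partial>\<P>) \<le> B"
      using moment[of j] by blast
    have "(\<integral>\<^sup>+\<omega>. W \<epsilon> ?F \<omega> ^ j \<partial>\<P>) \<le> ennreal b ^ j * B" for \<epsilon>
    proof -
      have "(\<integral>\<^sup>+\<omega>. W \<epsilon> ?F \<omega> ^ j \<partial>\<P>) \<le> (\<integral>\<^sup>+\<omega>. ennreal b ^ j * W \<epsilon> (\<lambda>_. 1) \<omega> ^ j \<partial>\<P>)"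
        by (intro nn_integral_mono) (simp add: U_le power_mono_ennreal flip: power_mult_distrib)
      also have "\<dots> = ennreal b ^ j * (\<integral>\<^sup>+\<omega>. W \<epsilon> (\<lambda>_. 1) \<omega> ^ j \<partial>\<P>)"
        by (intro nn_integral_cmult) measurable
      also have "\<dots> \<le> ennreal b ^ j * B" by (intro mult_left_mono B) simp
      finally show ?thesis .
    qed
    moreover have "ennreal b ^ j * B < \<infinity>"
      using B(1) by (simp add: ennreal_mult_less_top power_less_top_ennreal)
    ultimately show ?thesis by blast
  qed
  have V_finite: "V \<omega> < \<infinity>" for \<omega>
    unfolding V_def using F_le by (intro nn_integral_L_finite(1)) auto
  \<comment> \<open>The limit inherits the moment bounds by Fatou's lemma along an almost surely
    convergent sequence.\<close>
  have V_moment: "\<exists>B<\<infinity>. (\<forall>\<epsilon>. (\<integral>\<^sup>+\<omega>. W \<epsilon> ?F \<omega> ^ j \<partial>\<P>) \<le> B) \<and> (\<integral>\<^sup>+\<omega>. V \<omega> ^ j \<partial>\<P>) \<le> B" for j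
  proof -
    obtain B where B: "B < \<infinity>" "\<And>\<epsilon>. (\<integral>\<^sup>+\<omega>. W \<epsilon> ?F \<omega> ^ j \<partial>\<P>) \<le> B"
      using U_moment[of j] by blast
    have ex: "\<exists>\<epsilon>>0. \<epsilon> < b \<and> True" if "b > 0" for b :: real
      using that by (intro exI[of _ "b / 2"]) auto
    have "\<exists>a :: nat \<Rightarrow> real. (\<forall>k. 0 < a k \<and> a k < 1 \<and> True) \<and>
        (AE \<omega> in \<P>. \<forall>n::nat. (\<lambda>k. Wr (a k) f \<omega>) \<longlonglongrightarrow> Lr f \<omega>)"
      by (rule AE_convergent_choice[where f = "\<lambda>_. f" and Q = "\<lambda>_. True"]) (rule ex f; assumption?)+
    then obtain a where a: "AE \<omega> in \<P>. \<forall>n::nat. (\<lambda>k. Wr (a k) f \<omega>) \<longlonglongrightarrow> Lr f \<omega>"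
      by (elim exE conjE) (rule that)
    have "(\<integral>\<^sup>+\<omega>. V \<omega> ^ j \<partial>\<P>) \<le> (\<integral>\<^sup>+\<omega>. liminf (\<lambda>k. W (a k) ?F \<omega> ^ j) \<partial>\<P>)"
    proof (rule nn_integral_mono_AE)
      show "AE \<omega> in \<P>. V \<omega> ^ j \<le> liminf (\<lambda>k. W (a k) ?F \<omega> ^ j)"
        using a
      proof eventually_elim
        fix \<omega> assume "\<forall>n::nat. (\<lambda>k. Wr (a k) f \<omega>) \<longlonglongrightarrow> Lr f \<omega>"
        then have "(\<lambda>k. ennreal (Wr (a k) f \<omega> ^ j)) \<longlonglongrightarrow> ennreal (Lr f \<omega> ^ j)"
          by (intro tendsto_ennrealI tendsto_power) simp
        moreover have "ennreal (Lr f \<omega> ^ j) = V \<omega> ^ j"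
          using V_finite[of \<omega>] by (simp add: Lr_def V_def flip: ennreal_power)
        ultimately have "V \<omega> ^ j = liminf (\<lambda>k. ennreal (Wr (a k) f \<omega> ^ j))"
          by (simp add: lim_imp_Liminf)
        also have "\<dots> \<le> liminf (\<lambda>k. W (a k) ?F \<omega> ^ j)"
        proof (intro Liminf_mono always_eventually allI)
          fix k
          have "ennreal (enn2real z) \<le> z" for z by (cases z) auto
          then show "ennreal (Wr (a k) f \<omega> ^ j) \<le> W (a k) ?F \<omega> ^ j"
            by (simp add: Wr_def power_mono_ennreal flip: ennreal_power)
        qed
        finally show "V \<omega> ^ j \<le> liminf (\<lambda>k. W (a k) ?F \<omega> ^ j)" .
      qed
    qed
    also have "\<dots> \<le> liminf (\<lambda>k. \<integral>\<^sup>+\<omega>. W (a k) ?F \<omega> ^ j \<partial>\<P>)"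
      by (intro nn_integral_liminf) measurable
    also have "\<dots> \<le> liminf (\<lambda>k. B)"
      by (intro Liminf_mono always_eventually allI B)
    also have "\<dots> = B" by (simp add: Liminf_const)
    finally show ?thesis using B by blast
  qed
  define E where "E \<epsilon> \<omega> = ed (W \<epsilon> ?F \<omega>) (V \<omega>)" for \<epsilon> \<omega>
  have [measurable]: "E \<epsilon> \<in> borel_measurable \<P>" for \<epsilon> unfolding E_def by measurable
  have E_small: "\<exists>r>0. \<forall>\<epsilon>. 0 < \<epsilon> \<and> \<epsilon> < r \<longrightarrow> (\<integral>\<^sup>+\<omega>. E \<epsilon> \<omega> ^ k \<partial>\<P>) \<le> ennreal \<eta>" if \<eta>: "\<eta> > 0" for \<eta>
  proof -
    obtain B where B: "B < \<infinity>" "\<And>\<epsilon>. (\<integral>\<^sup>+\<omega>. W \<epsilon> ?F \<omega> ^ Suc k \<partial>\<P>) \<le> B" "(\<integral>\<^sup>+\<omega>. V \<omega> ^ Suc k \<partial>\<P>) \<le> B"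
      using V_moment[of "Suc k"] by blast
    then obtain B' where B': "B = ennreal B'" "B' \<ge> 0" by (cases B) auto
    define H where "H = 2 ^ Suc k * (B' + B')"
    have H: "(\<integral>\<^sup>+\<omega>. E \<epsilon> \<omega> ^ Suc k \<partial>\<P>) \<le> ennreal H" for \<epsilon>
    proof -
      have "(\<integral>\<^sup>+\<omega>. E \<epsilon> \<omega> ^ Suc k \<partial>\<P>) \<le> (\<integral>\<^sup>+\<omega>. 2 ^ Suc k * (W \<epsilon> ?F \<omega> ^ Suc k + V \<omega> ^ Suc k) \<partial>\<P>)"
      proof (rule nn_integral_mono)
        fix \<omega>
        have "E \<epsilon> \<omega> \<le> W \<epsilon> ?F \<omega> + V \<omega>"
          unfolding E_def by (rule order_trans[OF ed_le_max]) simp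
        then have "E \<epsilon> \<omega> ^ Suc k \<le> (W \<epsilon> ?F \<omega> + V \<omega>) ^ Suc k" by (rule power_mono_ennreal)
        also have "\<dots> \<le> 2 ^ Suc k * (W \<epsilon> ?F \<omega> ^ Suc k + V \<omega> ^ Suc k)" by (rule power_add_le)
        finally show "E \<epsilon> \<omega> ^ Suc k \<le> 2 ^ Suc k * (W \<epsilon> ?F \<omega> ^ Suc k + V \<omega> ^ Suc k)" .
      qed
      also have "\<dots> = 2 ^ Suc k * ((\<integral>\<^sup>+\<omega>. W \<epsilon> ?F \<omega> ^ Suc k \<partial>\<P>) + (\<integral>\<^sup>+\<omega>. V \<omega> ^ Suc k \<partial>\<P>))"
        by (subst nn_integral_cmult nn_integral_add; measurable)+
      also have "\<dots> \<le> 2 ^ Suc k * (B + B)" by (intro mult_left_mono add_mono B) simp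
      also have "\<dots> = ennreal H"
      proof -
        have "(2::ennreal) ^ Suc k = ennreal (2 ^ Suc k)" by (subst ennreal_power[symmetric]) simp_all
        then show ?thesis using B' by (simp only: H_def ennreal_mult' ennreal_plus zero_le_power zero_le_numeral)
      qed
      finally show ?thesis .
    qed
    \<comment> \<open>Threshold between small and large errors, chosen so that the large ones
      contribute at most \<open>H / M \<le> \<eta> / 2\<close>.\<close>
    define M where "M = 2 * H / \<eta> + 1"
    have H0: "H \<ge> 0" using B' by (simp add: H_def)
    have M: "M > 0" "H / M \<le> \<eta> / 2"
    proof -
      have "0 \<le> 2 * H / \<eta>" using H0 \<eta> by simp
      then show "M > 0" by (simp add: M_def)
      then show "H / M \<le> \<eta> / 2" using \<eta> by (simp add: M_def field_simps)
    qed
    \<comment> \<open>Below the threshold \<open>k - 1\<close> factors are replaced by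
      \<open>M\<close>; above it one more factor \<open>x / M\<close>, which is at least
      \<open>1\<close>, is inserted.\<close>
    have pow: "x ^ k \<le> ennreal (M ^ (k - 1)) * x + ennreal (1 / M) * x ^ Suc k" for x
    proof (cases "x \<le> ennreal M")
      case True
      have "x ^ k = x ^ (k - 1) * x" using k by (metis power_minus_mult zero_less_one less_le_trans)
      also have "\<dots> \<le> ennreal M ^ (k - 1) * x" by (intro mult_right_mono power_mono_ennreal True) simp
      also have "\<dots> = ennreal (M ^ (k - 1)) * x" using M by (simp add: ennreal_power)
      finally show ?thesis by (simp add: add_increasing2)
    next
      case False
      have "x ^ k = ennreal (1 / M) * ennreal M * x ^ k"
        using M(1) by (simp flip: ennreal_mult)
      also have "\<dots> \<le> ennreal (1 / M) * (x * x ^ k)"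
        using False by (simp add: mult.assoc mult_left_mono mult_right_mono)
      finally show ?thesis by (simp add: add_increasing)
    qed
    have "\<eta> / (2 * M ^ (k - 1)) > 0" using \<eta> M by simp
    then have "\<exists>r>0. \<forall>\<epsilon>. 0 < \<epsilon> \<and> \<epsilon> < r \<longrightarrow> (\<integral>\<^sup>+\<omega>. E \<epsilon> \<omega> \<partial>\<P>) \<le> ennreal (\<eta> / (2 * M ^ (k - 1)))"
      unfolding E_def V_def by (rule convD(3)[OF conv_Cc[OF f]])
    then obtain r where r: "r > 0" "\<And>\<epsilon>. 0 < \<epsilon> \<Longrightarrow> \<epsilon> < r \<Longrightarrow> (\<integral>\<^sup>+\<omega>. E \<epsilon> \<omega> \<partial>\<P>) \<le> ennreal (\<eta> / (2 * M ^ (k - 1)))"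
      by blast
    have "(\<integral>\<^sup>+\<omega>. E \<epsilon> \<omega> ^ k \<partial>\<P>) \<le> ennreal \<eta>" if \<epsilon>: "0 < \<epsilon>" "\<epsilon> < r" for \<epsilon>
    proof -
      have "(\<integral>\<^sup>+\<omega>. E \<epsilon> \<omega> ^ k \<partial>\<P>) \<le> (\<integral>\<^sup>+\<omega>. ennreal (M ^ (k - 1)) * E \<epsilon> \<omega> + ennreal (1 / M) * E \<epsilon> \<omega> ^ Suc k \<partial>\<P>)"
        by (intro nn_integral_mono pow)
      also have "\<dots> = (\<integral>\<^sup>+\<omega>. ennreal (M ^ (k - 1)) * E \<epsilon> \<omega> \<partial>\<P>) + (\<integral>\<^sup>+\<omega>. ennreal (1 / M) * E \<epsilon> \<omega> ^ Suc k \<partial>\<P>)"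
        by (intro nn_integral_add) measurable
      also have "\<dots> = ennreal (M ^ (k - 1)) * (\<integral>\<^sup>+\<omega>. E \<epsilon> \<omega> \<partial>\<P>) + ennreal (1 / M) * (\<integral>\<^sup>+\<omega>. E \<epsilon> \<omega> ^ Suc k \<partial>\<P>)"
        by (intro arg_cong2[where f = "(+)"] nn_integral_cmult) measurable
      also have "\<dots> \<le> ennreal (M ^ (k - 1)) * ennreal (\<eta> / (2 * M ^ (k - 1))) + ennreal (1 / M) * ennreal H"
        by (intro add_mono mult_left_mono r \<epsilon> H) simp_all
      also have "\<dots> = ennreal (\<eta> / 2) + ennreal (H / M)"
        using M \<eta> H0 by (simp flip: ennreal_mult)
      also have "\<dots> \<le> ennreal (\<eta> / 2) + ennreal (\<eta> / 2)"
        by (intro add_left_mono ennreal_leI M)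
      also have "\<dots> = ennreal \<eta>" using \<eta> by (simp flip: ennreal_plus)
      finally show ?thesis .
    qed
    then show ?thesis using r(1) by blast
  qed
  have Lk: "in_Lk N k Z" if [measurable]: "Z \<in> borel_measurable \<P>" "Z' \<in> borel_measurable \<P>"
    and Z: "\<And>\<omega>. \<omega> \<in> space \<P> \<Longrightarrow> Z \<omega> = enn2real (Z' \<omega>)" and Z': "(\<integral>\<^sup>+\<omega>. Z' \<omega> ^ k \<partial>\<P>) < \<infinity>" for Z Z'
    unfolding in_Lk_def
  proof (intro conjI integrableI_nonneg)
    show "Z \<in> borel_measurable N" "(\<lambda>\<omega>. \<bar>Z \<omega>\<bar> ^ k) \<in> borel_measurable N" by measurable
    have "(\<integral>\<^sup>+\<omega>. ennreal (\<bar>Z \<omega>\<bar> ^ k) \<partial>N) \<le> (\<integral>\<^sup>+\<omega>. Z' \<omega> ^ k \<partial>N)"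
    proof (rule nn_integral_mono)
      fix \<omega> assume "\<omega> \<in> space N"
      moreover have "ennreal (enn2real z) \<le> z" for z by (cases z) auto
      ultimately show "ennreal (\<bar>Z \<omega>\<bar> ^ k) \<le> Z' \<omega> ^ k"
        by (simp add: Z power_mono_ennreal flip: ennreal_power)
    qed
    also have "\<dots> \<le> c * (\<integral>\<^sup>+\<omega>. Z' \<omega> ^ k \<partial>\<P>)" by (intro N_le) measurable
    also have "\<dots> < \<infinity>" using Z' c by (simp add: ennreal_mult_less_top)
    finally show "(\<integral>\<^sup>+\<omega>. ennreal (\<bar>Z \<omega>\<bar> ^ k) \<partial>N) < \<infinity>" .
  qed simp
  obtain B where B: "B < \<infinity>" "\<And>\<epsilon>. (\<integral>\<^sup>+\<omega>. W \<epsilon> ?F \<omega> ^ k \<partial>\<P>) \<le> B" "(\<integral>\<^sup>+\<omega>. V \<omega> ^ k \<partial>\<P>) \<le> B"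
    using V_moment[of k] by blast
  have LkL: "in_Lk N k (\<lambda>\<omega>. \<integral>x. f x \<partial>L \<omega>)"
    using f B by (intro Lk[of _ V])
      (auto simp: integral_L V_def Lr_def[symmetric] intro: measurable_Lr order_le_less_trans)
  have LkY: "in_Lk N k (\<lambda>\<omega>. \<integral>x. f x \<partial>Y \<epsilon> \<omega>)" if "0 < \<epsilon>" for \<epsilon>
  proof (rule Lk[of _ "W \<epsilon> ?F"])
    have "Wr \<epsilon> f \<in> borel_measurable \<P>" by (rule measurable_Wr[OF f(1)])
    then show "(\<lambda>\<omega>. \<integral>x. f x \<partial>Y \<epsilon> \<omega>) \<in> borel_measurable \<P>"
      by (subst measurable_cong[OF integral_Y[OF f that]]) simp_all
    show "(\<integral>\<^sup>+\<omega>. W \<epsilon> ?F \<omega> ^ k \<partial>\<P>) < \<infinity>" using B by (auto intro: order_le_less_trans)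
    show "(\<integral>x. f x \<partial>Y \<epsilon> \<omega>) = enn2real (W \<epsilon> ?F \<omega>)" if "\<omega> \<in> space \<P>" for \<omega>
      using integral_Y[OF f \<open>0 < \<epsilon>\<close> that] by (simp add: Wr_def)
  qed measurable
  have "((\<lambda>\<epsilon>. \<integral>\<omega>. \<bar>(\<integral>x. f x \<partial>Y \<epsilon> \<omega>) - (\<integral>x. f x \<partial>L \<omega>)\<bar> ^ k \<partial>N) \<longlongrightarrow> 0) (at_right 0)"
  proof (rule tendstoI)
    fix e :: real assume e: "e > 0"
    obtain c' where c': "c = ennreal c'" "c' \<ge> 0" using c by (cases c) auto
    \<comment> \<open>The summand \<open>1\<close> covers \<open>c' = 0\<close>, and the factor
      \<open>2\<close> makes \<open>c' * \<eta> < e\<close> strict.\<close>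
    define \<eta> where "\<eta> = e / (2 * (c' + 1))"
    have \<eta>: "\<eta> > 0" using e c' by (simp add: \<eta>_def)
    obtain r where r: "r > 0" "\<And>\<epsilon>. 0 < \<epsilon> \<Longrightarrow> \<epsilon> < r \<Longrightarrow> (\<integral>\<^sup>+\<omega>. E \<epsilon> \<omega> ^ k \<partial>\<P>) \<le> ennreal \<eta>"
      using E_small[OF \<eta>] by blast
    have "\<bar>\<integral>\<omega>. \<bar>(\<integral>x. f x \<partial>Y \<epsilon> \<omega>) - (\<integral>x. f x \<partial>L \<omega>)\<bar> ^ k \<partial>N\<bar> < e" if \<epsilon>: "0 < \<epsilon>" "\<epsilon> < r" for \<epsilon>
    proof -
      let ?I = "\<integral>\<omega>. \<bar>(\<integral>x. f x \<partial>Y \<epsilon> \<omega>) - (\<integral>x. f x \<partial>L \<omega>)\<bar> ^ k \<partial>N"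
      have "?I \<le> c' * \<eta>"
      proof (rule integral_real_bounded)
        have "(\<integral>\<^sup>+\<omega>. ennreal (\<bar>(\<integral>x. f x \<partial>Y \<epsilon> \<omega>) - (\<integral>x. f x \<partial>L \<omega>)\<bar> ^ k) \<partial>N) \<le> (\<integral>\<^sup>+\<omega>. E \<epsilon> \<omega> ^ k \<partial>N)"
        proof (rule nn_integral_mono)
          fix \<omega> assume "\<omega> \<in> space N"
          then have "(\<integral>x. f x \<partial>Y \<epsilon> \<omega>) = enn2real (W \<epsilon> ?F \<omega>)" "(\<integral>x. f x \<partial>L \<omega>) = enn2real (V \<omega>)"
            using integral_Y[OF f \<epsilon>(1), of \<omega>] integral_L[OF f] by (simp_all add: Wr_def Lr_def V_def)
          then show "ennreal (\<bar>(\<integral>x. f x \<partial>Y \<epsilon> \<omega>) - (\<integral>x. f x \<partial>L \<omega>)\<bar> ^ k) \<le> E \<epsilon> \<omega> ^ k"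
            by (simp add: E_def power_mono_ennreal enn2real_diff_le_ed flip: ennreal_power)
        qed
        also have "\<dots> \<le> c * (\<integral>\<^sup>+\<omega>. E \<epsilon> \<omega> ^ k \<partial>\<P>)" by (intro N_le) measurable
        also have "\<dots> \<le> c * ennreal \<eta>" by (intro mult_left_mono r \<epsilon>) simp
        also have "\<dots> = ennreal (c' * \<eta>)" using c' \<eta> by (simp add: ennreal_mult)
        finally show "(\<integral>\<^sup>+\<omega>. ennreal (\<bar>(\<integral>x. f x \<partial>Y \<epsilon> \<omega>) - (\<integral>x. f x \<partial>L \<omega>)\<bar> ^ k) \<partial>N) \<le> ennreal (c' * \<eta>)" .
      qed (use c' \<eta> in simp)
      also have "c' * \<eta> < e"
      proof -
        have "c' * e < e * (2 * (c' + 1))" using e c' by (simp add: algebra_simps add_strict_increasing2)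
        then show ?thesis using c' by (simp add: \<eta>_def divide_less_eq)
      qed
      finally have "?I < e" .
      moreover have "0 \<le> ?I" by (rule integral_nonneg_AE) simp
      ultimately show ?thesis by simp
    qed
    then show "\<forall>\<^sub>F \<epsilon> in at_right 0. dist (\<integral>\<omega>. \<bar>(\<integral>x. f x \<partial>Y \<epsilon> \<omega>) - (\<integral>x. f x \<partial>L \<omega>)\<bar> ^ k \<partial>N) 0 < e"
      unfolding eventually_at_right_field using r(1) by (intro exI[of _ r]) simp
  qed
  moreover have "\<forall>\<^sub>F \<epsilon> in at_right 0. in_Lk N k (\<lambda>\<omega>. \<integral>x. f x \<partial>Y \<epsilon> \<omega>)"
    unfolding eventually_at_right_field using LkY by (intro exI[of _ 1]) auto
  ultimately show ?thesis unfolding converges_in_Lk_def using LkL by blast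
qed

end

section \<open>The intersection measure\<close>

text \<open>The constant is the reciprocal of the measure of \<open>A\<close>. On a null set
  \<open>uniform_measure\<close> is the zero measure by the convention on division, and the bound
  holds with constant zero.\<close>

lemma nn_integral_uniform_measure_le:
  assumes A [measurable]: "A \<in> sets M"
  shows "\<exists>c<\<infinity>. \<forall>g\<in>borel_measurable M. (\<integral>\<^sup>+x. g x \<partial>uniform_measure M A) \<le> c * (\<integral>\<^sup>+x. g x \<partial>M)"
proof (cases "emeasure M A = 0")
  case True
  have "(\<integral>\<^sup>+x. g x \<partial>uniform_measure M A) = 0" if "g \<in> borel_measurable M" for g :: "_ \<Rightarrow> ennreal"
  proof -
    have "(\<integral>\<^sup>+x. g x * indicator A x \<partial>M) = 0"
      using True A by (intro nn_integral_null_set) (auto simp: null_sets_def)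
    then show ?thesis using that by (simp add: nn_integral_uniform_measure divide_ennreal_def)
  qed
  then show ?thesis by (intro exI[of _ 0]) auto
next
  case False
  show ?thesis
  proof (intro exI[of _ "inverse (emeasure M A)"] conjI ballI)
    show "inverse (emeasure M A) < \<infinity>"
      using False by (simp add: less_top[symmetric] zero_less_iff_neq_zero)
    fix g :: "_ \<Rightarrow> ennreal" assume [measurable]: "g \<in> borel_measurable M"
    have "(\<integral>\<^sup>+x. g x \<partial>uniform_measure M A) = inverse (emeasure M A) * (\<integral>\<^sup>+x. g x * indicator A x \<partial>M)"
      by (simp add: nn_integral_uniform_measure divide_ennreal_def mult.commute)
    also have "\<dots> \<le> inverse (emeasure M A) * (\<integral>\<^sup>+x. g x \<partial>M)"
      by (intro mult_left_mono nn_integral_mono) (auto simp: indicator_def)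
    finally show "(\<integral>\<^sup>+x. g x \<partial>uniform_measure M A) \<le> inverse (emeasure M A) * (\<integral>\<^sup>+x. g x \<partial>M)" .
  qed
qed

context intersection
begin

lemma measurable_Z_path: "\<omega> \<in> space \<P> \<Longrightarrow> Z \<epsilon> \<omega> \<in> borel_measurable m"
  using measurable_Z[of "\<lambda>x. x" m "\<lambda>_. \<omega>" \<epsilon>] by (simp cong: measurable_cong_sets)

lemma random_measures:
  assumes lc: "locally_compact_space (euclidean :: 'a topology)"
  shows "random_measures \<P> \<nu> W"
proof (rule random_measures.intro[OF prob_space_axioms finite_measure_\<nu> random_measures_axioms.intro])
  show "W \<epsilon> f \<omega> \<le> W \<epsilon> g \<omega>" if "\<And>x. f x \<le> g x" for \<epsilon> f g \<omega>
    unfolding W_def by (intro nn_integral_mono mult_right_mono that) simp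
  fix \<epsilon> \<omega> and f :: "'a \<Rightarrow> ennreal" assume [measurable]: "f \<in> borel_measurable borel" and \<omega>: "\<omega> \<in> space \<P>"
  note [measurable] = measurable_Z_path[OF \<omega>]
  show "W \<epsilon> (\<lambda>x. c * f x) \<omega> = c * W \<epsilon> f \<omega>" for c
    unfolding W_def mult.assoc by (intro nn_integral_cmult) measurable
  fix g :: "'a \<Rightarrow> ennreal" assume [measurable]: "g \<in> borel_measurable borel"
  show "W \<epsilon> (\<lambda>x. f x + g x) \<omega> = W \<epsilon> f \<omega> + W \<epsilon> g \<omega>"
    unfolding W_def distrib_right by (intro nn_integral_add) measurable
qed (rule lc sets_\<nu> measurable_W nn_integral_W_le W_Cauchy; assumption)+

text \<open>Tonelli factorises the integral over \<open>[0, t] ^ p\<close>. Positivity of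
  \<open>\<epsilon>\<close> makes \<open>qq\<close> agree with \<open>q\<close>.\<close>

lemma approx_intersection_measure_eq:
  assumes \<epsilon>: "0 < \<epsilon>" and \<omega>: "\<omega> \<in> space \<P>"
  shows "approx_intersection_measure m p X q t \<epsilon> \<omega> = density m (Z \<epsilon> \<omega>)"
proof -
  let ?M = "restrict_space lborel {0..t}"
  interpret I: product_sigma_finite "\<lambda>_::nat. ?M"
    by (intro product_sigma_finite.intro sigma_finite_measure_restrict_space lborel.sigma_finite_measure_axioms) simp
  have "(\<integral>\<^sup>+s. (\<Prod>i=1..p. case X i (ennreal (s i)) \<omega> of None \<Rightarrow> 0 | Some y \<Rightarrow> q i \<epsilon> y x) \<partial>(\<Pi>\<^sub>M i\<in>{1..p}. ?M)) = Z \<epsilon> \<omega> x" for x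
  proof -
    let ?h = "\<lambda>i s. ext0 (\<lambda>y. density_process.qq (q i) \<epsilon> y x) (X i (ennreal s) \<omega>)"
    have h: "?h i \<in> borel_measurable lborel" and qq: "density_process.qq (q i) \<epsilon> y x = q i \<epsilon> y x"
      and A_eq: "A i \<epsilon> x \<omega> = (\<integral>\<^sup>+s\<in>{0..t}. ?h i s \<partial>lborel)" if "i \<in> {1..p}" for i y
    proof -
      interpret D: density_process \<P> "P i" "X i" m "q i" using that by (rule process)
      show "?h i \<in> borel_measurable lborel" using \<omega> by measurable
      show "D.qq \<epsilon> y x = q i \<epsilon> y x" using \<epsilon> by (simp add: D.qq_def)
      show "A i \<epsilon> x \<omega> = (\<integral>\<^sup>+s\<in>{0..t}. ?h i s \<partial>lborel)" by (simp add: A_def D.occ_def)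
    qed
    have "(\<integral>\<^sup>+s. (\<Prod>i=1..p. case X i (ennreal (s i)) \<omega> of None \<Rightarrow> 0 | Some y \<Rightarrow> q i \<epsilon> y x) \<partial>(\<Pi>\<^sub>M i\<in>{1..p}. ?M)) =
        (\<integral>\<^sup>+s. (\<Prod>i\<in>{1..p}. ?h i (s i)) \<partial>(\<Pi>\<^sub>M i\<in>{1..p}. ?M))"
      by (intro nn_integral_cong prod.cong refl) (simp add: ext0_def qq cong: option.case_cong)
    also have "\<dots> = (\<Prod>i\<in>{1..p}. integral\<^sup>N ?M (?h i))"
      by (intro I.product_nn_integral_prod measurable_restrict_space1 h) auto
    also have "\<dots> = Z \<epsilon> \<omega> x"
      unfolding Z_def by (intro prod.cong refl) (simp add: nn_integral_restrict_space A_eq)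
    finally show ?thesis .
  qed
  then show ?thesis unfolding approx_intersection_measure_def by simp
qed

text \<open>The process is at the cemetery from its life time on, so survival beyond
  \<open>t\<close> can be read from the position at time \<open>t\<close> alone.\<close>

lemma sets_alive_event: "alive_event \<P> p X t \<in> sets \<P>"
proof -
  have eq: "ennreal t < lifetime (X i) \<omega> \<longleftrightarrow> X i (ennreal t) \<omega> \<notin> {None}"
    if "i \<in> {1..p}" "\<omega> \<in> space \<P>" for i \<omega>
  proof -
    interpret D: density_process \<P> "P i" "X i" m "q i" using that(1) by (rule process)
    have *: "lifetime (X i) \<omega> \<le> ennreal t \<longleftrightarrow> X i (ennreal t) \<omega> = None"
      using D.dead[OF that(2), of "ennreal t"] by (auto simp: lifetime_def intro: Inf_lower)
    show ?thesis by (simp only: not_le[symmetric] * singleton_iff)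
  qed
  have meas: "{\<omega>\<in>space \<P>. X i (ennreal t) \<omega> \<notin> {None}} \<in> sets \<P>" if "i \<in> {1..p}" for i
  proof -
    interpret D: density_process \<P> "P i" "X i" m "q i" using that by (rule process)
    have "X i (ennreal t) -` {None} \<inter> space \<P> \<in> sets \<P>"
      by (rule measurable_sets[OF D.measurable_X sets_borel_Delta_None])
    then have "space \<P> - (X i (ennreal t) -` {None} \<inter> space \<P>) \<in> sets \<P>" by (rule sets.compl_sets)
    also have "space \<P> - (X i (ennreal t) -` {None} \<inter> space \<P>) = {\<omega>\<in>space \<P>. X i (ennreal t) \<omega> \<notin> {None}}"
      by auto
    finally show ?thesis .
  qed
  have "alive_event \<P> p X t = {\<omega>\<in>space \<P>. \<forall>i\<in>{1..p}. X i (ennreal t) \<omega> \<notin> {None}}"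
    unfolding alive_event_def using p eq by (subst Min_gr_iff) auto
  also have "\<dots> \<in> sets \<P>" by (intro sets.sets_Collect_finite_All meas) auto
  finally show ?thesis .
qed

lemma intersection_measure_limit:
  assumes lc: "locally_compact_space (euclidean :: 'a topology)"
  obtains L c where "random_measure_limit \<P> \<nu> W L (approx_intersection_measure m p X q t) (alive_measure \<P> p X t) c"
proof -
  interpret R: random_measures \<P> \<nu> W by (rule random_measures[OF lc])
  obtain c where c: "c < \<infinity>"
    "\<And>g. g \<in> borel_measurable \<P> \<Longrightarrow> (\<integral>\<^sup>+\<omega>. g \<omega> \<partial>alive_measure \<P> p X t) \<le> c * (\<integral>\<^sup>+\<omega>. g \<omega> \<partial>\<P>)"
    using nn_integral_uniform_measure_le[OF sets_alive_event] unfolding alive_measure_def by blast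
  show thesis
  proof (rule R.limit_measure_exists)
    fix L :: "'w \<Rightarrow> 'a measure"
    assume L: "\<And>\<omega>. sets (L \<omega>) = sets borel" "\<And>\<omega>. finite_measure (L \<omega>)"
      "\<And>f. f \<in> borel_measurable borel \<Longrightarrow> (\<integral>\<^sup>+x. f x \<partial>\<nu>) < \<infinity> \<Longrightarrow> R.conv f (\<lambda>\<omega>. \<integral>\<^sup>+x. f x \<partial>L \<omega>)"
    have "random_measure_limit \<P> \<nu> W L (approx_intersection_measure m p X q t) (alive_measure \<P> p X t) c"
    proof (rule random_measure_limit.intro[OF R.random_measures_axioms random_measure_limit_axioms.intro])
      show "sets (approx_intersection_measure m p X q t \<epsilon> \<omega>) = sets borel" for \<epsilon> \<omega>
        by (simp add: approx_intersection_measure_def)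
      show "sets (alive_measure \<P> p X t) = sets \<P>"
        by (simp add: alive_measure_def)
      show "(\<integral>\<^sup>+x. f x \<partial>approx_intersection_measure m p X q t \<epsilon> \<omega>) = W \<epsilon> f \<omega>"
        if "0 < \<epsilon>" "\<omega> \<in> space \<P>" "f \<in> borel_measurable borel" for \<epsilon> \<omega> f
      proof -
        have "f \<in> borel_measurable m" using that(3) by (simp cong: measurable_cong_sets)
        then show ?thesis
          unfolding approx_intersection_measure_eq[OF that(1,2)] W_def
          by (subst nn_integral_density[OF measurable_Z_path[OF that(2)]]) (simp_all add: mult.commute)
      qed
      show "\<exists>B<\<infinity>. \<forall>\<epsilon>. (\<integral>\<^sup>+\<omega>. W \<epsilon> (\<lambda>_. 1) \<omega> ^ k \<partial>\<P>) \<le> B" for k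
        by (rule W_moment)
    qed (rule L c; assumption)+
    then show thesis by (rule that)
  qed
qed

end

theorem proposition1p5:
  fixes p :: nat
    and m :: "'a::{metric_space, second_countable_topology} measure"
    and \<P> :: "'w measure"
    and P :: "nat \<Rightarrow> 'a option \<Rightarrow> 'w measure"
    and X :: "nat \<Rightarrow> ennreal \<Rightarrow> 'w \<Rightarrow> 'a option"
    and q :: "nat \<Rightarrow> real \<Rightarrow> 'a \<Rightarrow> 'a \<Rightarrow> ennreal"
    and x0 :: "nat \<Rightarrow> 'a"
    and t :: real
  assumes "p \<ge> 2"
    and "locally_compact_space (euclidean :: 'a topology)"
    and "radon_measure m" and "measure_supp m = UNIV"
    and "prob_space \<P>"
    and "\<And>i. i \<in> {1..p} \<Longrightarrow> hunt_process \<P> (P i) (X i)"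
    and "\<And>i. i \<in> {1..p} \<Longrightarrow> m_symmetric m (P i) (X i)"
    and "\<And>i. i \<in> {1..p} \<Longrightarrow> irreducible_process m (P i) (X i)"
    and "\<And>i. i \<in> {1..p} \<Longrightarrow> transition_density m (P i) (X i) (q i)"
    and "\<And>i. i \<in> {1..p} \<Longrightarrow> P i (Some (x0 i)) = \<P>"
    and "independent_processes \<P> p X"
    and "\<And>i. i \<in> {1..p} \<Longrightarrow>
           (SUP x. \<integral>\<^sup>+y. (resolvent_density 1 (q i) x y) ^ p \<partial>m) < \<infinity>"
    and "t > 0"
  shows "\<exists>L :: 'w \<Rightarrow> 'a measure.
     L \<in> alive_measure \<P> p X t \<rightarrow>\<^sub>M borel_of vague_topology \<and>
     converges_in_distribution (alive_measure \<P> p X t) vague_topology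
       (approx_intersection_measure m p X q t) L (at_right 0) \<and>
     (\<forall>f\<in>Cc. (\<forall>x. f x \<ge> 0) \<longrightarrow> (\<forall>k\<ge>1.
        converges_in_Lk (alive_measure \<P> p X t) k
          (\<lambda>\<epsilon> \<omega>. \<integral>x. f x \<partial>(approx_intersection_measure m p X q t \<epsilon> \<omega>))
          (\<lambda>\<omega>. \<integral>x. f x \<partial>(L \<omega>)) (at_right 0)))"
proof -
  \<comment> \<open>The sum of the suprema serves as one finite bound common to all
    processes.\<close>
  define C where "C = (\<Sum>i\<in>{1..p}. SUP x. \<integral>\<^sup>+y. (resolvent_density 1 (q i) x y) ^ p \<partial>m)"
  have sf: "sigma_finite_measure m" using assms(2,3) by (rule radon_measure_sigma_finite)
  have sets_m: "sets m = sets borel" using assms(3) by (simp add: radon_measure_def)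
  interpret intersection \<P> m p P X q x0 t C
  proof (rule intersection.intro[OF assms(5) sf intersection_axioms.intro])
    fix i assume i: "i \<in> {1..p}"
    show "density_process \<P> (P i) (X i) m (q i)"
      using assms(2,6,7,9) i sf sets_m by (intro density_process.intro density_process_axioms.intro)
    fix x
    have "(\<integral>\<^sup>+y. resolvent_density 1 (q i) x y ^ p \<partial>m) \<le> (SUP x. \<integral>\<^sup>+y. resolvent_density 1 (q i) x y ^ p \<partial>m)"
      by (intro SUP_upper) simp
    also have "\<dots> \<le> C" unfolding C_def using i by (intro member_le_sum) auto
    finally show "(\<integral>\<^sup>+y. resolvent_density 1 (q i) x y ^ p \<partial>m) \<le> C" .
  next
    show "C < \<infinity>" unfolding C_def using assms(12) by simp
  qed (rule assms; assumption)+
  obtain L c where "random_measure_limit \<P> \<nu> W L (approx_intersection_measure m p X q t) (alive_measure \<P> p X t) c"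
    by (rule intersection_measure_limit[OF assms(2)])
  then interpret random_measure_limit \<P> \<nu> W L "approx_intersection_measure m p X q t" "alive_measure \<P> p X t" c .
  show ?thesis
    using measurable_L_and_converges_in_distribution converges_in_Lk_Cc
    by (intro exI[of _ L] conjI ballI allI impI) simp_all
qed

end
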